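(* Assume the standing hypotheses (A) stated in the context. Let $0<r<+\infty$ and let $a_{\rm hom}(t)$ be the homogenized matrix defined in the context. Then the following hold. (i) (Uniform ellipticity) For any $\xi\in\mathbb R^N$ and a.e. $t\in(0,T)$, \begin{align*} &\lambda|\xi|^2+\lambda\|\nabla_y\Phi_\xi(t)\|^2_{L^2(\square)}+\frac{C_*t}{2}\frac{d}{dt}\|\Phi_\xi(t)\|^2_{L^2(\square)}\\ &\qquad\le a_{\rm hom}(t)\xi\cdot\xi\le|\xi|^2+\|\nabla_y\Phi_\xi(t)\|^2_{L^2(\square)}+\frac{C_*t}{2}\frac{d}{dt}\|\Phi_\xi(t)\|^2_{L^2(\square)}, \end{align*} where $\lambda>0$ is the ellipticity constant of $a(t,y)$ and $\Phi_\xi$ is the corrector in direction $\xi$ (defined in the context). (ii) (Symmetry and asymmetry) If $a(t,y)$ is a symmetric matrix, then $a_{\rm hom}(t)$ is an asymmetric matrix for $r=2$ and $C_*\ne0$. Otherwise, $a_{\rm hom}(t)$ is also a symmetric matrix.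
   Context: Notation. $N\ge1$; $\Omega\subset\mathbb R^N$ is a bounded domain with smooth boundary; $T>0$; $\square=(0,1)^N$; $\mathbb T^N=\mathbb R^N/\mathbb Z^N$; $e_1,\dots,e_N$ is the canonical basis of $\mathbb R^N$. $H^1_{\rm per}(\square)=H^1_{\rm per}(\mathbb T^N)$ is the closure in $H^1(\square)$ of the smooth $\square$-periodic functions, and $H^1_{\rm per}(\mathbb T^N)/\mathbb R=\{w\in H^1_{\rm per}(\square):\int_\square w\,dy=0\}$. Standing hypotheses (A). (i) $r>0$; $v^0_\varepsilon\in H^1_0(\Omega)$, $v^1_\varepsilon\in L^2(\Omega)$, $f_\varepsilon,f\in L^2(\Omega\times(0,T))$, and as $\varepsilon\to0_+$: $v^0_\varepsilon\to v^0$ weakly in $H^1_0(\Omega)$, $v^1_\varepsilon\to v^1$ weakly in $L^2(\Omega)$, $f_\varepsilon\to f$ weakly in $L^2(\Omega\times(0,T))$. (These data do not enter the definition of $a_{\rm hom}$.) (ii) $a\in[C^1([0,T];L^\infty(\mathbb R^N))]^{N\times N}$ is a symmetric matrix field for which there is $\lambda>0$ with $\lambda|\xi|^2\le a(t,y)\xi\cdot\xi\le|\xi|^2$ for all $\xi\in\mathbb R^N$ and a.e. $(t,y)\in(0,T)\times\mathbb R^N$, and $a(t,y+e_j)=a(t,y)$ for a.e. $(t,y)$ and all $j$. (iii) $g(s)=g_{\rm per}(s)+C_*s$ is continuous with $g_{\rm per}$ $1$-periodic, $C_*\ge0$ a constant, and $g(s)>0$ for all $s>0$. If $r=2$, in addition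 $C_*\le 2\lambda/C_\square$, where $C_\square=N/\pi^2$ (Poincaré constant of the unit cell). (iv) If $C_*\ne0$ and $2<r<+\infty$, then in addition $a=a(y)$ is independent of $t$; $a(y)$, $v^0_\varepsilon$, $v^1_\varepsilon$, $g(s)$ and $f_\varepsilon$ are smooth; and $(-\mathrm{div}(a(\tfrac x\varepsilon)\nabla v^0_\varepsilon))$, $(v^1_\varepsilon)$, $(f_\varepsilon)$, $(\partial_tf_\varepsilon)$ are bounded (uniformly in $\varepsilon$) in $L^2(\Omega)$, $H^1_0(\Omega)$, $L^\infty(0,T;L^2(\Omega))$, $L^2(\Omega\times(0,T))$, respectively. Correctors. For $\xi\in\mathbb R^N$, the corrector $\Phi_\xi$ is: - if $r\ne2$: for each $t$, the unique solution $\Phi_\xi(t,\cdot)\in H^1_{\rm per}(\mathbb T^N)/\mathbb R$ of $-\mathrm{div}_y[a(t,y)(\nabla_y\Phi_\xi+\xi)]=0$ in $\mathbb T^N\times(0,T)$; - if $r=2$: the unique solution $\Phi_\xi\in L^2(0,T;H^1_{\rm per}(\mathbb T^N)/\mathbb R)$ of $C_*t\,\partial_t\Phi_\xi-\mathrm{div}_y[a(t,y)(\nabla_y\Phi_\xi+\xi)]=0$ in $\mathbb T^N\times(0,T)$, both in the weak sense tested against $H^1_{\rm per}(\square)/\mathbb R$ (with $\partial_t$ in the distributional sense with values in its dual). Write $\Phi_k=\Phi_{e_k}$. Homogenized matrix: $a_{\rm hom}(t)e_k=\int_\square a(t,y)\bigl(\nabla_y\Phi_k(t,y)+e_k\bigr)\,dy$,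 $k=1,\dots,N$.
   Formalization: In (i), for 0<r<2 the term (C_*t/2) d/dt‖Φ_ξ‖² is dropped, as the bound with it fails for large C_*. In (ii), asymmetry for r=2, C_*≠0 is proved for some admissible symmetric a (a.e. t), given N≥2, λ<1 and any other data; constant a gives symmetric a_hom. *)

theory Defs
  imports "HOL-Analysis.Analysis" "HOL-Probability.Essential_Supremum"
begin

section \<open>Smooth functions, domains\<close>

fun Ck_on :: "nat \<Rightarrow> 'a::real_normed_vector set \<Rightarrow> ('a \<Rightarrow> 'b::real_normed_vector) \<Rightarrow> bool" where
  "Ck_on 0 S f \<longleftrightarrow> continuous_on S f"
| "Ck_on (Suc k) S f \<longleftrightarrow>
     (\<forall>x\<in>S. f differentiable (at x)) \<and> (\<forall>v. Ck_on k S (\<lambda>x. frechet_derivative f (at x) v))"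

text \<open>Only meaningful for open \<open>S\<close>.\<close>
definition smooth_on :: "'a::real_normed_vector set \<Rightarrow> ('a \<Rightarrow> 'b::real_normed_vector) \<Rightarrow> bool" where
  "smooth_on S f \<longleftrightarrow> (\<forall>k. Ck_on k S f)"

definition grad :: "(real^'n \<Rightarrow> real) \<Rightarrow> real^'n \<Rightarrow> real^'n" where
  "grad f x = (\<chi> i. frechet_derivative f (at x) (axis i 1))"

definition divergence :: "(real^'n \<Rightarrow> real^'n) \<Rightarrow> real^'n \<Rightarrow> real" where
  "divergence F x = (\<Sum>i\<in>UNIV. frechet_derivative F (at x) (axis i 1) $ i)"

definition test_fun :: "'a::real_normed_vector set \<Rightarrow> ('a \<Rightarrow> real) \<Rightarrow> bool" where
  "test_fun S \<phi> \<longleftrightarrow>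
     smooth_on UNIV \<phi> \<and> compact (closure {x. \<phi> x \<noteq> 0}) \<and> closure {x. \<phi> x \<noteq> 0} \<subseteq> S"

text \<open>Near each boundary point the domain is the sublevel set of a smooth function with
  non-vanishing gradient.\<close>
definition bounded_smooth_domain :: "(real^'n) set \<Rightarrow> bool" where
  "bounded_smooth_domain \<Omega> \<longleftrightarrow>
     open \<Omega> \<and> connected \<Omega> \<and> \<Omega> \<noteq> {} \<and> bounded \<Omega> \<and>
     (\<forall>x\<in>frontier \<Omega>. \<exists>U (\<rho> :: real^'n \<Rightarrow> real).
        open U \<and> x \<in> U \<and> smooth_on U \<rho> \<and> (\<forall>y\<in>U. grad \<rho> y \<noteq> 0) \<and>
        \<Omega> \<inter> U = {y\<in>U. \<rho> y < 0} \<and> frontier \<Omega> \<inter> U = {y\<in>U. \<rho> y = 0})"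

section \<open>Lebesgue and Sobolev spaces\<close>

text \<open>Elements of function spaces are represented by Borel measurable functions; values outside
  the set in question are irrelevant.\<close>

definition L2 :: "'a::euclidean_space set \<Rightarrow> ('a \<Rightarrow> 'b::euclidean_space) \<Rightarrow> bool" where
  "L2 S f \<longleftrightarrow> set_borel_measurable lborel S f \<and> set_integrable lborel S (\<lambda>x. (norm (f x))\<^sup>2)"

definition weak_grad :: "(real^'n) set \<Rightarrow> (real^'n \<Rightarrow> real) \<Rightarrow> (real^'n \<Rightarrow> real^'n) \<Rightarrow> bool" where
  "weak_grad S u G \<longleftrightarrow> (\<forall>\<phi> i. test_fun S \<phi> \<longrightarrow>
     (LINT x:S|lborel. u x * grad \<phi> x $ i) = - (LINT x:S|lborel. G x $ i * \<phi> x))"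

text \<open>\<open>H1 S u G\<close>: the function \<open>u\<close> is in \<open>H\<^sup>1(S)\<close> and \<open>G\<close> is its weak gradient.\<close>
definition H1 :: "(real^'n) set \<Rightarrow> (real^'n \<Rightarrow> real) \<Rightarrow> (real^'n \<Rightarrow> real^'n) \<Rightarrow> bool" where
  "H1 S u G \<longleftrightarrow> L2 S u \<and> L2 S G \<and> weak_grad S u G"

text \<open>The squared \<open>H\<^sup>1(S)\<close> norm of a function \<open>u\<close> with weak gradient \<open>G\<close>.\<close>
definition H1_sqnorm :: "(real^'n) set \<Rightarrow> (real^'n \<Rightarrow> real) \<Rightarrow> (real^'n \<Rightarrow> real^'n) \<Rightarrow> real" where
  "H1_sqnorm S u G = (LINT x:S|lborel. (u x)\<^sup>2) + (LINT x:S|lborel. (norm (G x))\<^sup>2)"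

definition H10 :: "(real^'n) set \<Rightarrow> (real^'n \<Rightarrow> real) \<Rightarrow> bool" where
  "H10 \<Omega> u \<longleftrightarrow> (\<exists>G. H1 \<Omega> u G \<and>
     (\<forall>e>0. \<exists>\<phi>. test_fun \<Omega> \<phi> \<and> H1_sqnorm \<Omega> (\<lambda>x. u x - \<phi> x) (\<lambda>x. G x - grad \<phi> x) < e))"

text \<open>The weak gradient of \<open>u\<close>, unique up to null sets.\<close>
definition wgrad :: "(real^'n) set \<Rightarrow> (real^'n \<Rightarrow> real) \<Rightarrow> real^'n \<Rightarrow> real^'n" where
  "wgrad S u = (SOME G. H1 S u G)"

definition H1_inner :: "(real^'n) set \<Rightarrow> (real^'n \<Rightarrow> real) \<Rightarrow> (real^'n \<Rightarrow> real) \<Rightarrow> real" where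
  "H1_inner S u w = (LINT x:S|lborel. u x * w x) + (LINT x:S|lborel. wgrad S u x \<bullet> wgrad S w x)"

text \<open>Weak convergence as \<open>\<epsilon> \<rightarrow> 0\<close> from the right; functionals are represented by the inner product.\<close>

definition weak_conv_L2 :: "'a::euclidean_space set \<Rightarrow> (real \<Rightarrow> 'a \<Rightarrow> real) \<Rightarrow> ('a \<Rightarrow> real) \<Rightarrow> bool" where
  "weak_conv_L2 S u\<epsilon> u \<longleftrightarrow> (\<forall>w. L2 S w \<longrightarrow>
     ((\<lambda>\<epsilon>. LINT x:S|lborel. u\<epsilon> \<epsilon> x * w x) \<longlongrightarrow> (LINT x:S|lborel. u x * w x)) (at_right 0))"

definition weak_conv_H10 :: "(real^'n) set \<Rightarrow> (real \<Rightarrow> real^'n \<Rightarrow> real) \<Rightarrow> (real^'n \<Rightarrow> real) \<Rightarrow> bool" where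
  "weak_conv_H10 S u\<epsilon> u \<longleftrightarrow> (\<forall>w. H10 S w \<longrightarrow>
     ((\<lambda>\<epsilon>. H1_inner S (u\<epsilon> \<epsilon>) w) \<longlongrightarrow> H1_inner S u w) (at_right 0))"

text \<open>The open unit cell.\<close>
abbreviation cell :: "(real^'n) set" where
  "cell \<equiv> box 0 1"

definition cell_periodic :: "(real^'n \<Rightarrow> 'b) \<Rightarrow> bool" where
  "cell_periodic u \<longleftrightarrow> (\<forall>y i. u (y + axis i 1) = u y)"

definition H1per :: "(real^'n \<Rightarrow> real) \<Rightarrow> (real^'n \<Rightarrow> real^'n) \<Rightarrow> bool" where
  "H1per u G \<longleftrightarrow> H1 cell u G \<and>
     (\<forall>e>0. \<exists>\<phi>. smooth_on UNIV \<phi> \<and> cell_periodic \<phi> \<and>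
        H1_sqnorm cell (\<lambda>y. u y - \<phi> y) (\<lambda>y. G y - grad \<phi> y) < e)"

definition H1per0 :: "(real^'n \<Rightarrow> real) \<Rightarrow> (real^'n \<Rightarrow> real^'n) \<Rightarrow> bool" where
  "H1per0 u G \<longleftrightarrow> H1per u G \<and> (LINT y:cell|lborel. u y) = 0"

section \<open>The coefficient field and the standing hypotheses\<close>

definition Linf_norm :: "(real^'n \<Rightarrow> 'b::euclidean_space) \<Rightarrow> ereal" where
  "Linf_norm f = esssup lborel (\<lambda>y. ereal (norm (f y)))"

definition Linf :: "(real^'n \<Rightarrow> 'b::euclidean_space) \<Rightarrow> bool" where
  "Linf f \<longleftrightarrow> f \<in> borel_measurable lborel \<and> Linf_norm f < \<infinity>"

text \<open>Membership in \<open>C\<^sup>1([0,T]; L\<^sup>\<infinity>)\<close> (with a jointly measurable representative);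
  \<open>b\<close> is the time derivative.\<close>
definition C1_Linf :: "real \<Rightarrow> (real \<Rightarrow> real^'n \<Rightarrow> real^'n^'n) \<Rightarrow> bool" where
  "C1_Linf T a \<longleftrightarrow>
     set_borel_measurable lborel ({0..T} \<times> UNIV) (\<lambda>(t, y). a t y) \<and>
     (\<exists>b :: real \<Rightarrow> real^'n \<Rightarrow> real^'n^'n. \<forall>t\<in>{0..T}.
        Linf (a t) \<and> Linf (b t) \<and>
        ((\<lambda>s. Linf_norm (\<lambda>y. (a s y - a t y) /\<^sub>R (s - t) - b t y)) \<longlongrightarrow> 0) (at t within {0..T}) \<and>
        ((\<lambda>s. Linf_norm (\<lambda>y. b s y - b t y)) \<longlongrightarrow> 0) (at t within {0..T}))"

definition hyp_data ::
  "(real^'n) set \<Rightarrow> real \<Rightarrow> real \<Rightarrow> (real \<Rightarrow> real^'n \<Rightarrow> real) \<Rightarrow> (real \<Rightarrow> real^'n \<Rightarrow> real) \<Rightarrow>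
   (real \<Rightarrow> (real^'n) \<times> real \<Rightarrow> real) \<Rightarrow> (real^'n \<Rightarrow> real) \<Rightarrow> (real^'n \<Rightarrow> real) \<Rightarrow>
   ((real^'n) \<times> real \<Rightarrow> real) \<Rightarrow> bool" where
  "hyp_data \<Omega> T r v0\<epsilon> v1\<epsilon> f\<epsilon> v0 v1 f \<longleftrightarrow>
     0 < r \<and>
     (\<forall>\<epsilon>>0. H10 \<Omega> (v0\<epsilon> \<epsilon>) \<and> L2 \<Omega> (v1\<epsilon> \<epsilon>) \<and> L2 (\<Omega> \<times> {0<..<T}) (f\<epsilon> \<epsilon>)) \<and>
     H10 \<Omega> v0 \<and> L2 \<Omega> v1 \<and> L2 (\<Omega> \<times> {0<..<T}) f \<and>
     weak_conv_H10 \<Omega> v0\<epsilon> v0 \<and> weak_conv_L2 \<Omega> v1\<epsilon> v1 \<and> weak_conv_L2 (\<Omega> \<times> {0<..<T}) f\<epsilon> f"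

definition hyp_coeff :: "real \<Rightarrow> real \<Rightarrow> (real \<Rightarrow> real^'n \<Rightarrow> real^'n^'n) \<Rightarrow> bool" where
  "hyp_coeff T lam a \<longleftrightarrow>
     C1_Linf T a \<and> 0 < lam \<and>
     (AE p in lborel. case p of (t, y) \<Rightarrow> t \<in> {0<..<T} \<longrightarrow>
        transpose (a t y) = a t y \<and>
        (\<forall>\<xi>. lam * (norm \<xi>)\<^sup>2 \<le> (a t y *v \<xi>) \<bullet> \<xi> \<and> (a t y *v \<xi>) \<bullet> \<xi> \<le> (norm \<xi>)\<^sup>2) \<and>
        (\<forall>j. a t (y + axis j 1) = a t y))"

text \<open>Here \<open>N / pi\<^sup>2\<close> is the Poincare constant of the unit cell in dimension \<open>N\<close>.\<close>
definition hyp_damping ::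
  "nat \<Rightarrow> real \<Rightarrow> real \<Rightarrow> (real \<Rightarrow> real) \<Rightarrow> (real \<Rightarrow> real) \<Rightarrow> real \<Rightarrow> bool" where
  "hyp_damping N r lam g gper Cs \<longleftrightarrow>
     (\<forall>s. g s = gper s + Cs * s) \<and> continuous_on UNIV g \<and> (\<forall>s. gper (s + 1) = gper s) \<and>
     0 \<le> Cs \<and> (\<forall>s>0. 0 < g s) \<and>
     (r = 2 \<longrightarrow> Cs \<le> 2 * lam / (real N / pi\<^sup>2))"

definition hyp_smooth ::
  "(real^'n) set \<Rightarrow> real \<Rightarrow> real \<Rightarrow> (real \<Rightarrow> real^'n \<Rightarrow> real) \<Rightarrow> (real \<Rightarrow> real^'n \<Rightarrow> real) \<Rightarrow>
   (real \<Rightarrow> (real^'n) \<times> real \<Rightarrow> real) \<Rightarrow> (real \<Rightarrow> real^'n \<Rightarrow> real^'n^'n) \<Rightarrow>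
   (real \<Rightarrow> real) \<Rightarrow> real \<Rightarrow> bool" where
  "hyp_smooth \<Omega> T r v0\<epsilon> v1\<epsilon> f\<epsilon> a g Cs \<longleftrightarrow> (Cs \<noteq> 0 \<and> 2 < r \<longrightarrow>
     (\<exists>A. smooth_on UNIV A \<and> (\<forall>t\<in>{0..T}. AE y in lborel. a t y = A y) \<and>
        smooth_on UNIV g \<and>
        (\<forall>\<epsilon>>0. smooth_on \<Omega> (v0\<epsilon> \<epsilon>) \<and> smooth_on \<Omega> (v1\<epsilon> \<epsilon>) \<and> smooth_on (\<Omega> \<times> {0<..<T}) (f\<epsilon> \<epsilon>)) \<and>
        (\<exists>K. \<forall>\<epsilon>>0.
           (let d = (\<lambda>x. - divergence (\<lambda>z. A (z /\<^sub>R \<epsilon>) *v grad (v0\<epsilon> \<epsilon>) z) x) in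
              L2 \<Omega> d \<and> (LINT x:\<Omega>|lborel. (d x)\<^sup>2) \<le> K) \<and>
           H10 \<Omega> (v1\<epsilon> \<epsilon>) \<and> H1_sqnorm \<Omega> (v1\<epsilon> \<epsilon>) (wgrad \<Omega> (v1\<epsilon> \<epsilon>)) \<le> K \<and>
           (AE t in lborel. t \<in> {0<..<T} \<longrightarrow>
              L2 \<Omega> (\<lambda>x. f\<epsilon> \<epsilon> (x, t)) \<and> (LINT x:\<Omega>|lborel. (f\<epsilon> \<epsilon> (x, t))\<^sup>2) \<le> K) \<and>
           (let d = (\<lambda>(x, t). deriv (\<lambda>s. f\<epsilon> \<epsilon> (x, s)) t) in
              L2 (\<Omega> \<times> {0<..<T}) d \<and> (LINT p:\<Omega> \<times> {0<..<T}|lborel. (d p)\<^sup>2) \<le> K))))"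

definition standing_hyps ::
  "(real^'n) set \<Rightarrow> real \<Rightarrow> real \<Rightarrow> (real \<Rightarrow> real^'n \<Rightarrow> real) \<Rightarrow> (real \<Rightarrow> real^'n \<Rightarrow> real) \<Rightarrow>
   (real \<Rightarrow> (real^'n) \<times> real \<Rightarrow> real) \<Rightarrow> (real^'n \<Rightarrow> real) \<Rightarrow> (real^'n \<Rightarrow> real) \<Rightarrow>
   ((real^'n) \<times> real \<Rightarrow> real) \<Rightarrow> real \<Rightarrow> (real \<Rightarrow> real^'n \<Rightarrow> real^'n^'n) \<Rightarrow>
   (real \<Rightarrow> real) \<Rightarrow> (real \<Rightarrow> real) \<Rightarrow> real \<Rightarrow> bool" where
  "standing_hyps \<Omega> T r v0\<epsilon> v1\<epsilon> f\<epsilon> v0 v1 f lam a g gper Cs \<longleftrightarrow>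
     bounded_smooth_domain \<Omega> \<and> 0 < T \<and>
     hyp_data \<Omega> T r v0\<epsilon> v1\<epsilon> f\<epsilon> v0 v1 f \<and> hyp_coeff T lam a \<and>
     hyp_damping CARD('n) r lam g gper Cs \<and> hyp_smooth \<Omega> T r v0\<epsilon> v1\<epsilon> f\<epsilon> a g Cs"

section \<open>Correctors and the homogenized matrix\<close>

text \<open>A corrector is represented by the function \<open>\<Phi>\<close> together with its spatial gradient \<open>G\<close>.\<close>

definition elliptic_corrector ::
  "real \<Rightarrow> (real \<Rightarrow> real^'n \<Rightarrow> real^'n^'n) \<Rightarrow> real^'n \<Rightarrow>
   (real \<Rightarrow> real^'n \<Rightarrow> real) \<Rightarrow> (real \<Rightarrow> real^'n \<Rightarrow> real^'n) \<Rightarrow> bool" where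
  "elliptic_corrector T a \<xi> \<Phi> G \<longleftrightarrow> (\<forall>t\<in>{0<..<T}.
     H1per0 (\<Phi> t) (G t) \<and>
     (\<forall>w H. H1per0 w H \<longrightarrow> (LINT y:cell|lborel. (a t y *v (G t y + \<xi>)) \<bullet> H y) = 0))"

text \<open>The two \<open>L2\<close> conditions and the a.e. membership say
  \<open>\<Phi> \<in> L\<^sup>2(0,T; H\<^sup>1\<^sub>p\<^sub>e\<^sub>r/\<real>)\<close>. In the equation, \<open>Cs t \<partial>\<^sub>t \<Phi>\<close> is the product of the smooth function
  \<open>Cs t\<close> with the distributional derivative of \<open>\<Phi>\<close>: its value at \<open>\<eta>\<close>, paired with \<open>w\<close>, is minus the
  integral of \<open>Cs (t \<eta>(t))' \<langle>\<Phi>(t), w\<rangle>\<close>.\<close>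
definition parabolic_corrector ::
  "real \<Rightarrow> real \<Rightarrow> (real \<Rightarrow> real^'n \<Rightarrow> real^'n^'n) \<Rightarrow> real^'n \<Rightarrow>
   (real \<Rightarrow> real^'n \<Rightarrow> real) \<Rightarrow> (real \<Rightarrow> real^'n \<Rightarrow> real^'n) \<Rightarrow> bool" where
  "parabolic_corrector Cs T a \<xi> \<Phi> G \<longleftrightarrow>
     L2 ({0<..<T} \<times> cell) (\<lambda>(t, y). \<Phi> t y) \<and> L2 ({0<..<T} \<times> cell) (\<lambda>(t, y). G t y) \<and>
     (AE t in lborel. t \<in> {0<..<T} \<longrightarrow> H1per0 (\<Phi> t) (G t)) \<and>
     (\<forall>w H \<eta>. H1per0 w H \<and> test_fun {0<..<T} \<eta> \<longrightarrow>
        - (LINT t:{0<..<T}|lborel. Cs * deriv (\<lambda>s. s * \<eta> s) t * (LINT y:cell|lborel. \<Phi> t y * w y))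
        + (LINT t:{0<..<T}|lborel. \<eta> t * (LINT y:cell|lborel. (a t y *v (G t y + \<xi>)) \<bullet> H y)) = 0)"

definition corrector ::
  "real \<Rightarrow> real \<Rightarrow> real \<Rightarrow> (real \<Rightarrow> real^'n \<Rightarrow> real^'n^'n) \<Rightarrow> real^'n \<Rightarrow>
   (real \<Rightarrow> real^'n \<Rightarrow> real) \<Rightarrow> (real \<Rightarrow> real^'n \<Rightarrow> real^'n) \<Rightarrow> bool" where
  "corrector r Cs T a \<xi> \<Phi> G \<longleftrightarrow>
     (if r = 2 then parabolic_corrector Cs T a \<xi> \<Phi> G else elliptic_corrector T a \<xi> \<Phi> G)"

text \<open>\<open>G \<xi>\<close> is the spatial gradient of the corrector in direction \<open>\<xi>\<close>; column \<open>k\<close> of the matrix is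
  the cell average of the flux in direction \<open>axis k 1\<close>.\<close>
definition a_hom ::
  "(real \<Rightarrow> real^'n \<Rightarrow> real^'n^'n) \<Rightarrow> (real^'n \<Rightarrow> real \<Rightarrow> real^'n \<Rightarrow> real^'n) \<Rightarrow> real \<Rightarrow> real^'n^'n" where
  "a_hom a G t = (\<chi> i k.
     (LINT y:cell|lborel. a t y *v (G (axis k 1) t y + axis k 1)) $ i)"

definition cell_sqnorm :: "(real^'n \<Rightarrow> 'b::real_normed_vector) \<Rightarrow> real" where
  "cell_sqnorm u = (LINT y:cell|lborel. (norm (u y))\<^sup>2)"

text \<open>\<open>D\<close> is the weak derivative of \<open>E\<close> on \<open>(0,T)\<close>.\<close>
definition weak_deriv :: "real \<Rightarrow> (real \<Rightarrow> real) \<Rightarrow> (real \<Rightarrow> real) \<Rightarrow> bool" where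
  "weak_deriv T E D \<longleftrightarrow>
     (\<forall>K. compact K \<and> K \<subseteq> {0<..<T} \<longrightarrow> set_integrable lborel K E \<and> set_integrable lborel K D) \<and>
     (\<forall>\<eta>. test_fun {0<..<T} \<eta> \<longrightarrow>
        (LINT t:{0<..<T}|lborel. E t * deriv \<eta> t) = - (LINT t:{0<..<T}|lborel. D t * \<eta> t))"

text \<open>Coefficient of \<open>(t/2) d/dt \<parallel>\<Phi>\<parallel>\<^sup>2\<close> in the energy estimate. For \<open>r < 2\<close> the corrector equation has
  no time derivative and does not constrain \<open>Cs\<close>, so no such term can appear (for large \<open>Cs\<close> and a
  time-dependent coefficient field the estimate with this term is false). For \<open>r > 2\<close> the term
  vanishes, since then \<open>Cs = 0\<close> or the coefficient field does not depend on time.\<close>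
definition dt_coeff :: "real \<Rightarrow> real \<Rightarrow> real" where
  "dt_coeff r Cs = (if r < 2 then 0 else Cs)"

end

theory Submission
  imports Defs "HOL-Probability.Probability_Measure"
begin

text \<open>
  Write \<open>F\<^sub>\<xi> = a (\<nabla>\<Phi>\<^sub>\<xi> + \<xi>)\<close> for the flux. Testing the corrector equation with the corrector itself gives
  \<open>a\<^sub>h\<^sub>o\<^sub>m \<xi> \<bullet> \<xi> = \<langle>a (\<nabla>\<Phi>\<^sub>\<xi> + \<xi>), \<nabla>\<Phi>\<^sub>\<xi> + \<xi>\<rangle> - \<langle>F\<^sub>\<xi>, \<nabla>\<Phi>\<^sub>\<xi>\<rangle>\<close>, the gradient of a periodic function has mean zero,
  and \<open>\<langle>F\<^sub>\<xi>, \<nabla>\<Phi>\<^sub>\<xi>\<rangle>\<close> is zero in the elliptic case and \<open>- (Cs t / 2) d/dt \<parallel>\<Phi>\<^sub>\<xi>\<parallel>\<^sup>2\<close> in the parabolic one. The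
  matrix \<open>a\<^sub>h\<^sub>o\<^sub>m\<close> is assembled from the correctors of the basis vectors, so the correctors also have to
  depend linearly on \<open>\<xi>\<close>. In the parabolic case this is the uniqueness of the solution of the degenerate
  equation without an initial condition: for a difference \<open>u\<close> of solutions,
  \<open>t d/dt \<parallel>u\<parallel>\<^sup>2 = - (2 / Cs) \<langle>a \<nabla>u, \<nabla>u\<rangle> \<le> - (2 lam / Cs) \<parallel>\<nabla>u\<parallel>\<^sup>2\<close>, and the bound on \<open>Cs\<close> with the Poincare
  inequality makes \<open>t \<parallel>u\<parallel>\<^sup>2\<close> decreasing, whereas \<open>\<parallel>u\<parallel>\<^sup>2\<close> is integrable near \<open>t = 0\<close>.

  Without the time derivative all \<open>F\<^sub>\<xi>\<close> are orthogonal to all \<open>\<nabla>\<Phi>\<^sub>\<zeta>\<close>, so that \<open>a\<^sub>h\<^sub>o\<^sub>m \<xi> \<bullet> \<zeta>\<close> is the symmetric form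
  \<open>\<langle>a (\<nabla>\<Phi>\<^sub>\<xi> + \<xi>), \<nabla>\<Phi>\<^sub>\<zeta> + \<zeta>\<rangle>\<close>. With it, a small perturbation of a multiple of the identity with entries
  depending on \<open>t\<close> and one coordinate \<open>y\<^sub>i\<close> has explicit correctors and a homogenized matrix which is
  not symmetric at any time.
\<close>

section \<open>Smooth functions\<close>

text \<open>At \<open>r = 2\<close> the weak formulation does not license testing with the corrector
  itself: the equation is given against products \<eta>(t) w(y) with \<open>w\<close> fixed, and the
  null set of bad times depends on \<open>w\<close>. The corrector at a frozen time \<open>s\<close>
  is an admissible \<open>w\<close>. The identities so obtained live on pairs (s, t), and a kernel
  concentrating on s = t brings them back to one time; as the diagonal is a null set, this limit
  rests on the continuity of time translations in L2. The Poincare constant proved here is N/16. It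
  lies below N/pi^2, so that equality in the bound on \<open>Cs\<close> still leaves a strict gap.
  The energy of the corrector needs a weak derivative in every regime, also where the equation has
  no time derivative. There it is Lipschitz in time because the coefficient field is, uniformly in
  L-infinity. The asymmetric example is built backwards: a corrector affine in \<open>t\<close> is
  prescribed and the matrix entries are solved from its flux.\<close>

lemma Ck_on_imp_continuous: "Ck_on k UNIV f \<Longrightarrow> continuous_on UNIV f"
  by (cases k) (auto intro!: continuous_at_imp_continuous_on differentiable_imp_continuous_within)

lemma Ck_on_Suc_D: "Ck_on (Suc k) UNIV f \<Longrightarrow> Ck_on k UNIV f"
proof (induction k arbitrary: f)
  case 0
  then show ?case using Ck_on_imp_continuous[OF 0] by simp
qed auto

text \<open>By uniqueness of the derivative, an explicit \<open>f'\<close> may stand in for the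
  choice made by \<open>frechet_derivative\<close>; the closure properties then follow by induction
  on the order.\<close>

lemma Ck_on_SucI:
  assumes "\<And>x. (f has_derivative f' x) (at x)" and "\<And>v. Ck_on k UNIV (\<lambda>x. f' x v)"
  shows "Ck_on (Suc k) UNIV f"
proof -
  have "frechet_derivative f (at x) = f' x" for x
    using frechet_derivative_at[OF assms(1)] by simp
  then show ?thesis
    using assms by (auto simp: differentiable_def)
qed

lemma Ck_on_SucE:
  assumes "Ck_on (Suc k) UNIV f"
  obtains f' where "\<And>x. (f has_derivative f' x) (at x)" and "\<And>v. Ck_on k UNIV (\<lambda>x. f' x v)"
  using assms by (intro that[of "\<lambda>x. frechet_derivative f (at x)"]) (auto simp: frechet_derivative_works[symmetric])

lemma Ck_on_const: "Ck_on k UNIV (\<lambda>x. c)"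
  by (induction k arbitrary: c) (simp_all add: frechet_derivative_const)

lemma Ck_on_bounded_linear: "bounded_linear f \<Longrightarrow> Ck_on k UNIV f"
proof (cases k)
  case 0
  assume "bounded_linear f" then show ?thesis
    using 0 by (simp add: linear_continuous_on)
next
  case (Suc m)
  assume f: "bounded_linear f"
  show ?thesis unfolding Suc
    by (rule Ck_on_SucI[where f'="\<lambda>_. f"]) (auto intro: bounded_linear_imp_has_derivative f Ck_on_const)
qed

lemma Ck_on_add: "Ck_on k UNIV f \<Longrightarrow> Ck_on k UNIV g \<Longrightarrow> Ck_on k UNIV (\<lambda>x. f x + g x)"
proof (induction k arbitrary: f g)
  case 0
  then show ?case by (auto intro: continuous_intros)
next
  case (Suc k)
  from Suc.prems(1) obtain f' where f: "\<And>x. (f has_derivative f' x) (at x)" "\<And>v. Ck_on k UNIV (\<lambda>x. f' x v)"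
    using Ck_on_SucE by blast
  from Suc.prems(2) obtain g' where g: "\<And>x. (g has_derivative g' x) (at x)" "\<And>v. Ck_on k UNIV (\<lambda>x. g' x v)"
    using Ck_on_SucE by blast
  show ?case
    by (rule Ck_on_SucI[where f'="\<lambda>x v. f' x v + g' x v"])
      (auto intro!: Suc.IH f g has_derivative_add)
qed

lemma Ck_on_mult:
  fixes f g :: "'a::real_normed_vector \<Rightarrow> real"
  shows "Ck_on k UNIV f \<Longrightarrow> Ck_on k UNIV g \<Longrightarrow> Ck_on k UNIV (\<lambda>x. f x * g x)"
proof (induction k arbitrary: f g)
  case 0
  then show ?case by (auto intro: continuous_intros)
next
  case (Suc k)
  from Suc.prems(1) obtain f' where f: "\<And>x. (f has_derivative f' x) (at x)" "\<And>v. Ck_on k UNIV (\<lambda>x. f' x v)"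
    using Ck_on_SucE by blast
  from Suc.prems(2) obtain g' where g: "\<And>x. (g has_derivative g' x) (at x)" "\<And>v. Ck_on k UNIV (\<lambda>x. g' x v)"
    using Ck_on_SucE by blast
  show ?case
    by (rule Ck_on_SucI[where f'="\<lambda>x v. f x * g' x v + f' x v * g x"])
      (auto intro!: Suc.IH f g has_derivative_mult Ck_on_add Ck_on_Suc_D[OF Suc.prems(1)] Ck_on_Suc_D[OF Suc.prems(2)])
qed

lemma Ck_on_affine:
  fixes f :: "real \<Rightarrow> real"
  shows "Ck_on k UNIV f \<Longrightarrow> Ck_on k UNIV (\<lambda>x. f (a * x + b))"
proof (induction k arbitrary: f)
  case 0
  then show ?case
    by (auto intro!: continuous_on_compose2[of UNIV f] continuous_intros)
next
  case (Suc k)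
  from Suc.prems(1) obtain f' where f: "\<And>x. (f has_derivative f' x) (at x)" "\<And>v. Ck_on k UNIV (\<lambda>x. f' x v)"
    using Ck_on_SucE by blast
  have *: "((\<lambda>x. f (a * x + b)) has_derivative (\<lambda>v. f' (a * x + b) (a * v))) (at x)" for x
  proof -
    have "((\<lambda>x. a * x + b) has_derivative (\<lambda>v. a * v)) (at x)"
      by (auto intro!: derivative_eq_intros)
    from diff_chain_at[OF this f(1)[of "a * x + b"]] show ?thesis
      by (simp add: o_def)
  qed
  show ?case
    by (rule Ck_on_SucI[OF *]) (auto intro!: Suc.IH f)
qed

lemma smooth_on_const: "smooth_on UNIV (\<lambda>x. c)"
  by (simp add: smooth_on_def Ck_on_const)

lemma smooth_on_add: "smooth_on UNIV f \<Longrightarrow> smooth_on UNIV g \<Longrightarrow> smooth_on UNIV (\<lambda>x. f x + g x)"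
  by (simp add: smooth_on_def Ck_on_add)

lemma smooth_on_mult:
  fixes f g :: "'a::real_normed_vector \<Rightarrow> real"
  shows "smooth_on UNIV f \<Longrightarrow> smooth_on UNIV g \<Longrightarrow> smooth_on UNIV (\<lambda>x. f x * g x)"
  by (simp add: smooth_on_def Ck_on_mult)

lemma smooth_on_affine:
  fixes f :: "real \<Rightarrow> real"
  shows "smooth_on UNIV f \<Longrightarrow> smooth_on UNIV (\<lambda>x. f (a * x + b))"
  by (simp add: smooth_on_def Ck_on_affine)

lemma smooth_on_ident: "smooth_on UNIV (\<lambda>x::real. x)"
  by (simp add: smooth_on_def Ck_on_bounded_linear bounded_linear_ident)

lemma smooth_on_differentiable: "smooth_on UNIV f \<Longrightarrow> f differentiable (at x)"
  unfolding smooth_on_def by (metis Ck_on.simps(2) UNIV_I)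

lemma smooth_on_continuous: "smooth_on UNIV f \<Longrightarrow> continuous_on UNIV f"
  unfolding smooth_on_def using Ck_on_imp_continuous by blast

lemma smooth_on_frechet: "smooth_on UNIV f \<Longrightarrow> smooth_on UNIV (\<lambda>x. frechet_derivative f (at x) v)"
  unfolding smooth_on_def by (metis Ck_on.simps(2))

lemma smooth_on_has_real_derivative:
  fixes f :: "real \<Rightarrow> real"
  shows "smooth_on UNIV f \<Longrightarrow> (f has_real_derivative deriv f x) (at x)"
  using DERIV_deriv_iff_real_differentiable smooth_on_differentiable by blast

lemma frechet_derivative_real:
  fixes f :: "real \<Rightarrow> real"
  assumes "f differentiable (at x)"
  shows "frechet_derivative f (at x) v = deriv f x * v"
  using frechet_derivative_at[of f "\<lambda>v. deriv f x * v" x] assms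
  by (metis DERIV_deriv_iff_real_differentiable has_field_derivative_def)

lemma smooth_on_deriv:
  fixes f :: "real \<Rightarrow> real"
  assumes "smooth_on UNIV f"
  shows "smooth_on UNIV (deriv f)"
proof -
  have "deriv f = (\<lambda>x. frechet_derivative f (at x) 1)"
    using frechet_derivative_real[OF smooth_on_differentiable[OF assms]] by auto
  then show ?thesis
    using smooth_on_frechet[OF assms] by simp
qed

lemma Ck_on_SucI_real:
  fixes f :: "real \<Rightarrow> real"
  assumes "\<And>x. (f has_real_derivative f' x) (at x)" and "Ck_on k UNIV f'"
  shows "Ck_on (Suc k) UNIV f"
  by (rule Ck_on_SucI[where f'="\<lambda>x v. f' x * v"])
    (use assms in \<open>auto simp: has_field_derivative_def intro!: Ck_on_mult Ck_on_const\<close>)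

text \<open>The family is closed under differentiation, so its members are smooth.\<close>
definition exp_inv :: "real poly \<Rightarrow> real \<Rightarrow> real" where
  "exp_inv p x = (if x \<le> 0 then 0 else poly p (1/x) * exp (- (1/x)))"

text \<open>After the substitution y = 1/x this is the decay of y^k exp(-y) at infinity, one
  monomial at a time.\<close>

lemma exp_inv_tendsto_0: "((\<lambda>x. poly p (1/x) * exp (- (1/x))) \<longlongrightarrow> 0) (at_right (0::real))"
proof -
  have mon: "((\<lambda>y::real. y ^ k * exp (- y)) \<longlongrightarrow> 0) at_top" for k
    using tendsto_power_div_exp_0[of k] by (simp add: exp_minus field_simps)
  have "((\<lambda>y. poly p y * exp (- y)) \<longlongrightarrow> 0) at_top"
  proof -
    have "((\<lambda>y. \<Sum>i\<le>degree p. coeff p i * (y ^ i * exp (- y))) \<longlongrightarrow> (\<Sum>i\<le>degree p. coeff p i * 0)) at_top"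
      by (intro tendsto_sum tendsto_mult tendsto_const mon)
    then show ?thesis
      by (simp add: poly_altdef sum_distrib_right mult.assoc)
  qed
  then show ?thesis
    using filterlim_compose[of "\<lambda>y. poly p y * exp (- y)" "nhds 0" at_top "\<lambda>x::real. inverse x" "at_right 0"]
      filterlim_inverse_at_top_right by (simp add: divide_inverse)
qed

text \<open>With y = 1/x the chain rule gives y^2 (p(y) - p'(y)) exp(-y), again a member of the
  family. At 0 the difference quotient from the right is y p(y) exp(-y), which tends to 0 for the
  same reason as the function itself.\<close>

lemma exp_inv_deriv:
  "(exp_inv p has_real_derivative exp_inv ([:0,0,1:] * (p - pderiv p)) x) (at x)"
proof -
  consider "x < 0" | "x = 0" | "x > 0" by linarith
  then show ?thesis
  proof cases
    case 1
    have "((\<lambda>x. 0) has_real_derivative 0) (at x)" by simp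
    then have "(exp_inv p has_real_derivative 0) (at x)"
      by (rule has_field_derivative_transform_within_open[where S="{..<0}"]) (use 1 in \<open>auto simp: exp_inv_def\<close>)
    then show ?thesis using 1 by (simp add: exp_inv_def)
  next
    case 2
    have "((\<lambda>h. exp_inv p h / h) \<longlongrightarrow> 0) (at 0)"
    proof (rule filterlim_split_at_real)
      show "((\<lambda>h. exp_inv p h / h) \<longlongrightarrow> 0) (at_left 0)"
        by (rule tendsto_eventually) (auto simp: eventually_at_left_field exp_inv_def intro!: exI[of _ "-1"])
      have "\<forall>\<^sub>F h in at_right 0. poly ([:0,1:] * p) (1/h) * exp (- (1/h)) = exp_inv p h / h"
        by (auto simp: eventually_at_right_field exp_inv_def intro!: exI[of _ "1"])
      then show "((\<lambda>h. exp_inv p h / h) \<longlongrightarrow> 0) (at_right 0)"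
        by (rule Lim_transform_eventually[OF exp_inv_tendsto_0])
    qed
    then show ?thesis using 2 by (simp add: DERIV_def exp_inv_def)
  next
    case 3
    have "((\<lambda>x. poly p (1/x) * exp (- (1/x))) has_real_derivative exp_inv ([:0,0,1:] * (p - pderiv p)) x) (at x)"
      using 3 by (auto intro!: derivative_eq_intros simp: exp_inv_def field_simps power2_eq_square)
    then show ?thesis
      by (rule has_field_derivative_transform_within_open[where S="{0<..}"]) (use 3 in \<open>auto simp: exp_inv_def\<close>)
  qed
qed

lemma smooth_exp_inv: "smooth_on UNIV (exp_inv p)"
proof -
  have "Ck_on k UNIV (exp_inv p)" for k
  proof (induction k arbitrary: p)
    case 0
    then show ?case
      by (auto intro!: continuous_at_imp_continuous_on DERIV_isCont[OF exp_inv_deriv])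
  next
    case (Suc k)
    show ?case
      by (rule Ck_on_SucI_real[OF exp_inv_deriv Suc.IH])
  qed
  then show ?thesis by (simp add: smooth_on_def)
qed

text \<open>The flat function exp(-1/x). It is positive exactly for x > 0 and bounded by 1, hence a
  smooth one-sided cutoff; a product of two reflected copies has compact support.\<close>

abbreviation ramp :: "real \<Rightarrow> real" where
  "ramp \<equiv> exp_inv 1"

lemma ramp_eq: "ramp x = (if x \<le> 0 then 0 else exp (- (1/x)))"
  by (simp add: exp_inv_def)

lemma ramp_nonneg: "0 \<le> ramp x" and ramp_le_1: "ramp x \<le> 1" and ramp_pos_iff: "0 < ramp x \<longleftrightarrow> 0 < x"
  by (auto simp: ramp_eq)

lemma deriv_ramp: "deriv ramp x = (if x \<le> 0 then 0 else exp (- (1/x)) / x\<^sup>2)"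
  using DERIV_imp_deriv[OF exp_inv_deriv[of 1 x]] by (auto simp: exp_inv_def power2_eq_square field_simps)

section \<open>Test functions on the real line\<close>

lemma compact_closure_subset: "closure A \<subseteq> closure B \<Longrightarrow> compact (closure B) \<Longrightarrow> compact (closure A)"
  using compact_Int_closed[of "closure B" "closure A"] by (simp add: inf.absorb2)

lemma test_fun_realI:
  fixes \<eta> :: "real \<Rightarrow> real"
  assumes "smooth_on UNIV \<eta>" "\<And>t. \<eta> t \<noteq> 0 \<Longrightarrow> a \<le> t \<and> t \<le> b" "{a..b} \<subseteq> S"
  shows "test_fun S \<eta>"
proof -
  have "closure {x. \<eta> x \<noteq> 0} \<subseteq> {a..b}"
    by (rule closure_minimal) (use assms(2) in auto)
  moreover have "compact (closure {x. \<eta> x \<noteq> 0})"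
    using compact_closure_subset[of "{x. \<eta> x \<noteq> 0}" "{a..b}"] calculation by simp
  ultimately show ?thesis
    unfolding test_fun_def using assms by blast
qed

lemma test_fun_realE:
  fixes \<eta> :: "real \<Rightarrow> real"
  assumes "test_fun {0<..<T} \<eta>" "0 < T"
  obtains a b where "0 < a" "a \<le> b" "b < T" "\<And>t. \<eta> t \<noteq> 0 \<Longrightarrow> a < t \<and> t < b"
proof -
  \<comment> \<open>\<open>T/2\<close> keeps the set nonempty when \<eta> is zero, so that its
    extrema exist.\<close>
  let ?K = "insert (T/2) (closure {x. \<eta> x \<noteq> 0})"
  have K: "compact ?K" "?K \<subseteq> {0<..<T}" "?K \<noteq> {}"
    using assms by (auto simp: test_fun_def)
  obtain l where l: "l \<in> ?K" "\<And>t. t \<in> ?K \<Longrightarrow> l \<le> t"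
    using compact_attains_inf[OF K(1,3)] by blast
  obtain u where u: "u \<in> ?K" "\<And>t. t \<in> ?K \<Longrightarrow> t \<le> u"
    using compact_attains_sup[OF K(1,3)] by blast
  have "0 < l" "u < T" "l \<le> u" using l u K(2) by auto
  moreover have "l \<le> t \<and> t \<le> u" if "\<eta> t \<noteq> 0" for t
    using l u that closure_subset[of "{x. \<eta> x \<noteq> 0}"] by auto
  \<comment> \<open>Half the distance to 0 and to \<open>T\<close> is given away to make the
    inequalities strict: \<eta> then vanishes at both endpoints.\<close>
  ultimately show thesis
    by (intro that[of "l/2" "(u+T)/2"]) force+
qed

lemma test_fun_smooth: "test_fun S \<eta> \<Longrightarrow> smooth_on UNIV \<eta>"
  by (simp add: test_fun_def)

lemma test_fun_mult_left:
  assumes "test_fun S \<eta>" "smooth_on UNIV f"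
  shows "test_fun S (\<lambda>x. f x * \<eta> x)"
proof -
  have "closure {x. f x * \<eta> x \<noteq> 0} \<subseteq> closure {x. \<eta> x \<noteq> 0}"
    by (rule closure_mono) auto
  then show ?thesis
    using assms compact_closure_subset unfolding test_fun_def by (auto intro: smooth_on_mult)
qed


section \<open>Division of test functions by powers of the variable\<close>

lemma deriv_eq_0_open:
  fixes f :: "real \<Rightarrow> real"
  assumes "open S" "x \<in> S" "\<And>y. y \<in> S \<Longrightarrow> f y = 0"
  shows "deriv f x = 0"
proof -
  have "((\<lambda>x. 0) has_real_derivative 0) (at x)" by simp
  then have "(f has_real_derivative 0) (at x)"
    by (rule has_field_derivative_transform_within_open[OF _ assms(1,2)]) (simp add: assms(3))
  then show ?thesis by (rule DERIV_imp_deriv)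
qed

text \<open>The derivative of \<eta>/t^m is \<eta>'/t^m - m \<eta>/t^(m+1), so the induction on the
  order needs all exponents and all such \<eta> at once. Vanishing for t \<le> a with a > 0 keeps
  the quotient away from its singularity.\<close>

lemma Ck_on_div_power:
  fixes \<eta> :: "real \<Rightarrow> real"
  assumes "0 < a"
  shows "smooth_on UNIV \<eta> \<Longrightarrow> (\<And>t. t \<le> a \<Longrightarrow> \<eta> t = 0) \<Longrightarrow> Ck_on k UNIV (\<lambda>t. \<eta> t / t ^ m)"
proof (induction k arbitrary: \<eta> m)
  have der: "((\<lambda>t. \<eta> t / t ^ m) has_real_derivative (deriv \<eta> x / x ^ m + (- real m) * (\<eta> x / x ^ Suc m))) (at x)"
    if s: "smooth_on UNIV \<eta>" and z: "\<And>t. t \<le> a \<Longrightarrow> \<eta> t = 0" for \<eta> m x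
  proof (cases "x < a")
    case True
    then have "deriv \<eta> x = 0"
      using deriv_eq_0_open[of "{..<a}" x \<eta>] z by simp
    moreover have "((\<lambda>t. \<eta> t / t ^ m) has_real_derivative 0) (at x)"
    proof (rule has_field_derivative_transform_within_open[where S="{..<a}"])
      show "((\<lambda>x. 0) has_real_derivative 0) (at x)" by simp
    qed (use True z in auto)
    ultimately show ?thesis using z True by simp
  next
    case False
    then have x: "0 < x" using assms by simp
    show ?thesis
      by (rule derivative_eq_intros smooth_on_has_real_derivative[OF s] refl)+
        (use x in \<open>cases m; simp add: field_simps power_add\<close>)+
  qed
  {
    case 0
    then show ?case
      by (auto intro!: continuous_at_imp_continuous_on DERIV_isCont[OF der])
  next
    case (Suc k)
    \<comment> \<open>Left of \<open>a\<close> the derivative is zero by openness; the endpoint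
      \<open>a\<close> itself is reached by continuity of \<open>deriv \<eta>\<close>.\<close>
    have z: "deriv \<eta> t = 0" if "t \<le> a" for t
    proof -
      have "closed ((deriv \<eta>) -` {0})"
        using smooth_on_continuous[OF smooth_on_deriv[OF Suc.prems(1)]]
        by (intro closed_vimage) (auto)
      moreover have "{..<a} \<subseteq> (deriv \<eta>) -` {0}"
        using deriv_eq_0_open[of "{..<a}" _ \<eta>] Suc.prems(2) by auto
      ultimately have "closure {..<a} \<subseteq> (deriv \<eta>) -` {0}"
        by (rule closure_minimal[rotated])
      then show ?thesis using that by auto
    qed
    have "Ck_on k UNIV (\<lambda>x. deriv \<eta> x / x ^ m)" "Ck_on k UNIV (\<lambda>x. \<eta> x / x ^ Suc m)"
      using Suc.IH[OF smooth_on_deriv[OF Suc.prems(1)] z, of m] Suc.IH[OF Suc.prems, of "Suc m"] by auto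
    then show ?case
      by (intro Ck_on_SucI_real[OF der[OF Suc.prems]] Ck_on_add Ck_on_mult[OF Ck_on_const])
  }
qed

text \<open>Makes multiplication by t invertible on the test functions of (0,T), which moves the
  degenerate factor from the time derivative to the flux.\<close>

lemma test_fun_divide:
  assumes "test_fun {0<..<T} \<eta>" "0 < T"
  shows "test_fun {0<..<T} (\<lambda>t. \<eta> t / t)"
proof -
  obtain a b where ab: "0 < a" "a \<le> b" "b < T" "\<And>t. \<eta> t \<noteq> 0 \<Longrightarrow> a < t \<and> t < b"
    using test_fun_realE[OF assms] by blast
  have "smooth_on UNIV (\<lambda>t. \<eta> t / t)"
    unfolding smooth_on_def
    using Ck_on_div_power[OF ab(1) test_fun_smooth[OF assms(1)], of _ 1] ab(4) by force
  then show ?thesis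
    by (rule test_fun_realI[where a=a and b=b]) (use ab in force)+
qed

lemma smooth_on_bounded:
  fixes \<eta> :: "real \<Rightarrow> real"
  assumes "smooth_on UNIV \<eta>" "\<And>t. \<eta> t \<noteq> 0 \<Longrightarrow> a \<le> t \<and> t \<le> b"
  obtains B where "0 < B" "\<And>t. \<bar>\<eta> t\<bar> \<le> B"
proof -
  have "compact (\<eta> ` {a..b})"
    using smooth_on_continuous[OF assms(1)] by (intro compact_continuous_image) (auto intro: continuous_on_subset)
  then obtain B where "\<And>t. t \<in> {a..b} \<Longrightarrow> \<bar>\<eta> t\<bar> \<le> B"
    using compact_imp_bounded bounded_iff by (metis image_eqI real_norm_def)
  then have "\<bar>\<eta> t\<bar> \<le> max B 1" for t
    using assms(2)[of t] by (cases "\<eta> t = 0") fastforce+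
  then show thesis by (intro that[of "max B 1"]) auto
qed

lemma deriv_support:
  fixes \<eta> :: "real \<Rightarrow> real"
  assumes "\<And>t. \<eta> t \<noteq> 0 \<Longrightarrow> a \<le> t \<and> t \<le> b" "deriv \<eta> t \<noteq> 0"
  shows "a \<le> t \<and> t \<le> b"
proof (rule ccontr)
  assume "\<not> (a \<le> t \<and> t \<le> b)"
  then have "t \<in> - {a..b}" by auto
  then have "deriv \<eta> t = 0"
    by (rule deriv_eq_0_open[rotated]) (use assms(1) in \<open>auto\<close>)
  then show False using assms(2) by simp
qed

section \<open>Square integrable functions\<close>

text \<open>Kept general in the measure: it serves the restricted measure on the cell as well as
  \<open>lborel\<close> on space-time, where functions are extended by zero.\<close>

definition sqi :: "'a measure \<Rightarrow> ('a \<Rightarrow> 'b::euclidean_space) \<Rightarrow> bool" where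
  "sqi M f \<longleftrightarrow> f \<in> borel_measurable M \<and> integrable M (\<lambda>x. (norm (f x))\<^sup>2)"

lemma sqi_measurable: "sqi M f \<Longrightarrow> f \<in> borel_measurable M"
  and sqi_integrable_norm: "sqi M f \<Longrightarrow> integrable M (\<lambda>x. (norm (f x))\<^sup>2)"
  by (auto simp: sqi_def)

lemma sqi_bound:
  assumes "sqi M f" "g \<in> borel_measurable M" "AE x in M. norm (g x) \<le> C * norm (f x)"
  shows "sqi M g"
proof -
  have "integrable M (\<lambda>x. C\<^sup>2 * (norm (f x))\<^sup>2)"
    using assms(1) by (simp add: sqi_def)
  then have "integrable M (\<lambda>x. (norm (g x))\<^sup>2)"
  proof (rule Bochner_Integration.integrable_bound)
    show "AE x in M. norm ((norm (g x))\<^sup>2) \<le> norm (C\<^sup>2 * (norm (f x))\<^sup>2)"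
      using assms(3)
    proof eventually_elim
      case (elim x)
      then have "(norm (g x))\<^sup>2 \<le> (C * norm (f x))\<^sup>2"
        by (intro power_mono) auto
      then show ?case by (simp add: power_mult_distrib)
    qed
  qed (use assms(2) in measurable)
  then show ?thesis using assms(2) by (simp add: sqi_def)
qed

lemma norm_inner_le_squares: "\<bar>a \<bullet> b\<bar> \<le> (norm a)\<^sup>2 + (norm b)\<^sup>2"
proof -
  have "\<bar>a \<bullet> b\<bar> \<le> norm a * norm b" by (rule Cauchy_Schwarz_ineq2)
  also have "\<dots> \<le> (norm a)\<^sup>2 + (norm b)\<^sup>2"
    using sum_squares_bound[of "norm a" "norm b"] mult_nonneg_nonneg[OF norm_ge_zero norm_ge_zero, of a b] by linarith
  finally show ?thesis .
qed

lemma sqi_inner_integrable: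
  assumes "sqi M f" "sqi M g"
  shows "integrable M (\<lambda>x. f x \<bullet> g x)"
proof -
  have "integrable M (\<lambda>x. (norm (f x))\<^sup>2 + (norm (g x))\<^sup>2)"
    using assms by (auto simp: sqi_def)
  then show ?thesis
    by (rule Bochner_Integration.integrable_bound)
      (use assms in \<open>auto simp: sqi_def norm_inner_le_squares\<close>)
qed

lemma sqi_mult_integrable:
  fixes f g :: "'a \<Rightarrow> real"
  shows "sqi M f \<Longrightarrow> sqi M g \<Longrightarrow> integrable M (\<lambda>x. f x * g x)"
  using sqi_inner_integrable[of M f g] by simp

lemma sqi_power2_integrable:
  fixes f :: "'a \<Rightarrow> real"
  shows "sqi M f \<Longrightarrow> integrable M (\<lambda>x. (f x)\<^sup>2)"
  using sqi_integrable_norm[of M f] by simp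

lemma sqi_zero: "sqi M (\<lambda>x. 0)"
  by (simp add: sqi_def)

lemma sqi_add:
  assumes "sqi M f" "sqi M g"
  shows "sqi M (\<lambda>x. f x + g x)"
proof -
  have "(norm (f x + g x))\<^sup>2 = (norm (f x))\<^sup>2 + 2 * (f x \<bullet> g x) + (norm (g x))\<^sup>2" for x
    by (simp add: power2_norm_eq_inner algebra_simps inner_commute)
  then show ?thesis
    using assms sqi_inner_integrable[OF assms] by (auto simp: sqi_def)
qed

lemma sqi_scaleR: "sqi M f \<Longrightarrow> sqi M (\<lambda>x. c *\<^sub>R f x)"
  by (rule sqi_bound[where f=f and C="\<bar>c\<bar>"]) (auto simp: sqi_def)

lemma sqi_cmult: "sqi M f \<Longrightarrow> sqi M (\<lambda>x. c * f x :: real)"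
  using sqi_scaleR[of M f c] by simp

lemma sqi_diff: "sqi M f \<Longrightarrow> sqi M g \<Longrightarrow> sqi M (\<lambda>x. f x - g x)"
  using sqi_add[OF _ sqi_scaleR[of M g "-1"]] by simp

lemma sqi_sum: "finite I \<Longrightarrow> (\<And>i. i \<in> I \<Longrightarrow> sqi M (f i)) \<Longrightarrow> sqi M (\<lambda>x. \<Sum>i\<in>I. f i x)"
  by (induction I rule: finite_induct) (auto intro: sqi_zero sqi_add)

lemma sqi_component: "sqi M f \<Longrightarrow> sqi M (\<lambda>x. f x \<bullet> b)"
  by (rule sqi_bound[where C="norm b"])
    (auto simp: sqi_def mult.commute[of "norm b"] intro!: Cauchy_Schwarz_ineq2)

lemma (in finite_measure) sqi_bounded:
  assumes "f \<in> borel_measurable M" "\<And>x. x \<in> space M \<Longrightarrow> norm (f x) \<le> B"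
  shows "sqi M f"
proof -
  have "sqi M (\<lambda>x. 1::real)" by (simp add: sqi_def)
  then show ?thesis
    by (rule sqi_bound[where C=B]) (use assms in auto)
qed

lemma (in finite_measure) sqi_const: "sqi M (\<lambda>x. c)"
  by (rule sqi_bounded[where B="norm c"]) auto

lemma (in finite_measure) sqi_integrable:
  assumes "sqi M f"
  shows "integrable M f"
proof -
  have "integrable M (\<lambda>x. 1 + (norm (f x))\<^sup>2)"
    using assms by (auto simp: sqi_def)
  moreover have "norm (f x) \<le> 1 + (norm (f x))\<^sup>2" for x
  proof -
    have "2 * norm (f x) \<le> (norm (f x))\<^sup>2 + 1"
      using sum_squares_bound[of "norm (f x)" 1] by simp
    then show ?thesis using norm_ge_zero[of "f x"] by linarith
  qed
  ultimately show ?thesis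
    using assms by (intro Bochner_Integration.integrable_bound[of M "\<lambda>x. 1 + (norm (f x))\<^sup>2" f]) (auto simp: sqi_def)
qed

lemma integral_norm_add_sq:
  assumes "sqi M f" "sqi M g"
  shows "(\<integral>x. (norm (f x + g x))\<^sup>2 \<partial>M) =
    (\<integral>x. (norm (f x))\<^sup>2 \<partial>M) + 2 * (\<integral>x. f x \<bullet> g x \<partial>M) + (\<integral>x. (norm (g x))\<^sup>2 \<partial>M)"
proof -
  have "(norm (f x + g x))\<^sup>2 = (norm (f x))\<^sup>2 + 2 * (f x \<bullet> g x) + (norm (g x))\<^sup>2" for x
    by (simp add: power2_norm_eq_inner algebra_simps inner_commute)
  then show ?thesis
    using assms sqi_inner_integrable[OF assms] by (simp add: sqi_def)
qed

text \<open>The squared norm of f - t g is a nonnegative quadratic polynomial in t, with minimum at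
  t = B/C.\<close>

lemma sqi_Cauchy_Schwarz:
  assumes "sqi M f" "sqi M g"
  shows "(\<integral>x. f x \<bullet> g x \<partial>M)\<^sup>2 \<le> (\<integral>x. (norm (f x))\<^sup>2 \<partial>M) * (\<integral>x. (norm (g x))\<^sup>2 \<partial>M)"
proof -
  define A B C where "A = (\<integral>x. (norm (f x))\<^sup>2 \<partial>M)" and "B = (\<integral>x. f x \<bullet> g x \<partial>M)"
    and "C = (\<integral>x. (norm (g x))\<^sup>2 \<partial>M)"
  have q: "0 \<le> A - 2 * t * B + t\<^sup>2 * C" for t
  proof -
    have "0 \<le> (\<integral>x. (norm (f x + (- t) *\<^sub>R g x))\<^sup>2 \<partial>M)" by simp
    also have "\<dots> = A - 2 * t * B + t\<^sup>2 * C"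
      using integral_norm_add_sq[OF assms(1) sqi_scaleR[OF assms(2), of "-t"]]
      by (simp add: A_def B_def C_def power_mult_distrib)
    finally show ?thesis .
  qed
  have "0 \<le> C" by (simp add: C_def)
  show ?thesis unfolding A_def[symmetric] B_def[symmetric] C_def[symmetric]
  proof (cases "C = 0")
    case True
    have "B = 0"
    proof (rule ccontr)
      assume "B \<noteq> 0"
      \<comment> \<open>If C = 0 the polynomial is affine in t; this t gives it the value
        -1.\<close>
      then show False using q[of "(A + 1) / (2 * B)"] True by (simp add: field_simps)
    qed
    then show "B\<^sup>2 \<le> A * C" using True by simp
  next
    case False
    then have "0 < C" using \<open>0 \<le> C\<close> by simp
    then show "B\<^sup>2 \<le> A * C"
      using q[of "B / C"] by (simp add: field_simps power2_eq_square)
  qed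
qed

lemma sqi_Cauchy_Schwarz_abs:
  assumes "sqi M f" "sqi M g"
  shows "\<bar>\<integral>x. f x \<bullet> g x \<partial>M\<bar> \<le> sqrt (\<integral>x. (norm (f x))\<^sup>2 \<partial>M) * sqrt (\<integral>x. (norm (g x))\<^sup>2 \<partial>M)"
  using real_sqrt_le_mono[OF sqi_Cauchy_Schwarz[OF assms]] by (simp add: real_sqrt_mult)

section \<open>The unit cell\<close>

abbreviation cellM :: "(real^'n) measure" where
  "cellM \<equiv> restrict_space lborel cell"

lemma cell_iff: "y \<in> cell \<longleftrightarrow> (\<forall>i. 0 < y $ i \<and> y $ i < (1::real))"
  by (simp add: mem_box_cart)

lemma emeasure_cell: "emeasure lborel (cell :: (real^'n) set) = 1"
proof -
  have "(\<Prod>b\<in>(Basis :: (real^'n) set). (1 - 0 :: real^'n) \<bullet> b) = 1"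
    by (rule prod.neutral) (auto simp: Basis_vec_def inner_axis)
  moreover have "\<And>b. b \<in> Basis \<Longrightarrow> (0 :: real^'n) \<bullet> b \<le> 1 \<bullet> b"
    by (auto simp: Basis_vec_def inner_axis)
  ultimately show ?thesis
    by (simp add: emeasure_lborel_box)
qed

lemma prob_cellM: "prob_space (cellM :: (real^'n) measure)"
  by (rule prob_spaceI) (simp add: emeasure_restrict_space space_restrict_space emeasure_cell)

interpretation cellM: prob_space "cellM :: (real^'n) measure"
  by (rule prob_cellM)

lemma measure_cellM [simp]: "measure cellM (cell :: (real^'n) set) = 1"
  using cellM.prob_space by simp

lemma cell_integral: "(LINT y:cell|lborel. f y) = (\<integral>y. f y \<partial>cellM)"
  for f :: "real^'n \<Rightarrow> 'b::{banach, second_countable_topology}"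
  by (simp add: set_lebesgue_integral_def integral_restrict_space)

lemma L2_iff_sqi: "S \<in> sets borel \<Longrightarrow> L2 S f \<longleftrightarrow> sqi (restrict_space lborel S) f"
  by (simp add: L2_def sqi_def set_borel_measurable_def set_integrable_def
      borel_measurable_restrict_space_iff integrable_restrict_space)

lemma L2_cell_iff: "L2 cell f \<longleftrightarrow> sqi cellM f"
  by (rule L2_iff_sqi) simp

lemma cell_sqnorm_eq: "cell_sqnorm u = (\<integral>y. (norm (u y))\<^sup>2 \<partial>cellM)"
  for u :: "real^'n \<Rightarrow> 'b::euclidean_space"
  by (simp add: cell_sqnorm_def cell_integral)

lemma cellM_measurable: "f \<in> borel_measurable borel \<Longrightarrow> f \<in> borel_measurable cellM"
  by (rule measurable_restrict_space1) simp

section \<open>Translation invariance of integrals of periodic functions\<close>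

definition slab :: "'n \<Rightarrow> real \<Rightarrow> real \<Rightarrow> (real^'n) set" where
  "slab i a b = {y. (\<forall>j. j \<noteq> i \<longrightarrow> 0 < y $ j \<and> y $ j < 1) \<and> a \<le> y $ i \<and> y $ i < b}"

lemma slab_measurable [measurable]: "slab i a b \<in> sets borel"
  unfolding slab_def by measurable

lemma slab_integrable:
  fixes h :: "real^'n \<Rightarrow> real"
  assumes "h \<in> borel_measurable borel" "\<And>y. \<bar>h y\<bar> \<le> B"
  shows "integrable lborel (\<lambda>y. indicator (slab i a b) y * h y)"
proof -
  have sub: "slab i a b \<subseteq> cbox (\<chi> j. if j = i then a else 0) (\<chi> j. if j = i then b else 1)"
    by (auto simp: slab_def mem_box_cart less_imp_le)
  have "emeasure lborel (slab i a b) \<le> emeasure lborel (cbox (\<chi> j. if j = i then a else 0) (\<chi> j. if j = i then b else 1))"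
    by (rule emeasure_mono[OF sub]) simp
  also have "\<dots> < \<infinity>" by (rule emeasure_lborel_cbox_finite)
  finally have "integrable lborel (\<lambda>y. indicator (slab i a b) y * B)"
    by (intro integrable_mult_left) (simp add: integrable_indicator_iff)
  then show ?thesis
    by (rule Bochner_Integration.integrable_bound)
      (use assms in \<open>auto simp: indicator_def intro: order_trans[OF _ abs_ge_self]\<close>)
qed

lemma lborel_integral_translate:
  fixes f :: "'a::euclidean_space \<Rightarrow> 'b::{banach, second_countable_topology}"
  assumes "f \<in> borel_measurable borel"
  shows "(\<integral>y. f (y + v) \<partial>lborel) = (\<integral>y. f y \<partial>lborel)"
proof -
  have "(\<integral>y. f y \<partial>lborel) = (\<integral>y. f y \<partial>distr lborel borel ((+) v))"
    by (simp add: lborel_distr_plus)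
  also have "\<dots> = (\<integral>y. f (v + y) \<partial>lborel)"
    by (rule integral_distr) (use assms in auto)
  finally show ?thesis by (simp add: add.commute)
qed

lemma AE_lborel_coord_neq: "AE y in lborel. (y :: real^'n) $ i \<noteq> c"
proof -
  have "negligible {y :: real^'n. y $ i = c}"
    using negligible_standard_hyperplane[of "axis i 1 :: real^'n" c]
    by (simp add: inner_axis)
  then have "{y :: real^'n. y $ i = c} \<in> null_sets lborel"
    by (simp add: negligible_iff_null_sets null_sets_completion_iff)
  then show ?thesis
    by (rule AE_I') auto
qed

text \<open>The shifted cell is cut along \<open>y $ i = 1\<close> and the protruding part is moved back by one period.\<close>
lemma cell_integral_shift_axis:
  fixes h :: "real^'n \<Rightarrow> real"
  assumes h: "h \<in> borel_measurable borel" "\<And>y. \<bar>h y\<bar> \<le> B" and per: "cell_periodic h"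
    and s: "0 \<le> s" "s \<le> 1"
  shows "(\<integral>y. h (y + s *\<^sub>R axis i 1) \<partial>cellM) = (\<integral>y. h y \<partial>cellM)"
proof -
  have [measurable]: "h \<in> borel_measurable borel" by (rule h)
  define I where "I a b = (\<integral>y. indicator (slab i a b) y * h y \<partial>lborel)" for a b
  \<comment> \<open>Slabs contain one of their two faces, so that adjacent ones concatenate
    exactly.\<close>
  have split: "I a c = I a b + I b c" if "a \<le> b" "b \<le> c" for a b c
  proof -
    have "indicator (slab i a c) y * h y = indicator (slab i a b) y * h y + indicator (slab i b c) y * h y" for y
      using that by (auto simp: slab_def indicator_def)
    then show ?thesis
      unfolding I_def using slab_integrable[OF h] by simp
  qed
  have slab_shift: "y + s *\<^sub>R axis i 1 \<in> slab i a b \<longleftrightarrow> y \<in> slab i (a - s) (b - s)" for y a b s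
    by (auto simp: slab_def axis_def)
  have ind_shift: "indicator (slab i a b) (y + s *\<^sub>R axis i 1) = (indicator (slab i (a - s) (b - s)) y :: real)" for y a b s
    using slab_shift[of y s a b] by (simp add: indicator_def)
  have periodic: "I (a + 1) (b + 1) = I a b" for a b
  proof -
    have "I (a + 1) (b + 1) = (\<integral>y. indicator (slab i (a+1) (b+1)) (y + 1 *\<^sub>R axis i 1) * h (y + 1 *\<^sub>R axis i 1) \<partial>lborel)"
      unfolding I_def by (rule lborel_integral_translate[symmetric]) measurable
    also have "\<dots> = I a b"
      unfolding I_def ind_shift using per by (simp add: cell_periodic_def)
    finally show ?thesis .
  qed
  have cell: "(\<integral>y. k y \<partial>cellM) = (\<integral>y. indicator (slab i 0 1) y * k y \<partial>lborel)"
    if [measurable]: "k \<in> borel_measurable borel" for k :: "real^'n \<Rightarrow> real"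
  proof -
    have "(\<integral>y. k y \<partial>cellM) = (\<integral>y. indicator cell y * k y \<partial>lborel)"
      by (simp add: integral_restrict_space)
    also have "\<dots> = (\<integral>y. indicator (slab i 0 1) y * k y \<partial>lborel)"
    proof (rule integral_cong_AE)
      show "AE y in lborel. indicator cell y * k y = indicator (slab i 0 1) y * k y"
        using AE_lborel_coord_neq[of i 0]
      proof eventually_elim
        case (elim y)
        then have "y \<in> cell \<longleftrightarrow> y \<in> slab i 0 1"
          unfolding cell_iff slab_def by (auto simp: less_le)
        then show ?case by (simp add: indicator_def)
      qed
    qed measurable
    finally show ?thesis .
  qed
  have "(\<integral>y. h (y + s *\<^sub>R axis i 1) \<partial>cellM) =
      (\<integral>y. indicator (slab i s (1 + s)) (y + s *\<^sub>R axis i 1) * h (y + s *\<^sub>R axis i 1) \<partial>lborel)"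
    by (subst cell) (simp_all add: ind_shift)
  also have "\<dots> = I s (1 + s)"
    unfolding I_def by (rule lborel_integral_translate) measurable
  also have "\<dots> = I s 1 + I 0 s"
    using split[of s 1 "1 + s"] periodic[of 0 s] s by (simp add: add.commute)
  also have "\<dots> = I 0 1"
    using split[of 0 s 1] s by simp
  also have "\<dots> = (\<integral>y. h y \<partial>cellM)"
    by (simp add: cell I_def)
  finally show ?thesis .
qed

lemma cell_periodic_shift: "cell_periodic u \<Longrightarrow> cell_periodic (\<lambda>y. u (y + v))"
  unfolding cell_periodic_def by (metis add.commute add.left_commute)

text \<open>Reached one coordinate at a time. A negative increment is treated as the positive shift
  that leads back from the translated function.\<close>

lemma cell_integral_shift:
  fixes h :: "real^'n \<Rightarrow> real"
  assumes h: "h \<in> borel_measurable borel" "\<And>y. \<bar>h y\<bar> \<le> B" and per: "cell_periodic h"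
    and v: "\<And>i. \<bar>v $ i\<bar> \<le> 1"
  shows "(\<integral>y. h (y + v) \<partial>cellM) = (\<integral>y. h y \<partial>cellM)"
proof -
  have axis: "(\<integral>y. h (y + (w + s *\<^sub>R axis i 1)) \<partial>cellM) = (\<integral>y. h (y + w) \<partial>cellM)" if "\<bar>s\<bar> \<le> 1" for w s i
  proof (cases "0 \<le> s")
    case True
    have "(\<integral>y. h ((y + s *\<^sub>R axis i 1) + w) \<partial>cellM) = (\<integral>y. h (y + w) \<partial>cellM)"
      by (rule cell_integral_shift_axis[where h="\<lambda>y. h (y + w)"])
        (use h per that True in \<open>auto intro!: cell_periodic_shift borel_measurable_continuous_onI continuous_intros measurable_compose[OF _ h(1)]\<close>)
    then show ?thesis by (simp add: algebra_simps)
  next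
    case False
    have "(\<integral>y. h ((y + (-s) *\<^sub>R axis i 1) + (w + s *\<^sub>R axis i 1)) \<partial>cellM) = (\<integral>y. h (y + (w + s *\<^sub>R axis i 1)) \<partial>cellM)"
      by (rule cell_integral_shift_axis[where h="\<lambda>y. h (y + (w + s *\<^sub>R axis i 1))"])
        (use h per that False in \<open>auto intro!: cell_periodic_shift borel_measurable_continuous_onI continuous_intros measurable_compose[OF _ h(1)]\<close>)
    then show ?thesis by (simp add: algebra_simps)
  qed
  have "(\<integral>y. h (y + (\<Sum>i\<in>J. (v $ i) *\<^sub>R axis i 1)) \<partial>cellM) = (\<integral>y. h y \<partial>cellM)" if "finite J" for J
    using that
  proof (induction J rule: finite_induct)
    case (insert j J)
    then show ?case
      using axis[of "v $ j" "\<Sum>i\<in>J. (v $ i) *\<^sub>R axis i 1" j] v[of j] by (simp add: add.commute)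
  qed simp
  from this[of UNIV] show ?thesis
    using basis_expansion[of v] by (simp add: scalar_mult_eq_scaleR)
qed

text \<open>The difference quotients have vanishing integral and converge boundedly.\<close>
lemma integral_directional_derivative:
  fixes h d :: "'a::euclidean_space \<Rightarrow> real"
  assumes h: "h \<in> borel_measurable borel"
    and der: "\<And>y. ((\<lambda>s. h (y + s *\<^sub>R v)) has_real_derivative d y) (at 0)"
    and d: "\<And>y. \<bar>d y\<bar> \<le> B"
    and M: "finite_measure M" "sets M = sets (restrict_space lborel S)"
    and zero: "\<And>n::nat. (\<integral>y. (h (y + (1/2^n) *\<^sub>R v) - h y) \<partial>M) = 0"
  shows "integrable M d" "(\<integral>y. d y \<partial>M) = 0"
proof -
  interpret finite_measure M by (rule M)
  have meas: "f \<in> borel_measurable M" if "f \<in> borel_measurable borel" for f :: "'a \<Rightarrow> real"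
    using measurable_restrict_space1[of f lborel borel S] that M(2) measurable_cong_sets by auto
  define q where "q n y = (h (y + (1/2^n) *\<^sub>R v) - h y) * 2^n" for n :: nat and y
  have der': "((\<lambda>s. h (y + s *\<^sub>R v)) has_real_derivative d (y + s *\<^sub>R v)) (at s)" for y s
  proof -
    have *: "((\<lambda>r. r - s) has_real_derivative 1) (at s)"
      by (auto intro!: derivative_eq_intros)
    have "((\<lambda>r. h ((y + s *\<^sub>R v) + (r - s) *\<^sub>R v)) has_real_derivative d (y + s *\<^sub>R v)) (at s)"
      using DERIV_chain2[of "\<lambda>r. h ((y + s *\<^sub>R v) + r *\<^sub>R v)" "d (y + s *\<^sub>R v)" "\<lambda>r. r - s" s 1 UNIV]
        der[of "y + s *\<^sub>R v"] * by simp
    then show ?thesis by (simp add: algebra_simps)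
  qed
  have qm: "q n \<in> borel_measurable borel" for n
    unfolding q_def
    by (intro borel_measurable_times borel_measurable_diff h borel_measurable_const measurable_compose[OF _ h]
        borel_measurable_continuous_onI continuous_intros)
  have lim: "(\<lambda>n. q n y) \<longlonglongrightarrow> d y" for y
  proof -
    have "((\<lambda>s. (h (y + s *\<^sub>R v) - h y) / s) \<longlongrightarrow> d y) (at 0)"
      using der[of y] by (simp add: DERIV_def)
    moreover have "filterlim (\<lambda>n::nat. 1 / 2^n :: real) (at 0) sequentially"
      unfolding filterlim_at using LIMSEQ_inverse_realpow_zero[of 2] by (simp add: divide_inverse power_inverse)
    ultimately have "(\<lambda>n. (h (y + (1/2^n) *\<^sub>R v) - h y) / (1/2^n)) \<longlonglongrightarrow> d y"
      by (rule filterlim_compose)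
    then show ?thesis by (simp add: q_def)
  qed
  \<comment> \<open>The mean value theorem turns the bound on the derivative into a bound on all
    difference quotients, the dominating constant.\<close>
  have bd: "\<bar>q n y\<bar> \<le> B" for n y
  proof -
    have "\<exists>z>0. z < 1/2^n \<and> h (y + (1/2^n) *\<^sub>R v) - h (y + 0 *\<^sub>R v) = (1/2^n - 0) * d (y + z *\<^sub>R v)"
      by (rule MVT2) (use der' in auto)
    then obtain z where "h (y + (1/2^n) *\<^sub>R v) - h y = (1/2^n) * d (y + z *\<^sub>R v)" by auto
    then show ?thesis using d by (simp add: q_def)
  qed
  have dm: "d \<in> borel_measurable borel"
    by (rule borel_measurable_LIMSEQ_real[OF lim qm])
  show "integrable M d"
    by (rule integrable_const_bound[where B=B]) (simp_all add: d meas[OF dm])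
  have "(\<lambda>n. \<integral>y. q n y \<partial>M) \<longlonglongrightarrow> (\<integral>y. d y \<partial>M)"
    by (rule integral_dominated_convergence[where w="\<lambda>_. B"]) (simp_all add: bd lim meas[OF dm] meas[OF qm])
  moreover have "(\<integral>y. q n y \<partial>M) = 0" for n
    unfolding q_def using zero by simp
  ultimately have "(\<lambda>n::nat. 0::real) \<longlonglongrightarrow> (\<integral>y. d y \<partial>M)" by simp
  then show "(\<integral>y. d y \<partial>M) = 0"
    using LIMSEQ_unique[OF tendsto_const] by metis
qed

lemma cell_integral_derivative:
  fixes h d :: "real^'n \<Rightarrow> real"
  assumes h: "h \<in> borel_measurable borel" "\<And>y. \<bar>h y\<bar> \<le> B" and per: "cell_periodic h"
    and der: "\<And>y. ((\<lambda>s. h (y + s *\<^sub>R axis i 1)) has_real_derivative d y) (at 0)"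
    and d: "\<And>y. \<bar>d y\<bar> \<le> B'"
  shows "(\<integral>y. d y \<partial>cellM) = 0"
proof (rule integral_directional_derivative(2)[OF h(1) der d])
  show "finite_measure cellM" by (rule cellM.finite_measure_axioms)
  fix n :: nat
  have s: "\<bar>((1/2^n) *\<^sub>R axis i (1::real)) $ j\<bar> \<le> 1" for j
    by (simp add: axis_def)
  have "integrable cellM (\<lambda>y. h (y + (1/2^n) *\<^sub>R axis i 1))" "integrable cellM h"
    by (auto intro!: cellM.integrable_const_bound[where B=B] cellM_measurable h(1) measurable_compose[OF _ h(1)]
        simp: h(2))
  then show "(\<integral>y. (h (y + (1/2^n) *\<^sub>R axis i 1) - h y) \<partial>cellM) = 0"
    using cell_integral_shift[OF h per s] by simp
qed simp

lemma integral_derivative_compact_support: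
  fixes h d :: "'a::euclidean_space \<Rightarrow> real"
  assumes h: "continuous_on UNIV h" "\<And>y. R \<le> norm y \<Longrightarrow> h y = 0"
    and der: "\<And>y. ((\<lambda>s. h (y + s *\<^sub>R v)) has_real_derivative d y) (at 0)"
    and d: "\<And>y. \<bar>d y\<bar> \<le> B'"
  shows "(\<integral>y. d y \<partial>lborel) = 0"
proof -
  \<comment> \<open>The margin \<open>norm v\<close> keeps the support of every translate by s v
    with 0 \<le> s \<le> 1 inside \<open>S\<close>, whose measure is finite.\<close>
  define S where "S = cball (0::'a) (R + norm v)"
  have hm: "h \<in> borel_measurable borel"
    by (rule borel_measurable_continuous_onI[OF h(1)])
  have S: "emeasure lborel S < \<infinity>" unfolding S_def by (rule emeasure_lborel_cball_finite)
  have hint: "(\<integral>y. h (y + s *\<^sub>R v) \<partial>restrict_space lborel S) = (\<integral>y. h y \<partial>lborel)"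
    and hint': "integrable (restrict_space lborel S) (\<lambda>y. h (y + s *\<^sub>R v))"
    if "0 \<le> s" "s \<le> 1" for s
  proof -
    have *: "indicator S y * h (y + s *\<^sub>R v) = h (y + s *\<^sub>R v)" for y
    proof (cases "y \<in> S")
      case False
      then have "R + norm v < norm y" by (simp add: S_def)
      moreover have "norm (s *\<^sub>R v) \<le> norm v" using that by (simp add: mult_left_le_one_le)
      moreover have "norm y \<le> norm (y + s *\<^sub>R v) + norm (s *\<^sub>R v)"
        using norm_triangle_ineq4[of "y + s *\<^sub>R v" "s *\<^sub>R v"] by simp
      ultimately show ?thesis using h(2) by simp
    qed simp
    have "(\<integral>y. h (y + s *\<^sub>R v) \<partial>restrict_space lborel S) = (\<integral>y. indicator S y *\<^sub>R h (y + s *\<^sub>R v) \<partial>lborel)"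
      by (rule integral_restrict_space) (simp add: S_def)
    then show "(\<integral>y. h (y + s *\<^sub>R v) \<partial>restrict_space lborel S) = (\<integral>y. h y \<partial>lborel)"
      using lborel_integral_translate[OF hm, of "s *\<^sub>R v"] by (simp add: *)
    have "set_integrable lborel S (\<lambda>y. h (y + s *\<^sub>R v))"
      unfolding S_def set_integrable_def
      by (intro borel_integrable_compact compact_cball) (auto intro!: continuous_on_compose2[OF h(1)] continuous_intros)
    then show "integrable (restrict_space lborel S) (\<lambda>y. h (y + s *\<^sub>R v))"
      by (simp add: integrable_restrict_space set_integrable_def S_def)
  qed
  have fin: "finite_measure (restrict_space lborel S)"
    by (rule finite_measureI) (use S in \<open>simp add: space_restrict_space emeasure_restrict_space S_def\<close>)
  have "(\<integral>y. d y \<partial>restrict_space lborel S) = 0"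
  proof (rule integral_directional_derivative(2)[OF hm der d fin refl])
    fix n :: nat
    show "(\<integral>y. (h (y + (1/2^n) *\<^sub>R v) - h y) \<partial>restrict_space lborel S) = 0"
      using hint[of "1/2^n"] hint'[of "1/2^n"] hint[of 0] hint'[of 0] by simp
  qed
  moreover have ind: "indicator S y *\<^sub>R d y = d y" for y
  proof (cases "y \<in> S")
    case False
    have "((\<lambda>s. 0) has_real_derivative 0) (at (0::real))" by simp
    then have "((\<lambda>s. h (y + s *\<^sub>R v)) has_real_derivative 0) (at 0)"
    proof (rule has_field_derivative_transform_within_open[where S="{s. R < norm (y + s *\<^sub>R v)}"])
      show "open {s. R < norm (y + s *\<^sub>R v)}"
        by (intro open_Collect_less continuous_intros)
      show "0 \<in> {s. R < norm (y + s *\<^sub>R v)}"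
        using False by (simp add: S_def) (smt (verit) norm_ge_zero)
    qed (use h(2) in auto)
    then have "d y = 0" using der[of y] DERIV_unique by blast
    then show ?thesis by simp
  qed simp
  moreover have "(\<integral>y. d y \<partial>restrict_space lborel S) = (\<integral>y. indicator S y *\<^sub>R d y \<partial>lborel)"
    by (rule integral_restrict_space) (simp add: S_def)
  ultimately show ?thesis by (simp only: ind)
qed

section \<open>Gradients of smooth periodic functions\<close>

lemma smooth_directional:
  fixes \<phi> :: "'a::real_normed_vector \<Rightarrow> real"
  assumes "smooth_on UNIV \<phi>"
  shows "((\<lambda>s. \<phi> (y + s *\<^sub>R v)) has_real_derivative frechet_derivative \<phi> (at (y + s *\<^sub>R v)) v) (at s)"
proof -
  have "(\<phi> has_derivative frechet_derivative \<phi> (at (y + s *\<^sub>R v))) (at (y + s *\<^sub>R v))"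
    using smooth_on_differentiable[OF assms] frechet_derivative_works by blast
  moreover have "((\<lambda>s. y + s *\<^sub>R v) has_derivative (\<lambda>r. r *\<^sub>R v)) (at s)"
    by (auto intro!: derivative_eq_intros)
  ultimately have "((\<lambda>s. \<phi> (y + s *\<^sub>R v)) has_derivative (\<lambda>r. frechet_derivative \<phi> (at (y + s *\<^sub>R v)) (r *\<^sub>R v))) (at s)"
    using diff_chain_at[of "\<lambda>s. y + s *\<^sub>R v"] by (fastforce simp: o_def)
  moreover have "frechet_derivative \<phi> (at (y + s *\<^sub>R v)) (r *\<^sub>R v) = r * frechet_derivative \<phi> (at (y + s *\<^sub>R v)) v" for r
    using linear_frechet_derivative[OF smooth_on_differentiable[OF assms]] by (simp add: linear_scale)
  ultimately show ?thesis
    by (simp add: has_field_derivative_def mult_commute_abs)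
qed

lemma frechet_eq_grad:
  fixes \<phi> :: "real^'n \<Rightarrow> real"
  assumes "\<phi> differentiable (at y)"
  shows "frechet_derivative \<phi> (at y) v = grad \<phi> y \<bullet> v"
proof -
  have lin: "linear (frechet_derivative \<phi> (at y))"
    by (rule linear_frechet_derivative[OF assms])
  have "frechet_derivative \<phi> (at y) v = frechet_derivative \<phi> (at y) (\<Sum>i\<in>UNIV. (v $ i) *\<^sub>R axis i 1)"
    using basis_expansion[of v] by (simp add: scalar_mult_eq_scaleR)
  also have "\<dots> = (\<Sum>i\<in>UNIV. v $ i * frechet_derivative \<phi> (at y) (axis i 1))"
    by (simp add: linear_sum[OF lin] linear_scale[OF lin])
  finally show ?thesis
    by (simp add: grad_def inner_vec_def mult.commute)
qed

lemma smooth_on_grad_continuous: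
  assumes "smooth_on UNIV \<phi>"
  shows "continuous_on UNIV (grad \<phi>)"
  unfolding grad_def
  by (intro continuous_on_vec_lambda smooth_on_continuous[OF smooth_on_frechet[OF assms]])

text \<open>Stated for arbitrary integers \<open>k i\<close>; with the integer parts of the
  coordinates the translation carries any point into the closed cell.\<close>

lemma cell_periodic_floor:
  fixes u :: "real^'n \<Rightarrow> 'b"
  assumes "cell_periodic u"
  shows "u (y - (\<chi> i. of_int (k i))) = u y"
proof -
  have nat: "u (z + real n *\<^sub>R axis i 1) = u z" for z i n
  proof (induction n)
    case (Suc n)
    have "u (z + real (Suc n) *\<^sub>R axis i 1) = u ((z + real n *\<^sub>R axis i 1) + axis i 1)"
      by (simp add: algebra_simps)
    then show ?case using Suc assms by (simp add: cell_periodic_def)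
  qed simp
  have int: "u (z - of_int m *\<^sub>R axis i 1) = u z" for z i m
  proof (cases "0 \<le> m")
    case True
    then show ?thesis
      using nat[of "z - of_int m *\<^sub>R axis i 1" "nat m" i] by simp
  next
    case False
    then show ?thesis
      using nat[of z "nat (-m)" i] by simp
  qed
  have "u (y - (\<Sum>i\<in>J. of_int (k i) *\<^sub>R axis i 1)) = u y" if "finite J" for J
    using that
  proof (induction J rule: finite_induct)
    case (insert j J)
    then show ?case
      using int[of "y - (\<Sum>i\<in>J. of_int (k i) *\<^sub>R axis i 1)" "k j" j] by (simp add: algebra_simps)
  qed simp
  from this[of UNIV] show ?thesis
    using basis_expansion[of "\<chi> i. real_of_int (k i)"] by (simp add: scalar_mult_eq_scaleR)
qed

lemma cell_periodic_bounded:
  fixes u :: "real^'n \<Rightarrow> 'b::real_normed_vector"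
  assumes "cell_periodic u" "continuous_on UNIV u"
  obtains B where "\<And>y. norm (u y) \<le> B"
proof -
  have "compact (u ` cbox 0 1)"
    by (intro compact_continuous_image continuous_on_subset[OF assms(2)]) auto
  then obtain B where B: "\<And>y. y \<in> cbox 0 1 \<Longrightarrow> norm (u y) \<le> B"
    using compact_imp_bounded bounded_iff by (metis image_eqI)
  have "norm (u y) \<le> B" for y
  proof -
    have "y - (\<chi> i. of_int \<lfloor>y $ i\<rfloor>) \<in> cbox 0 1"
      by (auto simp: mem_box_cart) (smt (verit) real_of_int_floor_add_one_ge)
    from B[OF this] show ?thesis
      using cell_periodic_floor[OF assms(1), of y] by simp
  qed
  then show thesis by (rule that)
qed

lemma frechet_derivative_periodic:
  fixes \<phi> :: "real^'n \<Rightarrow> real"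
  assumes "cell_periodic \<phi>" "\<And>y. \<phi> differentiable (at y)"
  shows "frechet_derivative \<phi> (at (y + axis i 1)) = frechet_derivative \<phi> (at y)"
proof -
  have "(\<phi> has_derivative frechet_derivative \<phi> (at (y + axis i 1))) (at (y + axis i 1))"
    using assms(2) frechet_derivative_works by blast
  moreover have "((\<lambda>y. y + axis i 1) has_derivative (\<lambda>v. v)) (at y)"
    by (auto intro!: derivative_eq_intros)
  ultimately have "((\<lambda>y. \<phi> (y + axis i 1)) has_derivative frechet_derivative \<phi> (at (y + axis i 1))) (at y)"
    using diff_chain_at[of "\<lambda>y. y + axis i 1"] by (fastforce simp: o_def)
  then show ?thesis
    using assms(1) frechet_derivative_at by (simp add: cell_periodic_def)
qed

lemma cell_periodic_grad:
  assumes "cell_periodic \<phi>" "smooth_on UNIV \<phi>"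
  shows "cell_periodic (grad \<phi>)"
  using frechet_derivative_periodic[OF assms(1) smooth_on_differentiable[OF assms(2)]]
  by (simp add: cell_periodic_def grad_def)

lemma cell_continuous_sqi:
  fixes u :: "real^'n \<Rightarrow> 'b::euclidean_space"
  assumes "continuous_on UNIV u"
  shows "sqi cellM u"
proof -
  have "compact (u ` cbox 0 1)"
    by (intro compact_continuous_image continuous_on_subset[OF assms]) auto
  then obtain B where B: "\<And>y. y \<in> cbox 0 1 \<Longrightarrow> norm (u y) \<le> B"
    using compact_imp_bounded bounded_iff by (metis image_eqI)
  show ?thesis
    by (intro cellM.sqi_bounded[where B=B] cellM_measurable borel_measurable_continuous_onI assms B)
      (use box_subset_cbox in auto)
qed

lemma cell_integral_grad:
  assumes "cell_periodic \<phi>" "smooth_on UNIV \<phi>"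
  shows "(\<integral>y. grad \<phi> y $ i \<partial>cellM) = 0"
proof -
  obtain B where B: "\<And>y. norm (\<phi> y) \<le> B"
    using cell_periodic_bounded[OF assms(1) smooth_on_continuous[OF assms(2)]] by blast
  obtain B' where B': "\<And>y. norm (grad \<phi> y) \<le> B'"
    using cell_periodic_bounded[OF cell_periodic_grad[OF assms] smooth_on_grad_continuous[OF assms(2)]] by blast
  show ?thesis
  proof (rule cell_integral_derivative[where h=\<phi> and B=B and B'=B' and i=i])
    show "((\<lambda>s. \<phi> (y + s *\<^sub>R axis i 1)) has_real_derivative grad \<phi> y $ i) (at 0)" for y
      using smooth_directional[OF assms(2), of y "axis i 1" 0] by (simp add: grad_def)
    show "\<bar>grad \<phi> y $ i\<bar> \<le> B'" for y
      using component_le_norm_cart[of "grad \<phi> y" i] B'[of y] by linarith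
  qed (use B assms in \<open>auto intro: borel_measurable_continuous_onI smooth_on_continuous\<close>)
qed

section \<open>The Poincare inequality on the cell\<close>

text \<open>On [0, pi/2] the concave sine lies above its chord. The number 16 in the Poincare
  constant originates from this inequality.\<close>

lemma Jordan_sin:
  fixes x :: real
  assumes "0 \<le> x" "x \<le> 1/2"
  shows "2 * x \<le> sin (pi * x)"
proof -
  have "convex_on {0..pi/2} (\<lambda>x. - sin x)"
  proof (rule convex_on_realI[where f'="\<lambda>x. - cos x"])
    show "- cos x \<le> - cos y" if "x \<in> {0..pi/2}" "y \<in> {0..pi/2}" "x \<le> y" for x y :: real
      using that cos_monotone_0_pi_le[of x y] by auto
  qed (auto intro!: derivative_eq_intros)
  from convex_onD[OF this, of "2 * x" 0 "pi/2"] show ?thesis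
    using assms by (simp add: mult.commute)
qed

lemma cos_coord_has_derivative:
  fixes y :: "real^'n"
  shows "((\<lambda>s. sin (2 * pi * (y + s *\<^sub>R axis i 1) $ i)) has_real_derivative 2 * pi * cos (2 * pi * y $ i)) (at 0)"
  by (auto intro!: derivative_eq_intros simp: axis_def)

lemma cell_periodic_cos_coord: "cell_periodic (\<lambda>y. cos (2 * pi * y $ i))"
  and cell_periodic_sin_coord: "cell_periodic (\<lambda>y. sin (2 * pi * y $ i))"
  by (simp_all add: cell_periodic_def axis_def distrib_left)

lemma cell_integral_cos: "(\<integral>y. cos (2 * pi * y $ i) \<partial>cellM) = 0"
proof -
  have "(\<integral>y. 2 * pi * cos (2 * pi * y $ i) \<partial>cellM) = 0"
  proof (rule cell_integral_derivative[OF _ _ cell_periodic_sin_coord cos_coord_has_derivative, where B=1 and B'="2*pi"])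
    show "\<bar>2 * pi * cos (2 * pi * y $ i)\<bar> \<le> 2 * pi" for y
      using abs_cos_le_one[of "2 * pi * y $ i"] by (simp add: abs_mult)
  qed (auto intro!: borel_measurable_continuous_onI continuous_intros)
  then show ?thesis by simp
qed

text \<open>The increment is cut into N equal steps. Cauchy-Schwarz for the telescoping sum and
  translation invariance bound its squared norm by that of N times a single step, which converges to
  the directional derivative as N grows.\<close>

lemma cell_integral_increment_le:
  fixes \<phi> :: "real^'n \<Rightarrow> real"
  assumes sm: "smooth_on UNIV \<phi>" and per: "cell_periodic \<phi>" and z: "\<And>i. \<bar>z $ i\<bar> \<le> 1"
  shows "(\<integral>y. (\<phi> (y + z) - \<phi> y)\<^sup>2 \<partial>cellM) \<le> (\<integral>y. (grad \<phi> y \<bullet> z)\<^sup>2 \<partial>cellM)"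
proof -
  obtain B where B: "\<And>y. norm (\<phi> y) \<le> B"
    using cell_periodic_bounded[OF per smooth_on_continuous[OF sm]] by blast
  have gp: "cell_periodic (grad \<phi>)" and gc: "continuous_on UNIV (grad \<phi>)"
    using cell_periodic_grad[OF per sm] smooth_on_grad_continuous[OF sm] by auto
  obtain B' where B': "\<And>y. norm (grad \<phi> y) \<le> B'"
    using cell_periodic_bounded[OF gp gc] by blast
  note cont = continuous_on_compose2[OF smooth_on_continuous[OF sm]]
  define D where "D n y = \<phi> (y + (1 / real (Suc n)) *\<^sub>R z) - \<phi> y" for n y
  have Dm: "continuous_on UNIV (D n)" for n
    unfolding D_def by (intro continuous_intros cont) auto
  have DB: "\<bar>D n y\<bar> \<le> 2 * B" for n y
    using B[of y] B[of "y + (1 / real (Suc n)) *\<^sub>R z"] by (simp add: D_def)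
  have Dper: "cell_periodic (\<lambda>y. (D n y)\<^sup>2)" for n
    using cell_periodic_shift[OF per] per by (simp add: cell_periodic_def D_def)
  have der: "((\<lambda>s. \<phi> (y + s *\<^sub>R z)) has_real_derivative grad \<phi> (y + s *\<^sub>R z) \<bullet> z) (at s)" for y s
    using smooth_directional[OF sm, of y z s] frechet_eq_grad[OF smooth_on_differentiable[OF sm]] by simp
  \<comment> \<open>By the mean value theorem the scaled increments are bounded uniformly in
    \<open>n\<close>, as dominated convergence requires.\<close>
  have DB2: "\<bar>real (Suc n) * D n y\<bar> \<le> B' * norm z" for n y
  proof -
    have "\<exists>t>0. t < 1 / real (Suc n) \<and> \<phi> (y + (1 / real (Suc n)) *\<^sub>R z) - \<phi> (y + 0 *\<^sub>R z)
        = (1 / real (Suc n) - 0) * (grad \<phi> (y + t *\<^sub>R z) \<bullet> z)"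
      by (rule MVT2) (use der in auto)
    then obtain t where "D n y = (1 / real (Suc n)) * (grad \<phi> (y + t *\<^sub>R z) \<bullet> z)"
      by (auto simp: D_def)
    then have "real (Suc n) * D n y = grad \<phi> (y + t *\<^sub>R z) \<bullet> z"
      by (simp add: field_simps)
    also have "\<bar>\<dots>\<bar> \<le> norm (grad \<phi> (y + t *\<^sub>R z)) * norm z"
      by (rule Cauchy_Schwarz_ineq2)
    also have "\<dots> \<le> B' * norm z"
      by (intro mult_right_mono B') auto
    finally show ?thesis .
  qed
  have lim: "(\<lambda>n. (\<integral>y. (real (Suc n) * D n y)\<^sup>2 \<partial>cellM)) \<longlonglongrightarrow> (\<integral>y. (grad \<phi> y \<bullet> z)\<^sup>2 \<partial>cellM)"
  proof (rule integral_dominated_convergence[where w="\<lambda>_. (B' * norm z)\<^sup>2"])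
    show "AE y in cellM. (\<lambda>n. (real (Suc n) * D n y)\<^sup>2) \<longlonglongrightarrow> (grad \<phi> y \<bullet> z)\<^sup>2"
    proof (rule AE_I2, rule tendsto_power)
      fix y
      have "((\<lambda>s. (\<phi> (y + s *\<^sub>R z) - \<phi> y) / s) \<longlongrightarrow> grad \<phi> y \<bullet> z) (at 0)"
        using der[of y 0] by (simp add: DERIV_def)
      moreover have "filterlim (\<lambda>n. 1 / real (Suc n)) (at 0) sequentially"
        unfolding filterlim_at using LIMSEQ_inverse_real_of_nat by (simp add: divide_inverse)
      ultimately have "(\<lambda>n. (\<phi> (y + (1 / real (Suc n)) *\<^sub>R z) - \<phi> y) / (1 / real (Suc n))) \<longlonglongrightarrow> grad \<phi> y \<bullet> z"
        by (rule filterlim_compose)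
      then show "(\<lambda>n. real (Suc n) * D n y) \<longlonglongrightarrow> grad \<phi> y \<bullet> z"
        by (simp add: D_def mult.commute)
    qed
    show "AE y in cellM. norm ((real (Suc n) * D n y)\<^sup>2) \<le> (B' * norm z)\<^sup>2" for n
      using power_mono[OF DB2[of n], of _ 2] by (auto simp: power_mult_distrib)
  qed (auto intro!: cellM_measurable borel_measurable_continuous_onI continuous_intros Dm gc)
  have "(\<integral>y. (\<phi> (y + z) - \<phi> y)\<^sup>2 \<partial>cellM) \<le> (\<integral>y. (real (Suc n) * D n y)\<^sup>2 \<partial>cellM)" for n
  proof -
    define N where "N = Suc n"
    have int: "integrable cellM (\<lambda>y. (D n (y + w))\<^sup>2)" for w
      by (rule sqi_power2_integrable[OF cell_continuous_sqi])
        (auto intro!: continuous_on_compose2[OF Dm] continuous_intros)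
    have int0: "integrable cellM (\<lambda>y. (\<phi> (y + z) - \<phi> y)\<^sup>2)"
      by (rule sqi_power2_integrable[OF cell_continuous_sqi]) (auto intro!: continuous_intros cont)
    have "\<phi> (y + z) - \<phi> y = (\<Sum>k<N. D n (y + (real k / real N) *\<^sub>R z))" for y
    proof -
      have "(\<Sum>k<N. D n (y + (real k / real N) *\<^sub>R z)) =
          (\<Sum>k<N. \<phi> (y + (real (Suc k) / real N) *\<^sub>R z) - \<phi> (y + (real k / real N) *\<^sub>R z))"
        unfolding D_def N_def[symmetric]
        by (intro sum.cong refl arg_cong2[where f="(-)"] arg_cong[where f=\<phi>])
          (simp add: add_divide_distrib scaleR_add_left)
      also have "\<dots> = \<phi> (y + (real N / real N) *\<^sub>R z) - \<phi> (y + (real 0 / real N) *\<^sub>R z)"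
        by (rule sum_lessThan_telescope)
      finally show ?thesis by (simp add: N_def)
    qed
    then have "(\<phi> (y + z) - \<phi> y)\<^sup>2 \<le> (\<Sum>k<N. (D n (y + (real k / real N) *\<^sub>R z))\<^sup>2) * real N" for y
      using sum_squared_le_sum_of_squares[of "\<lambda>k. D n (y + (real k / real N) *\<^sub>R z)" "{..<N}"] by simp
    then have "(\<integral>y. (\<phi> (y + z) - \<phi> y)\<^sup>2 \<partial>cellM) \<le>
        (\<integral>y. (\<Sum>k<N. (D n (y + (real k / real N) *\<^sub>R z))\<^sup>2) * real N \<partial>cellM)"
      by (intro integral_mono int0) (auto intro!: int)
    also have "\<dots> = (\<Sum>k<N. (\<integral>y. (D n (y + (real k / real N) *\<^sub>R z))\<^sup>2 \<partial>cellM)) * real N"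
      using int by simp
    also have "\<dots> = (\<Sum>k<N. (\<integral>y. (D n y)\<^sup>2 \<partial>cellM)) * real N"
    proof -
      have "(\<integral>y. (D n (y + (real k / real N) *\<^sub>R z))\<^sup>2 \<partial>cellM) = (\<integral>y. (D n y)\<^sup>2 \<partial>cellM)" if "k < N" for k
      proof (rule cell_integral_shift[where B="(2 * B)\<^sup>2"])
        show "\<bar>((real k / real N) *\<^sub>R z) $ i\<bar> \<le> 1" for i
          using that z[of i] mult_mono[of "real k / real N" 1 "\<bar>z $ i\<bar>" 1] by (simp add: abs_mult)
        show "\<bar>(D n y)\<^sup>2\<bar> \<le> (2 * B)\<^sup>2" for y
          using power_mono[OF DB[of n y], of 2] by simp
      qed (auto intro!: borel_measurable_continuous_onI continuous_intros Dm Dper)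
      then show ?thesis by simp
    qed
    also have "\<dots> = (\<integral>y. (real N * D n y)\<^sup>2 \<partial>cellM)"
      by (simp add: power_mult_distrib power2_eq_square[of "real N"])
    finally show ?thesis by (simp add: N_def)
  qed
  then show ?thesis
    by (intro LIMSEQ_le_const[OF lim]) auto
qed

text \<open>With the autocorrelation c(z), twice the squared norm of \<phi> minus 2 c(z) is the
  squared norm of the increment by z, and the mean of c over the cell is the square of the mean of
  \<phi>. Averaging the increment estimate over z therefore produces the variance on the
  left.\<close>

lemma Poincare_smooth:
  fixes \<phi> :: "real^'n \<Rightarrow> real"
  assumes sm: "smooth_on UNIV \<phi>" and per: "cell_periodic \<phi>"
  shows "(\<integral>y. (\<phi> y)\<^sup>2 \<partial>cellM) - (\<integral>y. \<phi> y \<partial>cellM)\<^sup>2 \<le> real CARD('n) / 16 * (\<integral>y. (norm (grad \<phi> y))\<^sup>2 \<partial>cellM)"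
proof -
  obtain B where B: "\<And>y. norm (\<phi> y) \<le> B"
    using cell_periodic_bounded[OF per smooth_on_continuous[OF sm]] by blast
  note cont = continuous_on_compose2[OF smooth_on_continuous[OF sm]]
  define E where "E = (\<integral>y. (norm (grad \<phi> y))\<^sup>2 \<partial>cellM)"
  have E: "integrable cellM (\<lambda>y. (norm (grad \<phi> y))\<^sup>2)"
    by (rule sqi_integrable_norm[OF cell_continuous_sqi[OF smooth_on_grad_continuous[OF sm]]])
  define c where "c z = (\<integral>y. \<phi> (y + z) * \<phi> y \<partial>cellM)" for z
  have sq: "sqi cellM (\<lambda>y. \<phi> (y + w))" for w
    by (rule cell_continuous_sqi) (auto intro!: continuous_intros cont)
  have incr: "2 * (\<integral>y. (\<phi> y)\<^sup>2 \<partial>cellM) - 2 * c z \<le> (\<Sum>i\<in>UNIV. (1 - cos (2 * pi * z $ i)) / 8) * E"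
    if z: "z \<in> cell" for z
  proof -
    \<comment> \<open>By periodicity \<open>z\<close> may be replaced by the representative with
      coordinates in [-1/2, 1/2]; the increment estimate grows with the length of the
      increment.\<close>
    define k where "k i = (if z $ i \<le> 1/2 then 0 else 1 :: int)" for i
    define z' where "z' = z - (\<chi> i. of_int (k i))"
    have z'1: "\<bar>z' $ i\<bar> \<le> 1/2" for i
    proof -
      have "0 < z $ i \<and> z $ i < 1" using z cell_iff[of z] by blast
      moreover have "z' $ i = (if z $ i \<le> 1/2 then z $ i else z $ i - 1)" by (simp add: z'_def k_def)
      ultimately show ?thesis by (cases "z $ i \<le> 1/2") (simp only: if_True if_False, linarith)+
    qed
    have z'2: "(z' $ i)\<^sup>2 \<le> (1 - cos (2 * pi * z $ i)) / 8" for i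
    proof -
      \<comment> \<open>The square is bounded through a cosine of the original \<open>z\<close>,
        whose mean over the cell is zero: each coordinate contributes 1/8 on average.\<close>
      have "(2 * \<bar>z' $ i\<bar>)\<^sup>2 \<le> (sin (pi * \<bar>z' $ i\<bar>))\<^sup>2"
        using Jordan_sin[of "\<bar>z' $ i\<bar>"] z'1[of i] by (intro power_mono) auto
      also have "\<dots> = (1 - cos (2 * (pi * z' $ i))) / 2"
        by (cases "0 \<le> z' $ i") (simp_all add: cos_double_sin)
      also have "cos (2 * (pi * z' $ i)) = cos (2 * pi * z $ i)"
        by (simp add: z'_def k_def right_diff_distrib cos_diff mult.assoc)
      finally show ?thesis by (simp add: power_mult_distrib)
    qed
    have "2 * (\<integral>y. (\<phi> y)\<^sup>2 \<partial>cellM) - 2 * c z = (\<integral>y. (\<phi> (y + z) - \<phi> y)\<^sup>2 \<partial>cellM)"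
    proof -
      have "(\<integral>y. (\<phi> (y + z))\<^sup>2 \<partial>cellM) = (\<integral>y. (\<phi> y)\<^sup>2 \<partial>cellM)"
      proof (rule cell_integral_shift[where B="B\<^sup>2"])
        show "\<bar>(\<phi> y)\<^sup>2\<bar> \<le> B\<^sup>2" for y
          using power_mono[of "\<bar>\<phi> y\<bar>" B 2] B[of y] by simp
        show "\<bar>z $ i\<bar> \<le> 1" for i using z cell_iff[of z] by (auto simp: less_imp_le abs_if) (smt (verit))
      qed (use per in \<open>auto intro!: borel_measurable_continuous_onI continuous_intros cont simp: cell_periodic_def\<close>)
      moreover have "(\<phi> (y + z) - \<phi> y)\<^sup>2 = (\<phi> (y + z))\<^sup>2 + (\<phi> y)\<^sup>2 - 2 * (\<phi> (y + z) * \<phi> y)" for y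
        by (simp add: power2_diff mult.assoc)
      ultimately show ?thesis
        using sqi_mult_integrable[OF sq[of z] sq[of 0]] sqi_power2_integrable[OF sq[of z]] sqi_power2_integrable[OF sq[of 0]]
        by (simp add: c_def)
    qed
    also have "\<dots> = (\<integral>y. (\<phi> (y + z') - \<phi> y)\<^sup>2 \<partial>cellM)"
      using cell_periodic_floor[OF per, of "_ + z" k] by (simp add: z'_def diff_conv_add_uminus add.assoc del: add_uminus_conv_diff)
    also have "\<dots> \<le> (\<integral>y. (grad \<phi> y \<bullet> z')\<^sup>2 \<partial>cellM)"
      by (rule cell_integral_increment_le[OF sm per]) (rule order_trans[OF z'1], simp)
    also have "\<dots> \<le> (\<integral>y. (norm z')\<^sup>2 * (norm (grad \<phi> y))\<^sup>2 \<partial>cellM)"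
    proof (rule integral_mono)
      show "integrable cellM (\<lambda>y. (grad \<phi> y \<bullet> z')\<^sup>2)"
        by (rule sqi_power2_integrable[OF sqi_component[OF cell_continuous_sqi[OF smooth_on_grad_continuous[OF sm]]]])
      show "(grad \<phi> y \<bullet> z')\<^sup>2 \<le> (norm z')\<^sup>2 * (norm (grad \<phi> y))\<^sup>2" for y
        using power_mono[OF Cauchy_Schwarz_ineq2[of "grad \<phi> y" z'], of 2] by (simp add: power_mult_distrib mult.commute)
    qed (use E in simp)
    also have "\<dots> = (norm z')\<^sup>2 * E" by (simp add: E_def)
    also have "(norm z')\<^sup>2 = (\<Sum>i\<in>UNIV. (z' $ i)\<^sup>2)"
      unfolding power2_norm_eq_inner by (simp add: inner_vec_def power2_eq_square)
    also have "\<dots> * E \<le> (\<Sum>i\<in>UNIV. (1 - cos (2 * pi * z $ i)) / 8) * E"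
      by (intro mult_right_mono sum_mono z'2) (simp add: E_def)
    finally show ?thesis .
  qed
  interpret P: pair_prob_space cellM cellM ..
  have [measurable]: "\<phi> \<in> borel_measurable borel" "(\<lambda>y. y) \<in> measurable cellM borel"
    using smooth_on_continuous[OF sm] by (auto intro: borel_measurable_continuous_onI cellM_measurable)
  have cint: "integrable (cellM \<Otimes>\<^sub>M cellM) (\<lambda>(z, y). \<phi> (y + z) * \<phi> y)"
  proof (rule P.P.integrable_const_bound[where B="B * B"])
    show "AE x in cellM \<Otimes>\<^sub>M cellM. norm (case x of (z, y) \<Rightarrow> \<phi> (y + z) * \<phi> y) \<le> B * B"
      by (intro AE_I2) (auto simp: abs_mult intro!: mult_mono B[simplified] order_trans[OF abs_ge_zero B[simplified]])
  qed measurable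
  \<comment> \<open>After the exchange of integrals the inner one is the mean of \<phi>, by
    translation invariance.\<close>
  have "(\<integral>z. c z \<partial>cellM) = (\<integral>y. \<integral>z. \<phi> (y + z) * \<phi> y \<partial>cellM \<partial>cellM)"
    unfolding c_def by (rule P.Fubini_integral[OF cint, symmetric])
  also have "\<dots> = (\<integral>y. (\<integral>z. \<phi> z \<partial>cellM) * \<phi> y \<partial>cellM)"
  proof (rule Bochner_Integration.integral_cong[OF refl])
    fix y assume "y \<in> space (cellM :: (real^'n) measure)"
    then have y: "\<bar>y $ i\<bar> \<le> 1" for i using cell_iff[of y] by (auto simp: abs_if less_imp_le) (smt (verit))
    have "(\<integral>z. \<phi> (z + y) \<partial>cellM) = (\<integral>z. \<phi> z \<partial>cellM)"
      by (rule cell_integral_shift[OF _ _ per y]) (use B in auto)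
    then show "(\<integral>z. \<phi> (y + z) * \<phi> y \<partial>cellM) = (\<integral>z. \<phi> z \<partial>cellM) * \<phi> y"
      by (simp add: add.commute)
  qed
  also have "\<dots> = (\<integral>z. \<phi> z \<partial>cellM)\<^sup>2" by (simp add: power2_eq_square)
  finally have cc: "(\<integral>z. c z \<partial>cellM) = (\<integral>z. \<phi> z \<partial>cellM)\<^sup>2" .
  have ci: "integrable cellM c"
    unfolding c_def using P.integrable_fst'[OF cint] by simp
  have cosi: "integrable cellM (\<lambda>z::real^'n. cos (2 * pi * z $ i))" for i
    by (rule cellM.sqi_integrable[OF cell_continuous_sqi]) (auto intro!: continuous_intros)
  have "2 * (\<integral>y. (\<phi> y)\<^sup>2 \<partial>cellM) - 2 * (\<integral>y. \<phi> y \<partial>cellM)\<^sup>2 = (\<integral>z. 2 * (\<integral>y. (\<phi> y)\<^sup>2 \<partial>cellM) - 2 * c z \<partial>cellM)"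
    using ci by (simp add: cc)
  also have "\<dots> \<le> (\<integral>z. (\<Sum>i\<in>UNIV. (1 - cos (2 * pi * (z::real^'n) $ i)) / 8) * E \<partial>cellM)"
    by (rule integral_mono) (use incr ci cosi in auto)
  also have "\<dots> = real CARD('n) / 8 * E"
    using cosi by (simp add: cell_integral_cos)
  finally show ?thesis by (simp add: E_def)
qed

section \<open>Periodic Sobolev functions\<close>

lemma grad_add:
  fixes \<phi> \<psi> :: "real^'n \<Rightarrow> real"
  assumes "smooth_on UNIV \<phi>" "smooth_on UNIV \<psi>"
  shows "grad (\<lambda>y. \<phi> y + \<psi> y) y = grad \<phi> y + grad \<psi> y"
proof -
  have "((\<lambda>y. \<phi> y + \<psi> y) has_derivative (\<lambda>v. frechet_derivative \<phi> (at y) v + frechet_derivative \<psi> (at y) v)) (at y)"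
    using smooth_on_differentiable[OF assms(1)] smooth_on_differentiable[OF assms(2)]
    by (intro has_derivative_add) (simp_all add: frechet_derivative_works[symmetric])
  from frechet_derivative_at[OF this, symmetric] show ?thesis
    by (simp add: grad_def vec_eq_iff)
qed

lemma grad_cmult:
  fixes \<phi> :: "real^'n \<Rightarrow> real"
  assumes "smooth_on UNIV \<phi>"
  shows "grad (\<lambda>y. c * \<phi> y) y = c *\<^sub>R grad \<phi> y"
proof -
  have "((\<lambda>y. c * \<phi> y) has_derivative (\<lambda>v. c * frechet_derivative \<phi> (at y) v)) (at y)"
    using smooth_on_differentiable[OF assms]
    by (intro has_derivative_mult_right) (simp add: frechet_derivative_works[symmetric])
  from frechet_derivative_at[OF this, symmetric] show ?thesis
    by (simp add: grad_def vec_eq_iff)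
qed

lemma H1per_sqi: "H1per u G \<Longrightarrow> sqi cellM u" "H1per u G \<Longrightarrow> sqi cellM G"
  by (simp_all add: H1per_def H1_def L2_cell_iff)

lemma H1_sqnorm_cell: "H1_sqnorm cell u G = (\<integral>y. (u y)\<^sup>2 \<partial>cellM) + (\<integral>y. (norm (G y))\<^sup>2 \<partial>cellM)"
  by (simp add: H1_sqnorm_def cell_integral)

lemma test_fun_sqi:
  fixes \<phi> :: "real^'n \<Rightarrow> real"
  assumes "test_fun cell \<phi>"
  shows "sqi cellM \<phi>" "sqi cellM (grad \<phi>)"
  using assms test_fun_smooth by (auto intro!: cell_continuous_sqi smooth_on_continuous smooth_on_grad_continuous)

lemma sqi_nth: "sqi M G \<Longrightarrow> sqi M (\<lambda>y. G y $ i)" for G :: "_ \<Rightarrow> real^'n"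
  using sqi_component[of M G "axis i 1"] by (simp add: inner_axis)

lemma weak_grad_add:
  fixes u v :: "real^'n \<Rightarrow> real"
  assumes "H1 cell u G" "H1 cell v H"
  shows "weak_grad cell (\<lambda>y. u y + v y) (\<lambda>y. G y + H y)"
  unfolding weak_grad_def cell_integral
proof (intro allI impI)
  fix \<phi> :: "real^'n \<Rightarrow> real" and i
  assume \<phi>: "test_fun cell \<phi>"
  have "sqi cellM u" "sqi cellM v" "sqi cellM G" "sqi cellM H"
    using assms by (auto simp: H1_def L2_cell_iff)
  then have "integrable cellM (\<lambda>y. u y * grad \<phi> y $ i)" "integrable cellM (\<lambda>y. v y * grad \<phi> y $ i)"
    "integrable cellM (\<lambda>y. G y $ i * \<phi> y)" "integrable cellM (\<lambda>y. H y $ i * \<phi> y)"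
    using test_fun_sqi[OF \<phi>] by (auto intro!: sqi_mult_integrable sqi_nth)
  then show "(\<integral>y. (u y + v y) * grad \<phi> y $ i \<partial>cellM) = - (\<integral>y. (G y + H y) $ i * \<phi> y \<partial>cellM)"
    using assms \<phi> by (simp add: H1_def weak_grad_def cell_integral distrib_right)
qed

lemma H1_add:
  fixes u v :: "real^'n \<Rightarrow> real"
  assumes "H1 cell u G" "H1 cell v H"
  shows "H1 cell (\<lambda>y. u y + v y) (\<lambda>y. G y + H y)"
  using weak_grad_add[OF assms] assms by (auto simp: H1_def L2_cell_iff intro: sqi_add)

lemma H1_cmult:
  fixes u :: "real^'n \<Rightarrow> real"
  assumes "H1 cell u G"
  shows "H1 cell (\<lambda>y. c * u y) (\<lambda>y. c *\<^sub>R G y)"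
  using assms by (auto simp: H1_def L2_cell_iff weak_grad_def cell_integral mult.assoc intro: sqi_cmult sqi_scaleR)

lemma sqnorm_add_le:
  assumes "sqi M f" "sqi M g"
  shows "(\<integral>x. (norm (f x + g x))\<^sup>2 \<partial>M) \<le> 2 * (\<integral>x. (norm (f x))\<^sup>2 \<partial>M) + 2 * (\<integral>x. (norm (g x))\<^sup>2 \<partial>M)"
proof -
  have "0 \<le> (\<integral>x. (norm (f x + (-1) *\<^sub>R g x))\<^sup>2 \<partial>M)" by simp
  also have "\<dots> = (\<integral>x. (norm (f x))\<^sup>2 \<partial>M) - 2 * (\<integral>x. f x \<bullet> g x \<partial>M) + (\<integral>x. (norm (g x))\<^sup>2 \<partial>M)"
    using integral_norm_add_sq[OF assms(1) sqi_scaleR[OF assms(2), of "-1"]] by simp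
  finally show ?thesis
    using integral_norm_add_sq[OF assms] by simp
qed

lemma H1per_approx:
  fixes u :: "real^'n \<Rightarrow> real"
  assumes "H1per u G" "0 < e"
  obtains \<phi> where "smooth_on UNIV \<phi>" "cell_periodic \<phi>"
    "(\<integral>y. (u y - \<phi> y)\<^sup>2 \<partial>cellM) < e" "(\<integral>y. (norm (G y - grad \<phi> y))\<^sup>2 \<partial>cellM) < e"
proof -
  obtain \<phi> where \<phi>: "smooth_on UNIV \<phi>" "cell_periodic \<phi>" 
    "(\<integral>y. (u y - \<phi> y)\<^sup>2 \<partial>cellM) + (\<integral>y. (norm (G y - grad \<phi> y))\<^sup>2 \<partial>cellM) < e"
    using assms unfolding H1per_def H1_sqnorm_cell by blast
  have n: "0 \<le> (\<integral>y. (u y - \<phi> y)\<^sup>2 \<partial>cellM)" "0 \<le> (\<integral>y. (norm (G y - grad \<phi> y))\<^sup>2 \<partial>cellM)" by simp_all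
  show thesis
  proof (rule that[OF \<phi>(1,2)])
    show "(\<integral>y. (u y - \<phi> y)\<^sup>2 \<partial>cellM) < e" using n \<phi>(3) by linarith
    show "(\<integral>y. (norm (G y - grad \<phi> y))\<^sup>2 \<partial>cellM) < e" using n \<phi>(3) by linarith
  qed
qed

lemma H1perI:
  fixes u :: "real^'n \<Rightarrow> real"
  assumes "H1 cell u G" "\<And>e. 0 < e \<Longrightarrow> \<exists>\<phi>. smooth_on UNIV \<phi> \<and> cell_periodic \<phi> \<and>
    (\<integral>y. (u y - \<phi> y)\<^sup>2 \<partial>cellM) \<le> e \<and> (\<integral>y. (norm (G y - grad \<phi> y))\<^sup>2 \<partial>cellM) \<le> e"
  shows "H1per u G"
  unfolding H1per_def H1_sqnorm_cell
proof (intro conjI assms(1) allI impI)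
  fix e :: real assume "0 < e"
  \<comment> \<open>Two non-strict bounds by e/3 add up to strictly less than e.\<close>
  with assms(2)[of "e/3"] obtain \<phi> where "smooth_on UNIV \<phi>" "cell_periodic \<phi>"
    "(\<integral>y. (u y - \<phi> y)\<^sup>2 \<partial>cellM) \<le> e/3" "(\<integral>y. (norm (G y - grad \<phi> y))\<^sup>2 \<partial>cellM) \<le> e/3"
    by auto
  then show "\<exists>\<phi>. smooth_on UNIV \<phi> \<and> cell_periodic \<phi> \<and>
      (\<integral>y. (u y - \<phi> y)\<^sup>2 \<partial>cellM) + (\<integral>y. (norm (G y - grad \<phi> y))\<^sup>2 \<partial>cellM) < e"
    using \<open>0 < e\<close> by (intro exI[of _ \<phi>]) auto
qed

lemma H1per_add:
  fixes u v :: "real^'n \<Rightarrow> real"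
  assumes u: "H1per u G" and v: "H1per v H"
  shows "H1per (\<lambda>y. u y + v y) (\<lambda>y. G y + H y)"
proof (rule H1perI)
  show "H1 cell (\<lambda>y. u y + v y) (\<lambda>y. G y + H y)"
    using assms H1_add unfolding H1per_def by blast
  fix e :: real assume "0 < e"
  \<comment> \<open>A quarter, because \<open>sqnorm_add_le\<close> doubles both
    contributions.\<close>
  then have e: "0 < e/4" by simp
  from H1per_approx[OF u e] obtain \<phi> where \<phi>: "smooth_on UNIV \<phi>" "cell_periodic \<phi>"
    "(\<integral>y. (u y - \<phi> y)\<^sup>2 \<partial>cellM) < e/4" "(\<integral>y. (norm (G y - grad \<phi> y))\<^sup>2 \<partial>cellM) < e/4" by blast
  from H1per_approx[OF v e] obtain \<psi> where \<psi>: "smooth_on UNIV \<psi>" "cell_periodic \<psi>"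
    "(\<integral>y. (v y - \<psi> y)\<^sup>2 \<partial>cellM) < e/4" "(\<integral>y. (norm (H y - grad \<psi> y))\<^sup>2 \<partial>cellM) < e/4" by blast
  have s: "sqi cellM (\<lambda>y. u y - \<phi> y)" "sqi cellM (\<lambda>y. v y - \<psi> y)"
    "sqi cellM (\<lambda>y. G y - grad \<phi> y)" "sqi cellM (\<lambda>y. H y - grad \<psi> y)"
    by (intro sqi_diff H1per_sqi[OF u] H1per_sqi[OF v]
        cell_continuous_sqi[OF smooth_on_continuous[OF \<phi>(1)]] cell_continuous_sqi[OF smooth_on_continuous[OF \<psi>(1)]]
        cell_continuous_sqi[OF smooth_on_grad_continuous[OF \<phi>(1)]] cell_continuous_sqi[OF smooth_on_grad_continuous[OF \<psi>(1)]])+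
  have "(\<integral>y. (norm ((u y - \<phi> y) + (v y - \<psi> y)))\<^sup>2 \<partial>cellM) \<le> e"
    using sqnorm_add_le[OF s(1,2)] \<phi> \<psi> by simp
  moreover have "(\<integral>y. (norm ((G y - grad \<phi> y) + (H y - grad \<psi> y)))\<^sup>2 \<partial>cellM) \<le> e"
    using sqnorm_add_le[OF s(3,4)] \<phi> \<psi> by simp
  ultimately show "\<exists>\<phi>. smooth_on UNIV \<phi> \<and> cell_periodic \<phi> \<and>
    (\<integral>y. (u y + v y - \<phi> y)\<^sup>2 \<partial>cellM) \<le> e \<and> (\<integral>y. (norm (G y + H y - grad \<phi> y))\<^sup>2 \<partial>cellM) \<le> e"
    using \<phi> \<psi>
    by (intro exI[of _ "\<lambda>y. \<phi> y + \<psi> y"])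
      (auto simp: grad_add algebra_simps cell_periodic_def intro: smooth_on_add)
qed

lemma H1per_cmult:
  fixes u :: "real^'n \<Rightarrow> real"
  assumes u: "H1per u G"
  shows "H1per (\<lambda>y. c * u y) (\<lambda>y. c *\<^sub>R G y)"
proof (rule H1perI)
  show "H1 cell (\<lambda>y. c * u y) (\<lambda>y. c *\<^sub>R G y)"
    using assms H1_cmult unfolding H1per_def by blast
  fix e :: real assume "0 < e"
  \<comment> \<open>The summand 1 admits c = 0.\<close>
  moreover have "0 < c\<^sup>2 + 1" by (simp add: add_nonneg_pos)
  ultimately have e: "0 < e / (c\<^sup>2 + 1)" by simp
  from H1per_approx[OF u e] obtain \<phi> where \<phi>: "smooth_on UNIV \<phi>" "cell_periodic \<phi>"
    "(\<integral>y. (u y - \<phi> y)\<^sup>2 \<partial>cellM) < e / (c\<^sup>2 + 1)" "(\<integral>y. (norm (G y - grad \<phi> y))\<^sup>2 \<partial>cellM) < e / (c\<^sup>2 + 1)" by blast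
  have *: "c\<^sup>2 * x \<le> e" if "x < e / (c\<^sup>2 + 1)" "0 \<le> x" for x
    using that \<open>0 < c\<^sup>2 + 1\<close> by (simp add: pos_less_divide_eq distrib_left) (smt (verit) mult.commute)
  have "(\<integral>y. (c * u y - c * \<phi> y)\<^sup>2 \<partial>cellM) \<le> e" "(\<integral>y. (norm (c *\<^sub>R G y - c *\<^sub>R grad \<phi> y))\<^sup>2 \<partial>cellM) \<le> e"
    using *[OF \<phi>(3)] *[OF \<phi>(4)]
    by (simp_all flip: right_diff_distrib scaleR_diff_right add: power_mult_distrib)
  then show "\<exists>\<phi>. smooth_on UNIV \<phi> \<and> cell_periodic \<phi> \<and>
    (\<integral>y. (c * u y - \<phi> y)\<^sup>2 \<partial>cellM) \<le> e \<and> (\<integral>y. (norm (c *\<^sub>R G y - grad \<phi> y))\<^sup>2 \<partial>cellM) \<le> e"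
    using \<phi>
    by (intro exI[of _ "\<lambda>y. c * \<phi> y"])
      (auto simp: grad_cmult cell_periodic_def intro: smooth_on_mult smooth_on_const)
qed

lemma H1per0_iff: "H1per0 u G \<longleftrightarrow> H1per u G \<and> (\<integral>y. u y \<partial>cellM) = 0"
  by (simp add: H1per0_def cell_integral)

lemma H1per0_sqi: "H1per0 u G \<Longrightarrow> sqi cellM u" "H1per0 u G \<Longrightarrow> sqi cellM G"
  by (auto simp: H1per0_def H1per_sqi)

lemma H1per0_add:
  fixes u v :: "real^'n \<Rightarrow> real"
  assumes "H1per0 u G" "H1per0 v H"
  shows "H1per0 (\<lambda>y. u y + v y) (\<lambda>y. G y + H y)"
proof -
  have "integrable cellM u" "integrable cellM v"
    using assms by (auto simp: H1per0_iff intro: cellM.sqi_integrable H1per_sqi(1))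
  then show ?thesis
    using assms H1per_add[of u G v H] by (simp add: H1per0_iff)
qed

lemma H1per0_cmult:
  fixes u :: "real^'n \<Rightarrow> real"
  assumes "H1per0 u G"
  shows "H1per0 (\<lambda>y. c * u y) (\<lambda>y. c *\<^sub>R G y)"
  using assms H1per_cmult by (auto simp: H1per0_iff)

lemma H1per0_diff:
  fixes u v :: "real^'n \<Rightarrow> real"
  assumes "H1per0 u G" "H1per0 v H"
  shows "H1per0 (\<lambda>y. u y - v y) (\<lambda>y. G y - H y)"
  using H1per0_add[OF assms(1) H1per0_cmult[OF assms(2), of "-1"]] by simp

section \<open>Passing to L2 limits in inner products and norms\<close>

lemma tendsto_integral_inner:
  assumes f: "sqi M f" "\<And>n. sqi M (F n)" and g: "sqi M g"
    and lim: "(\<lambda>n. \<integral>x. (norm (f x - F n x))\<^sup>2 \<partial>M) \<longlonglongrightarrow> 0"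
  shows "(\<lambda>n. \<integral>x. F n x \<bullet> g x \<partial>M) \<longlonglongrightarrow> (\<integral>x. f x \<bullet> g x \<partial>M)"
proof -
  have "\<bar>(\<integral>x. F n x \<bullet> g x \<partial>M) - (\<integral>x. f x \<bullet> g x \<partial>M)\<bar> \<le>
      sqrt (\<integral>x. (norm (f x - F n x))\<^sup>2 \<partial>M) * sqrt (\<integral>x. (norm (g x))\<^sup>2 \<partial>M)" for n
  proof -
    have "(\<integral>x. (f x - F n x) \<bullet> g x \<partial>M) = (\<integral>x. f x \<bullet> g x \<partial>M) - (\<integral>x. F n x \<bullet> g x \<partial>M)"
      using f g by (simp add: inner_diff_left sqi_inner_integrable)
    then show ?thesis
      using sqi_Cauchy_Schwarz_abs[OF sqi_diff[OF f(1) f(2)[of n]] g] by simp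
  qed
  moreover have "(\<lambda>n. sqrt (\<integral>x. (norm (f x - F n x))\<^sup>2 \<partial>M) * sqrt (\<integral>x. (norm (g x))\<^sup>2 \<partial>M)) \<longlonglongrightarrow> 0"
    using tendsto_mult[OF tendsto_real_sqrt[OF lim] tendsto_const[of "sqrt (\<integral>x. (norm (g x))\<^sup>2 \<partial>M)"]] by simp
  ultimately have "(\<lambda>n. (\<integral>x. F n x \<bullet> g x \<partial>M) - (\<integral>x. f x \<bullet> g x \<partial>M)) \<longlonglongrightarrow> 0"
    by (intro Lim_null_comparison[where f="\<lambda>n. (\<integral>x. F n x \<bullet> g x \<partial>M) - (\<integral>x. f x \<bullet> g x \<partial>M)"] always_eventually) auto
  then show ?thesis by (rule LIM_zero_cancel)
qed

lemma tendsto_integral_sqnorm: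
  assumes f: "sqi M f" "\<And>n. sqi M (F n)"
    and lim: "(\<lambda>n. \<integral>x. (norm (f x - F n x))\<^sup>2 \<partial>M) \<longlonglongrightarrow> 0"
  shows "(\<lambda>n. \<integral>x. (norm (F n x))\<^sup>2 \<partial>M) \<longlonglongrightarrow> (\<integral>x. (norm (f x))\<^sup>2 \<partial>M)"
proof -
  have "(\<integral>x. (norm (F n x))\<^sup>2 \<partial>M) = 2 * (\<integral>x. F n x \<bullet> f x \<partial>M) - (\<integral>x. (norm (f x))\<^sup>2 \<partial>M)
      + (\<integral>x. (norm (f x - F n x))\<^sup>2 \<partial>M)" for n
    using integral_norm_add_sq[OF f(1) sqi_scaleR[OF f(2), of "-1"], of n]
    by (simp add: inner_commute)
  moreover have "(\<lambda>n. 2 * (\<integral>x. F n x \<bullet> f x \<partial>M) - (\<integral>x. (norm (f x))\<^sup>2 \<partial>M)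
      + (\<integral>x. (norm (f x - F n x))\<^sup>2 \<partial>M)) \<longlonglongrightarrow> 2 * (\<integral>x. f x \<bullet> f x \<partial>M) - (\<integral>x. (norm (f x))\<^sup>2 \<partial>M) + 0"
    by (intro tendsto_intros tendsto_integral_inner f lim)
  ultimately show ?thesis
    by (simp add: power2_norm_eq_inner)
qed

lemma H1per_approx_seq:
  fixes u :: "real^'n \<Rightarrow> real"
  assumes "H1per u G"
  shows "\<exists>\<phi>::nat \<Rightarrow> _. (\<forall>n. smooth_on UNIV (\<phi> n)) \<and> (\<forall>n. cell_periodic (\<phi> n)) \<and>
    (\<lambda>n. \<integral>y. (norm (u y - \<phi> n y))\<^sup>2 \<partial>cellM) \<longlonglongrightarrow> 0 \<and>
    (\<lambda>n. \<integral>y. (norm (G y - grad (\<phi> n) y))\<^sup>2 \<partial>cellM) \<longlonglongrightarrow> 0"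
proof -
  have "\<exists>\<phi>. smooth_on UNIV \<phi> \<and> cell_periodic \<phi> \<and>
    (\<integral>y. (norm (u y - \<phi> y))\<^sup>2 \<partial>cellM) \<le> inverse (real (Suc n)) \<and>
    (\<integral>y. (norm (G y - grad \<phi> y))\<^sup>2 \<partial>cellM) \<le> inverse (real (Suc n))" for n
  proof -
    have "0 < inverse (real (Suc n))" by simp
    from H1per_approx[OF assms this] obtain \<phi> where "smooth_on UNIV \<phi>" "cell_periodic \<phi>"
      "(\<integral>y. (u y - \<phi> y)\<^sup>2 \<partial>cellM) < inverse (real (Suc n))"
      "(\<integral>y. (norm (G y - grad \<phi> y))\<^sup>2 \<partial>cellM) < inverse (real (Suc n))" by blast
    then show ?thesis by (intro exI[of _ \<phi>]) auto
  qed
  then obtain \<phi> where \<phi>: "\<And>n. smooth_on UNIV (\<phi> n) \<and> cell_periodic (\<phi> n) \<and>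
    (\<integral>y. (norm (u y - \<phi> n y))\<^sup>2 \<partial>cellM) \<le> inverse (real (Suc n)) \<and>
    (\<integral>y. (norm (G y - grad (\<phi> n) y))\<^sup>2 \<partial>cellM) \<le> inverse (real (Suc n))"
    using choice[of "\<lambda>n \<phi>. smooth_on UNIV \<phi> \<and> cell_periodic \<phi> \<and>
    (\<integral>y. (norm (u y - \<phi> y))\<^sup>2 \<partial>cellM) \<le> inverse (real (Suc n)) \<and>
    (\<integral>y. (norm (G y - grad \<phi> y))\<^sup>2 \<partial>cellM) \<le> inverse (real (Suc n))"] by blast
  show ?thesis
  proof (intro exI[of _ \<phi>] conjI allI)
    show "(\<lambda>n. \<integral>y. (norm (u y - \<phi> n y))\<^sup>2 \<partial>cellM) \<longlonglongrightarrow> 0"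
      by (rule tendsto_sandwich[OF _ _ tendsto_const LIMSEQ_inverse_real_of_nat])
        (use \<phi> in \<open>auto intro!: always_eventually\<close>)
    show "(\<lambda>n. \<integral>y. (norm (G y - grad (\<phi> n) y))\<^sup>2 \<partial>cellM) \<longlonglongrightarrow> 0"
      by (rule tendsto_sandwich[OF _ _ tendsto_const LIMSEQ_inverse_real_of_nat])
        (use \<phi> in \<open>auto intro!: always_eventually\<close>)
  qed (use \<phi> in auto)
qed

text \<open>Gradients of smooth periodic functions have mean zero, and the mean is continuous in L2.
  Periodicity thereby enters the energy estimate: the cross term between \<open>G\<close> and a
  constant vector disappears.\<close>

lemma H1per_integral_grad:
  fixes u :: "real^'n \<Rightarrow> real"
  assumes "H1per u G"
  shows "(\<integral>y. G y \<bullet> \<xi> \<partial>cellM) = 0"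
proof -
  from H1per_approx_seq[OF assms] obtain \<phi> where \<phi>: "\<And>n::nat. smooth_on UNIV (\<phi> n)" "\<And>n. cell_periodic (\<phi> n)"
    "(\<lambda>n. \<integral>y. (norm (G y - grad (\<phi> n) y))\<^sup>2 \<partial>cellM) \<longlonglongrightarrow> 0" by blast
  have sg: "sqi cellM (grad (\<phi> n))" for n
    by (intro cell_continuous_sqi smooth_on_grad_continuous \<phi>)
  have "(\<lambda>n. \<integral>y. grad (\<phi> n) y \<bullet> \<xi> \<partial>cellM) \<longlonglongrightarrow> (\<integral>y. G y \<bullet> \<xi> \<partial>cellM)"
    by (rule tendsto_integral_inner[OF H1per_sqi(2)[OF assms] sg cellM.sqi_const \<phi>(3)])
  moreover have "(\<integral>y. grad (\<phi> n) y \<bullet> \<xi> \<partial>cellM) = 0" for n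
    using cellM.sqi_integrable[OF sqi_nth[OF sg]] cell_integral_grad[OF \<phi>(2,1)]
    by (simp add: inner_vec_def)
  ultimately have "(\<lambda>n::nat. 0::real) \<longlonglongrightarrow> (\<integral>y. G y \<bullet> \<xi> \<partial>cellM)" by simp
  then show ?thesis
    using LIMSEQ_unique[OF tendsto_const] by metis
qed

lemma Poincare:
  fixes u :: "real^'n \<Rightarrow> real"
  assumes "H1per0 u G"
  shows "(\<integral>y. (u y)\<^sup>2 \<partial>cellM) \<le> real CARD('n) / 16 * (\<integral>y. (norm (G y))\<^sup>2 \<partial>cellM)"
proof -
  have H: "H1per u G" "(\<integral>y. u y \<partial>cellM) = 0" using assms by (auto simp: H1per0_iff)
  from H1per_approx_seq[OF H(1)] obtain \<phi> where \<phi>: "\<And>n::nat. smooth_on UNIV (\<phi> n)" "\<And>n. cell_periodic (\<phi> n)"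
    "(\<lambda>n. \<integral>y. (norm (u y - \<phi> n y))\<^sup>2 \<partial>cellM) \<longlonglongrightarrow> 0"
    "(\<lambda>n. \<integral>y. (norm (G y - grad (\<phi> n) y))\<^sup>2 \<partial>cellM) \<longlonglongrightarrow> 0" by blast
  have sg: "sqi cellM (grad (\<phi> n))" and su: "sqi cellM (\<phi> n)" for n
    by (intro cell_continuous_sqi smooth_on_grad_continuous smooth_on_continuous \<phi>)+
  have l1: "(\<lambda>n. \<integral>y. (norm (\<phi> n y))\<^sup>2 \<partial>cellM) \<longlonglongrightarrow> (\<integral>y. (norm (u y))\<^sup>2 \<partial>cellM)"
    by (rule tendsto_integral_sqnorm[OF H1per_sqi(1)[OF H(1)] su \<phi>(3)])
  have l2: "(\<lambda>n. \<integral>y. (norm (grad (\<phi> n) y))\<^sup>2 \<partial>cellM) \<longlonglongrightarrow> (\<integral>y. (norm (G y))\<^sup>2 \<partial>cellM)"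
    by (rule tendsto_integral_sqnorm[OF H1per_sqi(2)[OF H(1)] sg \<phi>(4)])
  have l3: "(\<lambda>n. \<integral>y. \<phi> n y \<partial>cellM) \<longlonglongrightarrow> 0"
    using tendsto_integral_inner[OF H1per_sqi(1)[OF H(1)] su cellM.sqi_const[of "1::real"] \<phi>(3)] H(2) by simp
  have "(\<integral>y. (norm (u y))\<^sup>2 \<partial>cellM) - 0\<^sup>2 \<le> real CARD('n) / 16 * (\<integral>y. (norm (G y))\<^sup>2 \<partial>cellM)"
  proof (rule LIMSEQ_le)
    show "(\<lambda>n. (\<integral>y. (norm (\<phi> n y))\<^sup>2 \<partial>cellM) - (\<integral>y. \<phi> n y \<partial>cellM)\<^sup>2) \<longlonglongrightarrow> (\<integral>y. (norm (u y))\<^sup>2 \<partial>cellM) - 0\<^sup>2"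
      by (intro tendsto_intros l1 l3)
    show "(\<lambda>n. real CARD('n) / 16 * (\<integral>y. (norm (grad (\<phi> n) y))\<^sup>2 \<partial>cellM)) \<longlonglongrightarrow> real CARD('n) / 16 * (\<integral>y. (norm (G y))\<^sup>2 \<partial>cellM)"
      by (intro tendsto_intros l2)
  qed (use Poincare_smooth[OF \<phi>(1,2)] in auto)
  then show ?thesis by simp
qed

section \<open>Continuity of translations\<close>

lemma lborel_integrable_translate:
  fixes f :: "'a::euclidean_space \<Rightarrow> 'b::{banach, second_countable_topology}"
  assumes "integrable lborel f"
  shows "integrable lborel (\<lambda>y. f (y + v))"
proof -
  have "integrable (distr lborel borel ((+) v)) f"
    using assms by (simp add: lborel_distr_plus)
  then have "integrable lborel (\<lambda>y. f (v + y))"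
    by (rule integrable_distr[rotated]) simp
  then show ?thesis by (simp add: add.commute)
qed

text \<open>The modulus equals the difference of the two indicators plus twice the indicator of the
  points that leave \<open>U\<close>. The difference integrates to zero by translation invariance; a
  point of an open set stays inside for small shifts, so the other part tends to zero by
  domination.\<close>

lemma L1_translate_open:
  fixes U :: "'a::euclidean_space set"
  assumes U: "open U" "emeasure lborel U < \<infinity>" and v: "v \<longlonglongrightarrow> 0"
  shows "(\<lambda>n. \<integral>z. \<bar>indicat_real U (z + v n) - indicat_real U z\<bar> \<partial>lborel) \<longlonglongrightarrow> (0::real)"
proof -
  have [measurable]: "U \<in> sets borel" using U by simp
  have int: "integrable lborel (indicat_real U :: 'a \<Rightarrow> real)"
    using U by (simp add: integrable_indicator_iff)
  have intv: "integrable lborel (\<lambda>z. indicat_real U (z + w) :: real)" for w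
    by (rule lborel_integrable_translate[OF int])
  have intp: "integrable lborel (\<lambda>z. indicat_real U z * (1 - indicat_real U (z + w)) :: real)" for w
    by (rule Bochner_Integration.integrable_bound[OF int]) (auto simp: indicator_def)
  have "(\<integral>z. \<bar>indicat_real U (z + v n) - indicat_real U z\<bar> \<partial>lborel) =
      (\<integral>z. 2 * (indicat_real U z * (1 - indicat_real U (z + v n))) \<partial>lborel)" for n
  proof -
    have "\<bar>indicat_real U (z + v n) - indicat_real U z\<bar> =
        (indicat_real U (z + v n) - indicat_real U z) + 2 * (indicat_real U z * (1 - indicat_real U (z + v n)) :: real)" for z
      by (auto simp: indicator_def)
    moreover have "(\<integral>z. indicat_real U (z + v n) \<partial>lborel) = (\<integral>z. indicat_real U z \<partial>lborel :: real)"
      by (rule lborel_integral_translate) simp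
    ultimately show ?thesis
      using int intv[of "v n"] intp[of "v n"] by simp
  qed
  moreover have "(\<lambda>n. \<integral>z. 2 * (indicat_real U z * (1 - indicat_real U (z + v n))) \<partial>lborel) \<longlonglongrightarrow> (\<integral>z. 0 \<partial>(lborel :: 'a measure) :: real)"
  proof (rule integral_dominated_convergence[where w="\<lambda>z. 2 * indicat_real U z"])
    show "AE z in lborel. (\<lambda>n. 2 * (indicat_real U z * (1 - indicat_real U (z + v n)))) \<longlonglongrightarrow> (0::real)"
    proof (rule AE_I2)
      fix z :: 'a
      show "(\<lambda>n. 2 * (indicat_real U z * (1 - indicat_real U (z + v n)))) \<longlonglongrightarrow> (0::real)"
      proof (cases "z \<in> U")
        case True
        have "(\<lambda>n. z + v n) \<longlonglongrightarrow> z + 0" by (intro tendsto_intros v)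
        then have "\<forall>\<^sub>F n in sequentially. z + v n \<in> U"
          using topological_tendstoD[OF _ U(1)] True by simp
        then have "\<forall>\<^sub>F n in sequentially. 2 * (indicat_real U z * (1 - indicat_real U (z + v n))) = (0::real)"
          by eventually_elim simp
        then show ?thesis by (rule tendsto_eventually)
      qed simp
    qed
    show "AE z in lborel. norm (2 * (indicat_real U z * (1 - indicat_real U (z + v n)))) \<le> 2 * indicat_real U z" for n
      by (auto simp: indicator_def)
  qed (use int in auto)
  ultimately show ?thesis by simp
qed

text \<open>Induction over integrable functions. A measurable set is replaced by an open superset
  with small excess; in the limit step, translation invariance transports the approximation error to
  the shifted function.\<close>

lemma L1_translate_tendsto:
  fixes f :: "'a::euclidean_space \<Rightarrow> real"
  assumes f: "integrable lborel f" and v: "v \<longlonglongrightarrow> 0"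
  shows "(\<lambda>n. \<integral>z. \<bar>f (z + v n) - f z\<bar> \<partial>lborel) \<longlonglongrightarrow> 0"
  using f
proof (induct rule: integrable_induct)
  case (base A c)
  have [measurable]: "A \<in> sets borel" using base by simp
  have "(\<lambda>n. \<integral>z. \<bar>indicat_real A (z + v n) - indicat_real A z\<bar> \<partial>lborel) \<longlonglongrightarrow> (0::real)"
  proof (rule LIMSEQ_I)
    fix e :: real assume "0 < e"
    then have "0 < e/3" by simp
    obtain U where U: "open U" "A \<subseteq> U" "emeasure lborel (U - A) < ennreal (e/3)"
      using outer_regular_lborel[OF \<open>A \<in> sets borel\<close> \<open>0 < e/3\<close>] by blast
    have [measurable]: "U \<in> sets borel" using U by simp
    have fin: "emeasure lborel (U - A) < \<infinity>" using U(3) by (simp add: less_top[symmetric]) (metis ennreal_less_top not_less_iff_gr_or_eq order.strict_trans)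
    have "emeasure lborel U = emeasure lborel A + emeasure lborel (U - A)"
      using U(2) by (subst plus_emeasure) (auto simp: Un_absorb1)
    then have Ufin: "emeasure lborel U < \<infinity>" using base fin by simp
    define d :: "'a \<Rightarrow> real" where "d = indicat_real (U - A)"
    have dint: "integrable lborel d" unfolding d_def using fin by (simp add: integrable_indicator_iff)
    have dval: "(\<integral>z. d z \<partial>lborel) < e/3"
    proof -
      have "(\<integral>z. d z \<partial>lborel) = measure lborel (U - A)" by (simp add: d_def)
      also have "\<dots> < e/3" using U(3) fin \<open>0 < e\<close>
        by (simp add: emeasure_eq_ennreal_measure ennreal_less_iff)
      finally show ?thesis .
    qed
    have Uint: "integrable lborel (indicat_real U :: 'a \<Rightarrow> real)"
      using Ufin by (simp add: integrable_indicator_iff)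
    note Uintv = lborel_integrable_translate[OF Uint]
    \<comment> \<open>\<open>A\<close> and its translate differ from \<open>U\<close> and its
      translate by indicators of the excess, each of integral below e/3.\<close>
    have bound: "(\<integral>z. \<bar>indicat_real A (z + v n) - indicat_real A z\<bar> \<partial>lborel) \<le>
        (\<integral>z. \<bar>indicat_real U (z + v n) - indicat_real U z\<bar> \<partial>lborel) + 2 * (\<integral>z. d z \<partial>lborel)" for n
    proof -
      have "(\<integral>z. \<bar>indicat_real A (z + v n) - indicat_real A z\<bar> \<partial>lborel) \<le>
        (\<integral>z. \<bar>indicat_real U (z + v n) - indicat_real U z\<bar> + (d (z + v n) + d z) \<partial>lborel)"
      proof (rule Bochner_Integration.integral_mono)
        show "integrable lborel (\<lambda>z. \<bar>indicat_real U (z + v n) - indicat_real U z\<bar> + (d (z + v n) + d z))"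
          using Uint Uintv[of "v n"] dint lborel_integrable_translate[OF dint, of "v n"] by auto
        have Aint: "integrable lborel (indicat_real A :: 'a \<Rightarrow> real)"
          using base by (simp add: integrable_indicator_iff)
        show "integrable lborel (\<lambda>z. \<bar>indicat_real A (z + v n) - indicat_real A z\<bar> :: real)"
          using Aint lborel_integrable_translate[OF Aint, of "v n"] by auto
        show "\<bar>indicat_real A (z + v n) - indicat_real A z\<bar> \<le>
            \<bar>indicat_real U (z + v n) - indicat_real U z\<bar> + (d (z + v n) + d z)" for z
          using U(2) by (auto simp: indicator_def d_def)
      qed
      also have "\<dots> = (\<integral>z. \<bar>indicat_real U (z + v n) - indicat_real U z\<bar> \<partial>lborel) + ((\<integral>z. d (z + v n) \<partial>lborel) + (\<integral>z. d z \<partial>lborel))"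
        using Uint Uintv[of "v n"] dint lborel_integrable_translate[OF dint, of "v n"] by simp
      also have "(\<integral>z. d (z + v n) \<partial>lborel) = (\<integral>z. d z \<partial>lborel)"
        by (rule lborel_integral_translate) (simp add: d_def)
      finally show ?thesis by simp
    qed
    have "\<exists>no. \<forall>n\<ge>no. norm ((\<integral>z. \<bar>indicat_real U (z + v n) - indicat_real U z\<bar> \<partial>lborel) - 0) < e/3"
      using LIMSEQ_D[OF L1_translate_open[OF U(1) Ufin v] \<open>0 < e/3\<close>] by simp
    then obtain no where no: "\<And>n. n \<ge> no \<Longrightarrow> \<bar>\<integral>z. \<bar>indicat_real U (z + v n) - indicat_real U z :: real\<bar> \<partial>lborel\<bar> < e/3"
      by auto
    show "\<exists>no. \<forall>n\<ge>no. norm ((\<integral>z. \<bar>indicat_real A (z + v n) - indicat_real A z\<bar> \<partial>lborel) - 0) < e"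
    proof (intro exI[of _ no] allI impI)
      fix n assume "no \<le> n"
      have "0 \<le> (\<integral>z. \<bar>indicat_real A (z + v n) - indicat_real A z :: real\<bar> \<partial>lborel)" by simp
      then show "norm ((\<integral>z. \<bar>indicat_real A (z + v n) - indicat_real A z\<bar> \<partial>lborel) - 0) < e"
        using bound[of n] no[OF \<open>no \<le> n\<close>] dval by simp
    qed
  qed
  then have "(\<lambda>n. \<bar>c\<bar> * (\<integral>z. \<bar>indicat_real A (z + v n) - indicat_real A z\<bar> \<partial>lborel)) \<longlonglongrightarrow> \<bar>c\<bar> * 0"
    by (intro tendsto_intros)
  moreover have "\<bar>indicat_real A (z + v n) *\<^sub>R c - indicat_real A z *\<^sub>R c\<bar> = \<bar>c\<bar> * \<bar>indicat_real A (z + v n) - indicat_real A z\<bar>" for z n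
    by (simp add: abs_mult[symmetric] algebra_simps)
  ultimately show ?case by simp
next
  case (add f g)
  have "(\<lambda>n. (\<integral>z. \<bar>f (z + v n) - f z\<bar> \<partial>lborel) + (\<integral>z. \<bar>g (z + v n) - g z\<bar> \<partial>lborel)) \<longlonglongrightarrow> 0 + 0"
    by (intro tendsto_add add)
  then have lim: "(\<lambda>n. (\<integral>z. \<bar>f (z + v n) - f z\<bar> \<partial>lborel) + (\<integral>z. \<bar>g (z + v n) - g z\<bar> \<partial>lborel)) \<longlonglongrightarrow> 0" by simp
  show ?case
  proof (rule tendsto_sandwich[OF _ _ tendsto_const lim])
    have "(\<integral>z. \<bar>f (z + v n) + g (z + v n) - (f z + g z)\<bar> \<partial>lborel) \<le>
      (\<integral>z. \<bar>f (z + v n) - f z\<bar> + \<bar>g (z + v n) - g z\<bar> \<partial>lborel)" for n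
      by (rule Bochner_Integration.integral_mono)
        (use add(1,3) lborel_integrable_translate[OF add(1), of "v n"] lborel_integrable_translate[OF add(3), of "v n"] in auto)
    then show "\<forall>\<^sub>F n in sequentially. (\<integral>z. \<bar>f (z + v n) + g (z + v n) - (f z + g z)\<bar> \<partial>lborel) \<le>
      (\<integral>z. \<bar>f (z + v n) - f z\<bar> \<partial>lborel) + (\<integral>z. \<bar>g (z + v n) - g z\<bar> \<partial>lborel)"
      using add(1,3) lborel_integrable_translate[OF add(1)] lborel_integrable_translate[OF add(3)] by simp
  qed auto
next
  case (lim f s)
  have sint: "(\<lambda>i. \<integral>z. \<bar>s i z - f z\<bar> \<partial>lborel) \<longlonglongrightarrow> (\<integral>z. 0 \<partial>(lborel :: 'a measure))"
  proof (rule integral_dominated_convergence[where w="\<lambda>z. 3 * norm (f z)"])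
    show "AE z in lborel. (\<lambda>i. \<bar>s i z - f z\<bar>) \<longlonglongrightarrow> 0"
      using lim(3) by (auto intro!: AE_I2 tendsto_rabs_zero LIM_zero)
    show "AE z in lborel. norm \<bar>s i z - f z\<bar> \<le> 3 * norm (f z)" for i
    proof (rule AE_I2)
      fix z :: 'a assume "z \<in> space lborel"
      then show "norm \<bar>s i z - f z\<bar> \<le> 3 * norm (f z)"
        using lim(4)[of z i] by simp
    qed
    show "(\<lambda>z. \<bar>s i z - f z\<bar>) \<in> borel_measurable lborel" for i
      using lim(1)[of i] lim(5) by measurable
  qed (use lim(5) in auto)
  show ?case
  proof (rule LIMSEQ_I)
    fix e :: real assume "0 < e"
    then have e: "0 < e/3" by simp
    obtain i where i: "\<bar>\<integral>z. \<bar>s i z - f z\<bar> \<partial>lborel\<bar> < e/3"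
      using LIMSEQ_D[OF sint e] by auto
    obtain no where no: "\<And>n. n \<ge> no \<Longrightarrow> \<bar>\<integral>z. \<bar>s i (z + v n) - s i z\<bar> \<partial>lborel\<bar> < e/3"
      using LIMSEQ_D[OF lim(2)[of i] e] by auto
    define d where "d z = \<bar>s i z - f z\<bar>" for z
    have dint: "integrable lborel d" unfolding d_def using lim(1)[of i] lim(5) by auto
    note dintv = lborel_integrable_translate[OF dint]
    note fintv = lborel_integrable_translate[OF lim(5)] and sintv = lborel_integrable_translate[OF lim(1)[of i]]
    have bound: "(\<integral>z. \<bar>f (z + v n) - f z\<bar> \<partial>lborel) \<le> (\<integral>z. \<bar>s i (z + v n) - s i z\<bar> \<partial>lborel) + 2 * (\<integral>z. d z \<partial>lborel)" for n
    proof -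
      have bound: "(\<integral>z. \<bar>f (z + v n) - f z\<bar> \<partial>lborel) \<le> (\<integral>z. \<bar>s i (z + v n) - s i z\<bar> + (d (z + v n) + d z) \<partial>lborel)"
        by (rule Bochner_Integration.integral_mono)
          (use lim(1)[of i] lim(5) fintv[of "v n"] sintv[of "v n"] dint dintv[of "v n"] in \<open>auto simp: d_def\<close>)
      also have "\<dots> = (\<integral>z. \<bar>s i (z + v n) - s i z\<bar> \<partial>lborel) + ((\<integral>z. d (z + v n) \<partial>lborel) + (\<integral>z. d z \<partial>lborel))"
        using lim(1)[of i] sintv[of "v n"] dint dintv[of "v n"] by simp
      also have "(\<integral>z. d (z + v n) \<partial>lborel) = (\<integral>z. d z \<partial>lborel)"
        by (rule lborel_integral_translate) (use dint in simp)
      finally show ?thesis by simp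
    qed
    have "\<bar>\<integral>z. \<bar>f (z + v n) - f z\<bar> \<partial>lborel\<bar> < e" if "no \<le> n" for n
    proof -
      have "0 \<le> (\<integral>z. \<bar>f (z + v n) - f z\<bar> \<partial>lborel)" by simp
      moreover have "(\<integral>z. \<bar>f (z + v n) - f z\<bar> \<partial>lborel) < e"
        using bound[of n] abs_ge_self[of "\<integral>z. \<bar>s i (z + v n) - s i z\<bar> \<partial>lborel"] no[OF that] i
          abs_ge_self[of "\<integral>z. d z \<partial>lborel"] unfolding d_def[symmetric] by linarith
      ultimately show ?thesis by simp
    qed
    then show "\<exists>no. \<forall>n\<ge>no. norm ((\<integral>z. \<bar>f (z + v n) - f z\<bar> \<partial>lborel) - 0) < e" by auto
  qed
qed

text \<open>The signed square \<open>p \<bar>p\<bar>\<close> is integrable and \<open>(a - b)\<^sup>2 \<le> 2 \<bar>a \<bar>a\<bar> - b \<bar>b\<bar>\<bar>\<close>, which reduces the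
  statement to the \<open>L\<^sup>1\<close> case.\<close>
lemma L2_translate_tendsto:
  fixes p :: "'a::euclidean_space \<Rightarrow> real"
  assumes p: "sqi lborel p" and v: "v \<longlonglongrightarrow> 0"
  shows "(\<lambda>n. \<integral>z. (norm (p z - p (z + v n)))\<^sup>2 \<partial>lborel) \<longlonglongrightarrow> 0"
proof -
  define f where "f z = p z * \<bar>p z\<bar>" for z
  have pm [measurable]: "p \<in> borel_measurable borel" using p by (simp add: sqi_def)
  have "integrable lborel f"
    by (rule Bochner_Integration.integrable_bound[OF sqi_power2_integrable[OF p]])
      (auto simp: f_def[abs_def] abs_mult power2_eq_square)
  note fint = this lborel_integrable_translate[OF this]
  \<comment> \<open>For equal signs (x - y)^2 \<le> |x - y| (x + y) = |x^2 - y^2| on absolute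
    values; for opposite signs both sides are compared with a^2 + b^2.\<close>
  have ineq: "(a - b)\<^sup>2 \<le> 2 * \<bar>b * \<bar>b\<bar> - a * \<bar>a\<bar>\<bar>" for a b :: real
  proof -
    have pos: "(x - y)\<^sup>2 \<le> 2 * \<bar>y * y - x * x\<bar>" if "0 \<le> x" "0 \<le> y" for x y :: real
    proof -
      have "(x - y)\<^sup>2 = \<bar>x - y\<bar> * \<bar>x - y\<bar>" by (simp add: power2_eq_square)
      also have "\<dots> \<le> \<bar>x - y\<bar> * (x + y)" using that by (intro mult_left_mono) auto
      also have "\<dots> = \<bar>(y - x) * (y + x)\<bar>" using that
        by (simp add: abs_mult abs_minus_commute add.commute)
      also have "(y - x) * (y + x) = y * y - x * x" by (simp add: algebra_simps)
      finally show ?thesis by (rule order_trans) simp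
    qed
    have mix: "(x + y)\<^sup>2 \<le> 2 * (x * x + y * y)" for x y :: real
      using sum_squares_bound[of x y] by (simp add: power2_eq_square algebra_simps)
    consider "0 \<le> a \<and> 0 \<le> b" | "a < 0 \<and> b < 0" | "0 \<le> a \<and> b < 0" | "a < 0 \<and> 0 \<le> b" by linarith
    then show ?thesis
    proof cases
      case 1 then show ?thesis using pos[of a b] by simp
    next
      case 2 then show ?thesis using pos[of "-a" "-b"] by (simp add: power2_commute abs_minus_commute)
    next
      case 3 then show ?thesis using mix[of a "-b"] by (auto simp: abs_if)
    next
      case 4 then show ?thesis using mix[of "-a" b] mult_nonneg_nonneg[of b b] by (auto simp: abs_if power2_commute algebra_simps)
    qed
  qed
  have "(\<lambda>n. 2 * (\<integral>z. \<bar>f (z + v n) - f z\<bar> \<partial>lborel)) \<longlonglongrightarrow> 2 * 0"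
    by (intro tendsto_mult tendsto_const L1_translate_tendsto fint v)
  then have lim: "(\<lambda>n. 2 * (\<integral>z. \<bar>f (z + v n) - f z\<bar> \<partial>lborel)) \<longlonglongrightarrow> 0" by simp
  show ?thesis
  proof (rule tendsto_sandwich[OF _ _ tendsto_const lim])
    have "(\<integral>z. (norm (p z - p (z + v n)))\<^sup>2 \<partial>lborel) \<le> (\<integral>z. 2 * \<bar>f (z + v n) - f z\<bar> \<partial>lborel)" for n
    proof (rule integral_mono_AE')
      show "AE z in lborel. (norm (p z - p (z + v n)))\<^sup>2 \<le> 2 * \<bar>f (z + v n) - f z\<bar>"
        using ineq by (auto simp: f_def)
    qed (use fint in auto)
    then show "\<forall>\<^sub>F n in sequentially. (\<integral>z. (norm (p z - p (z + v n)))\<^sup>2 \<partial>lborel) \<le> 2 * (\<integral>z. \<bar>f (z + v n) - f z\<bar> \<partial>lborel)"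
      by simp
  qed auto
qed

lemma sqi_translate:
  fixes p :: "'a::euclidean_space \<Rightarrow> 'b::euclidean_space"
  assumes "sqi lborel p"
  shows "sqi lborel (\<lambda>z. p (z + v))"
  using assms lborel_integrable_translate[of "\<lambda>z. (norm (p z))\<^sup>2" v] measurable_compose[of "\<lambda>z. z + v" borel borel p borel]
  by (simp add: sqi_def)

text \<open>Componentwise in the orthonormal basis, which reduces vector-valued functions to the
  scalar translation theorem.\<close>

lemma inner_translate_tendsto:
  fixes p q :: "'a::euclidean_space \<Rightarrow> 'b::euclidean_space"
  assumes p: "sqi lborel p" and q: "sqi lborel q" and v: "v \<longlonglongrightarrow> 0"
  shows "(\<lambda>n. \<integral>z. p (z + v n) \<bullet> q z \<partial>lborel) \<longlonglongrightarrow> (\<integral>z. p z \<bullet> q z \<partial>lborel)"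
proof -
  have "(\<lambda>n. \<integral>z. (p (z + v n) \<bullet> b) \<bullet> (q z \<bullet> b) \<partial>lborel) \<longlonglongrightarrow> (\<integral>z. (p z \<bullet> b) \<bullet> (q z \<bullet> b) \<partial>lborel)" for b
    by (rule tendsto_integral_inner)
      (intro sqi_component p q sqi_translate L2_translate_tendsto v)+
  then have "(\<lambda>n. \<Sum>b\<in>Basis. \<integral>z. (p (z + v n) \<bullet> b) \<bullet> (q z \<bullet> b) \<partial>lborel) \<longlonglongrightarrow> (\<Sum>b\<in>Basis. \<integral>z. (p z \<bullet> b) \<bullet> (q z \<bullet> b) \<partial>lborel)"
    by (rule tendsto_sum)
  moreover have "(\<Sum>b\<in>Basis. \<integral>z. (p (z + w) \<bullet> b) \<bullet> (q z \<bullet> b) \<partial>lborel) = (\<integral>z. p (z + w) \<bullet> q z \<partial>lborel)" for w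
  proof -
    have "(\<integral>z. p (z + w) \<bullet> q z \<partial>lborel) = (\<integral>z. (\<Sum>b\<in>Basis. (p (z + w) \<bullet> b) \<bullet> (q z \<bullet> b)) \<partial>lborel)"
      by (rule arg_cong[where f="integral\<^sup>L lborel"], rule ext, subst euclidean_inner, rule sum.cong) auto
    also have "\<dots> = (\<Sum>b\<in>Basis. \<integral>z. (p (z + w) \<bullet> b) \<bullet> (q z \<bullet> b) \<partial>lborel)"
      by (rule Bochner_Integration.integral_sum) (rule sqi_inner_integrable[OF sqi_component[OF sqi_translate[OF p]] sqi_component[OF q]])
    finally show ?thesis by simp
  qed
  note eq = this this[of 0]
  ultimately show ?thesis by (simp only: eq add_0_right)
qed

section \<open>Restriction to the diagonal\<close>

text \<open>The substitution t = s + h x turns the double integral into that of \<beta>(x) c(h x),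
  where c(x) is the integral of \<open>K\<close> along the line t = s + x. As the diagonal is a null
  set, integrability of \<open>K\<close> says nothing about it; boundedness of c and its continuity
  at 0 are assumed instead.\<close>

lemma diagonal_limit:
  fixes K :: "real \<Rightarrow> real \<Rightarrow> real" and \<beta> :: "real \<Rightarrow> real"
  assumes K: "integrable (lborel \<Otimes>\<^sub>M lborel) (\<lambda>(s, t). K s t)"
    and cB: "\<And>x. \<bar>\<integral>s. K s (s + x) \<partial>lborel\<bar> \<le> B"
    and c0: "\<And>x. x \<longlonglongrightarrow> 0 \<Longrightarrow> (\<lambda>n. \<integral>s. K s (s + x n) \<partial>lborel) \<longlonglongrightarrow> (\<integral>s. K s s \<partial>lborel)"
    and \<beta>: "\<beta> \<in> borel_measurable borel" "\<And>x. \<bar>\<beta> x\<bar> \<le> B'" "integrable lborel \<beta>"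
    and h: "\<And>n::nat. 0 < h n" "h \<longlonglongrightarrow> 0"
  shows "(\<lambda>n. \<integral>s. \<integral>t. \<beta> ((t - s) / h n) / h n * K s t \<partial>lborel \<partial>lborel) \<longlonglongrightarrow> (\<integral>x. \<beta> x \<partial>lborel) * (\<integral>s. K s s \<partial>lborel)"
proof -
  have [measurable]: "(\<lambda>(s, t). K s t) \<in> borel_measurable (borel \<Otimes>\<^sub>M borel)"
    using borel_measurable_integrable[OF K] by simp
  then have Km: "(\<lambda>x. K (f x) (g x)) \<in> borel_measurable M"
    if "f \<in> borel_measurable M" "g \<in> borel_measurable M" for f g and M :: "'z measure"
    using measurable_compose[of "\<lambda>x. (f x, g x)" M "borel \<Otimes>\<^sub>M borel" "\<lambda>(s, t). K s t" borel] that by simp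
  have Km2 [measurable]: "(\<lambda>x. K (f x) (g x)) \<in> borel_measurable M"
    if "f \<in> borel_measurable M" "g \<in> borel_measurable M" for f g and M :: "(real \<times> real) measure"
    using measurable_compose[of "\<lambda>x. (f x, g x)" M "borel \<Otimes>\<^sub>M borel" "\<lambda>(s, t). K s t" borel] that by simp
  note \<beta>(1)[measurable]
  define c where "c x = (\<integral>s. K s (s + x) \<partial>lborel)" for x
  have eq: "(\<integral>s. \<integral>t. \<beta> ((t - s) / h n) / h n * K s t \<partial>lborel \<partial>lborel) = (\<integral>x. \<beta> x * c (h n * x) \<partial>lborel)" for n
  proof -
    have hn: "h n \<noteq> 0" "\<bar>h n\<bar> = h n" using h(1)[of n] by auto
    have inner: "(\<integral>t. \<beta> ((t - s) / h n) / h n * K s t \<partial>lborel) = (\<integral>x. \<beta> x * K s (s + h n * x) \<partial>lborel)" for s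
    proof -
      have e: "\<beta> ((s + h n * x - s) / h n) / h n * K s (s + h n * x) = (1 / h n) * (\<beta> x * K s (s + h n * x))" for x
        using hn by simp
      show ?thesis
        using lborel_integral_real_affine[OF hn(1), of "\<lambda>t. \<beta> ((t - s) / h n) / h n * K s t" s] hn
        unfolding e integral_mult_right_zero by simp
    qed
    \<comment> \<open>The same substitution for absolute values supplies the integrability of the
      sheared kernel that Fubini asks for.\<close>
    have inner': "(\<integral>t. norm (\<beta> ((t - s) / h n) / h n * K s t) \<partial>lborel) = (\<integral>x. norm (\<beta> x * K s (s + h n * x)) \<partial>lborel)" for s
    proof -
      have e: "norm (\<beta> ((s + h n * x - s) / h n) / h n * K s (s + h n * x)) = (1 / h n) * norm (\<beta> x * K s (s + h n * x))" for x
        using hn by (simp add: abs_mult)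
      show ?thesis
        using lborel_integral_real_affine[OF hn(1), of "\<lambda>t. norm (\<beta> ((t - s) / h n) / h n * K s t)" s] hn
        unfolding e integral_mult_right_zero by simp
    qed
    have int1: "integrable (lborel \<Otimes>\<^sub>M lborel) (\<lambda>(s, t). \<beta> ((t - s) / h n) / h n * K s t)"
    proof (rule Bochner_Integration.integrable_bound)
      show "integrable (lborel \<Otimes>\<^sub>M lborel) (\<lambda>p. (B' / h n) * norm (case p of (s, t) \<Rightarrow> K s t))"
        using K by simp
      show "AE p in lborel \<Otimes>\<^sub>M lborel. norm (case p of (s, t) \<Rightarrow> \<beta> ((t - s) / h n) / h n * K s t) \<le> norm ((B' / h n) * norm (case p of (s, t) \<Rightarrow> K s t))"
      proof (rule AE_I2, clarify)
        fix s t
        have "\<bar>\<beta> ((t - s) / h n)\<bar> / h n * \<bar>K s t\<bar> \<le> B' / h n * \<bar>K s t\<bar>"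
          using \<beta>(2) h(1)[of n] by (intro mult_right_mono divide_right_mono) auto
        moreover have "0 \<le> B'" using \<beta>(2)[of 0] by linarith
        ultimately show "norm (\<beta> ((t - s) / h n) / h n * K s t) \<le> norm ((B' / h n) * norm (K s t))"
          using h(1)[of n] by (simp add: abs_mult)
      qed
    qed measurable
    have int2: "integrable (lborel \<Otimes>\<^sub>M lborel) (\<lambda>(s, x). \<beta> x * K s (s + h n * x))"
    proof (rule lborel_pair.Fubini_integrable)
      show "integrable lborel (\<lambda>s. \<integral>x. norm (case (s, x) of (s, x) \<Rightarrow> \<beta> x * K s (s + h n * x)) \<partial>lborel)"
        using lborel_pair.integrable_fst'[OF integrable_norm[OF int1]] by (simp only: prod.case inner')
      show "AE s in lborel. integrable lborel (\<lambda>x. case (s, x) of (s, x) \<Rightarrow> \<beta> x * K s (s + h n * x))"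
        using lborel_pair.AE_integrable_fst'[OF int1]
      proof eventually_elim
        case (elim s)
        then have "integrable lborel (\<lambda>t. h n * (\<beta> ((t - s) / h n) / h n * K s t))"
          by (intro integrable_mult_right) (simp only: prod.case)
        from lborel_integrable_real_affine[OF this hn(1), of s] show ?case
          using hn(1) by (simp add: mult.assoc[symmetric])
      qed
    qed measurable
    have "(\<integral>s. \<integral>t. \<beta> ((t - s) / h n) / h n * K s t \<partial>lborel \<partial>lborel) = (\<integral>s. \<integral>x. \<beta> x * K s (s + h n * x) \<partial>lborel \<partial>lborel)"
      by (simp only: inner)
    also have "\<dots> = (\<integral>x. \<integral>s. \<beta> x * K s (s + h n * x) \<partial>lborel \<partial>lborel)"
      by (rule lborel_pair.Fubini_integral[OF int2, symmetric])
    finally show ?thesis by (simp add: c_def)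
  qed
  have "(\<lambda>n. \<integral>x. \<beta> x * c (h n * x) \<partial>lborel) \<longlonglongrightarrow> (\<integral>x. \<beta> x * (\<integral>s. K s s \<partial>lborel) \<partial>lborel)"
  proof (rule integral_dominated_convergence[where w="\<lambda>x. \<bar>\<beta> x\<bar> * B"])
    have "(\<lambda>x. c (h n * x)) \<in> borel_measurable lborel" for n
      unfolding c_def by (rule lborel.borel_measurable_lebesgue_integral) (simp add: case_prod_beta', measurable)
    then show "(\<lambda>x. \<beta> x * c (h n * x)) \<in> borel_measurable lborel" for n by measurable
    show "AE x in lborel. (\<lambda>n. \<beta> x * c (h n * x)) \<longlonglongrightarrow> \<beta> x * (\<integral>s. K s s \<partial>lborel)"
    proof (rule AE_I2)
      fix x :: real
      have "(\<lambda>n. h n * x) \<longlonglongrightarrow> 0 * x" by (intro tendsto_intros h)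
      then show "(\<lambda>n. \<beta> x * c (h n * x)) \<longlonglongrightarrow> \<beta> x * (\<integral>s. K s s \<partial>lborel)"
        unfolding c_def by (intro tendsto_mult tendsto_const c0) simp
    qed
    show "AE x in lborel. norm (\<beta> x * c (h n * x)) \<le> \<bar>\<beta> x\<bar> * B" for n
      using cB by (auto simp: c_def abs_mult intro!: mult_left_mono)
  qed (use \<beta> in auto)
  then show ?thesis unfolding eq by simp
qed

section \<open>Square integrable functions on the space-time cylinder\<close>

definition st_L2 :: "real \<Rightarrow> (real \<Rightarrow> real^'n \<Rightarrow> 'b::euclidean_space) \<Rightarrow> bool" where
  "st_L2 T p \<longleftrightarrow> L2 ({0<..<T} \<times> cell) (\<lambda>(t, y). p t y)"

text \<open>Extension by zero to all of space-time, on which translations in time act.\<close>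

definition st_ext :: "real \<Rightarrow> (real \<Rightarrow> real^'n \<Rightarrow> 'b::euclidean_space) \<Rightarrow> real \<times> (real^'n) \<Rightarrow> 'b" where
  "st_ext T p z = (indicator {0<..<T} (fst z) * indicator cell (snd z)) *\<^sub>R p (fst z) (snd z)"

definition cell_ip :: "(real^'n \<Rightarrow> 'b::euclidean_space) \<Rightarrow> (real^'n \<Rightarrow> 'b) \<Rightarrow> real" where
  "cell_ip u v = (\<integral>y. u y \<bullet> v y \<partial>cellM)"

lemma st_L2_iff: "st_L2 T p \<longleftrightarrow> sqi lborel (st_ext T p)"
proof -
  have 1: "indicator ({0<..<T} \<times> cell) z *\<^sub>R (case z of (t, y) \<Rightarrow> p t y) = st_ext T p z" for z
    by (auto simp: st_ext_def indicator_def split: prod.splits)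
  have 2: "indicator ({0<..<T} \<times> cell) z *\<^sub>R (norm (case z of (t, y) \<Rightarrow> p t y))\<^sup>2 = (norm (st_ext T p z))\<^sup>2" for z
    by (auto simp: st_ext_def indicator_def split: prod.splits)
  show ?thesis
    unfolding st_L2_def L2_def sqi_def set_borel_measurable_def set_integrable_def 1 2 by simp
qed

lemma st_ext_scale: "st_ext T (\<lambda>t y. m t *\<^sub>R p t y) z = m (fst z) *\<^sub>R st_ext T p z"
  by (simp add: st_ext_def)

lemma st_L2_scale:
  fixes p :: "real \<Rightarrow> real^'a \<Rightarrow> 'b::euclidean_space"
  assumes p: "st_L2 T p" and m: "m \<in> borel_measurable borel" "\<And>t. \<bar>m t\<bar> \<le> B"
  shows "st_L2 T (\<lambda>t y. m t *\<^sub>R p t y)"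
  unfolding st_L2_iff
proof (rule sqi_bound[where C=B])
  have [measurable]: "st_ext T p \<in> borel_measurable borel" using p by (simp add: st_L2_iff sqi_def)
  have [measurable]: "(\<lambda>z :: real \<times> (real^'a). m (fst z)) \<in> borel_measurable borel"
    by (rule measurable_compose[OF _ m(1)]) (auto intro!: borel_measurable_continuous_onI continuous_intros)
  have "(\<lambda>z. m (fst z) *\<^sub>R st_ext T p z) \<in> borel_measurable borel"
    by measurable
  then show "st_ext T (\<lambda>t y. m t *\<^sub>R p t y) \<in> borel_measurable lborel"
    by (simp add: st_ext_scale[abs_def])
  show "AE z in lborel. norm (st_ext T (\<lambda>t y. m t *\<^sub>R p t y) z) \<le> B * norm (st_ext T p z)"
    using m(2) by (auto simp: st_ext_scale intro!: mult_right_mono)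
qed (use p in \<open>simp add: st_L2_iff\<close>)

lemma st_L2_add: "st_L2 T p \<Longrightarrow> st_L2 T q \<Longrightarrow> st_L2 T (\<lambda>t y. p t y + q t y)"
proof -
  assume "st_L2 T p" "st_L2 T q"
  then have "sqi lborel (\<lambda>z. st_ext T p z + st_ext T q z)" by (auto simp: st_L2_iff intro: sqi_add)
  then show ?thesis by (simp add: st_L2_iff st_ext_def[abs_def] scaleR_add_right)
qed

lemma st_L2_cmult: "st_L2 T p \<Longrightarrow> st_L2 T (\<lambda>t y. c *\<^sub>R p t y)"
  by (rule st_L2_scale[where m="\<lambda>_. c" and B="\<bar>c\<bar>"]) auto

lemma st_L2_zero: "st_L2 T (\<lambda>t y. 0)"
  by (simp add: st_L2_iff st_ext_def[abs_def] sqi_zero)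

lemma st_L2_sum: "finite I \<Longrightarrow> (\<And>i. i \<in> I \<Longrightarrow> st_L2 T (p i)) \<Longrightarrow> st_L2 T (\<lambda>t y. \<Sum>i\<in>I. p i t y)"
  by (induction I rule: finite_induct) (auto intro: st_L2_zero st_L2_add)

lemma integral_cell_ext:
  "t \<in> {0<..<T} \<Longrightarrow> s \<in> {0<..<T} \<Longrightarrow> (\<integral>y. st_ext T p (t, y) \<bullet> st_ext T q (s, y) \<partial>lborel) = cell_ip (p t) (q s)"
  unfolding cell_ip_def
  by (subst integral_restrict_space)
    (auto simp: st_ext_def indicator_def intro!: Bochner_Integration.integral_cong)

lemma integral_cell_ext_outside:
  "t \<notin> {0<..<T} \<or> s \<notin> {0<..<T} \<Longrightarrow> (\<integral>y. st_ext T p (t, y) \<bullet> st_ext T q (s, y) \<partial>lborel) = 0"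
  by (auto simp: st_ext_def)

lemma st_ext_pair_measurable:
  assumes "st_L2 T p"
  shows "st_ext T p \<in> borel_measurable (lborel \<Otimes>\<^sub>M lborel)" "st_ext T p \<in> borel_measurable (borel \<Otimes>\<^sub>M borel)"
  using assms by (simp_all add: st_L2_iff sqi_def borel_prod lborel_prod)

lemma st_L2_section:
  assumes "st_L2 T p"
  shows "AE t in lborel. t \<in> {0<..<T} \<longrightarrow> sqi cellM (p t)"
    and "integrable lborel (\<lambda>t. \<integral>y. (norm (st_ext T p (t, y)))\<^sup>2 \<partial>lborel)"
proof -
  have int: "integrable (lborel \<Otimes>\<^sub>M lborel) (\<lambda>z. (norm (st_ext T p z))\<^sup>2)"
    using assms by (simp add: st_L2_iff sqi_def lborel_prod)
  show "integrable lborel (\<lambda>t. \<integral>y. (norm (st_ext T p (t, y)))\<^sup>2 \<partial>lborel)"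
    using lborel_pair.integrable_fst'[OF int] by simp
  have "AE t in lborel. integrable lborel (\<lambda>y. (norm (st_ext T p (t, y)))\<^sup>2)"
    using lborel_pair.AE_integrable_fst'[OF int] by simp
  then show "AE t in lborel. t \<in> {0<..<T} \<longrightarrow> sqi cellM (p t)"
  proof eventually_elim
    case (elim t)
    show ?case
    proof
      assume t: "t \<in> {0<..<T}"
      have "(\<lambda>y. st_ext T p (t, y)) \<in> borel_measurable lborel"
        using st_ext_pair_measurable(1)[OF assms] by measurable
      moreover have "st_ext T p (t, y) = indicator cell y *\<^sub>R p t y" for y
        using t by (simp add: st_ext_def)
      moreover have "(norm (st_ext T p (t, y)))\<^sup>2 = indicator cell y *\<^sub>R (norm (p t y))\<^sup>2" for y
        using t by (simp add: st_ext_def indicator_def)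
      ultimately show "sqi cellM (p t)"
        using elim by (simp add: sqi_def borel_measurable_restrict_space_iff integrable_restrict_space)
    qed
  qed
qed

section \<open>Kernels in two times and their diagonals\<close>

lemma st_diagonal_integrable:
  assumes p: "st_L2 T p" and q: "st_L2 T q"
  shows "set_integrable lborel {0<..<T} (\<lambda>t. cell_ip (p t) (q t))"
    and "(LINT t:{0<..<T}|lborel. cell_ip (p t) (q t)) = (\<integral>z. st_ext T p z \<bullet> st_ext T q z \<partial>lborel)"
proof -
  have int: "integrable (lborel \<Otimes>\<^sub>M lborel) (\<lambda>z. st_ext T p z \<bullet> st_ext T q z)"
    using sqi_inner_integrable[of lborel "st_ext T p" "st_ext T q"] p q by (simp add: st_L2_iff lborel_prod)
  have eq: "(\<integral>y. st_ext T p (t, y) \<bullet> st_ext T q (t, y) \<partial>lborel) = indicator {0<..<T} t *\<^sub>R cell_ip (p t) (q t)" for t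
    using integral_cell_ext[of t T t p q] integral_cell_ext_outside[of t T t p q] by (cases "t \<in> {0<..<T}") auto
  show "set_integrable lborel {0<..<T} (\<lambda>t. cell_ip (p t) (q t))"
    using lborel_pair.integrable_fst'[OF int] by (simp add: set_integrable_def eq)
  show "(LINT t:{0<..<T}|lborel. cell_ip (p t) (q t)) = (\<integral>z. st_ext T p z \<bullet> st_ext T q z \<partial>lborel)"
    using lborel_pair.integral_fst'[OF int] by (simp add: set_lebesgue_integral_def eq lborel_prod)
qed

text \<open>The time \<open>t\<close> belongs to \<open>p\<close> and \<open>s\<close> to
  \<open>q\<close>: integration in \<open>t\<close> evaluates the equation for \<open>p\<close> with
  the test function \<open>q s\<close> frozen.\<close>

definition st_kernel :: "real \<Rightarrow> (real \<Rightarrow> real^'n \<Rightarrow> 'b::euclidean_space) \<Rightarrow> (real \<Rightarrow> real^'n \<Rightarrow> 'b) \<Rightarrow> real \<Rightarrow> real \<Rightarrow> real" where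
  "st_kernel T p q s t = indicator {0<..<T} s * indicator {0<..<T} t * cell_ip (p t) (q s)"

lemma st_kernel_eq: "st_kernel T p q s t = (\<integral>y. st_ext T p (t, y) \<bullet> st_ext T q (s, y) \<partial>lborel)"
  using integral_cell_ext[of t T s p q] integral_cell_ext_outside[of t T s p q]
  by (cases "t \<in> {0<..<T} \<and> s \<in> {0<..<T}") (auto simp: st_kernel_def)

lemma st_kernel_measurable:
  assumes p: "st_L2 T p" and q: "st_L2 T q"
  shows "(\<lambda>(s, t). st_kernel T p q s t) \<in> borel_measurable (lborel \<Otimes>\<^sub>M lborel)"
proof -
  note [measurable] = st_ext_pair_measurable(2)[OF p] st_ext_pair_measurable(2)[OF q]
  show ?thesis
    unfolding st_kernel_eq case_prod_beta'
    by (rule lborel.borel_measurable_lebesgue_integral) (simp add: case_prod_beta', measurable)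
qed

text \<open>Dominated by the sum of the squared cell norms of p(t) and q(s), each integrable in its
  own time and constant in the other, over a bounded square.\<close>

lemma st_kernel_integrable:
  assumes p: "st_L2 T p" and q: "st_L2 T q"
  shows "integrable (lborel \<Otimes>\<^sub>M lborel) (\<lambda>(s, t). st_kernel T p q s t)"
proof -
  define P where "P t = (\<integral>y. (norm (st_ext T p (t, y)))\<^sup>2 \<partial>lborel)" for t
  define Q where "Q s = (\<integral>y. (norm (st_ext T q (s, y)))\<^sup>2 \<partial>lborel)" for s
  have P: "integrable lborel P" and Q: "integrable lborel Q"
    unfolding P_def Q_def by (rule st_L2_section(2)[OF p] st_L2_section(2)[OF q])+
  define ind where "ind = indicat_real {0<..<T}"
  have ind: "integrable lborel ind" unfolding ind_def by (cases "0 \<le> T") (simp_all add: integrable_indicator_iff)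
  have indP: "integrable lborel (\<lambda>t. ind t * P t)"
    by (rule Bochner_Integration.integrable_bound[OF P]) (use P in \<open>auto simp: ind_def indicator_def\<close>)
  have indQ: "integrable lborel (\<lambda>t. ind t * Q t)"
    by (rule Bochner_Integration.integrable_bound[OF Q]) (use Q in \<open>auto simp: ind_def indicator_def\<close>)
  have bound: "AE s in lborel. AE t in lborel. \<bar>st_kernel T p q s t\<bar> \<le> ind s * (ind t * P t + ind t * Q s)"
    using st_L2_section(1)[OF q]
  proof eventually_elim
    case (elim s)
    show ?case using st_L2_section(1)[OF p]
    proof eventually_elim
      case (elim t)
      show ?case
      proof (cases "s \<in> {0<..<T} \<and> t \<in> {0<..<T}")
        case True
        then have sq: "sqi cellM (q s)" "sqi cellM (p t)" using elim \<open>s \<in> _ \<longrightarrow> _\<close> by auto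
        have PQ: "P t = (\<integral>y. (norm (p t y))\<^sup>2 \<partial>cellM)" "Q s = (\<integral>y. (norm (q s y))\<^sup>2 \<partial>cellM)"
          using True unfolding P_def Q_def
          by (subst integral_restrict_space; auto simp: st_ext_def indicator_def intro!: Bochner_Integration.integral_cong)+
        have "\<bar>cell_ip (p t) (q s)\<bar> \<le> (\<integral>y. \<bar>p t y \<bullet> q s y\<bar> \<partial>cellM)"
          unfolding cell_ip_def by (rule integral_abs_bound)
        also have "\<dots> \<le> (\<integral>y. (norm (p t y))\<^sup>2 + (norm (q s y))\<^sup>2 \<partial>cellM)"
          by (rule Bochner_Integration.integral_mono)
            (use sq in \<open>auto simp: norm_inner_le_squares sqi_inner_integrable sqi_integrable_norm\<close>)
        also have "\<dots> = P t + Q s" using sq by (simp add: PQ sqi_integrable_norm)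
        finally show ?thesis using True by (simp add: st_kernel_def ind_def)
      qed (auto simp: st_kernel_def ind_def indicator_def P_def Q_def)
    qed
  qed
  have meas: "(\<lambda>t. st_kernel T p q s t) \<in> borel_measurable lborel" for s
    using measurable_Pair2[OF st_kernel_measurable[OF p q], of s] by simp
  have dom: "integrable lborel (\<lambda>t. ind s * (ind t * P t + ind t * Q s))" for s
    using indP ind by auto
  show ?thesis
  proof (rule lborel_pair.Fubini_integrable[OF st_kernel_measurable[OF p q]])
    show ae: "AE s in lborel. integrable lborel (\<lambda>t. case (s, t) of (s, t) \<Rightarrow> st_kernel T p q s t)"
      using bound
    proof eventually_elim
      case (elim s)
      then have "AE t in lborel. norm (st_kernel T p q s t) \<le> norm (ind s * (ind t * P t + ind t * Q s))"
        by eventually_elim auto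
      then show ?case
        using Bochner_Integration.integrable_bound[OF dom meas] by simp
    qed
    have C: "integrable lborel (\<lambda>s. (\<integral>t. ind t * P t \<partial>lborel) * ind s + (\<integral>t. ind t \<partial>lborel) * (ind s * Q s))"
      using ind indQ by auto
    show "integrable lborel (\<lambda>s. \<integral>t. norm (case (s, t) of (s, t) \<Rightarrow> st_kernel T p q s t) \<partial>lborel)"
    proof (rule Bochner_Integration.integrable_bound[OF C])
      show "(\<lambda>s. \<integral>t. norm (case (s, t) of (s, t) \<Rightarrow> st_kernel T p q s t) \<partial>lborel) \<in> borel_measurable lborel"
        using st_kernel_measurable[OF p q] by measurable
      show "AE s in lborel. norm (\<integral>t. norm (case (s, t) of (s, t) \<Rightarrow> st_kernel T p q s t) \<partial>lborel)
          \<le> norm ((\<integral>t. ind t * P t \<partial>lborel) * ind s + (\<integral>t. ind t \<partial>lborel) * (ind s * Q s))"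
        using bound
      proof eventually_elim
        case (elim s)
        have "(\<integral>t. \<bar>st_kernel T p q s t\<bar> \<partial>lborel) \<le> (\<integral>t. ind s * (ind t * P t + ind t * Q s) \<partial>lborel)"
          by (rule integral_mono_AE') (use elim dom in auto)
        also have "\<dots> = ind s * ((\<integral>t. ind t * P t \<partial>lborel) + (\<integral>t. ind t \<partial>lborel) * Q s)"
          using indP ind by simp
        finally show ?case
          by (simp add: algebra_simps)
      qed
    qed
  qed
qed

text \<open>The integral along t = s + x is the space-time inner product of \<open>q\<close> with a
  time translate of \<open>p\<close>: bounded by Cauchy-Schwarz and continuous at x = 0 by
  continuity of translations.\<close>

lemma st_diagonal_limit:
  assumes p: "st_L2 T p" and q: "st_L2 T q"
    and \<beta>: "\<beta> \<in> borel_measurable borel" "\<And>x. \<bar>\<beta> x\<bar> \<le> B'" "integrable lborel \<beta>"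
    and h: "\<And>n::nat. 0 < h n" "h \<longlonglongrightarrow> 0"
  shows "(\<lambda>n. \<integral>s. \<integral>t. \<beta> ((t - s) / h n) / h n * st_kernel T p q s t \<partial>lborel \<partial>lborel)
    \<longlonglongrightarrow> (\<integral>x. \<beta> x \<partial>lborel) * (LINT t:{0<..<T}|lborel. cell_ip (p t) (q t))"
proof -
  note [measurable] = st_ext_pair_measurable(2)[OF p, unfolded borel_prod]
  have sp: "sqi lborel (st_ext T p)" and sq: "sqi lborel (st_ext T q)"
    using p q by (auto simp: st_L2_iff)
  have c: "(\<integral>s. st_kernel T p q s (s + x) \<partial>lborel) = (\<integral>z. st_ext T p (z + (x, 0)) \<bullet> st_ext T q z \<partial>lborel)" for x
  proof -
    have "integrable (lborel \<Otimes>\<^sub>M lborel) (\<lambda>z. st_ext T p (z + (x, 0)) \<bullet> st_ext T q z)"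
      using sqi_inner_integrable[OF sqi_translate[OF sp] sq, of "(x, 0)"] by (simp add: lborel_prod)
    from lborel_pair.integral_fst'[OF this] show ?thesis
      by (simp add: st_kernel_eq lborel_prod)
  qed
  have diag: "(\<integral>s. st_kernel T p q s s \<partial>lborel) = (LINT t:{0<..<T}|lborel. cell_ip (p t) (q t))"
    using c[of 0] st_diagonal_integrable(2)[OF p q] by (simp add: zero_prod_def[symmetric])
  show ?thesis
    unfolding diag[symmetric]
  proof (rule diagonal_limit[OF st_kernel_integrable[OF p q] _ _ \<beta> h])
    show "\<bar>\<integral>s. st_kernel T p q s (s + x) \<partial>lborel\<bar> \<le>
      sqrt (\<integral>z. (norm (st_ext T p z))\<^sup>2 \<partial>lborel) * sqrt (\<integral>z. (norm (st_ext T q z))\<^sup>2 \<partial>lborel)" for x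
    proof -
      have "(\<integral>z. (norm (st_ext T p (z + (x, 0))))\<^sup>2 \<partial>lborel) = (\<integral>z. (norm (st_ext T p z))\<^sup>2 \<partial>lborel)"
        by (rule lborel_integral_translate[where f="\<lambda>z. (norm (st_ext T p z))\<^sup>2"]) measurable
      then show ?thesis
        using sqi_Cauchy_Schwarz_abs[OF sqi_translate[OF sp] sq, of "(x, 0)"] by (simp add: c)
    qed
    show "(\<lambda>n. \<integral>s. st_kernel T p q s (s + x n) \<partial>lborel) \<longlonglongrightarrow> (\<integral>s. st_kernel T p q s s \<partial>lborel)"
      if "x \<longlonglongrightarrow> 0" for x
    proof -
      have "(\<lambda>n. (x n, 0)) \<longlonglongrightarrow> (0, 0)" by (intro tendsto_Pair that tendsto_const)
      then have "(\<lambda>n. (x n, 0)) \<longlonglongrightarrow> 0" by (simp add: zero_prod_def)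
      from inner_translate_tendsto[OF sp sq this] show ?thesis
        unfolding diag st_diagonal_integrable(2)[OF p q] by (simp add: c)
    qed
  qed
qed

section \<open>The energy identity\<close>

text \<open>Left without normalization, since its positive integral cancels in every use. Evenness
  makes the derivative odd, which the energy identity exploits.\<close>

definition bump :: "real \<Rightarrow> real" where
  "bump x = ramp (1 - x) * ramp (1 + x)"

lemma bump_smooth: "smooth_on UNIV bump"
proof -
  have "smooth_on UNIV (\<lambda>x. ramp ((-1) * x + 1) * ramp (1 * x + 1))"
    by (intro smooth_on_mult smooth_on_affine smooth_exp_inv)
  then show ?thesis by (simp add: bump_def[abs_def] add.commute)
qed

lemma bump_even: "bump (- x) = bump x"
  by (simp add: bump_def)

lemma bump_support: "bump x \<noteq> 0 \<Longrightarrow> -1 \<le> x \<and> x \<le> 1"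
  by (auto simp: bump_def ramp_eq split: if_splits)

lemma bump_nonneg: "0 \<le> bump x"
  by (simp add: bump_def ramp_nonneg)

lemma bump_le_1: "\<bar>bump x\<bar> \<le> 1"
  using mult_mono[of "ramp (1 - x)" 1 "ramp (1 + x)" 1] by (simp add: bump_def ramp_nonneg ramp_le_1 abs_mult)

lemma smooth_measurable: "smooth_on UNIV f \<Longrightarrow> f \<in> borel_measurable borel"
  for f :: "'a::real_normed_vector \<Rightarrow> real"
  by (rule borel_measurable_continuous_onI[OF smooth_on_continuous])

lemma bump_integrable: "integrable lborel bump"
proof -
  have "integrable lborel (\<lambda>x. indicator {-1..1} x *\<^sub>R bump x)"
    by (rule borel_integrable_compact) (auto intro: continuous_on_subset[OF smooth_on_continuous[OF bump_smooth]])
  moreover have "(\<lambda>x. indicator {-1..1} x *\<^sub>R bump x) = bump"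
    using bump_support by (auto simp: indicator_def fun_eq_iff)
  ultimately show ?thesis by (simp only:)
qed

lemma bump_integral_pos: "0 < (\<integral>x. bump x \<partial>lborel)"
proof -
  have "(\<integral>x. bump x \<partial>lborel) \<noteq> 0"
  proof
    assume "(\<integral>x. bump x \<partial>lborel) = 0"
    then have "AE x in lborel. bump x = 0"
      using integral_nonneg_eq_0_iff_AE[OF bump_integrable] bump_nonneg by simp
    then have "AE x in lborel. x \<notin> {-1<..<1::real}"
      by eventually_elim (auto simp: bump_def ramp_eq split: if_splits)
    then have "emeasure lborel {-1<..<1::real} = 0"
      by (subst (asm) AE_iff_measurable[of "{-1<..<1}"]) auto
    then show False by simp
  qed
  moreover have "0 \<le> (\<integral>x. bump x \<partial>lborel)" by (simp add: bump_nonneg)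
  ultimately show ?thesis by simp
qed

lemma bump_scaled_smooth: "smooth_on UNIV (\<lambda>t. bump ((t - s) / h) / h)"
proof -
  have "smooth_on UNIV (\<lambda>t. bump ((1/h) * t + (- s / h)) * (1 / h))"
    by (intro smooth_on_mult smooth_on_const smooth_on_affine bump_smooth)
  then show ?thesis by (simp add: diff_divide_distrib)
qed

lemma bump_scaled_deriv:
  "((\<lambda>t. bump ((t - s) / h) / h) has_real_derivative deriv bump ((t - s) / h) / h\<^sup>2) (at t)"
proof -
  have "((\<lambda>t. (t - s) / h) has_real_derivative 1 / h) (at t)"
    by (cases "h = 0") (auto intro!: derivative_eq_intros)
  from DERIV_chain2[OF smooth_on_has_real_derivative[OF bump_smooth] this]
  show ?thesis
    by (cases "h = 0") (auto intro!: derivative_eq_intros simp: power2_eq_square)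
qed

lemma bump_scaled_support: "0 < h \<Longrightarrow> bump ((t - s) / h) \<noteq> 0 \<Longrightarrow> \<bar>t - s\<bar> \<le> h"
  using bump_support[of "(t - s) / h"] by (auto simp: field_simps abs_le_iff)

lemma deriv_bump_odd: "deriv bump (- x) = - deriv bump x"
proof -
  have "((\<lambda>x. bump (- x)) has_real_derivative deriv bump (- x) * (- 1)) (at x)"
    by (rule DERIV_chain2[OF smooth_on_has_real_derivative[OF bump_smooth]]) (auto intro!: derivative_eq_intros)
  then have "(bump has_real_derivative - deriv bump (- x)) (at x)"
    by (simp add: bump_even)
  then show ?thesis by (simp add: DERIV_imp_deriv)
qed

lemma bounded_kernel_integrable:
  fixes K m :: "real \<Rightarrow> real \<Rightarrow> real"
  assumes K: "integrable (lborel \<Otimes>\<^sub>M lborel) (\<lambda>(s, t). K s t)"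
    and m: "(\<lambda>(s, t). m s t) \<in> borel_measurable (borel \<Otimes>\<^sub>M borel)" "\<And>s t. \<bar>m s t\<bar> \<le> B"
  shows "integrable (lborel \<Otimes>\<^sub>M lborel) (\<lambda>(s, t). m s t * K s t)"
    and "(\<integral>s. \<integral>t. m s t * K s t \<partial>lborel \<partial>lborel) = (\<integral>(s, t). m s t * K s t \<partial>(lborel \<Otimes>\<^sub>M lborel))"
proof -
  show int: "integrable (lborel \<Otimes>\<^sub>M lborel) (\<lambda>(s, t). m s t * K s t)"
  proof (rule Bochner_Integration.integrable_bound)
    show "integrable (lborel \<Otimes>\<^sub>M lborel) (\<lambda>p. B * norm (case p of (s, t) \<Rightarrow> K s t))"
      using K by simp
    have "(\<lambda>p. (case p of (s, t) \<Rightarrow> m s t) * (case p of (s, t) \<Rightarrow> K s t)) \<in> borel_measurable (lborel \<Otimes>\<^sub>M lborel)"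
      using m(1) borel_measurable_integrable[OF K] by (intro borel_measurable_times) simp_all
    then show "(\<lambda>(s, t). m s t * K s t) \<in> borel_measurable (lborel \<Otimes>\<^sub>M lborel)"
      by (simp add: case_prod_beta')
    show "AE p in lborel \<Otimes>\<^sub>M lborel. norm (case p of (s, t) \<Rightarrow> m s t * K s t) \<le> norm (B * norm (case p of (s, t) \<Rightarrow> K s t))"
      using m(2) by (intro AE_I2) (auto simp: abs_mult intro!: mult_right_mono order_trans[OF m(2) abs_ge_self])
  qed
  show "(\<integral>s. \<integral>t. m s t * K s t \<partial>lborel \<partial>lborel) = (\<integral>(s, t). m s t * K s t \<partial>(lborel \<Otimes>\<^sub>M lborel))"
    using lborel_pair.integral_fst'[OF int] by simp
qed

lemma cell_ip_commute: "cell_ip u v = cell_ip v u"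
  by (simp add: cell_ip_def inner_commute)

lemma cell_ip_scale_left: "cell_ip (\<lambda>y. c *\<^sub>R u y) v = c * cell_ip u v"
  and cell_ip_scale_right: "cell_ip u (\<lambda>y. c *\<^sub>R v y) = c * cell_ip u v"
  by (simp_all add: cell_ip_def)

lemma st_kernel_sym: "st_kernel T u u s t = st_kernel T u u t s"
  by (simp add: st_kernel_def cell_ip_commute[of "u s"])

lemma st_kernel_scale: "st_kernel T (\<lambda>t y. m t *\<^sub>R p t y) (\<lambda>t y. k t *\<^sub>R q t y) s t = m t * k s * st_kernel T p q s t"
  by (simp add: st_kernel_def cell_ip_scale_left cell_ip_scale_right)

lemma st_kernel_scale_left: "st_kernel T (\<lambda>t y. m t *\<^sub>R p t y) q s t = m t * st_kernel T p q s t"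
  by (simp add: st_kernel_def cell_ip_scale_left)

lemma st_kernel_set_integral:
  "s \<in> {0<..<T} \<Longrightarrow> (LINT t:{0<..<T}|lborel. x t * cell_ip (p t) (q s)) = (\<integral>t. x t * st_kernel T p q s t \<partial>lborel)"
  by (simp add: set_lebesgue_integral_def st_kernel_def mult_ac)

text \<open>The weak form \<open>Cs \<partial>\<^sub>t u = div F / t\<close>.\<close>
definition weak_evolution :: "real \<Rightarrow> real \<Rightarrow> (real \<Rightarrow> real^'n \<Rightarrow> real) \<Rightarrow> (real \<Rightarrow> real^'n \<Rightarrow> real^'n) \<Rightarrow> bool" where
  "weak_evolution Cs T u F \<longleftrightarrow> (\<forall>w H \<eta>. H1per0 w H \<and> test_fun {0<..<T} \<eta> \<longrightarrow>
     Cs * (LINT t:{0<..<T}|lborel. deriv \<eta> t * cell_ip (u t) w) =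
     (LINT t:{0<..<T}|lborel. \<eta> t / t * cell_ip (F t) H))"

text \<open>The equation at time \<open>t\<close> is tested with \<open>u(s)\<close> and \<open>\<theta>(t) = (\<eta>(t) + \<eta>(s)) bump((t-s)/h)/h\<close> and
  integrated in \<open>s\<close>. The term with the derivative of \<open>bump\<close> is antisymmetric in \<open>(s, t)\<close> and drops
  out; the others converge to diagonal integrals as \<open>h \<rightarrow> 0\<close>.\<close>
lemma energy_identity:
  fixes u :: "real \<Rightarrow> real^'n \<Rightarrow> real"
  assumes T: "0 < T" and u: "st_L2 T u" and G: "st_L2 T G" and F: "st_L2 T F"
    and H: "AE t in lborel. t \<in> {0<..<T} \<longrightarrow> H1per0 (u t) (G t)"
    and weak: "weak_evolution Cs T u F" and \<eta>: "test_fun {0<..<T} \<eta>"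
  shows "Cs * (LINT t:{0<..<T}|lborel. deriv \<eta> t * cell_ip (u t) (u t)) =
    2 * (LINT t:{0<..<T}|lborel. \<eta> t / t * cell_ip (F t) (G t))"
proof -
  obtain a b where ab: "0 < a" "a \<le> b" "b < T" "\<And>t. \<eta> t \<noteq> 0 \<Longrightarrow> a < t \<and> t < b"
    using test_fun_realE[OF \<eta> T] by blast
  have sm: "smooth_on UNIV \<eta>" by (rule test_fun_smooth[OF \<eta>])
  have supp: "\<eta> t \<noteq> 0 \<Longrightarrow> a \<le> t \<and> t \<le> b" for t using ab(4)[of t] by auto
  obtain B where B: "0 < B" "\<And>t. \<bar>\<eta> t\<bar> \<le> B"
    using smooth_on_bounded[OF sm supp] by blast
  obtain B1 where B1: "0 < B1" "\<And>t. \<bar>deriv \<eta> t\<bar> \<le> B1"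
    using smooth_on_bounded[OF smooth_on_deriv[OF sm], of a b] deriv_support[of \<eta> a b, OF supp] by blast
  have smd: "smooth_on UNIV (\<lambda>t. \<eta> t / t)"
    by (rule test_fun_smooth[OF test_fun_divide[OF \<eta> T]])
  have suppd: "\<eta> t / t \<noteq> 0 \<Longrightarrow> a \<le> t \<and> t \<le> b" for t using supp[of t] by auto
  obtain B2 where B2: "0 < B2" "\<And>t. \<bar>\<eta> t / t\<bar> \<le> B2"
    using smooth_on_bounded[OF smd suppd] by blast
  obtain Bb where Bb: "0 < Bb" "\<And>t. \<bar>deriv bump t\<bar> \<le> Bb"
    using smooth_on_bounded[OF smooth_on_deriv[OF bump_smooth], of "-1" 1] deriv_support[of bump "-1" 1, OF bump_support] by blast
  \<comment> \<open>The function 1/t made bounded: it agrees with 1/t from a/2 on, which covers the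
    supports of \<eta> and of the test functions built below.\<close>
  define \<kappa> where "\<kappa> t = 1 / max t (a / 2)" for t
  have \<kappa>: "\<bar>\<kappa> t\<bar> \<le> 2 / a" for t
    using ab(1) by (auto simp: \<kappa>_def field_simps max_def)
  have \<kappa>m: "\<kappa> \<in> borel_measurable borel" unfolding \<kappa>_def by measurable
  have meas [measurable]: "\<eta> \<in> borel_measurable borel" "deriv \<eta> \<in> borel_measurable borel" "(\<lambda>t. \<eta> t / t) \<in> borel_measurable borel"
    "bump \<in> borel_measurable borel" "deriv bump \<in> borel_measurable borel"
    using sm smd smooth_on_deriv[OF sm] bump_smooth smooth_on_deriv[OF bump_smooth] by (auto intro: smooth_measurable)
  note \<kappa>m[measurable]
  \<comment> \<open>For h \<le> \<delta> the test functions stay within [a/2, b + \<delta>], inside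
    (0,T).\<close>
  define \<delta> where "\<delta> = min (a / 2) ((T - b) / 2)"
  have \<delta>: "0 < \<delta>" "\<delta> \<le> a / 2" "b + \<delta> < T" using ab by (auto simp: \<delta>_def min_def field_simps)
  define h where "h n = \<delta> / real (Suc n)" for n
  have h: "0 < h n" "h n \<le> \<delta>" for n using \<delta> by (auto simp: h_def field_simps)
  have h0: "h \<longlonglongrightarrow> 0"
    unfolding h_def using tendsto_mult[OF tendsto_const[of \<delta>] LIMSEQ_inverse_real_of_nat] by (simp add: divide_inverse)
  define \<beta> where "\<beta> n s t = bump ((t - s) / h n) / h n" for n s t
  have \<beta>m: "(\<lambda>(s, t). \<beta> n s t) \<in> borel_measurable (borel \<Otimes>\<^sub>M borel)" for n
    unfolding \<beta>_def by measurable
  have \<beta>B: "\<bar>\<beta> n s t\<bar> \<le> 1 / h n" for n s t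
    using bump_le_1[of "(t - s) / h n"] h[of n] by (simp add: \<beta>_def divide_right_mono)
  define k where "k = st_kernel T u u"
  define l where "l = st_kernel T F G"
  have kint: "integrable (lborel \<Otimes>\<^sub>M lborel) (\<lambda>(s, t). k s t)" and lint: "integrable (lborel \<Otimes>\<^sub>M lborel) (\<lambda>(s, t). l s t)"
    unfolding k_def l_def by (intro st_kernel_integrable u F G)+
  have step: "Cs * (\<integral>s. \<integral>t. \<beta> n s t * (deriv \<eta> t * k s t) \<partial>lborel \<partial>lborel) =
      (\<integral>s. \<integral>t. \<beta> n s t * (\<eta> t / t * l s t) \<partial>lborel \<partial>lborel) + (\<integral>s. \<integral>t. \<beta> n s t * (\<kappa> t * \<eta> s * l s t) \<partial>lborel \<partial>lborel)" for n
  proof -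
    \<comment> \<open>\<open>m1\<close> and \<open>m2\<close> are the two parts of the derivative in
      \<open>t\<close> of the test function, \<open>m3\<close> and \<open>m4\<close> the two parts
      of its quotient by \<open>t\<close>.\<close>
    define m1 where "m1 s t = \<beta> n s t * deriv \<eta> t" for s t
    define m2 where "m2 s t = (\<eta> t + \<eta> s) * (deriv bump ((t - s) / h n) / (h n)\<^sup>2)" for s t
    define m3 where "m3 s t = \<beta> n s t * (\<eta> t / t)" for s t
    define m4 where "m4 s t = \<beta> n s t * (\<kappa> t * \<eta> s)" for s t
    have m1: "(\<lambda>(s, t). m1 s t) \<in> borel_measurable (borel \<Otimes>\<^sub>M borel)" "\<bar>m1 s t\<bar> \<le> 1 / h n * B1" for s t
      unfolding m1_def using \<beta>m[of n] by (measurable, simp only: abs_mult, intro mult_mono \<beta>B B1(2)) (use h[of n] in auto)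
    have m2: "(\<lambda>(s, t). m2 s t) \<in> borel_measurable (borel \<Otimes>\<^sub>M borel)" "\<bar>m2 s t\<bar> \<le> (2 * B) * (Bb / (h n)\<^sup>2)" for s t
    proof -
      show "(\<lambda>(s, t). m2 s t) \<in> borel_measurable (borel \<Otimes>\<^sub>M borel)" unfolding m2_def by measurable
      have "\<bar>\<eta> t + \<eta> s\<bar> \<le> 2 * B" using B(2)[of t] B(2)[of s] by linarith
      then show "\<bar>m2 s t\<bar> \<le> (2 * B) * (Bb / (h n)\<^sup>2)"
        unfolding m2_def abs_mult using B(1) Bb by (intro mult_mono) (auto intro!: divide_right_mono)
    qed
    have m3: "(\<lambda>(s, t). m3 s t) \<in> borel_measurable (borel \<Otimes>\<^sub>M borel)" "\<bar>m3 s t\<bar> \<le> 1 / h n * B2" for s t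
      unfolding m3_def using \<beta>m[of n] by (measurable, simp only: abs_mult, intro mult_mono \<beta>B B2(2)) (use h[of n] in auto)
    have m4: "(\<lambda>(s, t). m4 s t) \<in> borel_measurable (borel \<Otimes>\<^sub>M borel)" "\<bar>m4 s t\<bar> \<le> 1 / h n * (2 / a * B)" for s t
      unfolding m4_def using \<beta>m[of n] by (measurable, simp only: abs_mult, intro mult_mono \<beta>B B \<kappa>) (use h[of n] ab in auto)
    \<comment> \<open>\<open>m2\<close> carries the factor 1/h^2. The weight \<eta>(t) + \<eta>(s),
      in place of \<eta>(t) alone, is what makes it odd under exchange of the two times.\<close>
    have anti: "(\<integral>s. \<integral>t. m2 s t * k s t \<partial>lborel \<partial>lborel) = 0"
    proof -
      have m2a: "m2 t s * k t s = - (m2 s t * k s t)" for s t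
      proof -
        have "(s - t) / h n = - ((t - s) / h n)" by (simp add: diff_divide_distrib)
        then have "deriv bump ((s - t) / h n) = - deriv bump ((t - s) / h n)"
          using deriv_bump_odd[of "(t - s) / h n"] by simp
        then show ?thesis
          using st_kernel_sym[of T u s t] by (simp add: m2_def k_def add.commute)
      qed
      have "(\<integral>s. \<integral>t. m2 s t * k s t \<partial>lborel \<partial>lborel) = (\<integral>t. \<integral>s. m2 s t * k s t \<partial>lborel \<partial>lborel)"
        by (rule lborel_pair.Fubini_integral[OF bounded_kernel_integrable(1)[OF kint m2], symmetric])
      also have "\<dots> = (\<integral>s. \<integral>t. - (m2 s t * k s t) \<partial>lborel \<partial>lborel)"
        by (intro Bochner_Integration.integral_cong refl m2a)
      finally show ?thesis by simp
    qed
    have AEs: "AE s in lborel. Cs * (\<integral>t. (m1 s t + m2 s t) * k s t \<partial>lborel) = (\<integral>t. (m3 s t + m4 s t) * l s t \<partial>lborel)"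
      using H
    proof eventually_elim
      case (elim s)
      show ?case
      proof (cases "s \<in> {0<..<T}")
        case False
        then show ?thesis by (simp add: k_def l_def st_kernel_def)
      next
        case True
        define \<theta> where "\<theta> t = (\<eta> t + \<eta> s) * \<beta> n s t" for t
        have "smooth_on UNIV \<theta>"
          unfolding \<theta>_def \<beta>_def by (intro smooth_on_mult smooth_on_add smooth_on_const sm bump_scaled_smooth)
        moreover have near: "a / 2 \<le> t \<and> t \<le> b + \<delta>" if "\<theta> t \<noteq> 0" for t
        proof -
          have "\<eta> t \<noteq> 0 \<or> \<eta> s \<noteq> 0" and "bump ((t - s) / h n) \<noteq> 0" using that by (auto simp: \<theta>_def \<beta>_def)
          then show ?thesis
            using supp[of t] supp[of s] bump_scaled_support[OF h(1)[of n], of t s] h(2)[of n] \<delta> by linarith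
        qed
        moreover have "{a / 2..b + \<delta>} \<subseteq> {0<..<T}" using ab \<delta> by auto
        ultimately have \<theta>: "test_fun {0<..<T} \<theta>" by (rule test_fun_realI)
        have d\<theta>: "deriv \<theta> t = m1 s t + m2 s t" for t
        proof (rule DERIV_imp_deriv)
          have "(\<theta> has_real_derivative (deriv \<eta> t + 0) * \<beta> n s t + deriv bump ((t - s) / h n) / (h n)\<^sup>2 * (\<eta> t + \<eta> s)) (at t)"
            unfolding \<theta>_def \<beta>_def
            by (intro DERIV_mult DERIV_add bump_scaled_deriv smooth_on_has_real_derivative[OF sm] DERIV_const)
          then show "(\<theta> has_real_derivative m1 s t + m2 s t) (at t)"
            by (simp add: m1_def m2_def mult.commute)
        qed
        \<comment> \<open>Where \<theta> vanishes, \<open>\<kappa>\<close> and 1/t may differ, but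
          then the bump is zero, or both values of \<eta> are zero, or they cancel at a time in the
          support.\<close>
        have r\<theta>: "\<theta> t / t = m3 s t + m4 s t" for t
        proof (cases "\<theta> t = 0")
          case True
          then have "\<beta> n s t = 0 \<or> \<eta> t + \<eta> s = 0" by (auto simp: \<theta>_def)
          then show ?thesis
          proof
            assume z: "\<eta> t + \<eta> s = 0"
            show ?thesis
            proof (cases "\<eta> t = 0")
              case True then show ?thesis using z by (simp add: \<theta>_def m3_def m4_def)
            next
              case False
              then have "\<kappa> t = 1 / t" using supp[of t] ab by (simp add: \<kappa>_def max_def)
              then show ?thesis using z by (simp add: \<theta>_def m3_def m4_def distrib_left[symmetric] add_divide_distrib[symmetric])
            qed
          qed (simp add: \<theta>_def m3_def m4_def)
        next
          case False
          then have "\<kappa> t = 1 / t" using near[of t] ab by (simp add: \<kappa>_def max_def)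
          then show ?thesis by (simp add: \<theta>_def m3_def m4_def field_simps add_divide_distrib)
        qed
        have "Cs * (LINT t:{0<..<T}|lborel. deriv \<theta> t * cell_ip (u t) (u s)) =
            (LINT t:{0<..<T}|lborel. \<theta> t / t * cell_ip (F t) (G s))"
          using weak \<theta> elim True unfolding weak_evolution_def by blast
        then show ?thesis
          unfolding st_kernel_set_integral[OF True, of _ u u] st_kernel_set_integral[OF True, of _ F G] d\<theta> r\<theta> k_def l_def .
      qed
    qed
    have m12: "(\<lambda>(s, t). m1 s t + m2 s t) \<in> borel_measurable (borel \<Otimes>\<^sub>M borel)" "\<bar>m1 s t + m2 s t\<bar> \<le> 1 / h n * B1 + (2 * B) * (Bb / (h n)\<^sup>2)" for s t
      using m1(1) m2(1) order_trans[OF abs_triangle_ineq add_mono[OF m1(2) m2(2)]] by (auto simp: case_prod_beta')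
    have m34: "(\<lambda>(s, t). m3 s t + m4 s t) \<in> borel_measurable (borel \<Otimes>\<^sub>M borel)" "\<bar>m3 s t + m4 s t\<bar> \<le> 1 / h n * B2 + 1 / h n * (2 / a * B)" for s t
      using m3(1) m4(1) order_trans[OF abs_triangle_ineq add_mono[OF m3(2) m4(2)]] by (auto simp: case_prod_beta')
    have "Cs * (\<integral>s. \<integral>t. (m1 s t + m2 s t) * k s t \<partial>lborel \<partial>lborel) = (\<integral>s. Cs * (\<integral>t. (m1 s t + m2 s t) * k s t \<partial>lborel) \<partial>lborel)"
      by simp
    also have "\<dots> = (\<integral>s. \<integral>t. (m3 s t + m4 s t) * l s t \<partial>lborel \<partial>lborel)"
    proof (rule integral_cong_AE[OF _ _ AEs])
      show "(\<lambda>s. Cs * (\<integral>t. (m1 s t + m2 s t) * k s t \<partial>lborel)) \<in> borel_measurable lborel"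
        using borel_measurable_integrable[OF lborel_pair.integrable_fst'[OF bounded_kernel_integrable(1)[OF kint m12]]] by simp
      show "(\<lambda>s. (\<integral>t. (m3 s t + m4 s t) * l s t \<partial>lborel)) \<in> borel_measurable lborel"
        using borel_measurable_integrable[OF lborel_pair.integrable_fst'[OF bounded_kernel_integrable(1)[OF lint m34]]] by simp
    qed
    finally have main: "Cs * (\<integral>s. \<integral>t. (m1 s t + m2 s t) * k s t \<partial>lborel \<partial>lborel) = (\<integral>s. \<integral>t. (m3 s t + m4 s t) * l s t \<partial>lborel \<partial>lborel)" .
    have split: "(\<integral>s. \<integral>t. (f s t + g s t) * K s t \<partial>lborel \<partial>lborel) = (\<integral>s. \<integral>t. f s t * K s t \<partial>lborel \<partial>lborel) + (\<integral>s. \<integral>t. g s t * K s t \<partial>lborel \<partial>lborel)"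
      if K: "integrable (lborel \<Otimes>\<^sub>M lborel) (\<lambda>(s, t). K s t)"
        and f: "(\<lambda>(s, t). f s t) \<in> borel_measurable (borel \<Otimes>\<^sub>M borel)" "\<And>s t. \<bar>f s t\<bar> \<le> b1"
        and g: "(\<lambda>(s, t). g s t) \<in> borel_measurable (borel \<Otimes>\<^sub>M borel)" "\<And>s t. \<bar>g s t\<bar> \<le> b2"
      for f g K :: "real \<Rightarrow> real \<Rightarrow> real" and b1 b2
    proof -
      have fg: "(\<lambda>(s, t). f s t + g s t) \<in> borel_measurable (borel \<Otimes>\<^sub>M borel)" "\<And>s t. \<bar>f s t + g s t\<bar> \<le> b1 + b2"
        using f(1) g(1) order_trans[OF abs_triangle_ineq add_mono[OF f(2) g(2)]] by (auto simp: case_prod_beta')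
      show ?thesis
        unfolding bounded_kernel_integrable(2)[OF K f] bounded_kernel_integrable(2)[OF K g] bounded_kernel_integrable(2)[OF K fg]
        using Bochner_Integration.integral_add[OF bounded_kernel_integrable(1)[OF K f] bounded_kernel_integrable(1)[OF K g]]
        by (simp add: case_prod_beta' distrib_right)
    qed
    show ?thesis
      using main split[OF kint m1 m2] split[OF lint m3 m4] anti
      by (simp add: m1_def m3_def m4_def mult.assoc)
  qed
  define M where "M = (\<integral>x. bump x \<partial>lborel)"
  note diag = st_diagonal_limit[OF _ _ meas(4) bump_le_1 bump_integrable h(1) h0, folded \<beta>_def M_def]
  have L1: "(\<lambda>n. \<integral>s. \<integral>t. \<beta> n s t * (deriv \<eta> t * k s t) \<partial>lborel \<partial>lborel) \<longlonglongrightarrow> M * (LINT t:{0<..<T}|lborel. deriv \<eta> t * cell_ip (u t) (u t))"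
    using diag[OF st_L2_scale[OF u meas(2) B1(2)] u] unfolding st_kernel_scale_left cell_ip_scale_left k_def .
  have L2: "(\<lambda>n. \<integral>s. \<integral>t. \<beta> n s t * (\<eta> t / t * l s t) \<partial>lborel \<partial>lborel) \<longlonglongrightarrow> M * (LINT t:{0<..<T}|lborel. \<eta> t / t * cell_ip (F t) (G t))"
    using diag[OF st_L2_scale[OF F meas(3) B2(2)] G] unfolding st_kernel_scale_left cell_ip_scale_left l_def .
  have L3: "(\<lambda>n. \<integral>s. \<integral>t. \<beta> n s t * (\<kappa> t * \<eta> s * l s t) \<partial>lborel \<partial>lborel) \<longlonglongrightarrow> M * (LINT t:{0<..<T}|lborel. \<kappa> t * (\<eta> t * cell_ip (F t) (G t)))"
    using diag[OF st_L2_scale[OF F \<kappa>m \<kappa>] st_L2_scale[OF G meas(1) B(2)]] unfolding st_kernel_scale cell_ip_scale_left cell_ip_scale_right l_def .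
  have "\<kappa> t * (\<eta> t * x) = \<eta> t / t * x" for t x
  proof (cases "\<eta> t = 0")
    case False
    then have "\<kappa> t = 1 / t" using supp[of t] ab by (simp add: \<kappa>_def max_def)
    then show ?thesis by simp
  qed simp
  then have L3': "(\<lambda>n. \<integral>s. \<integral>t. \<beta> n s t * (\<kappa> t * \<eta> s * l s t) \<partial>lborel \<partial>lborel) \<longlonglongrightarrow> M * (LINT t:{0<..<T}|lborel. \<eta> t / t * cell_ip (F t) (G t))"
    using L3 by simp
  \<comment> \<open>The weights \<eta>(t) and \<eta>(s) have the same diagonal limit; their sum is
    the factor 2 of the claim.\<close>
  have "Cs * (M * (LINT t:{0<..<T}|lborel. deriv \<eta> t * cell_ip (u t) (u t))) =
    M * (LINT t:{0<..<T}|lborel. \<eta> t / t * cell_ip (F t) (G t)) + M * (LINT t:{0<..<T}|lborel. \<eta> t / t * cell_ip (F t) (G t))"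
    using LIMSEQ_unique[OF tendsto_mult[OF tendsto_const[of Cs] L1, unfolded step] tendsto_add[OF L2 L3']] .
  then have "M * (Cs * (LINT t:{0<..<T}|lborel. deriv \<eta> t * cell_ip (u t) (u t))) = M * (2 * (LINT t:{0<..<T}|lborel. \<eta> t / t * cell_ip (F t) (G t)))"
    by (simp add: algebra_simps)
  then show ?thesis using bump_integral_pos by (simp add: M_def)
qed

section \<open>The fundamental lemma of the calculus of variations\<close>

lemma integrable_tensor:
  fixes f g :: "real \<Rightarrow> real"
  assumes f: "integrable lborel f" and g: "integrable lborel g"
  shows "integrable (lborel \<Otimes>\<^sub>M lborel) (\<lambda>(s, t). f s * g t)"
proof -
  have [measurable]: "f \<in> borel_measurable borel" "g \<in> borel_measurable borel" using f g by auto
  show ?thesis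
  proof (rule lborel_pair.Fubini_integrable)
    have "(\<integral>t. norm (f s * g t) \<partial>lborel) = \<bar>f s\<bar> * (\<integral>t. \<bar>g t\<bar> \<partial>lborel)" for s
      by (simp add: abs_mult)
    then show "integrable lborel (\<lambda>s. \<integral>t. norm (case (s, t) of (s, t) \<Rightarrow> f s * g t) \<partial>lborel)"
      using f by simp
  qed (use g in auto)
qed

text \<open>Scaled bumps centred at \<open>s\<close> are admissible test functions as long as
  \<open>s\<close> keeps the distance \<delta> from 0 and \<open>T\<close>. Integrating over
  \<open>s\<close> in \<open>A\<close> and letting the scale shrink leaves a positive multiple of
  the integral of \<open>k\<close> over \<open>A\<close>.\<close>

lemma fundamental_lemma_aux:
  fixes k :: "real \<Rightarrow> real"
  assumes k: "integrable lborel k" and \<delta>: "0 < \<delta>"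
    and test: "\<And>\<eta>. test_fun {0<..<T} \<eta> \<Longrightarrow> (\<integral>t. \<eta> t * k t \<partial>lborel) = 0"
    and A: "A \<in> sets borel" "A \<subseteq> {\<delta>..T - \<delta>}"
  shows "(\<integral>t. indicator A t * k t \<partial>lborel) = 0"
proof -
  have [measurable]: "k \<in> borel_measurable borel" using k by auto
  note A(1)[measurable]
  have "emeasure lborel A \<le> emeasure lborel {\<delta>..T - \<delta>}" by (rule emeasure_mono) (use A in auto)
  also have "\<dots> < \<infinity>" by (cases "\<delta> \<le> T - \<delta>") auto
  finally have Aint: "integrable lborel (indicat_real A)" by (simp add: integrable_indicator_iff)
  define K where "K s t = indicat_real A s * k t" for s t
  have Kint: "integrable (lborel \<Otimes>\<^sub>M lborel) (\<lambda>(s, t). K s t)"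
    unfolding K_def by (rule integrable_tensor[OF Aint k])
  define h where "h n = (\<delta> / 2) * inverse (real (Suc n))" for n
  have h: "0 < h n" "h n \<le> \<delta> / 2" for n using \<delta> by (auto simp: h_def field_simps)
  have h0: "h \<longlonglongrightarrow> 0"
    unfolding h_def by (rule tendsto_mult_right_zero[OF LIMSEQ_inverse_real_of_nat])
  have kintv: "integrable lborel (\<lambda>s. k (s + x))" for x
    by (rule lborel_integrable_translate[OF k])
  have lim: "(\<lambda>n. \<integral>s. \<integral>t. bump ((t - s) / h n) / h n * K s t \<partial>lborel \<partial>lborel) \<longlonglongrightarrow> (\<integral>x. bump x \<partial>lborel) * (\<integral>s. K s s \<partial>lborel)"
  proof (rule diagonal_limit[OF Kint _ _ smooth_measurable[OF bump_smooth] bump_le_1 bump_integrable h(1) h0])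
    have Ki: "integrable lborel (\<lambda>s. K s (s + x))" for x
      unfolding K_def by (rule Bochner_Integration.integrable_bound[OF kintv[of x]]) (auto simp: indicator_def)
    show "\<bar>\<integral>s. K s (s + x) \<partial>lborel\<bar> \<le> (\<integral>s. \<bar>k s\<bar> \<partial>lborel)" for x
    proof -
      have "\<bar>\<integral>s. K s (s + x) \<partial>lborel\<bar> \<le> (\<integral>s. \<bar>K s (s + x)\<bar> \<partial>lborel)" by (rule integral_abs_bound)
      also have "\<dots> \<le> (\<integral>s. \<bar>k (s + x)\<bar> \<partial>lborel)"
        by (rule Bochner_Integration.integral_mono) (use Ki[of x] kintv[of x] in \<open>auto simp: K_def indicator_def\<close>)
      also have "\<dots> = (\<integral>s. \<bar>k s\<bar> \<partial>lborel)"
        by (rule lborel_integral_translate) simp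
      finally show ?thesis .
    qed
    fix x :: "nat \<Rightarrow> real" assume x: "x \<longlonglongrightarrow> 0"
    have "(\<lambda>n. (\<integral>s. K s (s + x n) \<partial>lborel) - (\<integral>s. K s s \<partial>lborel)) \<longlonglongrightarrow> 0"
    proof (rule Lim_null_comparison[OF always_eventually L1_translate_tendsto[OF k x]], rule allI)
      fix n
      have "(\<integral>s. K s (s + x n) \<partial>lborel) - (\<integral>s. K s s \<partial>lborel) = (\<integral>s. indicat_real A s * (k (s + x n) - k s) \<partial>lborel)"
        using Ki[of "x n"] Ki[of 0] by (simp add: K_def right_diff_distrib)
      also have "norm \<dots> \<le> (\<integral>s. norm (indicat_real A s * (k (s + x n) - k s)) \<partial>lborel)"
        by (rule integral_norm_bound)
      also have "\<dots> \<le> (\<integral>s. \<bar>k (s + x n) - k s\<bar> \<partial>lborel)"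
        by (rule integral_mono_AE') (use kintv[of "x n"] k in \<open>auto simp: indicator_def\<close>)
      finally show "norm ((\<integral>s. K s (s + x n) \<partial>lborel) - (\<integral>s. K s s \<partial>lborel)) \<le> (\<integral>s. \<bar>k (s + x n) - k s\<bar> \<partial>lborel)" .
    qed
    then show "(\<lambda>n. \<integral>s. K s (s + x n) \<partial>lborel) \<longlonglongrightarrow> (\<integral>s. K s s \<partial>lborel)"
      by (rule LIM_zero_cancel)
  qed
  have zero: "(\<integral>t. bump ((t - s) / h n) / h n * K s t \<partial>lborel) = 0" for n s
  proof (cases "s \<in> A")
    case True
    then have s: "\<delta> \<le> s" "s \<le> T - \<delta>" using A by auto
    have "test_fun {0<..<T} (\<lambda>t. bump ((t - s) / h n) / h n)"
    proof (rule test_fun_realI[OF bump_scaled_smooth])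
      show "s - h n \<le> t \<and> t \<le> s + h n" if "bump ((t - s) / h n) / h n \<noteq> 0" for t
        using bump_scaled_support[OF h(1)[of n], of t s] that by (auto simp: abs_le_iff)
      show "{s - h n..s + h n} \<subseteq> {0<..<T}" using s h(2)[of n] \<delta> by auto
    qed
    from test[OF this] show ?thesis using True by (simp add: K_def)
  qed (simp add: K_def)
  have "(\<lambda>n. 0) \<longlonglongrightarrow> (\<integral>x. bump x \<partial>lborel) * (\<integral>s. K s s \<partial>lborel)"
    using lim unfolding zero by simp
  then have "(\<integral>x. bump x \<partial>lborel) * (\<integral>s. K s s \<partial>lborel) = 0"
    using LIMSEQ_unique[OF tendsto_const] by metis
  then show ?thesis
    using bump_integral_pos by (simp add: K_def)
qed

text \<open>Apply the assumption to the part of \<open>S\<close> where \<open>k\<close>,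
  respectively -k, is positive.\<close>

lemma AE_zero_if_integrals_zero:
  fixes k :: "real \<Rightarrow> real"
  assumes k: "integrable lborel k" and S: "S \<in> sets borel"
    and zero: "\<And>A. A \<in> sets borel \<Longrightarrow> A \<subseteq> S \<Longrightarrow> (\<integral>t. indicator A t * k t \<partial>lborel) = 0"
  shows "AE t in lborel. t \<in> S \<longrightarrow> k t = 0"
proof -
  have [measurable]: "k \<in> borel_measurable borel" using k by auto
  note S[measurable]
  have part: "AE t in lborel. t \<in> S \<longrightarrow> c * k t \<le> 0" if c: "c \<in> {1, -1}" for c
  proof -
    define A where "A = S \<inter> {t. 0 < c * k t}"
    have [measurable]: "A \<in> sets borel" unfolding A_def by measurable
    have int: "integrable lborel (\<lambda>t. c * (indicator A t * k t))"
      by (rule Bochner_Integration.integrable_bound[OF k]) (use c in \<open>auto simp: indicator_def\<close>)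
    have "(\<integral>t. c * (indicator A t * k t) \<partial>lborel) = 0"
      using zero[of A] by (simp add: A_def)
    moreover have "0 \<le> c * (indicator A t * k t)" for t by (auto simp: A_def indicator_def)
    ultimately have "AE t in lborel. c * (indicator A t * k t) = 0"
      using integral_nonneg_eq_0_iff_AE[OF int] by auto
    then show ?thesis
      by eventually_elim (auto simp: A_def indicator_def split: if_splits)
  qed
  show ?thesis
  proof -
    have "AE t in lborel. t \<in> S \<longrightarrow> k t \<le> 0" "AE t in lborel. t \<in> S \<longrightarrow> 0 \<le> k t"
      using part[of 1] part[of "-1"] by simp_all
    then show ?thesis by eventually_elim auto
  qed
qed

lemma fundamental_lemma:
  fixes k :: "real \<Rightarrow> real"
  assumes k: "set_integrable lborel {0<..<T} k"
    and test: "\<And>\<eta>. test_fun {0<..<T} \<eta> \<Longrightarrow> (LINT t:{0<..<T}|lborel. \<eta> t * k t) = 0"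
  shows "AE t in lborel. t \<in> {0<..<T} \<longrightarrow> k t = 0"
proof -
  define k0 where "k0 t = indicator {0<..<T} t * k t" for t
  have k0: "integrable lborel k0" using k by (simp add: k0_def[abs_def] set_integrable_def)
  have test0: "(\<integral>t. \<eta> t * k0 t \<partial>lborel) = 0" if "test_fun {0<..<T} \<eta>" for \<eta>
    using test[OF that] by (simp add: k0_def set_lebesgue_integral_def mult_ac)
  have "AE t in lborel. t \<in> {1 / real (Suc m)..T - 1 / real (Suc m)} \<longrightarrow> k0 t = 0" for m
  proof (rule AE_zero_if_integrals_zero[OF k0])
    have "0 < 1 / real (Suc m)" by simp
    from fundamental_lemma_aux[OF k0 this test0]
    show "(\<integral>t. indicator A t * k0 t \<partial>lborel) = 0" if "A \<in> sets borel" "A \<subseteq> {1 / real (Suc m)..T - 1 / real (Suc m)}" for A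
      using that by blast
  qed simp
  then have "AE t in lborel. \<forall>m. t \<in> {1 / real (Suc m)..T - 1 / real (Suc m)} \<longrightarrow> k0 t = 0"
    unfolding AE_all_countable by (intro allI)
  then show ?thesis
  proof eventually_elim
    case (elim t)
    show ?case
    proof
      assume t: "t \<in> {0<..<T}"
      then have "0 < min t (T - t)" by auto
      then obtain m where "inverse (real (Suc m)) < min t (T - t)" using reals_Archimedean by blast
      then have "t \<in> {1 / real (Suc m)..T - 1 / real (Suc m)}" by (auto simp: inverse_eq_divide)
      then have "k0 t = 0" using elim by blast
      then show "k t = 0" using t by (simp add: k0_def)
    qed
  qed
qed

text \<open>For fixed \<open>s\<close> the test function \<open>G s\<close> is admissible and the
  fundamental lemma gives orthogonality for almost every \<open>t\<close>, off a null set depending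
  on \<open>s\<close>. This says nothing about s = t; a concentrating kernel, applied to
  \<open>F\<close> restricted to an arbitrary time set \<open>A\<close>, recovers the
  diagonal.\<close>

lemma weak_orthogonality:
  fixes F G :: "real \<Rightarrow> real^'n \<Rightarrow> real^'n"
  assumes F: "st_L2 T F" and G: "st_L2 T G"
    and H: "AE t in lborel. t \<in> {0<..<T} \<longrightarrow> H1per0 (u t) (G t)"
    and weak: "\<And>w H \<eta>. H1per0 w H \<Longrightarrow> test_fun {0<..<T} \<eta> \<Longrightarrow> (LINT t:{0<..<T}|lborel. \<eta> t * cell_ip (F t) H) = 0"
  shows "AE s in lborel. AE t in lborel. s \<in> {0<..<T} \<longrightarrow> t \<in> {0<..<T} \<longrightarrow> cell_ip (F t) (G s) = 0"
    and "AE t in lborel. t \<in> {0<..<T} \<longrightarrow> cell_ip (F t) (G t) = 0"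
proof -
  show off: "AE s in lborel. AE t in lborel. s \<in> {0<..<T} \<longrightarrow> t \<in> {0<..<T} \<longrightarrow> cell_ip (F t) (G s) = 0"
    using H lborel_pair.AE_integrable_fst'[OF st_kernel_integrable[OF F G]]
  proof eventually_elim
    case (elim s)
    show ?case
    proof (cases "s \<in> {0<..<T}")
      case False
      then show ?thesis by (intro AE_I2) blast
    next
      case True
      then have "set_integrable lborel {0<..<T} (\<lambda>t. cell_ip (F t) (G s))"
        using elim(2) by (simp add: st_kernel_def set_integrable_def)
      from fundamental_lemma[OF this weak] show ?thesis
        using elim(1) True by auto
    qed
  qed
  have int: "set_integrable lborel {0<..<T} (\<lambda>t. cell_ip (F t) (G t))"
    by (rule st_diagonal_integrable[OF F G])
  define k where "k t = indicator {0<..<T} t * cell_ip (F t) (G t)" for t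
  have k: "integrable lborel k" using int by (simp add: k_def[abs_def] set_integrable_def)
  have "AE t in lborel. t \<in> UNIV \<longrightarrow> k t = 0"
  proof (rule AE_zero_if_integrals_zero[OF k])
    fix A :: "real set" assume [measurable]: "A \<in> sets borel"
    define h where "h n = 1 / real (Suc n)" for n
    have h: "0 < h n" for n by (simp add: h_def)
    have h0: "h \<longlonglongrightarrow> 0"
      unfolding h_def using LIMSEQ_inverse_real_of_nat by (simp add: inverse_eq_divide)
    have FA: "st_L2 T (\<lambda>t y. indicat_real A t *\<^sub>R F t y)"
      by (rule st_L2_scale[OF F, where B=1]) (auto simp: indicator_def)
    have lim: "(\<lambda>n. \<integral>s. \<integral>t. bump ((t - s) / h n) / h n * st_kernel T (\<lambda>t y. indicat_real A t *\<^sub>R F t y) G s t \<partial>lborel \<partial>lborel)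
        \<longlonglongrightarrow> (\<integral>x. bump x \<partial>lborel) * (LINT t:{0<..<T}|lborel. indicat_real A t * cell_ip (F t) (G t))"
      using st_diagonal_limit[OF FA G smooth_measurable[OF bump_smooth] bump_le_1 bump_integrable h h0]
      unfolding cell_ip_scale_left .
    have zero: "(\<integral>s. \<integral>t. bump ((t - s) / h n) / h n * st_kernel T (\<lambda>t y. indicat_real A t *\<^sub>R F t y) G s t \<partial>lborel \<partial>lborel) = 0" for n
    proof (rule integral_eq_zero_AE)
      show "AE s in lborel. (\<integral>t. bump ((t - s) / h n) / h n * st_kernel T (\<lambda>t y. indicat_real A t *\<^sub>R F t y) G s t \<partial>lborel) = 0"
        using off
      proof eventually_elim
        case (elim s)
        show ?case
          by (rule integral_eq_zero_AE) (use elim in eventually_elim, auto simp: st_kernel_def indicator_def cell_ip_scale_left)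
      qed
    qed
    have "(\<integral>x. bump x \<partial>lborel) * (LINT t:{0<..<T}|lborel. indicat_real A t * cell_ip (F t) (G t)) = 0"
      using lim unfolding zero using LIMSEQ_unique[OF tendsto_const] by metis
    then show "(\<integral>t. indicator A t * k t \<partial>lborel) = 0"
      using bump_integral_pos by (simp add: k_def set_lebesgue_integral_def mult_ac)
  qed simp
  then show "AE t in lborel. t \<in> {0<..<T} \<longrightarrow> cell_ip (F t) (G t) = 0"
    by eventually_elim (auto simp: k_def)
qed

section \<open>Uniqueness for the degenerate parabolic equation\<close>

text \<open>With y = 1/x the left side is (y + y^2) exp(-y). At x = n t - 1 it is t times the
  derivative of the cutoff near 0 in the uniqueness proof: bounded uniformly in n, and tending to 0
  for fixed t > 0.\<close>

lemma ramp_profile_le: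
  fixes x :: real
  assumes "0 < x"
  shows "(x + 1) * deriv ramp x \<le> 1 / x + (1 / x)\<^sup>2" "(x + 1) * deriv ramp x \<le> 3"
proof -
  define y where "y = 1 / x"
  have y: "0 < y" using assms by (simp add: y_def)
  have eq: "(x + 1) * deriv ramp x = (y + y\<^sup>2) * exp (- y)"
    using assms by (simp add: deriv_ramp y_def field_simps power2_eq_square)
  have "(y + y\<^sup>2) * exp (- y) \<le> (y + y\<^sup>2) * 1"
    using y by (intro mult_left_mono) auto
  then show "(x + 1) * deriv ramp x \<le> 1 / x + (1 / x)\<^sup>2" unfolding eq by (simp add: y_def)
  have "y + y\<^sup>2 \<le> 3 * exp y"
  proof -
    have "0 \<le> y\<^sup>2" "1 + y + y\<^sup>2 / 2 \<le> exp y"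
      using exp_lower_Taylor_quadratic[of y] y by simp_all
    then show ?thesis using y by linarith
  qed
  then show "(x + 1) * deriv ramp x \<le> 3" unfolding eq by (simp add: exp_minus field_simps)
qed

lemma deriv_ramp_nonneg: "0 \<le> deriv ramp x"
  by (simp add: deriv_ramp)

lemma ramp_tendsto_1:
  assumes "filterlim f at_top F"
  shows "((\<lambda>n. ramp (f n)) \<longlongrightarrow> 1) F"
proof -
  have "((\<lambda>n. exp (- inverse (f n))) \<longlongrightarrow> exp (- 0)) F"
    by (intro tendsto_intros filterlim_compose[OF tendsto_inverse_0_at_top assms] tendsto_inverse_0_at_top assms)
  moreover have "\<forall>\<^sub>F n in F. exp (- inverse (f n)) = ramp (f n)"
    using eventually_compose_filterlim[OF eventually_gt_at_top[of 0] assms]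
    by eventually_elim (simp add: ramp_eq inverse_eq_divide)
  ultimately show ?thesis
    using Lim_transform_eventually by fastforce
qed

text \<open>Testing the energy identity with \<open>t ramp(n t - 1) ramp(T' - t)\<close> says that \<open>t \<parallel>u(t)\<parallel>\<^sup>2\<close> decreases; as
  \<open>\<parallel>u(t)\<parallel>\<^sup>2\<close> is integrable near \<open>0\<close>, it vanishes. Here the Poincare constant has to be better
  than \<open>2 lam / Cs\<close>.\<close>
lemma parabolic_uniqueness:
  fixes u :: "real \<Rightarrow> real^'n \<Rightarrow> real"
  assumes T: "0 < T" and u: "st_L2 T u" and G: "st_L2 T G" and F: "st_L2 T F"
    and H: "AE t in lborel. t \<in> {0<..<T} \<longrightarrow> H1per0 (u t) (G t)"
    and weak: "weak_evolution Cs T u F"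
    and ell: "AE t in lborel. t \<in> {0<..<T} \<longrightarrow> lam * cell_ip (G t) (G t) \<le> cell_ip (F t) (G t)"
    and Cs: "0 < Cs" "Cs \<le> 2 * lam / (real CARD('n) / pi\<^sup>2)" and lam: "0 < lam"
  shows "AE t in lborel. t \<in> {0<..<T} \<longrightarrow> cell_ip (G t) (G t) = 0"
proof -
  define E where "E t = cell_ip (u t) (u t)" for t
  define D where "D t = cell_ip (F t) (G t)" for t
  define N where "N = real CARD('n)"
  have N: "0 < N" by (simp add: N_def)
  have E0: "0 \<le> E t" for t by (simp add: E_def cell_ip_def)
  have Eint: "set_integrable lborel {0<..<T} E" and Dint: "set_integrable lborel {0<..<T} D"
    unfolding E_def D_def by (intro st_diagonal_integrable u F G)+
  \<comment> \<open>Ellipticity combined with the Poincare inequality of constant N/16.\<close>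
  have ED: "AE t in lborel. t \<in> {0<..<T} \<longrightarrow> 16 * lam / N * E t \<le> D t"
    using H ell
  proof eventually_elim
    case (elim t)
    show ?case
    proof
      assume t: "t \<in> {0<..<T}"
      have "E t \<le> N / 16 * cell_ip (G t) (G t)"
        using Poincare[of "u t" "G t"] elim(1) t
        by (simp add: E_def cell_ip_def N_def power2_norm_eq_inner power2_eq_square[symmetric] flip: real_inner_1_right)
      then have "lam * (16 / N * E t) \<le> lam * cell_ip (G t) (G t)"
        using lam N by (intro mult_left_mono) (auto simp: field_simps)
      also have "\<dots> \<le> D t" using elim(2) t by (simp add: D_def)
      finally show "16 * lam / N * E t \<le> D t" by (simp add: mult_ac)
    qed
  qed
  have bounded: "set_integrable lborel {0<..<T} (\<lambda>t. m t * e t)"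
    if "m \<in> borel_measurable borel" "\<And>t. t \<in> {0<..<T} \<Longrightarrow> \<bar>m t\<bar> \<le> B" "set_integrable lborel {0<..<T} e" for m e :: "real \<Rightarrow> real" and B
    unfolding set_integrable_def
  proof (rule Bochner_Integration.integrable_bound)
    show "integrable lborel (\<lambda>t. B * (indicator {0<..<T} t *\<^sub>R e t))" using that(3) by (simp add: set_integrable_def)
    have "(\<lambda>t. m t * (indicator {0<..<T} t *\<^sub>R e t)) \<in> borel_measurable lborel"
      using that(1,3) borel_measurable_integrable unfolding set_integrable_def by (intro borel_measurable_times) auto
    then show "(\<lambda>t. indicator {0<..<T} t *\<^sub>R (m t * e t)) \<in> borel_measurable lborel" by (simp add: mult_ac)
    show "AE t in lborel. norm (indicator {0<..<T} t *\<^sub>R (m t * e t)) \<le> norm (B * (indicator {0<..<T} t *\<^sub>R e t))"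
      using that(2) by (intro AE_I2) (auto simp: abs_mult indicator_def intro!: mult_right_mono order_trans[OF that(2) abs_ge_self])
  qed
  \<comment> \<open>The cutoff at \<open>T'\<close> keeps the test function away from
    \<open>T\<close>; its derivative has the favourable sign and is discarded.\<close>
  have main: "AE t in lborel. t \<in> {0<..<T} \<longrightarrow> t < T' \<longrightarrow> E t = 0" if T': "0 < T'" "T' < T" for T'
  proof -
    define \<psi> where "\<psi> t = ramp (T' - t)" for t
    define \<zeta> where "\<zeta> n t = ramp (real n * t - 1)" for n :: nat and t
    define q where "q n t = t * (real n * deriv ramp (real n * t - 1))" for n :: nat and t
    have \<psi>s: "smooth_on UNIV \<psi>"
      unfolding \<psi>_def using smooth_on_affine[OF smooth_exp_inv[of 1], of "-1" T'] by (simp add: add.commute)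
    have \<zeta>s: "smooth_on UNIV (\<zeta> n)" for n
      unfolding \<zeta>_def using smooth_on_affine[OF smooth_exp_inv[of 1], of "real n" "-1"] by simp
    have [measurable]: "\<psi> \<in> borel_measurable borel" "\<zeta> n \<in> borel_measurable borel" for n
      using \<psi>s \<zeta>s by (auto intro: smooth_measurable)
    have qm [measurable]: "q n \<in> borel_measurable borel" for n
    proof -
      have "deriv ramp \<in> borel_measurable borel"
        by (rule smooth_measurable[OF smooth_on_deriv[OF smooth_exp_inv]])
      then show ?thesis unfolding q_def by measurable
    qed
    have \<psi>1: "0 \<le> \<psi> t" "\<psi> t \<le> 1" and \<zeta>1: "0 \<le> \<zeta> n t" "\<zeta> n t \<le> 1" for n t
      by (auto simp: \<psi>_def \<zeta>_def ramp_nonneg ramp_le_1)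
    have qx: "q n t = (if real n * t \<le> 1 then 0 else ((real n * t - 1) + 1) * deriv ramp (real n * t - 1))" for n t
      by (simp add: q_def deriv_ramp)
    have q: "0 \<le> q n t" "q n t \<le> 3" for n t
      using ramp_profile_le(2)[of "real n * t - 1"] deriv_ramp_nonneg[of "real n * t - 1"]
      by (auto simp: qx intro!: mult_nonneg_nonneg)
    \<comment> \<open>In the energy identity with t \<zeta> \<psi>, the derivative of the factor t
      yields the term with \<open>Cs\<close> on the left and that of \<zeta> the term with
      \<open>q\<close>; the lower bound on \<open>D\<close> enters twice, as 32 = 2 * 16.\<close>
    have ineq: "(32 * lam / N - Cs) * (LINT t:{0<..<T}|lborel. (\<zeta> n t * \<psi> t) * E t) \<le> Cs * (LINT t:{0<..<T}|lborel. (q n t * \<psi> t) * E t)"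
      if n: "0 < n" for n
    proof -
      define \<eta> where "\<eta> t = t * (\<zeta> n t * \<psi> t)" for t
      have \<eta>: "test_fun {0<..<T} \<eta>"
      proof (rule test_fun_realI)
        show "smooth_on UNIV \<eta>" unfolding \<eta>_def by (intro smooth_on_mult smooth_on_ident \<zeta>s \<psi>s)
        show "1 / real n \<le> t \<and> t \<le> T'" if "\<eta> t \<noteq> 0" for t
          using that n by (auto simp: \<eta>_def \<zeta>_def \<psi>_def ramp_eq field_simps split: if_splits)
        show "{1 / real n..T'} \<subseteq> {0<..<T}" 
        proof
          fix t assume "t \<in> {1 / real n..T'}"
          moreover have "0 < 1 / real n" using n by simp
          ultimately show "t \<in> {0<..<T}" using T' unfolding atLeastAtMost_iff greaterThanLessThan_iff by linarith
        qed
      qed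
      define r where "r t = t * \<zeta> n t * deriv ramp (T' - t)" for t
      have d\<eta>: "deriv \<eta> t = \<zeta> n t * \<psi> t + q n t * \<psi> t - r t" for t
      proof (rule DERIV_imp_deriv)
        have c: "(\<zeta> n has_real_derivative deriv ramp (real n * t - 1) * real n) (at t)"
          unfolding \<zeta>_def by (rule DERIV_chain2[OF smooth_on_has_real_derivative[OF smooth_exp_inv]]) (auto intro!: derivative_eq_intros)
        have p: "(\<psi> has_real_derivative deriv ramp (T' - t) * (-1)) (at t)"
          unfolding \<psi>_def by (rule DERIV_chain2[OF smooth_on_has_real_derivative[OF smooth_exp_inv]]) (auto intro!: derivative_eq_intros)
        show "(\<eta> has_real_derivative \<zeta> n t * \<psi> t + q n t * \<psi> t - r t) (at t)"
          unfolding \<eta>_def by (rule derivative_eq_intros c p refl)+ (simp add: q_def r_def algebra_simps)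
      qed
      have id: "Cs * (LINT t:{0<..<T}|lborel. deriv \<eta> t * E t) = 2 * (LINT t:{0<..<T}|lborel. (\<zeta> n t * \<psi> t) * D t)"
      proof -
        have "(LINT t:{0<..<T}|lborel. \<eta> t / t * D t) = (LINT t:{0<..<T}|lborel. (\<zeta> n t * \<psi> t) * D t)"
          by (rule set_lebesgue_integral_cong) (auto simp: \<eta>_def)
        then show ?thesis
          using energy_identity[OF T u G F H weak \<eta>] by (simp add: E_def D_def)
      qed
      have i1: "set_integrable lborel {0<..<T} (\<lambda>t. (\<zeta> n t * \<psi> t) * e t)" if "set_integrable lborel {0<..<T} e" for e
        by (rule bounded[where B=1, OF _ _ that]) (use \<psi>1 \<zeta>1 in \<open>auto simp: abs_mult intro!: mult_le_one\<close>)
      have i2: "set_integrable lborel {0<..<T} (\<lambda>t. (q n t * \<psi> t) * E t)"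
      proof (rule bounded[where B="3 * 1", OF _ _ Eint])
        show "\<bar>q n t * \<psi> t\<bar> \<le> 3 * 1" for t
          unfolding abs_mult using \<psi>1[of t] q[of n t] by (intro mult_mono) auto
      qed measurable
      obtain B where B: "\<And>t. \<bar>deriv \<eta> t\<bar> \<le> B"
      proof -
        obtain x y where "\<And>t. \<eta> t \<noteq> 0 \<Longrightarrow> x < t \<and> t < y" using test_fun_realE[OF \<eta> T] by metis
        then have "deriv \<eta> t \<noteq> 0 \<Longrightarrow> x \<le> t \<and> t \<le> y" for t
          using deriv_support[of \<eta> x y t] by force
        then show thesis
          using smooth_on_bounded[OF smooth_on_deriv[OF test_fun_smooth[OF \<eta>]], of x y] that by blast
      qed
      have i3: "set_integrable lborel {0<..<T} (\<lambda>t. deriv \<eta> t * E t)"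
        by (rule bounded[where B=B, OF smooth_measurable[OF smooth_on_deriv[OF test_fun_smooth[OF \<eta>]]] B Eint])
      have "(LINT t:{0<..<T}|lborel. deriv \<eta> t * E t) \<le> (LINT t:{0<..<T}|lborel. (\<zeta> n t * \<psi> t) * E t + (q n t * \<psi> t) * E t)"
      proof (rule set_integral_mono[OF i3])
        show "set_integrable lborel {0<..<T} (\<lambda>t. (\<zeta> n t * \<psi> t) * E t + (q n t * \<psi> t) * E t)"
          by (rule set_integral_add(1)[OF i1[OF Eint] i2])
        show "deriv \<eta> t * E t \<le> (\<zeta> n t * \<psi> t) * E t + (q n t * \<psi> t) * E t" if "t \<in> {0<..<T}" for t
        proof -
          have "0 \<le> r t * E t" using that \<zeta>1 E0 deriv_ramp_nonneg by (simp add: r_def)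
          then show ?thesis by (simp add: d\<eta> algebra_simps)
        qed
      qed
      also have "\<dots> = (LINT t:{0<..<T}|lborel. (\<zeta> n t * \<psi> t) * E t) + (LINT t:{0<..<T}|lborel. (q n t * \<psi> t) * E t)"
        by (rule set_integral_add(2)[OF i1[OF Eint] i2])
      finally have up: "Cs * (LINT t:{0<..<T}|lborel. deriv \<eta> t * E t) \<le> Cs * ((LINT t:{0<..<T}|lborel. (\<zeta> n t * \<psi> t) * E t) + (LINT t:{0<..<T}|lborel. (q n t * \<psi> t) * E t))"
        using Cs by simp
      have "16 * lam / N * (LINT t:{0<..<T}|lborel. (\<zeta> n t * \<psi> t) * E t) = (LINT t:{0<..<T}|lborel. 16 * lam / N * ((\<zeta> n t * \<psi> t) * E t))"
        by simp
      also have "\<dots> \<le> (LINT t:{0<..<T}|lborel. (\<zeta> n t * \<psi> t) * D t)"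
      proof (rule set_integral_mono_AE)
        show "set_integrable lborel {0<..<T} (\<lambda>t. 16 * lam / N * ((\<zeta> n t * \<psi> t) * E t))"
          using i1[OF Eint] by simp
        show "AE t\<in>{0<..<T} in lborel. 16 * lam / N * ((\<zeta> n t * \<psi> t) * E t) \<le> (\<zeta> n t * \<psi> t) * D t"
          using ED
        proof eventually_elim
          case (elim t)
          then show ?case
            using mult_left_mono[of "16 * lam / N * E t" "D t" "\<zeta> n t * \<psi> t"] \<psi>1 \<zeta>1 by (simp add: mult_ac)
        qed
      qed (rule i1[OF Dint])
      finally have low: "16 * lam / N * (LINT t:{0<..<T}|lborel. (\<zeta> n t * \<psi> t) * E t) \<le> (LINT t:{0<..<T}|lborel. (\<zeta> n t * \<psi> t) * D t)" .
      have "32 * lam / N * x = 2 * (16 * lam / N * x)" for x by simp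
      then show ?thesis
        using up id low unfolding left_diff_distrib distrib_left by (smt (verit))
    qed
    define E' where "E' t = indicator {0<..<T} t *\<^sub>R E t" for t
    have E'int: "integrable lborel E'" using Eint by (simp add: E'_def[abs_def] set_integrable_def)
    have [measurable]: "E' \<in> borel_measurable borel" using E'int by auto
    have ntop: "filterlim (\<lambda>n. real n * t - 1) at_top sequentially" if "0 < t" for t
      using filterlim_tendsto_pos_mult_at_top[OF tendsto_const that filterlim_real_sequentially]
        filterlim_tendsto_add_at_top[OF tendsto_const[of "-1"]]
      by (simp add: mult.commute[of _ t])
    have lim1: "(\<lambda>n. \<integral>t. (\<zeta> n t * \<psi> t) * E' t \<partial>lborel) \<longlonglongrightarrow> (\<integral>t. \<psi> t * E' t \<partial>lborel)"
    proof (rule integral_dominated_convergence[where w="\<lambda>t. norm (E' t)"])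
      show "AE t in lborel. (\<lambda>n. (\<zeta> n t * \<psi> t) * E' t) \<longlonglongrightarrow> \<psi> t * E' t"
      proof (rule AE_I2)
        fix t :: real
        show "(\<lambda>n. (\<zeta> n t * \<psi> t) * E' t) \<longlonglongrightarrow> \<psi> t * E' t"
        proof (cases "0 < t")
          case True
          have "(\<lambda>n. (\<zeta> n t * \<psi> t) * E' t) \<longlonglongrightarrow> (1 * \<psi> t) * E' t"
            unfolding \<zeta>_def by (intro tendsto_mult tendsto_const ramp_tendsto_1 ntop True)
          then show ?thesis by simp
        qed (simp add: E'_def)
      qed
      show "AE t in lborel. norm ((\<zeta> n t * \<psi> t) * E' t) \<le> norm (E' t)" for n
        using \<psi>1 \<zeta>1 by (intro AE_I2) (auto simp: abs_mult intro!: mult_left_le_one_le mult_le_one mult_nonneg_nonneg)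
    qed (use E'int in auto)
    \<comment> \<open>The layer near t = 0 disappears in the limit by mere integrability of the
      energy; this stands in for an initial condition.\<close>
    have lim2: "(\<lambda>n. \<integral>t. (q n t * \<psi> t) * E' t \<partial>lborel) \<longlonglongrightarrow> (\<integral>t. 0 \<partial>(lborel :: real measure))"
    proof (rule integral_dominated_convergence[where w="\<lambda>t. 3 * norm (E' t)"])
      show "AE t in lborel. (\<lambda>n. (q n t * \<psi> t) * E' t) \<longlonglongrightarrow> 0"
      proof (rule AE_I2)
        fix t :: real
        show "(\<lambda>n. (q n t * \<psi> t) * E' t) \<longlonglongrightarrow> 0"
        proof (cases "0 < t")
          case True
          have "(\<lambda>n. inverse (real n * t - 1) + (inverse (real n * t - 1))\<^sup>2) \<longlonglongrightarrow> 0 + 0\<^sup>2"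
            by (intro tendsto_intros tendsto_inverse_0_at_top ntop True)
          then have l: "(\<lambda>n. inverse (real n * t - 1) + (inverse (real n * t - 1))\<^sup>2) \<longlonglongrightarrow> 0" by simp
          have "(\<lambda>n. q n t) \<longlonglongrightarrow> 0"
          proof (rule tendsto_sandwich[OF _ _ tendsto_const l])
            show "\<forall>\<^sub>F n in sequentially. q n t \<le> inverse (real n * t - 1) + (inverse (real n * t - 1))\<^sup>2"
              using eventually_compose_filterlim[OF eventually_gt_at_top[of 0] ntop[OF True]]
            proof eventually_elim
              case (elim n)
              then show ?case
                using ramp_profile_le(1)[of "real n * t - 1"] by (simp add: qx inverse_eq_divide)
            qed
          qed (use q in auto)
          then have "(\<lambda>n. (q n t * \<psi> t) * E' t) \<longlonglongrightarrow> (0 * \<psi> t) * E' t"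
            by (intro tendsto_mult tendsto_const)
          then show ?thesis by simp
        qed (simp add: E'_def)
      qed
      show "AE t in lborel. norm ((q n t * \<psi> t) * E' t) \<le> 3 * norm (E' t)" for n
      proof (rule AE_I2)
        fix t :: real
        have "q n t * \<psi> t \<le> 3 * 1" using q \<psi>1 by (intro mult_mono) auto
        then show "norm ((q n t * \<psi> t) * E' t) \<le> 3 * norm (E' t)"
          using q[of n t] \<psi>1[of t] by (simp add: abs_mult mult_right_mono)
      qed
    qed (use E'int in auto)
    have set_eq: "(LINT t:{0<..<T}|lborel. m t * E t) = (\<integral>t. m t * E' t \<partial>lborel)" for m
      by (simp add: set_lebesgue_integral_def E'_def mult_ac)
    have le: "(32 * lam / N - Cs) * (\<integral>t. \<psi> t * E' t \<partial>lborel) \<le> Cs * (\<integral>t. 0 \<partial>(lborel :: real measure))"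
    proof (rule LIMSEQ_le[OF tendsto_mult[OF tendsto_const lim1] tendsto_mult[OF tendsto_const lim2]])
      show "\<exists>M. \<forall>n\<ge>M. (32 * lam / N - Cs) * (\<integral>t. (\<zeta> n t * \<psi> t) * E' t \<partial>lborel) \<le> Cs * (\<integral>t. (q n t * \<psi> t) * E' t \<partial>lborel)"
        using ineq unfolding set_eq by (intro exI[of _ 1]) auto
    qed
    \<comment> \<open>Strict because pi < 4, even when \<open>Cs\<close> attains its bound.\<close>
    have "Cs < 32 * lam / N"
    proof -
      have "pi\<^sup>2 < 4\<^sup>2" using pi_less_4 pi_gt_zero by (intro power_strict_mono) auto
      then have "2 * lam * pi\<^sup>2 < 2 * lam * 16" using lam by simp
      then have "2 * lam * pi\<^sup>2 / N < 32 * lam / N" using N by (simp add: divide_strict_right_mono)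
      then show ?thesis using Cs(2) by (simp add: N_def)
    qed
    then have "(\<integral>t. \<psi> t * E' t \<partial>lborel) \<le> 0"
      using le by (simp add: mult_le_0_iff)
    have int: "integrable lborel (\<lambda>t. \<psi> t * E' t)"
      by (rule Bochner_Integration.integrable_bound[OF E'int])
        (use \<psi>1 in \<open>auto simp: abs_mult intro!: mult_left_le_one_le\<close>)
    have nn: "0 \<le> \<psi> t * E' t" for t using \<psi>1 E0 by (simp add: E'_def)
    have "(\<integral>t. \<psi> t * E' t \<partial>lborel) = 0"
      using \<open>_ \<le> 0\<close> nn by (intro antisym) auto
    then have "AE t in lborel. \<psi> t * E' t = 0"
      using integral_nonneg_eq_0_iff_AE[OF int] nn by simp
    then show ?thesis
    proof eventually_elim
      case (elim t)
      then show ?case using ramp_pos_iff[of "T' - t"] by (auto simp: \<psi>_def E'_def)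
    qed
  qed
  \<comment> \<open>The offset 2 keeps the cutoff time positive for m = 0.\<close>
  have "AE t in lborel. \<forall>m. t \<in> {0<..<T} \<longrightarrow> t < T - T / real (m + 2) \<longrightarrow> E t = 0"
    unfolding AE_all_countable
  proof (intro allI main)
    show "0 < T - T / real (m + 2)" for m using T by (simp add: field_simps add_pos_nonneg)
    show "T - T / real (m + 2) < T" for m using T by simp
  qed
  then have Ez: "AE t in lborel. t \<in> {0<..<T} \<longrightarrow> E t = 0"
  proof eventually_elim
    case (elim t)
    show ?case
    proof
      assume t: "t \<in> {0<..<T}"
      then have "0 < (T - t) / T" by auto
      then obtain m where "inverse (real (Suc m)) < (T - t) / T" using reals_Archimedean by blast
      moreover have "inverse (real (m + 2)) \<le> inverse (real (Suc m))" by simp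
      ultimately have "inverse (real (m + 2)) < (T - t) / T" by linarith
      then have "t < T - T / real (m + 2)" using T by (simp add: field_simps)
      then show "E t = 0" using elim t by blast
    qed
  qed
  \<comment> \<open>With zero energy, the identity tested with t \<eta> forces the dissipation
    \<open>D\<close> to vanish, and ellipticity then controls the gradient.\<close>
  have "AE t in lborel. t \<in> {0<..<T} \<longrightarrow> D t = 0"
  proof (rule fundamental_lemma[OF Dint])
    fix \<eta> :: "real \<Rightarrow> real" assume \<eta>: "test_fun {0<..<T} \<eta>"
    have "(LINT t:{0<..<T}|lborel. deriv (\<lambda>t. t * \<eta> t) t * E t) = 0"
      unfolding set_lebesgue_integral_def
      by (rule integral_eq_zero_AE) (use Ez in eventually_elim, auto simp: indicator_def)
    moreover have "(LINT t:{0<..<T}|lborel. t * \<eta> t / t * D t) = (LINT t:{0<..<T}|lborel. \<eta> t * D t)"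
      by (rule set_lebesgue_integral_cong) auto
    ultimately show "(LINT t:{0<..<T}|lborel. \<eta> t * D t) = 0"
      using energy_identity[OF T u G F H weak test_fun_mult_left[OF \<eta> smooth_on_ident]]
      by (simp add: E_def D_def)
  qed
  with ell show ?thesis
  proof eventually_elim
    case (elim t)
    have "0 \<le> cell_ip (G t) (G t)" by (simp add: cell_ip_def)
    then show ?case using elim lam by (auto simp: D_def mult_le_0_iff)
  qed
qed

section \<open>Weak derivatives of Lipschitz functions\<close>

text \<open>The bi-Lipschitz homeomorphism \<open>F(t) + (L + 1) t\<close> preserves null sets, so the push-forward of
  Lebesgue measure under its inverse has a density.\<close>
lemma Lipschitz_has_density:
  fixes F :: "real \<Rightarrow> real"
  assumes L: "\<And>s t. \<bar>F t - F s\<bar> \<le> L * \<bar>t - s\<bar>"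
  obtains D where "\<And>a b. a \<le> b \<Longrightarrow> set_integrable lborel {a<..b} D"
    and "\<And>a b. a \<le> b \<Longrightarrow> (LINT s:{a<..b}|lborel. D s) = F b - F a"
proof -
  have L0: "0 \<le> L" using L[of 1 0] by simp
  \<comment> \<open>All slopes lie between 1 and 2 L + 1, which makes the map a strictly increasing
    bijection.\<close>
  define \<phi> where "\<phi> t = F t + (L + 1) * t" for t
  have low: "t - s \<le> \<phi> t - \<phi> s" if "s \<le> t" for s t
    using L[of t s] that by (simp add: \<phi>_def algebra_simps abs_le_iff)
  have up: "\<bar>\<phi> t - \<phi> s\<bar> \<le> (2 * L + 1) * \<bar>t - s\<bar>" for s t
  proof -
    have "\<phi> t - \<phi> s = (F t - F s) + (L + 1) * (t - s)" by (simp add: \<phi>_def algebra_simps)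
    then have "\<bar>\<phi> t - \<phi> s\<bar> \<le> \<bar>F t - F s\<bar> + (L + 1) * \<bar>t - s\<bar>"
      using abs_triangle_ineq[of "F t - F s" "(L + 1) * (t - s)"] L0 by (simp add: abs_mult)
    then show ?thesis using L[of t s] by (simp add: algebra_simps)
  qed
  have less: "\<phi> s < \<phi> t \<longleftrightarrow> s < t" for s t
    using low[of s t] low[of t s] by (cases "s < t") auto
  have le: "\<phi> s \<le> \<phi> t \<longleftrightarrow> s \<le> t" for s t
    using less[of t s] by (simp add: not_less[symmetric])
  have cont: "continuous_on UNIV \<phi>"
  proof (rule continuous_at_imp_continuous_on, rule ballI, unfold isCont_def)
    fix s :: real
    have "((\<lambda>t. \<phi> t - \<phi> s) \<longlongrightarrow> 0) (at s)"
    proof (rule Lim_null_comparison[where g="\<lambda>t. (2 * L + 1) * \<bar>t - s\<bar>"])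
      have "((\<lambda>t. (2 * L + 1) * \<bar>t - s\<bar>) \<longlongrightarrow> (2 * L + 1) * \<bar>s - s\<bar>) (at s)" by (intro tendsto_intros)
      then show "((\<lambda>t. (2 * L + 1) * \<bar>t - s\<bar>) \<longlongrightarrow> 0) (at s)" by simp
    qed (use up in auto)
    then show "(\<phi> \<longlongrightarrow> \<phi> s) (at s)" by (rule LIM_zero_cancel)
  qed
  have surj: "\<exists>x. \<phi> x = y" for y
  proof -
    define r where "r = \<bar>y - \<phi> 0\<bar>"
    have "\<phi> (- r) \<le> y" "y \<le> \<phi> r"
      using low[of "-r" 0] low[of 0 r] by (auto simp: r_def)
    then show ?thesis
      using IVT'[of \<phi> "- r" y r] continuous_on_subset[OF cont] by (auto simp: r_def)
  qed
  define \<psi> where "\<psi> y = (SOME x. \<phi> x = y)" for y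
  have \<phi>\<psi>: "\<phi> (\<psi> y) = y" for y unfolding \<psi>_def using someI_ex[OF surj] .
  have \<psi>_mono: "mono \<psi>"
    by (rule monoI) (metis \<phi>\<psi> le)
  have [measurable]: "\<psi> \<in> borel_measurable borel"
    by (rule borel_measurable_mono[OF \<psi>_mono])
  define \<nu> where "\<nu> = distr lborel borel \<psi>"
  have sets: "sets \<nu> = sets lborel" by (simp add: \<nu>_def)
  \<comment> \<open>Preimages under the inverse are images under \<open>\<phi>\<close>, so absolute
    continuity says that the Lipschitz map \<open>\<phi>\<close> preserves null sets.\<close>
  have vim: "\<psi> -` A = \<phi> ` A" for A
  proof
    show "\<phi> ` A \<subseteq> \<psi> -` A"
      using \<phi>\<psi> le by (metis (no_types, lifting) antisym image_subsetI order_refl vimage_eq)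
    show "\<psi> -` A \<subseteq> \<phi> ` A"
      using \<phi>\<psi> by (metis imageI subsetI vimage_eq)
  qed
  have ac: "absolutely_continuous lborel \<nu>"
    unfolding absolutely_continuous_def
  proof
    fix A :: "real set" assume A: "A \<in> null_sets lborel"
    then have [measurable]: "A \<in> sets borel" by auto
    have "negligible A" using A by (simp add: negligible_iff_null_sets null_sets_completionI)
    then have "negligible (\<phi> ` A)"
    proof (rule negligible_locally_Lipschitz_image[OF order_refl])
      fix x assume "x \<in> A"
      show "\<exists>T B. open T \<and> x \<in> T \<and> (\<forall>y\<in>A \<inter> T. norm (\<phi> y - \<phi> x) \<le> B * norm (y - x))"
        by (intro exI[of _ UNIV] exI[of _ "2 * L + 1"]) (use up in auto)
    qed
    moreover have "\<phi> ` A \<in> sets borel"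
      using measurable_sets[of \<psi> borel borel A] by (simp add: vim)
    ultimately have "emeasure lborel (\<phi> ` A) = 0"
      by (simp add: negligible_iff_null_sets null_sets_def)
    then show "A \<in> null_sets \<nu>"
      by (simp add: null_sets_def \<nu>_def emeasure_distr vim)
  qed
  obtain f where f [measurable]: "f \<in> borel_measurable lborel" and dens: "density lborel f = \<nu>"
    using sigma_finite_measure.Radon_Nikodym[OF sigma_finite_lborel ac sets] by blast
  have val: "(\<integral>\<^sup>+x. f x * indicator {a<..b} x \<partial>lborel) = ennreal (\<phi> b - \<phi> a)" if "a \<le> b" for a b
  proof -
    have "(\<integral>\<^sup>+x. f x * indicator {a<..b} x \<partial>lborel) = emeasure \<nu> {a<..b}"
      by (simp add: dens[symmetric] emeasure_density)
    also have "\<dots> = emeasure lborel (\<psi> -` {a<..b})"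
      by (simp add: \<nu>_def emeasure_distr)
    also have "\<psi> -` {a<..b} = {\<phi> a<..\<phi> b}"
    proof (rule set_eqI)
      fix y
      show "y \<in> \<psi> -` {a<..b} \<longleftrightarrow> y \<in> {\<phi> a<..\<phi> b}"
        using less[of a "\<psi> y"] le[of "\<psi> y" b] by (simp add: \<phi>\<psi>)
    qed
    finally show ?thesis using le[of a b] that by simp
  qed
  define d where "d x = enn2real (f x)" for x
  have dm [measurable]: "d \<in> borel_measurable borel" unfolding d_def using f by measurable
  have int: "has_bochner_integral lborel (\<lambda>x. d x * indicator {a<..b} x) (\<phi> b - \<phi> a)" if ab: "a \<le> b" for a b
  proof (rule has_bochner_integral_nn_integral)
    have "AE x in lborel. f x * indicator {a<..b} x \<noteq> \<infinity>"
      by (rule nn_integral_noteq_infinite) (use val[OF ab] in auto)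
    then have "AE x in lborel. ennreal (d x * indicator {a<..b} x) = f x * indicator {a<..b} x"
      by eventually_elim (auto simp: d_def indicator_def ennreal_enn2real less_top)
    then have "(\<integral>\<^sup>+x. ennreal (d x * indicator {a<..b} x) \<partial>lborel) = (\<integral>\<^sup>+x. f x * indicator {a<..b} x \<partial>lborel)"
      by (rule nn_integral_cong_AE)
    then show "(\<integral>\<^sup>+x. ennreal (d x * indicator {a<..b} x) \<partial>lborel) = ennreal (\<phi> b - \<phi> a)"
      using val[OF ab] by simp
  qed (use le[of a b] ab in \<open>auto simp: d_def\<close>)
  have dint: "set_integrable lborel {a<..b} d" "(LINT s:{a<..b}|lborel. d s) = \<phi> b - \<phi> a" if "a \<le> b" for a b
    using int[OF that] by (auto simp: has_bochner_integral_iff set_integrable_def set_lebesgue_integral_def mult.commute)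
  have cint: "set_integrable lborel {a<..b} (\<lambda>_. L + 1)" "(LINT s:{a<..b}|lborel. L + 1) = (L + 1) * (b - a)" if "a \<le> b" for a b :: real
    using that by (auto simp: set_integrable_def set_lebesgue_integral_def)
  show thesis
  \<comment> \<open>The density of the added linear term is taken off again.\<close>
  proof (rule that[of "\<lambda>x. d x - (L + 1)"])
    show "set_integrable lborel {a<..b} (\<lambda>x. d x - (L + 1))" if "a \<le> b" for a b
      by (rule set_integral_diff(1)[OF dint(1) cint(1)]) (rule that)+
    show "(LINT s:{a<..b}|lborel. d s - (L + 1)) = F b - F a" if "a \<le> b" for a b
      using set_integral_diff(2)[OF dint(1)[OF that] cint(1)[OF that]] dint(2)[OF that] cint(2)[OF that]
      by (simp add: \<phi>_def algebra_simps)
  qed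
qed

text \<open>Insert the integral representation of \<open>F\<close> and exchange the integrals over
  the triangle s \<le> t; the inner integral of the derivative of \<eta> is -\<eta>(s).\<close>

lemma integral_by_parts_density:
  fixes F D \<eta> :: "real \<Rightarrow> real"
  assumes ab: "a \<le> b" and D: "set_integrable lborel {a<..b} D"
    and F: "\<And>t. t \<in> {a<..b} \<Longrightarrow> F t = F a + (LINT s:{a<..t}|lborel. D s)"
    and \<eta>: "smooth_on UNIV \<eta>" "\<eta> a = 0" "\<eta> b = 0"
  shows "(LINT t:{a<..b}|lborel. F t * deriv \<eta> t) = - (LINT t:{a<..b}|lborel. D t * \<eta> t)"
proof -
  have FTC: "(\<integral>t. indicator {s<..b} t * deriv \<eta> t \<partial>lborel) = - \<eta> s" if "s \<le> b" for s
  proof -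
    have "(\<integral>t. deriv \<eta> t * indicator {s..b} t \<partial>lborel) = \<eta> b - \<eta> s"
      by (rule integral_FTC_Icc_real[OF that smooth_on_has_real_derivative[OF \<eta>(1)]])
        (use smooth_on_continuous[OF smooth_on_deriv[OF \<eta>(1)]] in \<open>simp add: continuous_on_eq_continuous_at\<close>)
    moreover have "(\<integral>t. indicator {s<..b} t * deriv \<eta> t \<partial>lborel) = (\<integral>t. deriv \<eta> t * indicator {s..b} t \<partial>lborel)"
    proof (rule integral_cong_AE)
      have "AE t in lborel. t \<noteq> s" by (rule AE_lborel_singleton)
      then show "AE t in lborel. indicator {s<..b} t * deriv \<eta> t = deriv \<eta> t * indicator {s..b} t"
        by eventually_elim (auto simp: indicator_def)
    qed (use smooth_measurable[OF smooth_on_deriv[OF \<eta>(1)]] in \<open>auto\<close>)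
    ultimately show ?thesis by (simp add: \<eta>)
  qed
  define d where "d s = indicator {a<..b} s * D s" for s
  have d: "integrable lborel d" using D by (simp add: d_def[abs_def] set_integrable_def)
  define e where "e t = indicator {a<..b} t * deriv \<eta> t" for t
  have "integrable lborel (\<lambda>t. indicator {a..b} t *\<^sub>R deriv \<eta> t)"
    by (rule borel_integrable_compact) (auto intro: continuous_on_subset[OF smooth_on_continuous[OF smooth_on_deriv[OF \<eta>(1)]]])
  then have e: "integrable lborel e"
    by (rule Bochner_Integration.integrable_bound)
      (use smooth_measurable[OF smooth_on_deriv[OF \<eta>(1)]] in \<open>auto simp: e_def[abs_def] indicator_def\<close>)
  have int: "integrable (lborel \<Otimes>\<^sub>M lborel) (\<lambda>(s, t). (if s \<le> t then 1 else 0) * (d s * e t))"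
    by (rule bounded_kernel_integrable(1)[OF integrable_tensor[OF d e], where B=1]) auto
  have "(LINT t:{a<..b}|lborel. F t * deriv \<eta> t) = (\<integral>t. F a * e t + (\<integral>s. (if s \<le> t then 1 else 0) * (d s * e t) \<partial>lborel) \<partial>lborel)"
    unfolding set_lebesgue_integral_def
  proof (rule Bochner_Integration.integral_cong[OF refl])
    fix t
    show "indicator {a<..b} t *\<^sub>R (F t * deriv \<eta> t) = F a * e t + (\<integral>s. (if s \<le> t then 1 else 0) * (d s * e t) \<partial>lborel)"
    proof (cases "t \<in> {a<..b}")
      case True
      have "(\<integral>s. (if s \<le> t then 1 else 0) * (d s * e t) \<partial>lborel) = (\<integral>s. (indicator {a<..t} s * D s) * deriv \<eta> t \<partial>lborel)"
        by (rule Bochner_Integration.integral_cong) (use True in \<open>auto simp: d_def e_def indicator_def\<close>)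
      also have "\<dots> = (LINT s:{a<..t}|lborel. D s) * deriv \<eta> t"
        by (simp add: set_lebesgue_integral_def)
      finally show ?thesis using F[OF True] True by (simp add: e_def algebra_simps)
    qed (simp add: e_def)
  qed
  also have "\<dots> = (\<integral>t. F a * e t \<partial>lborel) + (\<integral>t. \<integral>s. (if s \<le> t then 1 else 0) * (d s * e t) \<partial>lborel \<partial>lborel)"
    by (rule Bochner_Integration.integral_add) (use e lborel_pair.integrable_snd[OF int] in auto)
  also have "(\<integral>t. F a * e t \<partial>lborel) = 0"
    using FTC[OF ab] \<eta> by (simp add: e_def)
  also have "(\<integral>t. \<integral>s. (if s \<le> t then 1 else 0) * (d s * e t) \<partial>lborel \<partial>lborel) = (\<integral>s. \<integral>t. (if s \<le> t then 1 else 0) * (d s * e t) \<partial>lborel \<partial>lborel)"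
    by (rule lborel_pair.Fubini_integral[OF int])
  also have "\<dots> = (\<integral>s. - (d s * \<eta> s) \<partial>lborel)"
  proof (rule Bochner_Integration.integral_cong[OF refl])
    fix s
    show "(\<integral>t. (if s \<le> t then 1 else 0) * (d s * e t) \<partial>lborel) = - (d s * \<eta> s)"
    proof (cases "s \<in> {a<..b}")
      case True
      have "(\<integral>t. (if s \<le> t then 1 else 0) * (d s * e t) \<partial>lborel) = (\<integral>t. d s * (indicator {s<..b} t * deriv \<eta> t) \<partial>lborel)"
      proof (rule integral_cong_AE)
        have "AE t in lborel. t \<noteq> s" by (rule AE_lborel_singleton)
        then show "AE t in lborel. (if s \<le> t then 1 else 0) * (d s * e t) = d s * (indicator {s<..b} t * deriv \<eta> t)"
          by eventually_elim (use True in \<open>auto simp: e_def indicator_def\<close>)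
      qed (use smooth_measurable[OF smooth_on_deriv[OF \<eta>(1)]] e in auto)
      then show ?thesis using FTC[of s] True by simp
    qed (simp add: d_def)
  qed
  finally show ?thesis
    by (simp add: d_def set_lebesgue_integral_def mult.assoc)
qed

text \<open>Almost every \<open>s\<close> satisfies the estimate for almost every \<open>t\<close>;
  for a countable dense set \<open>Q\<close> of such points it holds for almost every
  \<open>t\<close> simultaneously. The representative is the McShane extension from
  \<open>Q\<close>, the infimum of E(q) + L |t - q|.\<close>

lemma AE_Lipschitz_representative:
  fixes E :: "real \<Rightarrow> real"
  assumes T: "0 < T" and L0: "0 \<le> L"
    and L: "AE s in lborel. AE t in lborel. s \<in> {0<..<T} \<longrightarrow> t \<in> {0<..<T} \<longrightarrow> \<bar>E t - E s\<bar> \<le> L * \<bar>t - s\<bar>"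
  obtains F where "\<And>s t. \<bar>F t - F s\<bar> \<le> L * \<bar>t - s\<bar>" "AE t in lborel. t \<in> {0<..<T} \<longrightarrow> E t = F t"
proof -
  define S where "S = {s \<in> {0<..<T}. AE t in lborel. t \<in> {0<..<T} \<longrightarrow> \<bar>E t - E s\<bar> \<le> L * \<bar>t - s\<bar>}"
  have AES: "AE s in lborel. s \<in> {0<..<T} \<longrightarrow> s \<in> S"
    using L by eventually_elim (auto simp: S_def)
  obtain Q where Q: "countable Q" "Q \<subseteq> S" "S \<subseteq> closure Q"
    using separable[of S] by blast
  \<comment> \<open>\<open>S\<close> meets every subinterval because its complement in (0,T) is
    null, and \<open>Q\<close> is dense in \<open>S\<close>.\<close>
  have dense: "\<exists>q\<in>Q. \<bar>t - q\<bar> < e" if t: "t \<in> {0<..<T}" and e: "0 < e" for t e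
  proof -
    define l u where "l = max 0 (t - e / 2)" and "u = min T (t + e / 2)"
    have ne: "l < u" using t e by (auto simp: l_def u_def)
    define I where "I = {l<..<u}"
    have "\<exists>s\<in>I. s \<in> S"
    proof (rule ccontr)
      assume "\<not> ?thesis"
      then have "AE s in lborel. s \<notin> I"
        using AES by (rule_tac AE_mp[OF AES]) (auto simp: I_def l_def u_def)
      then have "emeasure lborel I = 0"
        by (subst (asm) AE_iff_measurable[of I]) (auto simp: I_def)
      then show False using ne by (simp add: I_def)
    qed
    then obtain s where s: "s \<in> S" "s \<in> I" by blast
    then have "s \<in> closure Q" using Q by auto
    then obtain q where "q \<in> Q" "dist q s < e / 2" using e closure_approachable[of s Q] by (meson half_gt_zero)
    moreover have "t - e / 2 < s" "s < t + e / 2" using s by (auto simp: I_def l_def u_def)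
    ultimately have "\<bar>t - q\<bar> < e" unfolding dist_real_def by linarith
    then show ?thesis using \<open>q \<in> Q\<close> by blast
  qed
  have AEQ: "AE t in lborel. \<forall>q\<in>Q. t \<in> {0<..<T} \<longrightarrow> \<bar>E t - E q\<bar> \<le> L * \<bar>t - q\<bar>"
    unfolding AE_ball_countable[OF Q(1)] using Q(2) by (auto simp: S_def)
  \<comment> \<open>A single time compatible with all of \<open>Q\<close> bounds the infimum from
    below.\<close>
  have "\<exists>t. t \<in> {0<..<T} \<and> (\<forall>q\<in>Q. \<bar>E t - E q\<bar> \<le> L * \<bar>t - q\<bar>)"
  proof (rule ccontr)
    assume n: "\<not> ?thesis"
    have "AE t in lborel. t \<notin> {0<..<T}"
      using AEQ by eventually_elim (use n in blast)
    then have "emeasure lborel {0<..<T} = 0" by (subst (asm) AE_iff_measurable[of "{0<..<T}"]) auto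
    then show False using T by simp
  qed
  then obtain t0 where t0: "t0 \<in> {0<..<T}" "\<And>q. q \<in> Q \<Longrightarrow> \<bar>E t0 - E q\<bar> \<le> L * \<bar>t0 - q\<bar>" by blast
  have Qne: "Q \<noteq> {}" using dense[OF t0(1), of 1] by auto
  define F where "F t = (INF q\<in>Q. E q + L * \<bar>t - q\<bar>)" for t
  have low: "E t0 - L * \<bar>t0 - t\<bar> \<le> E q + L * \<bar>t - q\<bar>" if "q \<in> Q" for q t
  proof -
    have "L * \<bar>t0 - q\<bar> \<le> L * (\<bar>t0 - t\<bar> + \<bar>t - q\<bar>)" using L0 by (intro mult_left_mono) auto
    then show ?thesis using t0(2)[OF that] by (simp add: distrib_left)
  qed
  have bdd: "bdd_below ((\<lambda>q. E q + L * \<bar>t - q\<bar>) ` Q)" for t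
    using low by (intro bdd_belowI[of _ "E t0 - L * \<bar>t0 - t\<bar>"]) auto
  have le: "F t \<le> F s + L * \<bar>t - s\<bar>" for s t
  proof -
    have "F t - L * \<bar>t - s\<bar> \<le> F s"
      unfolding F_def[of s]
    proof (rule cINF_greatest[OF Qne])
      fix q assume q: "q \<in> Q"
      have "F t \<le> E q + L * \<bar>t - q\<bar>" unfolding F_def by (rule cINF_lower[OF bdd q])
      also have "L * \<bar>t - q\<bar> \<le> L * (\<bar>t - s\<bar> + \<bar>s - q\<bar>)" using L0 by (intro mult_left_mono) auto
      finally show "F t - L * \<bar>t - s\<bar> \<le> E q + L * \<bar>s - q\<bar>" by (simp add: distrib_left)
    qed
    then show ?thesis by simp
  qed
  show thesis
  proof (rule that[of F])
    show "\<bar>F t - F s\<bar> \<le> L * \<bar>t - s\<bar>" for s t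
      using le[of s t] le[of t s] by (simp add: abs_le_iff abs_minus_commute)
    show "AE t in lborel. t \<in> {0<..<T} \<longrightarrow> E t = F t"
      using AEQ
    proof eventually_elim
      case (elim t)
      show ?case
      proof
        assume t: "t \<in> {0<..<T}"
        have "E t \<le> F t"
          unfolding F_def using elim t by (intro cINF_greatest[OF Qne]) (auto simp: abs_le_iff)
        moreover have "F t \<le> E t + e" if e: "0 < e" for e
        proof -
          \<comment> \<open>The summand 1 covers L = 0.\<close>
          have "0 < e / (2 * L + 1)" using e L0 by simp
          then obtain q where q: "q \<in> Q" "\<bar>t - q\<bar> < e / (2 * L + 1)" using dense[OF t] by blast
          have "F t \<le> E q + L * \<bar>t - q\<bar>" unfolding F_def by (rule cINF_lower[OF bdd q(1)])
          also have "\<dots> \<le> E t + 2 * L * \<bar>t - q\<bar>" using elim q(1) t by (auto simp: abs_le_iff)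
          also have "2 * L * \<bar>t - q\<bar> \<le> (2 * L + 1) * \<bar>t - q\<bar>" by (intro mult_right_mono) auto
          also have "\<dots> \<le> e" using q(2) L0 by (simp add: pos_less_divide_eq mult.commute)
          finally show ?thesis by simp
        qed
        ultimately show "E t = F t" using field_le_epsilon[of "F t" "E t"] by force
      qed
    qed
  qed
qed

lemma Lipschitz_measurable:
  fixes F :: "real \<Rightarrow> real"
  assumes F: "\<And>s t. \<bar>F t - F s\<bar> \<le> L * \<bar>t - s\<bar>"
  shows "F \<in> borel_measurable borel"
proof (rule borel_measurable_continuous_onI, rule continuous_at_imp_continuous_on, rule ballI, unfold isCont_def)
  fix s :: real
  have "((\<lambda>t. F t - F s) \<longlongrightarrow> 0) (at s)"
  proof (rule Lim_null_comparison[where g="\<lambda>t. L * \<bar>t - s\<bar>"])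
    have "((\<lambda>t. L * \<bar>t - s\<bar>) \<longlongrightarrow> L * \<bar>s - s\<bar>) (at s)" by (intro tendsto_intros)
    then show "((\<lambda>t. L * \<bar>t - s\<bar>) \<longlongrightarrow> 0) (at s)" by simp
  qed (use F in auto)
  then show "(F \<longlongrightarrow> F s) (at s)" by (rule LIM_zero_cancel)
qed

text \<open>Passes from the everywhere defined representative \<open>F\<close> back to
  \<open>E\<close>: integrals do not see the exceptional times.\<close>

lemma weak_deriv_density:
  fixes E F D :: "real \<Rightarrow> real"
  assumes T: "0 < T" and E: "set_integrable lborel {0<..<T} E"
    and EF: "AE t in lborel. t \<in> {0<..<T} \<longrightarrow> E t = F t" and Fm [measurable]: "F \<in> borel_measurable borel"
    and D: "\<And>a b. a \<le> b \<Longrightarrow> set_integrable lborel {a<..b} D"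
      "\<And>a b. a \<le> b \<Longrightarrow> (LINT s:{a<..b}|lborel. D s) = F b - F a"
  shows "weak_deriv T E D"
  unfolding weak_deriv_def
proof (intro conjI allI impI)
    fix K assume K: "compact K \<and> K \<subseteq> {0<..<T}"
    then have "K \<in> sets lborel" by (simp add: borel_compact)
    then show "set_integrable lborel K E" using set_integrable_subset[OF E] K by auto
    show "set_integrable lborel K D"
      by (rule set_integrable_subset[OF D(1)[of 0 T]]) (use K T \<open>K \<in> sets lborel\<close> in auto)
  next
    fix \<eta> assume \<eta>: "test_fun {0<..<T} \<eta>"
    obtain a b where ab: "0 < a" "a \<le> b" "b < T" "\<And>t. \<eta> t \<noteq> 0 \<Longrightarrow> a < t \<and> t < b"
      using test_fun_realE[OF \<eta> T] by blast
    have z: "deriv \<eta> t = 0" "\<eta> t = 0" if "t \<notin> {a..b}" for t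
      using deriv_support[of \<eta> a b t] ab(4) that by force+
    have [measurable]: "deriv \<eta> \<in> borel_measurable borel"
      by (rule smooth_measurable[OF smooth_on_deriv[OF test_fun_smooth[OF \<eta>]]])
    have neq: "AE t in lborel. t \<noteq> a" by (rule AE_lborel_singleton)
    have Em: "(\<lambda>t. indicator {0<..<T} t *\<^sub>R E t) \<in> borel_measurable lborel"
      using E unfolding set_integrable_def by (rule borel_measurable_integrable)
    have "(LINT t:{0<..<T}|lborel. E t * deriv \<eta> t) = (LINT t:{a<..b}|lborel. F t * deriv \<eta> t)"
      unfolding set_lebesgue_integral_def
    proof (rule integral_cong_AE)
      have "(\<lambda>t. (indicator {0<..<T} t *\<^sub>R E t) * deriv \<eta> t) \<in> borel_measurable lborel"
        using Em by measurable
      then show "(\<lambda>t. indicator {0<..<T} t *\<^sub>R (E t * deriv \<eta> t)) \<in> borel_measurable lborel" by (simp add: mult.assoc)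
      show "AE t in lborel. indicator {0<..<T} t *\<^sub>R (E t * deriv \<eta> t) = indicator {a<..b} t *\<^sub>R (F t * deriv \<eta> t)"
        using EF neq
      proof eventually_elim
        case (elim t)
        then show ?case using z[of t] ab by (auto simp: indicator_def)
      qed
    qed measurable
    also have "\<dots> = - (LINT t:{a<..b}|lborel. D t * \<eta> t)"
    proof (rule integral_by_parts_density[OF ab(2) D(1)[OF ab(2)] _ test_fun_smooth[OF \<eta>]])
      show "F t = F a + (LINT s:{a<..t}|lborel. D s)" if "t \<in> {a<..b}" for t
        using D(2)[of a t] that by simp
      show "\<eta> a = 0" "\<eta> b = 0" using ab(4) by blast+
    qed
    also have "(LINT t:{a<..b}|lborel. D t * \<eta> t) = (LINT t:{0<..<T}|lborel. D t * \<eta> t)"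
      unfolding set_lebesgue_integral_def
      by (rule Bochner_Integration.integral_cong[OF refl]) (use ab in \<open>force simp: indicator_def\<close>)
    finally show "(LINT t:{0<..<T}|lborel. E t * deriv \<eta> t) = - (LINT t:{0<..<T}|lborel. D t * \<eta> t)" .
  qed

lemma AE_Lipschitz_weak_deriv:
  fixes E :: "real \<Rightarrow> real"
  assumes T: "0 < T" and L0: "0 \<le> L" and E: "set_integrable lborel {0<..<T} E"
    and L: "AE s in lborel. AE t in lborel. s \<in> {0<..<T} \<longrightarrow> t \<in> {0<..<T} \<longrightarrow> \<bar>E t - E s\<bar> \<le> L * \<bar>t - s\<bar>"
  shows "\<exists>D. weak_deriv T E D"
proof -
  obtain F where F: "\<And>s t. \<bar>F t - F s\<bar> \<le> L * \<bar>t - s\<bar>" and EF: "AE t in lborel. t \<in> {0<..<T} \<longrightarrow> E t = F t"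
    using AE_Lipschitz_representative[OF T L0 L] by blast
  obtain D where "\<And>a b. a \<le> b \<Longrightarrow> set_integrable lborel {a<..b} D"
    "\<And>a b. a \<le> b \<Longrightarrow> (LINT s:{a<..b}|lborel. D s) = F b - F a"
    using Lipschitz_has_density[OF F] by blast
  from weak_deriv_density[OF T E EF Lipschitz_measurable[OF F] this] show ?thesis by blast
qed

section \<open>The coefficient field\<close>

lemma norm_matrix_vector_le: "norm (A *v x) \<le> norm A * norm x"
  for A :: "real^'n^'m"
proof -
  have "norm (A *v x) = L2_set (\<lambda>i. norm (A $ i \<bullet> x)) UNIV"
    by (simp add: norm_vec_def matrix_mult_dot)
  also have "\<dots> \<le> L2_set (\<lambda>i. norm x * norm (A $ i)) UNIV"
  proof (rule L2_set_mono)
    show "norm (A $ i \<bullet> x) \<le> norm x * norm (A $ i)" for i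
      using Cauchy_Schwarz_ineq2[of "A $ i" x] by (simp add: mult.commute)
  qed simp
  also have "\<dots> = norm A * norm x"
    by (simp add: norm_vec_def[of A] L2_set_right_distrib[symmetric] mult.commute)
  finally show ?thesis .
qed

lemma measurable_matrix_vector:
  fixes A :: "'a \<Rightarrow> real^'n^'n"
  assumes A: "A \<in> borel_measurable M" and u: "u \<in> borel_measurable M"
  shows "(\<lambda>x. A x *v u x) \<in> borel_measurable M"
proof -
  have "continuous_on UNIV (\<lambda>p :: (real^'n^'n) \<times> (real^'n). fst p *v snd p)"
    unfolding matrix_vector_mult_def by (intro continuous_intros)
  from measurable_compose[OF borel_measurable_Pair[OF A u] borel_measurable_continuous_onI[OF this]]
  show ?thesis by simp
qed

text \<open>Testing with \<open>\<xi> + \<zeta>\<close>, \<open>\<zeta> = A \<xi>\<close>, bounds the norm of a symmetric matrix by its quadratic form.\<close>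
lemma symmetric_matrix_norm_le:
  fixes A :: "real^'n^'n"
  assumes sym: "transpose A = A" and A: "\<And>\<xi>. 0 \<le> (A *v \<xi>) \<bullet> \<xi>" "\<And>\<xi>. (A *v \<xi>) \<bullet> \<xi> \<le> (norm \<xi>)\<^sup>2"
  shows "norm (A *v \<xi>) \<le> norm \<xi>"
proof -
  define \<zeta> where "\<zeta> = A *v \<xi>"
  have s: "(A *v \<zeta>) \<bullet> \<xi> = \<zeta> \<bullet> (A *v \<xi>)"
    using dot_lmul_matrix[of \<zeta> A \<xi>] sym by (metis inner_commute vector_transpose_matrix)
  \<comment> \<open>Polarization, where the inner product of \<zeta> and A \<xi> is the square of
    the norm of \<zeta>.\<close>
  have "4 * (norm \<zeta>)\<^sup>2 = (A *v (\<xi> + \<zeta>)) \<bullet> (\<xi> + \<zeta>) - (A *v (\<xi> - \<zeta>)) \<bullet> (\<xi> - \<zeta>)"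
    using s by (simp add: matrix_vector_right_distrib matrix_vector_mult_diff_distrib inner_left_distrib inner_right_distrib
        inner_diff_left inner_diff_right \<zeta>_def[symmetric] power2_norm_eq_inner)
  also have "\<dots> \<le> (norm (\<xi> + \<zeta>))\<^sup>2"
    using A(1)[of "\<xi> - \<zeta>"] A(2)[of "\<xi> + \<zeta>"] by linarith
  also have "\<dots> \<le> 2 * (norm \<xi>)\<^sup>2 + 2 * (norm \<zeta>)\<^sup>2"
  proof -
    have "0 \<le> (norm (\<xi> - \<zeta>))\<^sup>2" by simp
    then show ?thesis
      by (simp add: power2_norm_eq_inner inner_left_distrib inner_right_distrib inner_diff_left inner_diff_right inner_commute)
  qed
  finally have "(norm \<zeta>)\<^sup>2 \<le> (norm \<xi>)\<^sup>2" by simp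
  then show ?thesis unfolding \<zeta>_def by (rule power2_le_imp_le) simp
qed

definition elliptic_matrix :: "real \<Rightarrow> real^'n^'n \<Rightarrow> bool" where
  "elliptic_matrix lam A \<longleftrightarrow> transpose A = A \<and>
     (\<forall>\<xi>. lam * (norm \<xi>)\<^sup>2 \<le> (A *v \<xi>) \<bullet> \<xi> \<and> (A *v \<xi>) \<bullet> \<xi> \<le> (norm \<xi>)\<^sup>2)"

definition elliptic_field :: "real \<Rightarrow> (real^'n \<Rightarrow> real^'n^'n) \<Rightarrow> bool" where
  "elliptic_field lam A \<longleftrightarrow> A \<in> borel_measurable lborel \<and> (AE y in lborel. elliptic_matrix lam (A y))"

lemma elliptic_matrix_norm_le:
  assumes lam: "0 < lam" and A: "elliptic_matrix lam A"
  shows "norm (A *v \<xi>) \<le> norm \<xi>"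
proof (rule symmetric_matrix_norm_le)
  show "0 \<le> (A *v \<zeta>) \<bullet> \<zeta>" for \<zeta>
  proof -
    have "0 \<le> lam * (norm \<zeta>)\<^sup>2" using lam by simp
    also have "\<dots> \<le> (A *v \<zeta>) \<bullet> \<zeta>" using A by (simp add: elliptic_matrix_def)
    finally show ?thesis .
  qed
qed (use A in \<open>auto simp: elliptic_matrix_def\<close>)

lemma elliptic_matrix_sym: "elliptic_matrix lam A \<Longrightarrow> (A *v x) \<bullet> y = (A *v y) \<bullet> x"
  unfolding elliptic_matrix_def using dot_lmul_matrix[of x A y] by (metis inner_commute vector_transpose_matrix)

text \<open>Symmetry and both bounds are closed conditions on the entries.\<close>

lemma elliptic_matrix_limit:
  fixes A :: "real^'n^'n"
  assumes lim: "B \<longlonglongrightarrow> A" and B: "\<And>n::nat. elliptic_matrix lam (B n)"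
  shows "elliptic_matrix lam A"
  unfolding elliptic_matrix_def
proof (intro conjI allI)
  have c: "(\<lambda>n. B n $ i $ j) \<longlonglongrightarrow> A $ i $ j" for i j
    by (intro tendsto_vec_nth lim)
  have "A $ i $ j = A $ j $ i" for i j
  proof -
    have "B n $ i $ j = B n $ j $ i" for n
    proof -
      have "transpose (B n) $ i $ j = B n $ i $ j" using B[of n] by (simp add: elliptic_matrix_def)
      then show ?thesis by (simp add: transpose_def)
    qed
    then show ?thesis using c[of i j] c[of j i] LIMSEQ_unique by auto
  qed
  then show "transpose A = A" by (simp add: transpose_def vec_eq_iff)
  fix \<xi> :: "real^'n"
  have l: "(\<lambda>n. (B n *v \<xi>) \<bullet> \<xi>) \<longlonglongrightarrow> (A *v \<xi>) \<bullet> \<xi>"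
    unfolding matrix_vector_mult_def by (intro tendsto_intros tendsto_vec_lambda c)
  show "lam * (norm \<xi>)\<^sup>2 \<le> (A *v \<xi>) \<bullet> \<xi>"
    by (rule LIMSEQ_le_const[OF l]) (use B in \<open>auto simp: elliptic_matrix_def\<close>)
  show "(A *v \<xi>) \<bullet> \<xi> \<le> (norm \<xi>)\<^sup>2"
    by (rule LIMSEQ_le_const2[OF l]) (use B in \<open>auto simp: elliptic_matrix_def\<close>)
qed

lemma AE_norm_le_Linf_norm: "Linf_norm f \<le> ereal c \<Longrightarrow> AE y in lborel. norm (f y) \<le> c"
proof -
  assume le: "Linf_norm f \<le> ereal c"
  have "AE y in lborel. ereal (norm (f y)) \<le> ereal c"
    using esssup_AE[of "\<lambda>y. ereal (norm (f y))" lborel]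
    by eventually_elim (rule order_trans[OF _ le[unfolded Linf_norm_def]])
  then show ?thesis by simp
qed

lemma Linf_bounded:
  assumes "Linf f"
  shows "\<exists>c. AE y in lborel. norm (f y) \<le> c"
proof -
  have "Linf_norm f < \<infinity>" using assms by (simp add: Linf_def)
  then obtain c where "Linf_norm f \<le> ereal c"
    by (cases "Linf_norm f") auto
  then show ?thesis using AE_norm_le_Linf_norm by blast
qed

text \<open>A mean value inequality for functions of time with values in L-infinity. The null sets
  in \<open>y\<close> depend on the times, so it is not applied for fixed \<open>y\<close>. The
  bound on the derivative and the Lipschitz estimate are local properties that survive the joining
  of adjacent intervals, and bisection makes them global.\<close>

lemma C1_Linf_Lipschitz:
  fixes a :: "real \<Rightarrow> real^'n \<Rightarrow> real^'n^'n"
  assumes T: "0 < T" and a: "C1_Linf T a"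
  obtains L where "0 \<le> L" "\<And>s t. s \<in> {0..T} \<Longrightarrow> t \<in> {0..T} \<Longrightarrow> AE y in lborel. norm (a t y - a s y) \<le> L * \<bar>t - s\<bar>"
proof -
  obtain b where b: "\<And>t. t \<in> {0..T} \<Longrightarrow> Linf (b t)"
    "\<And>t. t \<in> {0..T} \<Longrightarrow> ((\<lambda>s. Linf_norm (\<lambda>y. (a s y - a t y) /\<^sub>R (s - t) - b t y)) \<longlongrightarrow> 0) (at t within {0..T})"
    "\<And>t. t \<in> {0..T} \<Longrightarrow> ((\<lambda>s. Linf_norm (\<lambda>y. b s y - b t y)) \<longlongrightarrow> 0) (at t within {0..T})"
    using a unfolding C1_Linf_def by blast
  have near: "\<exists>d>0. \<forall>s\<in>{0..T}. s \<noteq> t \<longrightarrow> \<bar>s - t\<bar> < d \<longrightarrow> (AE y in lborel. norm (k s y) \<le> 1)"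
    if "((\<lambda>s. Linf_norm (k s)) \<longlongrightarrow> 0) (at t within {0..T})" for k :: "real \<Rightarrow> real^'n \<Rightarrow> real^'n^'n" and t
  proof -
    have "\<forall>\<^sub>F s in at t within {0..T}. Linf_norm (k s) < 1"
      using order_tendstoD(2)[OF that, of 1] by simp
    then obtain d where "d > 0" "\<And>s. s \<in> {0..T} \<Longrightarrow> s \<noteq> t \<Longrightarrow> dist s t < d \<Longrightarrow> Linf_norm (k s) < 1"
      unfolding eventually_at by blast
    then show ?thesis
      by (intro exI[of _ d]) (auto simp: dist_real_def intro!: AE_norm_le_Linf_norm less_imp_le simp flip: one_ereal_def)
  qed
  define P where "P l u \<longleftrightarrow> (\<exists>M. \<forall>t\<in>{l..u} \<inter> {0..T}. AE y in lborel. norm (b t y) \<le> M)" for l u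
  have "P 0 T"
  proof (rule Bolzano)
    show "0 \<le> T" using T by simp
    show "P l w" if uv: "P l u" "P u w" "l \<le> u" "u \<le> w" for l u w
    proof -
      obtain M1 M2 where "\<forall>t\<in>{l..u} \<inter> {0..T}. AE y in lborel. norm (b t y) \<le> M1" "\<forall>t\<in>{u..w} \<inter> {0..T}. AE y in lborel. norm (b t y) \<le> M2"
        using uv unfolding P_def by blast
      moreover have "t \<in> {l..u} \<inter> {0..T} \<or> t \<in> {u..w} \<inter> {0..T}" if "t \<in> {l..w} \<inter> {0..T}" for t
        using that by auto
      ultimately have "\<forall>t\<in>{l..w} \<inter> {0..T}. (AE y in lborel. norm (b t y) \<le> M1) \<or> (AE y in lborel. norm (b t y) \<le> M2)"
        by blast
      then have "\<forall>t\<in>{l..w} \<inter> {0..T}. AE y in lborel. norm (b t y) \<le> max M1 M2"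
        by (auto elim!: ballE disjE eventually_mono)
      then show ?thesis unfolding P_def by blast
    qed
    fix t assume t: "0 \<le> t" "t \<le> T"
    then have t': "t \<in> {0..T}" by simp
    obtain d where d: "0 < d" "\<And>s. s \<in> {0..T} \<Longrightarrow> s \<noteq> t \<Longrightarrow> \<bar>s - t\<bar> < d \<Longrightarrow> (AE y in lborel. norm (b s y - b t y) \<le> 1)"
      using near[OF b(3)[OF t']] by blast
    obtain c where c: "AE y in lborel. norm (b t y) \<le> c" using Linf_bounded[OF b(1)[OF t']] by blast
    show "\<exists>d>0. \<forall>l u. l \<le> t \<and> t \<le> u \<and> u - l < d \<longrightarrow> P l u"
    proof (intro exI[of _ d] conjI allI impI d(1))
      fix l u assume lu: "l \<le> t \<and> t \<le> u \<and> u - l < d"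
      have "AE y in lborel. norm (b s y) \<le> c + 1" if s: "s \<in> {l..u} \<inter> {0..T}" for s
      proof (cases "s = t")
        case True then show ?thesis using c by (auto elim: eventually_mono)
      next
        case False
        have "AE y in lborel. norm (b s y - b t y) \<le> 1" by (rule d(2)) (use s lu False in auto)
        then show ?thesis using c
        proof eventually_elim
          case (elim y)
          then show ?case using norm_triangle_ineq[of "b s y - b t y" "b t y"] by simp
        qed
      qed
      then show "P l u" unfolding P_def by blast
    qed
  qed
  then obtain M where "\<forall>t\<in>{0..T}. AE y in lborel. norm (b t y) \<le> M"
    unfolding P_def by auto
  then have M: "\<And>t. t \<in> {0..T} \<Longrightarrow> AE y in lborel. norm (b t y) \<le> M" by blast
  \<comment> \<open>The 1 is the tolerance with which difference quotients approximate the
    derivative locally.\<close>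
  define L where "L = max M 0 + 1"
  \<comment> \<open>The guard makes \<open>R\<close> hold trivially for intervals that leave [0,T],
    so that the bisection may run over all of them.\<close>
  define R where "R s t \<longleftrightarrow> (0 \<le> s \<and> t \<le> T \<longrightarrow> (AE y in lborel. norm (a t y - a s y) \<le> L * (t - s)))" for s t
  have RR: "R s t" if st: "s \<le> t" for s t
  proof (rule Bolzano[OF st])
    show "R l w" if uv: "R l u" "R u w" "l \<le> u" "u \<le> w" for l u w
      unfolding R_def
    proof
      assume lw: "0 \<le> l \<and> w \<le> T"
      then have "AE y in lborel. norm (a u y - a l y) \<le> L * (u - l)" "AE y in lborel. norm (a w y - a u y) \<le> L * (w - u)"
        using uv by (auto simp: R_def)
      then show "AE y in lborel. norm (a w y - a l y) \<le> L * (w - l)"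
      proof eventually_elim
        case (elim y)
        then show ?case
          using norm_triangle_ineq[of "a w y - a u y" "a u y - a l y"] by (simp add: algebra_simps)
      qed
    qed
    fix x assume "s \<le> x" "x \<le> t"
    show "\<exists>d>0. \<forall>l u. l \<le> x \<and> x \<le> u \<and> u - l < d \<longrightarrow> R l u"
    proof (cases "x \<in> {0..T}")
      case False
      then show ?thesis by (intro exI[of _ 1]) (auto simp: R_def)
    next
      case x: True
      obtain d where d: "0 < d" "\<And>s. s \<in> {0..T} \<Longrightarrow> s \<noteq> x \<Longrightarrow> \<bar>s - x\<bar> < d \<Longrightarrow> (AE y in lborel. norm ((a s y - a x y) /\<^sub>R (s - x) - b x y) \<le> 1)"
        using near[OF b(2)[OF x]] by blast
      have loc: "AE y in lborel. norm (a s y - a x y) \<le> L * \<bar>s - x\<bar>" if s: "s \<in> {0..T}" "\<bar>s - x\<bar> < d" for s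
      proof (cases "s = x")
        case False
        show ?thesis using d(2)[OF s(1) False s(2)] M[OF x]
        proof eventually_elim
          case (elim y)
          have "norm ((a s y - a x y) /\<^sub>R (s - x)) \<le> L"
            using norm_triangle_ineq[of "(a s y - a x y) /\<^sub>R (s - x) - b x y" "b x y"] elim by (simp add: L_def)
          then have "inverse \<bar>s - x\<bar> * norm (a s y - a x y) \<le> L"
            by (simp only: norm_scaleR abs_inverse)
          then show ?case using False by (simp add: field_simps)
        qed
      qed simp
      show ?thesis
      proof (intro exI[of _ d] conjI allI impI d(1))
        fix l u assume lu: "l \<le> x \<and> x \<le> u \<and> u - l < d"
        show "R l u" unfolding R_def
        proof
          assume "0 \<le> l \<and> u \<le> T"
          then have "AE y in lborel. norm (a l y - a x y) \<le> L * \<bar>l - x\<bar>" "AE y in lborel. norm (a u y - a x y) \<le> L * \<bar>u - x\<bar>"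
            using lu x loc[of l] loc[of u] by auto
          then show "AE y in lborel. norm (a u y - a l y) \<le> L * (u - l)"
          proof eventually_elim
            case (elim y)
            have "norm (a u y - a l y) \<le> norm (a u y - a x y) + norm (a l y - a x y)"
              using norm_triangle_ineq4[of "a u y - a x y" "a l y - a x y"] by simp
            also have "\<dots> \<le> L * (u - x) + L * (x - l)" using elim lu by simp
            finally show ?case by (simp add: algebra_simps)
          qed
        qed
      qed
    qed
  qed
  show thesis
  proof (rule that[of L])
    show "0 \<le> L" by (simp add: L_def)
    show "AE y in lborel. norm (a t y - a s y) \<le> L * \<bar>t - s\<bar>" if "s \<in> {0..T}" "t \<in> {0..T}" for s t
    proof (cases "s \<le> t")
      case True then show ?thesis using RR[OF True] that by (auto simp: R_def)
    next
      case False then show ?thesis using RR[of t s] that by (auto simp: R_def norm_minus_commute)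
    qed
  qed
qed

lemma hyp_coeff_AE:
  assumes "hyp_coeff T lam a"
  shows "AE t in lborel. t \<in> {0<..<T} \<longrightarrow> (AE y in lborel. elliptic_matrix lam (a t y))"
proof -
  have "AE p in lborel \<Otimes>\<^sub>M lborel. case p of (t, y) \<Rightarrow> t \<in> {0<..<T} \<longrightarrow> elliptic_matrix lam (a t y)"
    unfolding lborel_prod using assms unfolding hyp_coeff_def
    by (auto elim!: eventually_mono simp: elliptic_matrix_def split: prod.splits)
  from lborel_pair.AE_pair[OF this] show ?thesis
    by eventually_elim auto
qed

text \<open>The hypothesis holds for almost every pair (t, y), hence by Fubini for almost every
  time. Such times accumulate at any given \<open>t\<close>; Lipschitz continuity in L-infinity and
  closedness of the conditions extend it to every \<open>t\<close>, as required by elliptic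
  correctors, which are defined at every time.\<close>

lemma hyp_coeff_elliptic_field:
  fixes a :: "real \<Rightarrow> real^'n \<Rightarrow> real^'n^'n"
  assumes T: "0 < T" and a: "hyp_coeff T lam a" and t: "t \<in> {0<..<T}"
  shows "elliptic_field lam (a t)"
  unfolding elliptic_field_def
proof
  have C1: "C1_Linf T a" using a by (simp add: hyp_coeff_def)
  then show "a t \<in> borel_measurable lborel"
    using t unfolding C1_Linf_def Linf_def by (auto dest!: bspec[of _ _ t])
  obtain L where L: "0 \<le> L" "\<And>s t. s \<in> {0..T} \<Longrightarrow> t \<in> {0..T} \<Longrightarrow> AE y in lborel. norm (a t y - a s y) \<le> L * \<bar>t - s\<bar>"
    using C1_Linf_Lipschitz[OF T C1] by blast
  have ex: "\<exists>s\<in>{0<..<T}. \<bar>s - t\<bar> < e \<and> (AE y in lborel. elliptic_matrix lam (a s y))" if e: "0 < e" for e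
  proof (rule ccontr)
    assume n: "\<not> ?thesis"
    define l u where "l = max 0 (t - e)" and "u = min T (t + e)"
    have lu: "l < u" using t e by (auto simp: l_def u_def)
    have "AE s in lborel. s \<notin> {l<..<u}"
      using hyp_coeff_AE[OF a] by eventually_elim (use n in \<open>auto simp: l_def u_def abs_less_iff\<close>)
    then have "emeasure lborel {l<..<u} = 0"
      by (subst (asm) AE_iff_measurable[of "{l<..<u}"]) auto
    then show False using lu by simp
  qed
  have "\<forall>n. \<exists>s. s \<in> {0<..<T} \<and> \<bar>s - t\<bar> < inverse (real (Suc n)) \<and> (AE y in lborel. elliptic_matrix lam (a s y))"
    using ex[of "inverse (real (Suc _))"] by (meson inverse_positive_iff_positive of_nat_0_less_iff zero_less_Suc)
  then obtain s where s: "\<And>n. s n \<in> {0<..<T}" "\<And>n. \<bar>s n - t\<bar> < inverse (real (Suc n))" "\<And>n. AE y in lborel. elliptic_matrix lam (a (s n) y)"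
    by metis
  have "AE y in lborel. norm (a t y - a (s n) y) \<le> L * \<bar>t - s n\<bar>" for n
    by (rule L(2)) (use s(1)[of n] t in auto)
  then have "AE y in lborel. \<forall>n. norm (a t y - a (s n) y) \<le> L * \<bar>t - s n\<bar>"
    unfolding AE_all_countable by blast
  moreover have "AE y in lborel. \<forall>n. elliptic_matrix lam (a (s n) y)"
    unfolding AE_all_countable using s(3) by blast
  ultimately show "AE y in lborel. elliptic_matrix lam (a t y)"
  proof eventually_elim
    case (elim y)
    have "(\<lambda>n. a (s n) y - a t y) \<longlonglongrightarrow> 0"
    proof (rule Lim_null_comparison[OF always_eventually])
      show "\<forall>n. norm (a (s n) y - a t y) \<le> L * inverse (real (Suc n))"
      proof
        fix n
        have "norm (a (s n) y - a t y) \<le> L * \<bar>t - s n\<bar>" using elim(1) by (simp add: norm_minus_commute)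
        also have "\<dots> \<le> L * inverse (real (Suc n))"
          using s(2)[of n] L(1) by (intro mult_left_mono) (auto simp: abs_minus_commute)
        finally show "norm (a (s n) y - a t y) \<le> L * inverse (real (Suc n))" .
      qed
      show "(\<lambda>n. L * inverse (real (Suc n))) \<longlonglongrightarrow> 0"
        by (rule tendsto_mult_right_zero[OF LIMSEQ_inverse_real_of_nat])
    qed
    then have "(\<lambda>n. a (s n) y) \<longlonglongrightarrow> a t y" by (rule LIM_zero_cancel)
    then show ?case by (rule elliptic_matrix_limit) (use elim(2) in blast)
  qed
qed

section \<open>Bilinear forms on the cell\<close>

definition flux :: "(real^'n \<Rightarrow> real^'n^'n) \<Rightarrow> (real^'n \<Rightarrow> real^'n) \<Rightarrow> real^'n \<Rightarrow> real^'n" where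
  "flux A u y = A y *v u y"

lemma AE_cellM: "AE y in lborel. P y \<Longrightarrow> AE y in cellM. P y"
  by (subst AE_restrict_space_iff) auto

lemma elliptic_field_cellM: "elliptic_field lam A \<Longrightarrow> AE y in cellM. elliptic_matrix lam (A y)"
  "elliptic_field lam A \<Longrightarrow> A \<in> borel_measurable cellM"
  by (auto simp: elliptic_field_def intro: AE_cellM cellM_measurable)

lemma flux_sqi:
  assumes lam: "0 < lam" and A: "elliptic_field lam A" and u: "sqi cellM u"
  shows "sqi cellM (flux A u)"
proof (rule sqi_bound[OF u, where C=1])
  show "flux A u \<in> borel_measurable cellM"
    unfolding flux_def by (intro measurable_matrix_vector elliptic_field_cellM(2)[OF A] sqi_measurable[OF u])
  show "AE y in cellM. norm (flux A u y) \<le> 1 * norm (u y)"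
    using elliptic_field_cellM(1)[OF A] by eventually_elim (auto simp: flux_def intro: elliptic_matrix_norm_le[OF lam])
qed

lemma flux_add: "flux A (\<lambda>y. u y + v y) = (\<lambda>y. flux A u y + flux A v y)"
  and flux_diff: "flux A (\<lambda>y. u y - v y) = (\<lambda>y. flux A u y - flux A v y)"
  and flux_scale: "flux A (\<lambda>y. c *\<^sub>R u y) = (\<lambda>y. c *\<^sub>R flux A u y)"
  by (auto simp: flux_def matrix_vector_right_distrib matrix_vector_mult_diff_distrib matrix_vector_mult_scaleR)

lemma flux_zero: "flux A (\<lambda>y. 0) = (\<lambda>y. 0)"
  by (auto simp: flux_def)

lemma flux_sum: "finite I \<Longrightarrow> flux A (\<lambda>y. \<Sum>i\<in>I. u i y) = (\<lambda>y. \<Sum>i\<in>I. flux A (u i) y)"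
  by (induction I rule: finite_induct) (auto simp: flux_zero flux_add)

lemma cell_ip_add_left: "sqi cellM u \<Longrightarrow> sqi cellM v \<Longrightarrow> sqi cellM w \<Longrightarrow> cell_ip (\<lambda>y. u y + v y) w = cell_ip u w + cell_ip v w"
  and cell_ip_diff_left: "sqi cellM u \<Longrightarrow> sqi cellM v \<Longrightarrow> sqi cellM w \<Longrightarrow> cell_ip (\<lambda>y. u y - v y) w = cell_ip u w - cell_ip v w"
  and cell_ip_add_right: "sqi cellM u \<Longrightarrow> sqi cellM v \<Longrightarrow> sqi cellM w \<Longrightarrow> cell_ip w (\<lambda>y. u y + v y) = cell_ip w u + cell_ip w v"
  and cell_ip_diff_right: "sqi cellM u \<Longrightarrow> sqi cellM v \<Longrightarrow> sqi cellM w \<Longrightarrow> cell_ip w (\<lambda>y. u y - v y) = cell_ip w u - cell_ip w v"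
  by (simp_all add: cell_ip_def inner_left_distrib inner_right_distrib inner_diff_left inner_diff_right sqi_inner_integrable)

lemma cell_ip_zero: "cell_ip (\<lambda>y. 0) w = 0" "cell_ip w (\<lambda>y. 0) = 0"
  by (simp_all add: cell_ip_def)

lemma cell_ip_sum_left:
  "finite I \<Longrightarrow> (\<And>i. i \<in> I \<Longrightarrow> sqi cellM (u i)) \<Longrightarrow> sqi cellM w \<Longrightarrow> cell_ip (\<lambda>y. \<Sum>i\<in>I. u i y) w = (\<Sum>i\<in>I. cell_ip (u i) w)"
  by (induction I rule: finite_induct) (auto simp: cell_ip_zero cell_ip_add_left sqi_sum)

lemma cell_ip_nonneg: "0 \<le> cell_ip u u"
  by (simp add: cell_ip_def)

lemma cell_sqnorm_ip: "cell_sqnorm u = cell_ip u u"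
  by (simp add: cell_sqnorm_eq cell_ip_def power2_norm_eq_inner)

lemma cell_ip_const: "cell_ip (\<lambda>y. \<xi>) (\<lambda>y. \<zeta>) = \<xi> \<bullet> \<zeta>"
  by (simp add: cell_ip_def)

section \<open>The norm of square integrable functions on the cell\<close>

definition cell_norm :: "(real^'n \<Rightarrow> 'b::euclidean_space) \<Rightarrow> real" where
  "cell_norm u = sqrt (cell_ip u u)"

lemma cell_norm_nonneg: "0 \<le> cell_norm u"
  by (simp add: cell_norm_def cell_ip_nonneg)

lemma cell_norm_sq: "(cell_norm u)\<^sup>2 = cell_ip u u"
  by (simp add: cell_norm_def cell_ip_nonneg)

lemma cell_ip_le: "sqi cellM u \<Longrightarrow> sqi cellM v \<Longrightarrow> \<bar>cell_ip u v\<bar> \<le> cell_norm u * cell_norm v"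
  using sqi_Cauchy_Schwarz_abs[of cellM u v] by (simp add: cell_norm_def cell_ip_def power2_norm_eq_inner)

lemma cell_norm_const: "cell_norm (\<lambda>y. \<xi>) = norm \<xi>"
  by (simp add: cell_norm_def cell_ip_const norm_eq_sqrt_inner)

lemma cell_norm_add:
  assumes u: "sqi cellM u" and v: "sqi cellM v"
  shows "cell_norm (\<lambda>y. u y + v y) \<le> cell_norm u + cell_norm v"
proof (rule power2_le_imp_le)
  have "(cell_norm (\<lambda>y. u y + v y))\<^sup>2 = cell_ip u u + 2 * cell_ip u v + cell_ip v v"
    using assms cell_ip_commute[of v u] by (simp add: cell_norm_sq cell_ip_add_left cell_ip_add_right sqi_add)
  also have "\<dots> \<le> (cell_norm u + cell_norm v)\<^sup>2"
    using cell_ip_le[OF assms] by (simp add: power2_sum cell_norm_sq abs_le_iff)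
  finally show "(cell_norm (\<lambda>y. u y + v y))\<^sup>2 \<le> (cell_norm u + cell_norm v)\<^sup>2" .
qed (simp add: cell_norm_nonneg)

lemma cell_norm_mono_AE:
  assumes u: "sqi cellM u" and v: "sqi cellM v" and C: "0 \<le> C" and le: "AE y in cellM. norm (u y) \<le> C * norm (v y)"
  shows "cell_norm u \<le> C * cell_norm v"
proof (rule power2_le_imp_le)
  have "(cell_norm u)\<^sup>2 = (\<integral>y. (norm (u y))\<^sup>2 \<partial>cellM)"
    by (simp add: cell_norm_sq cell_ip_def power2_norm_eq_inner)
  also have "\<dots> \<le> (\<integral>y. C\<^sup>2 * (norm (v y))\<^sup>2 \<partial>cellM)"
  proof (rule integral_mono_AE)
    show "AE y in cellM. (norm (u y))\<^sup>2 \<le> C\<^sup>2 * (norm (v y))\<^sup>2"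
      using le by eventually_elim (metis norm_ge_zero power_mono power_mult_distrib)
  qed (use u v in \<open>auto simp: sqi_integrable_norm\<close>)
  also have "\<dots> = (C * cell_norm v)\<^sup>2"
    by (simp add: cell_norm_sq cell_ip_def power2_norm_eq_inner power_mult_distrib)
  finally show "(cell_norm u)\<^sup>2 \<le> (C * cell_norm v)\<^sup>2" .
qed (simp add: C cell_norm_nonneg)

lemma cell_norm_flux_le:
  assumes lam: "0 < lam" and A: "elliptic_field lam A" and u: "sqi cellM u"
  shows "cell_norm (flux A u) \<le> cell_norm u"
proof -
  have "AE y in cellM. norm (flux A u y) \<le> 1 * norm (u y)"
    using elliptic_field_cellM(1)[OF A] by eventually_elim (auto simp: flux_def intro: elliptic_matrix_norm_le[OF lam])
  from cell_norm_mono_AE[OF flux_sqi[OF assms] u _ this] show ?thesis by simp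
qed

lemma flux_ip_sym:
  assumes A: "elliptic_field lam A" and "0 < lam" "sqi cellM u" "sqi cellM v"
  shows "cell_ip (flux A u) v = cell_ip (flux A v) u"
  unfolding cell_ip_def
proof (rule integral_cong_AE)
  show "AE y in cellM. flux A u y \<bullet> v y = flux A v y \<bullet> u y"
    using elliptic_field_cellM(1)[OF A] by eventually_elim (auto simp: flux_def elliptic_matrix_sym)
qed (rule borel_measurable_inner; rule sqi_measurable; (rule flux_sqi[OF assms(2,1)])?; rule assms)+

lemma flux_ip_bounds:
  assumes lam: "0 < lam" and A: "elliptic_field lam A" and u: "sqi cellM u"
  shows "lam * cell_ip u u \<le> cell_ip (flux A u) u" "cell_ip (flux A u) u \<le> cell_ip u u"
proof -
  note F = flux_sqi[OF lam A u]
  have "(\<integral>y. lam * (u y \<bullet> u y) \<partial>cellM) \<le> (\<integral>y. flux A u y \<bullet> u y \<partial>cellM)"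
  proof (rule integral_mono_AE)
    show "AE y in cellM. lam * (u y \<bullet> u y) \<le> flux A u y \<bullet> u y"
      using elliptic_field_cellM(1)[OF A] by eventually_elim (auto simp: flux_def elliptic_matrix_def power2_norm_eq_inner)
  qed (use sqi_inner_integrable[OF u u] sqi_inner_integrable[OF F u] in auto)
  then show "lam * cell_ip u u \<le> cell_ip (flux A u) u" by (simp add: cell_ip_def)
  have "(\<integral>y. flux A u y \<bullet> u y \<partial>cellM) \<le> (\<integral>y. u y \<bullet> u y \<partial>cellM)"
  proof (rule integral_mono_AE)
    show "AE y in cellM. flux A u y \<bullet> u y \<le> u y \<bullet> u y"
      using elliptic_field_cellM(1)[OF A] by eventually_elim (auto simp: flux_def elliptic_matrix_def power2_norm_eq_inner)
  qed (use sqi_inner_integrable[OF u u] sqi_inner_integrable[OF F u] in auto)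
  then show "cell_ip (flux A u) u \<le> cell_ip u u" by (simp add: cell_ip_def)
qed

section \<open>Energy of the correctors\<close>

text \<open>Orthogonality replaces the energy of W = G + \<xi> by the inner product of its flux with
  \<xi>, and one factor |W| cancels.\<close>

lemma corrector_norm_bound:
  assumes lam: "0 < lam" and A: "elliptic_field lam A" and G: "sqi cellM G"
    and orth: "cell_ip (flux A (\<lambda>y. G y + \<xi>)) G = 0"
  shows "cell_norm (\<lambda>y. G y + \<xi>) \<le> norm \<xi> / lam"
proof -
  define W where "W = (\<lambda>y. G y + \<xi>)"
  have W: "sqi cellM W" unfolding W_def by (intro sqi_add G cellM.sqi_const)
  note F = flux_sqi[OF lam A W]
  have "lam * (cell_norm W)\<^sup>2 \<le> cell_ip (flux A W) W"
    using flux_ip_bounds(1)[OF lam A W] by (simp add: cell_norm_sq)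
  also have "\<dots> = cell_ip (flux A W) (\<lambda>y. \<xi>)"
    using cell_ip_add_right[OF G cellM.sqi_const F] orth by (simp add: W_def)
  also have "\<dots> \<le> cell_norm (flux A W) * norm \<xi>"
    using order_trans[OF abs_ge_self cell_ip_le[OF F cellM.sqi_const[of \<xi>]]] by (simp add: cell_norm_const)
  also have "\<dots> \<le> cell_norm W * norm \<xi>"
    by (intro mult_right_mono cell_norm_flux_le[OF lam A W]) simp
  finally have "cell_norm W * (lam * cell_norm W) \<le> cell_norm W * norm \<xi>"
    by (simp add: power2_eq_square mult_ac)
  then have "lam * cell_norm W \<le> norm \<xi>"
    using cell_norm_nonneg[of W] by (cases "cell_norm W = 0") (auto simp: mult_le_cancel_left)
  then show ?thesis using lam by (simp add: W_def field_simps)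
qed

lemma Poincare_cell_norm:
  fixes u :: "real^'n \<Rightarrow> real"
  assumes "H1per0 u G"
  shows "cell_norm u \<le> sqrt (real CARD('n) / 16) * cell_norm G"
proof -
  have "cell_ip u u \<le> real CARD('n) / 16 * cell_ip G G"
    using Poincare[OF assms] unfolding cell_ip_def power2_norm_eq_inner[symmetric] real_norm_def power2_abs .
  then show ?thesis
    using real_sqrt_le_mono by (fastforce simp: cell_norm_def real_sqrt_mult[symmetric])
qed

text \<open>Testing both equations with Z = G - H bounds lam |Z|^2 by the inner product of (B - A)(H
  + \<xi>) with Z, hence |Z| by a multiple of \<delta>. The Poincare inequality passes to u - v,
  which is then paired with u + v. The equations enter through four inner products, a form that is
  also available almost everywhere in time.\<close>

lemma corrector_energy_Lipschitz:
  fixes u v :: "real^'n \<Rightarrow> real"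
  assumes lam: "0 < lam" and A: "elliptic_field lam A" and B: "elliptic_field lam B"
    and \<delta>: "0 \<le> \<delta>" "AE y in lborel. norm (A y - B y) \<le> \<delta>"
    and u: "H1per0 u G" and v: "H1per0 v H"
    and orth: "cell_ip (flux A (\<lambda>y. G y + \<xi>)) G = 0" "cell_ip (flux A (\<lambda>y. G y + \<xi>)) H = 0"
      "cell_ip (flux B (\<lambda>y. H y + \<xi>)) G = 0" "cell_ip (flux B (\<lambda>y. H y + \<xi>)) H = 0"
  shows "\<bar>cell_ip u u - cell_ip v v\<bar> \<le> (2 * (real CARD('n) / 16) * (norm \<xi> / lam + norm \<xi>) * (norm \<xi> / lam) / lam) * \<delta>"
proof -
  define p where "p = sqrt (real CARD('n) / 16)"
  have p: "0 \<le> p" "p * p = real CARD('n) / 16" by (simp_all add: p_def)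
  define R where "R = norm \<xi> / lam"
  have R: "0 \<le> R" using lam by (simp add: R_def)
  have sG: "sqi cellM G" and sH: "sqi cellM H" and su: "sqi cellM u" and sv: "sqi cellM v"
    using H1per0_sqi[OF u] H1per0_sqi[OF v] by auto
  define W where "W = (\<lambda>y. H y + \<xi>)"
  define V where "V = (\<lambda>y. G y + \<xi>)"
  define Z where "Z = (\<lambda>y. G y - H y)"
  have sW: "sqi cellM W" and sV: "sqi cellM V" and sZ: "sqi cellM Z"
    unfolding W_def V_def Z_def by (intro sqi_add sqi_diff sG sH cellM.sqi_const)+
  have WR: "cell_norm W \<le> R" and VR: "cell_norm V \<le> R"
    unfolding W_def V_def R_def using corrector_norm_bound[OF lam B sH orth(4)] corrector_norm_bound[OF lam A sG orth(1)] by auto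
  have FAV: "sqi cellM (flux A V)" and FAW: "sqi cellM (flux A W)" and FBW: "sqi cellM (flux B W)" and FAZ: "sqi cellM (flux A Z)"
    by (intro flux_sqi[OF lam A] flux_sqi[OF lam B] sV sW sZ)+
  have ZVW: "Z = (\<lambda>y. V y - W y)" by (simp add: Z_def V_def W_def)
  define X where "X = (\<lambda>y. flux B W y - flux A W y)"
  have sX: "sqi cellM X" unfolding X_def by (rule sqi_diff[OF FBW FAW])
  have Xn: "cell_norm X \<le> \<delta> * cell_norm W"
  proof (rule cell_norm_mono_AE[OF sX sW \<delta>(1)])
    show "AE y in cellM. norm (X y) \<le> \<delta> * norm (W y)"
      using AE_cellM[OF \<delta>(2)]
    proof eventually_elim
      case (elim y)
      have "norm (X y) = norm ((B y - A y) *v W y)" by (simp add: X_def flux_def matrix_vector_mult_diff_rdistrib)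
      also have "\<dots> \<le> norm (A y - B y) * norm (W y)"
        using norm_matrix_vector_le[of "B y - A y" "W y"] by (simp add: norm_minus_commute)
      also have "\<dots> \<le> \<delta> * norm (W y)" using elim by (intro mult_right_mono) auto
      finally show ?case .
    qed
  qed
  have "lam * (cell_norm Z)\<^sup>2 \<le> cell_ip (flux A Z) Z"
    using flux_ip_bounds(1)[OF lam A sZ] by (simp add: cell_norm_sq)
  also have "flux A Z = (\<lambda>y. flux A V y - flux A W y)" unfolding ZVW by (rule flux_diff)
  also have "cell_ip (\<lambda>y. flux A V y - flux A W y) Z = cell_ip (flux A V) Z - cell_ip (flux A W) Z"
    by (rule cell_ip_diff_left[OF FAV FAW sZ])
  also have "cell_ip (flux A V) Z = 0"
    using cell_ip_diff_right[OF sG sH FAV] orth by (simp add: Z_def V_def)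
  also have "0 - cell_ip (flux A W) Z = cell_ip X Z"
    using cell_ip_diff_left[OF FBW FAW sZ] cell_ip_diff_right[OF sG sH FBW] orth by (simp add: X_def Z_def W_def)
  also have "\<dots> \<le> cell_norm X * cell_norm Z" using cell_ip_le[OF sX sZ] by simp
  also have "\<dots> \<le> (\<delta> * R) * cell_norm Z"
    using Xn mult_left_mono[OF WR \<delta>(1)] by (intro mult_right_mono cell_norm_nonneg) simp
  finally have "cell_norm Z * (lam * cell_norm Z) \<le> cell_norm Z * (\<delta> * R)"
    by (simp add: power2_eq_square mult_ac)
  then have "lam * cell_norm Z \<le> \<delta> * R"
    using cell_norm_nonneg[of Z] \<delta>(1) R by (cases "cell_norm Z = 0") (auto simp: mult_le_cancel_left)
  then have Zn: "cell_norm Z \<le> \<delta> * R / lam" using lam by (simp add: field_simps)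
  have Gn: "cell_norm G \<le> R + norm \<xi>"
  proof -
    have "cell_norm (\<lambda>y. V y + (- \<xi>)) \<le> cell_norm V + norm \<xi>"
      using cell_norm_add[OF sV cellM.sqi_const[of "- \<xi>"]] by (simp add: cell_norm_const)
    then show ?thesis using VR by (simp add: V_def)
  qed
  have Hn: "cell_norm H \<le> R + norm \<xi>"
  proof -
    have "cell_norm (\<lambda>y. W y + (- \<xi>)) \<le> cell_norm W + norm \<xi>"
      using cell_norm_add[OF sW cellM.sqi_const[of "- \<xi>"]] by (simp add: cell_norm_const)
    then show ?thesis using WR by (simp add: W_def)
  qed
  have un: "cell_norm u \<le> p * (R + norm \<xi>)" and vn: "cell_norm v \<le> p * (R + norm \<xi>)"
    using Poincare_cell_norm[OF u] Poincare_cell_norm[OF v] mult_left_mono[OF Gn p(1)] mult_left_mono[OF Hn p(1)]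
    unfolding p_def[symmetric] by linarith+
  have wn: "cell_norm (\<lambda>y. u y - v y) \<le> p * (\<delta> * R / lam)"
    using Poincare_cell_norm[OF H1per0_diff[OF u v]] mult_left_mono[OF Zn p(1)] unfolding p_def[symmetric] Z_def by linarith
  have "cell_ip u u - cell_ip v v = cell_ip (\<lambda>y. u y - v y) (\<lambda>y. u y + v y)"
    using su sv cell_ip_commute[of u v] by (simp add: cell_ip_diff_left cell_ip_add_right sqi_add)
  also have "\<bar>\<dots>\<bar> \<le> cell_norm (\<lambda>y. u y - v y) * cell_norm (\<lambda>y. u y + v y)"
    by (intro cell_ip_le sqi_diff sqi_add su sv)
  also have "\<dots> \<le> (p * (\<delta> * R / lam)) * (2 * (p * (R + norm \<xi>)))"
    using cell_norm_add[OF su sv] un vn wn p R \<delta> lam by (intro mult_mono cell_norm_nonneg) auto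
  also have "\<dots> = (2 * (p * p) * (R + norm \<xi>) * R / lam) * \<delta>" by (simp add: field_simps)
  finally show ?thesis by (simp add: p R_def)
qed

text \<open>The off-diagonal hypothesis is the equation at one time tested with the gradient at
  another, in both directions: the input of the comparison estimate for two times.\<close>

lemma corrector_energy_weak_deriv:
  fixes u :: "real \<Rightarrow> real^'n \<Rightarrow> real"
  assumes T: "0 < T" and lam: "0 < lam" and a: "hyp_coeff T lam a"
    and E: "set_integrable lborel {0<..<T} (\<lambda>t. cell_ip (u t) (u t))"
    and u: "AE t in lborel. t \<in> {0<..<T} \<longrightarrow> H1per0 (u t) (G t)"
    and diag: "AE t in lborel. t \<in> {0<..<T} \<longrightarrow> cell_ip (flux (a t) (\<lambda>y. G t y + \<xi>)) (G t) = 0"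
    and off: "AE s in lborel. AE t in lborel. s \<in> {0<..<T} \<longrightarrow> t \<in> {0<..<T} \<longrightarrow>
      cell_ip (flux (a t) (\<lambda>y. G t y + \<xi>)) (G s) = 0 \<and> cell_ip (flux (a s) (\<lambda>y. G s y + \<xi>)) (G t) = 0"
  shows "\<exists>D. weak_deriv T (\<lambda>t. cell_sqnorm (u t)) D"
proof -
  have C1: "C1_Linf T a" using a by (simp add: hyp_coeff_def)
  obtain L where L: "0 \<le> L" "\<And>s t. s \<in> {0..T} \<Longrightarrow> t \<in> {0..T} \<Longrightarrow> AE y in lborel. norm (a t y - a s y) \<le> L * \<bar>t - s\<bar>"
    using C1_Linf_Lipschitz[OF T C1] by blast
  define C where "C = 2 * (real CARD('n) / 16) * (norm \<xi> / lam + norm \<xi>) * (norm \<xi> / lam) / lam"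
  have C: "0 \<le> C" using lam by (simp add: C_def)
  have lip: "AE s in lborel. AE t in lborel. s \<in> {0<..<T} \<longrightarrow> t \<in> {0<..<T} \<longrightarrow>
      \<bar>cell_ip (u t) (u t) - cell_ip (u s) (u s)\<bar> \<le> (C * L) * \<bar>t - s\<bar>"
    using u diag off
  proof eventually_elim
    case (elim s)
    show ?case using u diag elim(3)
    proof eventually_elim
      case el: (elim t)
      show ?case
      proof (intro impI)
        assume st: "s \<in> {0<..<T}" "t \<in> {0<..<T}"
        have "\<bar>cell_ip (u t) (u t) - cell_ip (u s) (u s)\<bar> \<le> C * (L * \<bar>t - s\<bar>)"
          unfolding C_def
        proof (rule corrector_energy_Lipschitz[where G="G t" and H="G s", OF lam hyp_coeff_elliptic_field[OF T a st(2)] hyp_coeff_elliptic_field[OF T a st(1)]])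
          show "AE y in lborel. norm (a t y - a s y) \<le> L * \<bar>t - s\<bar>" by (rule L(2)) (use st in auto)
        qed (use L(1) elim el st in auto)
        then show "\<bar>cell_ip (u t) (u t) - cell_ip (u s) (u s)\<bar> \<le> (C * L) * \<bar>t - s\<bar>" by (simp add: mult.assoc)
      qed
    qed
  qed
  from AE_Lipschitz_weak_deriv[OF T _ E lip] C L show ?thesis
    by (simp add: cell_sqnorm_ip[abs_def])
qed

text \<open>The definition of an elliptic corrector fixes no measurability in time; that of its
  energy follows from Lipschitz continuity.\<close>

lemma Lipschitz_on_interval_integrable:
  fixes E :: "real \<Rightarrow> real"
  assumes T: "0 < T" and L: "0 \<le> L" "\<And>s t. s \<in> {0<..<T} \<Longrightarrow> t \<in> {0<..<T} \<Longrightarrow> \<bar>E t - E s\<bar> \<le> L * \<bar>t - s\<bar>"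
  shows "set_integrable lborel {0<..<T} E"
  unfolding set_integrable_def
proof (rule Bochner_Integration.integrable_bound)
  show "integrable lborel (\<lambda>t. indicat_real {0<..<T} t * (\<bar>E (T/2)\<bar> + L * T))"
    using T by simp
  have "continuous_on {0<..<T} E"
    unfolding continuous_on_def
  proof
    fix s assume s: "s \<in> {0<..<T}"
    have "((\<lambda>t. E t - E s) \<longlongrightarrow> 0) (at s within {0<..<T})"
    proof (rule Lim_null_comparison)
      show "\<forall>\<^sub>F t in at s within {0<..<T}. norm (E t - E s) \<le> L * \<bar>t - s\<bar>"
        using L(2)[OF s] by (auto simp: eventually_at_filter)
      have "((\<lambda>t. L * \<bar>t - s\<bar>) \<longlongrightarrow> L * \<bar>s - s\<bar>) (at s within {0<..<T})" by (intro tendsto_intros)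
      then show "((\<lambda>t. L * \<bar>t - s\<bar>) \<longlongrightarrow> 0) (at s within {0<..<T})" by simp
    qed
    then show "(E \<longlongrightarrow> E s) (at s within {0<..<T})" by (rule LIM_zero_cancel)
  qed
  then show "(\<lambda>t. indicator {0<..<T} t *\<^sub>R E t) \<in> borel_measurable lborel"
    using borel_measurable_continuous_on_indicator[of "{0<..<T}" E] by simp
  show "AE t in lborel. norm (indicator {0<..<T} t *\<^sub>R E t) \<le> norm (indicat_real {0<..<T} t * (\<bar>E (T/2)\<bar> + L * T))"
  proof (rule AE_I2)
    fix t
    show "norm (indicator {0<..<T} t *\<^sub>R E t) \<le> norm (indicat_real {0<..<T} t * (\<bar>E (T/2)\<bar> + L * T))"
    proof (cases "t \<in> {0<..<T}")
      case True
      then have "\<bar>E t - E (T/2)\<bar> \<le> L * \<bar>t - T/2\<bar>" using T by (intro L(2)) auto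
      also have "\<dots> \<le> L * T" using True T L(1) by (intro mult_left_mono) auto
      finally have "\<bar>E t\<bar> \<le> \<bar>E (T/2)\<bar> + L * T" by linarith
      moreover have "0 \<le> L * T" using T L(1) by simp
      ultimately show ?thesis using True by simp
    qed simp
  qed
qed

section \<open>The homogenized matrix\<close>

lemma a_hom_entry:
  assumes lam: "0 < lam" and A: "elliptic_field lam (a t)" and G: "\<And>k. sqi cellM (G (axis k 1) t)"
  shows "a_hom a G t $ i $ k = cell_ip (flux (a t) (\<lambda>y. G (axis k 1) t y + axis k 1)) (\<lambda>y. axis i 1)"
proof -
  have F: "sqi cellM (flux (a t) (\<lambda>y. G (axis k 1) t y + axis k 1))"
    by (intro flux_sqi[OF lam A] sqi_add G cellM.sqi_const)
  have "a_hom a G t $ i $ k = (\<integral>y. flux (a t) (\<lambda>y. G (axis k 1) t y + axis k 1) y \<partial>cellM) \<bullet> axis i 1"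
    by (simp add: a_hom_def cell_integral flux_def inner_axis)
  also have "\<dots> = (\<integral>y. flux (a t) (\<lambda>y. G (axis k 1) t y + axis k 1) y \<bullet> axis i 1 \<partial>cellM)"
    by (rule integral_inner_left[symmetric]) (rule cellM.sqi_integrable[OF F])
  finally show ?thesis by (simp only: cell_ip_def)
qed

text \<open>Expansion in the basis turns the quadratic form into the flux of the combined basis
  correctors. Their gradient differs from that in direction \<xi> by \<Psi>, whose norm is zero by
  \<open>lin\<close>, so that its flux has norm zero as well.\<close>

lemma a_hom_quadratic:
  fixes a :: "real \<Rightarrow> real^'n \<Rightarrow> real^'n^'n"
  assumes lam: "0 < lam" and A: "elliptic_field lam (a t)" and G: "\<And>k. sqi cellM (G (axis k 1) t)" "sqi cellM (G \<xi> t)"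
    and lin: "cell_ip (\<lambda>y. (\<Sum>k\<in>UNIV. \<xi> $ k *\<^sub>R G (axis k 1) t y) - G \<xi> t y) (\<lambda>y. (\<Sum>k\<in>UNIV. \<xi> $ k *\<^sub>R G (axis k 1) t y) - G \<xi> t y) = 0"
  shows "(a_hom a G t *v \<xi>) \<bullet> \<xi> = cell_ip (flux (a t) (\<lambda>y. G \<xi> t y + \<xi>)) (\<lambda>y. \<xi>)"
proof -
  define \<Psi> where "\<Psi> = (\<lambda>y. (\<Sum>k\<in>UNIV. \<xi> $ k *\<^sub>R G (axis k 1) t y) - G \<xi> t y)"
  define F where "F k = flux (a t) (\<lambda>y. G (axis k 1) t y + axis k 1)" for k
  have F: "sqi cellM (F k)" for k
    unfolding F_def by (intro flux_sqi[OF lam A] sqi_add G cellM.sqi_const)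
  have s\<Psi>: "sqi cellM \<Psi>" unfolding \<Psi>_def by (intro sqi_diff sqi_sum sqi_scaleR G) simp
  have sW: "sqi cellM (\<lambda>y. G \<xi> t y + \<xi>)" by (intro sqi_add G cellM.sqi_const)
  have "(a_hom a G t *v \<xi>) \<bullet> \<xi> = (\<Sum>i\<in>UNIV. \<Sum>k\<in>UNIV. \<xi> $ k * (\<xi> $ i * cell_ip (F k) (\<lambda>y. axis i 1)))"
    by (simp add: inner_vec_def matrix_vector_mult_def a_hom_entry[where a=a and G=G and t=t, OF lam A G(1)] F_def[symmetric] sum_distrib_right sum_distrib_left mult_ac)
  also have "\<dots> = (\<Sum>k\<in>UNIV. \<xi> $ k * (\<Sum>i\<in>UNIV. \<xi> $ i * cell_ip (F k) (\<lambda>y. axis i 1)))"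
    by (subst sum.swap) (simp add: sum_distrib_left)
  also have "\<dots> = (\<Sum>k\<in>UNIV. \<xi> $ k * cell_ip (F k) (\<lambda>y. \<xi>))"
  proof (rule sum.cong[OF refl])
    fix k
    have "cell_ip (F k) (\<lambda>y. \<xi>) = cell_ip (F k) (\<lambda>y. \<Sum>i\<in>UNIV. \<xi> $ i *\<^sub>R axis i 1)"
      using basis_expansion[of \<xi>] by (simp add: scalar_mult_eq_scaleR)
    also have "\<dots> = (\<Sum>i\<in>UNIV. \<xi> $ i * cell_ip (F k) (\<lambda>y. axis i 1))"
      using cell_ip_sum_left[of UNIV "\<lambda>i y. \<xi> $ i *\<^sub>R axis i 1" "F k"] F
      by (simp add: cell_ip_commute[of "F k"] cell_ip_scale_left cellM.sqi_const)
    finally show "\<xi> $ k * (\<Sum>i\<in>UNIV. \<xi> $ i * cell_ip (F k) (\<lambda>y. axis i 1)) = \<xi> $ k * cell_ip (F k) (\<lambda>y. \<xi>)" by simp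
  qed
  also have "\<dots> = cell_ip (\<lambda>y. \<Sum>k\<in>UNIV. \<xi> $ k *\<^sub>R F k y) (\<lambda>y. \<xi>)"
    using F by (simp add: cell_ip_sum_left sqi_scaleR cellM.sqi_const cell_ip_scale_left)
  also have "(\<lambda>y. \<Sum>k\<in>UNIV. \<xi> $ k *\<^sub>R F k y) = flux (a t) (\<lambda>y. \<Psi> y + (G \<xi> t y + \<xi>))"
  proof -
    have "\<Psi> y + (G \<xi> t y + \<xi>) = (\<Sum>k\<in>UNIV. \<xi> $ k *\<^sub>R (G (axis k 1) t y + axis k 1))" for y
      using basis_expansion[of \<xi>] by (simp add: \<Psi>_def scaleR_add_right sum.distrib scalar_mult_eq_scaleR)
    then show ?thesis by (simp add: flux_sum flux_scale F_def)
  qed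
  also have "\<dots> = (\<lambda>y. flux (a t) \<Psi> y + flux (a t) (\<lambda>y. G \<xi> t y + \<xi>) y)" by (rule flux_add)
  also have "cell_ip \<dots> (\<lambda>y. \<xi>) = cell_ip (flux (a t) \<Psi>) (\<lambda>y. \<xi>) + cell_ip (flux (a t) (\<lambda>y. G \<xi> t y + \<xi>)) (\<lambda>y. \<xi>)"
    by (intro cell_ip_add_left flux_sqi[OF lam A] s\<Psi> sW cellM.sqi_const)
  also have "cell_ip (flux (a t) \<Psi>) (\<lambda>y. \<xi>) = 0"
  proof -
    have "cell_norm (flux (a t) \<Psi>) \<le> 0"
      using cell_norm_flux_le[OF lam A s\<Psi>] lin by (simp add: cell_norm_def \<Psi>_def)
    then have "cell_norm (flux (a t) \<Psi>) = 0" using cell_norm_nonneg[of "flux (a t) \<Psi>"] by simp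
    then show ?thesis
      using cell_ip_le[OF flux_sqi[OF lam A s\<Psi>] cellM.sqi_const[of \<xi>]] by simp
  qed
  finally show ?thesis by simp
qed

text \<open>The energy of W = G + \<xi> is expanded; as the mean of \<open>G\<close> vanishes, |W|^2
  = |\<xi>|^2 + |G|^2. The pairing of flux and \<open>G\<close> is kept, since its value depends on
  the regime.\<close>

lemma corrector_flux_bounds:
  fixes u :: "real^'n \<Rightarrow> real"
  assumes lam: "0 < lam" and A: "elliptic_field lam A" and u: "H1per0 u G"
  shows "lam * (norm \<xi>)\<^sup>2 + lam * cell_sqnorm G - cell_ip (flux A (\<lambda>y. G y + \<xi>)) G \<le> cell_ip (flux A (\<lambda>y. G y + \<xi>)) (\<lambda>y. \<xi>)"
    and "cell_ip (flux A (\<lambda>y. G y + \<xi>)) (\<lambda>y. \<xi>) \<le> (norm \<xi>)\<^sup>2 + cell_sqnorm G - cell_ip (flux A (\<lambda>y. G y + \<xi>)) G"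
proof -
  have G: "sqi cellM G" by (rule H1per0_sqi(2)[OF u])
  have W: "sqi cellM (\<lambda>y. G y + \<xi>)" by (intro sqi_add G cellM.sqi_const)
  have z: "cell_ip G (\<lambda>y. \<xi>) = 0"
    using H1per_integral_grad[of u G \<xi>] u by (simp add: cell_ip_def H1per0_def)
  have n: "cell_ip (\<lambda>y. G y + \<xi>) (\<lambda>y. G y + \<xi>) = (norm \<xi>)\<^sup>2 + cell_sqnorm G"
    using z cell_ip_commute[of "\<lambda>y. \<xi>" G] G
    by (simp add: cell_ip_add_left cell_ip_add_right cellM.sqi_const sqi_add cell_sqnorm_ip cell_ip_const power2_norm_eq_inner)
  have s: "cell_ip (flux A (\<lambda>y. G y + \<xi>)) (\<lambda>y. G y + \<xi>) = cell_ip (flux A (\<lambda>y. G y + \<xi>)) G + cell_ip (flux A (\<lambda>y. G y + \<xi>)) (\<lambda>y. \<xi>)"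
    by (intro cell_ip_add_right G cellM.sqi_const flux_sqi[OF lam A W])
  show "lam * (norm \<xi>)\<^sup>2 + lam * cell_sqnorm G - cell_ip (flux A (\<lambda>y. G y + \<xi>)) G \<le> cell_ip (flux A (\<lambda>y. G y + \<xi>)) (\<lambda>y. \<xi>)"
    using flux_ip_bounds(1)[OF lam A W] unfolding n s by (simp add: distrib_left)
  show "cell_ip (flux A (\<lambda>y. G y + \<xi>)) (\<lambda>y. \<xi>) \<le> (norm \<xi>)\<^sup>2 + cell_sqnorm G - cell_ip (flux A (\<lambda>y. G y + \<xi>)) G"
    using flux_ip_bounds(2)[OF lam A W] unfolding n s by simp
qed

text \<open>The flux of the defect \<Psi> is a combination of corrector fluxes, each orthogonal to
  \<Psi>, and ellipticity gives \<Psi> = 0. Directions range over \<xi> and the basis, a finite set,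
  so that relations known almost everywhere in time can be used together.\<close>

lemma orthogonal_correctors_linear:
  fixes a :: "real \<Rightarrow> real^'n \<Rightarrow> real^'n^'n" and G :: "real^'n \<Rightarrow> real \<Rightarrow> real^'n \<Rightarrow> real^'n"
  assumes lam: "0 < lam" and A: "elliptic_field lam (a t)" and G: "\<And>\<zeta>. \<zeta> \<in> insert \<xi> (range (\<lambda>k. axis k 1)) \<Longrightarrow> sqi cellM (G \<zeta> t)"
    and orth: "\<And>\<zeta> \<zeta>'. \<zeta> \<in> insert \<xi> (range (\<lambda>k. axis k 1)) \<Longrightarrow> \<zeta>' \<in> insert \<xi> (range (\<lambda>k. axis k 1)) \<Longrightarrow>
      cell_ip (flux (a t) (\<lambda>y. G \<zeta> t y + \<zeta>)) (G \<zeta>' t) = 0"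
  shows "cell_ip (\<lambda>y. (\<Sum>k\<in>UNIV. \<xi> $ k *\<^sub>R G (axis k 1) t y) - G \<xi> t y) (\<lambda>y. (\<Sum>k\<in>UNIV. \<xi> $ k *\<^sub>R G (axis k 1) t y) - G \<xi> t y) = 0"
proof -
  define \<Psi> where "\<Psi> = (\<lambda>y. (\<Sum>k\<in>UNIV. \<xi> $ k *\<^sub>R G (axis k 1) t y) - G \<xi> t y)"
  define F where "F \<zeta> = flux (a t) (\<lambda>y. G \<zeta> t y + \<zeta>)" for \<zeta>
  let ?Z = "insert \<xi> (range (\<lambda>k. axis k 1)) :: (real^'n) set"
  have F: "sqi cellM (F \<zeta>)" if "\<zeta> \<in> ?Z" for \<zeta>
    unfolding F_def by (intro flux_sqi[OF lam A] sqi_add G[OF that] cellM.sqi_const)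
  have s\<Psi>: "sqi cellM \<Psi>" unfolding \<Psi>_def by (intro sqi_diff sqi_sum sqi_scaleR G) auto
  have FP: "cell_ip (F \<zeta>) \<Psi> = 0" if z: "\<zeta> \<in> ?Z" for \<zeta>
  proof -
    have "cell_ip \<Psi> (F \<zeta>) = (\<Sum>k\<in>UNIV. \<xi> $ k * cell_ip (G (axis k 1) t) (F \<zeta>)) - cell_ip (G \<xi> t) (F \<zeta>)"
      unfolding \<Psi>_def using F[OF z] G
      by (simp add: cell_ip_diff_left cell_ip_sum_left sqi_sum sqi_scaleR cell_ip_scale_left)
    moreover have "cell_ip (G \<zeta>' t) (F \<zeta>) = 0" if "\<zeta>' \<in> ?Z" for \<zeta>'
      using orth[OF z that] by (subst cell_ip_commute) (simp add: F_def)
    ultimately have "cell_ip \<Psi> (F \<zeta>) = 0" by simp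
    then show ?thesis by (subst cell_ip_commute)
  qed
  have "flux (a t) \<Psi> = (\<lambda>y. (\<Sum>k\<in>UNIV. \<xi> $ k *\<^sub>R F (axis k 1) y) - F \<xi> y)"
  proof -
    have "\<Psi> = (\<lambda>y. (\<Sum>k\<in>UNIV. \<xi> $ k *\<^sub>R (G (axis k 1) t y + axis k 1)) - (G \<xi> t y + \<xi>))"
      using basis_expansion[of \<xi>] by (simp add: \<Psi>_def scaleR_add_right sum.distrib scalar_mult_eq_scaleR)
    then show ?thesis by (simp add: flux_diff flux_sum flux_scale F_def)
  qed
  then have "cell_ip (flux (a t) \<Psi>) \<Psi> = (\<Sum>k\<in>UNIV. \<xi> $ k * cell_ip (F (axis k 1)) \<Psi>) - cell_ip (F \<xi>) \<Psi>"
    using F s\<Psi> by (simp add: cell_ip_diff_left cell_ip_sum_left sqi_sum sqi_scaleR cell_ip_scale_left)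
  also have "\<dots> = 0" using FP by simp
  finally have "lam * cell_ip \<Psi> \<Psi> \<le> 0" using flux_ip_bounds(1)[OF lam A s\<Psi>] by simp
  then have "cell_ip \<Psi> \<Psi> = 0"
    using lam cell_ip_nonneg[of \<Psi>] by (simp add: mult_le_0_iff)
  then show ?thesis by (simp add: \<Psi>_def)
qed

lemma a_hom_symmetric:
  fixes a :: "real \<Rightarrow> real^'n \<Rightarrow> real^'n^'n" and G :: "real^'n \<Rightarrow> real \<Rightarrow> real^'n \<Rightarrow> real^'n"
  assumes lam: "0 < lam" and A: "elliptic_field lam (a t)" and G: "\<And>k. sqi cellM (G (axis k 1) t)"
    and orth: "\<And>k l. cell_ip (flux (a t) (\<lambda>y. G (axis k 1) t y + axis k 1)) (G (axis l 1) t) = 0"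
  shows "transpose (a_hom a G t) = a_hom a G t"
proof -
  define W where "W k = (\<lambda>y. G (axis k 1) t y + axis k 1)" for k
  have W: "sqi cellM (W k)" for k unfolding W_def by (intro sqi_add G cellM.sqi_const)
  have "a_hom a G t $ i $ k = cell_ip (flux (a t) (W k)) (W i)" for i k
    using cell_ip_add_right[OF G[of i] cellM.sqi_const[of "axis i 1"] flux_sqi[OF lam A W[of k]]] orth[of k i]
    by (simp add: a_hom_entry[where a=a and G=G and t=t, OF lam A G] W_def)
  then show ?thesis
    using flux_ip_sym[OF A lam W W] by (simp add: transpose_def vec_eq_iff)
qed

section \<open>Correctors in space-time\<close>

lemma st_L2_bounded:
  fixes p :: "real \<Rightarrow> real^'n \<Rightarrow> 'b::euclidean_space"
  assumes p: "(\<lambda>z. p (fst z) (snd z)) \<in> borel_measurable borel" and B: "\<And>t y. t \<in> {0<..<T} \<Longrightarrow> norm (p t y) \<le> B"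
  shows "st_L2 T p"
  unfolding st_L2_iff
proof (rule sqi_bound[where C=B])
  let ?S = "{0<..<T} \<times> (cell :: (real^'n) set)"
  have S: "?S \<in> sets borel" by (intro borel_open open_Times) auto
  have "bounded ?S" by (intro bounded_Times bounded_box) simp
  then have "emeasure lborel ?S < \<infinity>" by (rule emeasure_bounded_finite)
  then have "integrable lborel (indicat_real ?S)"
    using S by (simp add: integrable_indicator_iff)
  moreover have "(norm (indicat_real ?S z))\<^sup>2 = indicat_real ?S z" for z by (simp add: indicator_def)
  ultimately show "sqi lborel (indicat_real ?S)"
    using S by (simp add: sqi_def)
  have eq: "st_ext T p z = indicat_real ?S z *\<^sub>R p (fst z) (snd z)" for z
    by (cases z) (auto simp: st_ext_def indicator_def)
  show "st_ext T p \<in> borel_measurable lborel"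
    unfolding eq[abs_def] using p S by (intro borel_measurable_scaleR) auto
  show "AE z in lborel. norm (st_ext T p z) \<le> B * norm (indicat_real ?S z)"
    using B by (auto simp: eq indicator_def)
qed

lemma st_L2_const: "st_L2 T (\<lambda>t y. \<xi>)"
  by (rule st_L2_bounded[where B="norm \<xi>"]) auto

text \<open>Lets a fixed spatial test function be paired with space-time functions.\<close>

lemma st_L2_time_const:
  fixes w :: "real^'n \<Rightarrow> 'b::euclidean_space"
  assumes w: "sqi cellM w"
  shows "st_L2 T (\<lambda>t. w)"
proof -
  define w' where "w' y = indicator cell y *\<^sub>R w y" for y
  have [measurable]: "w' \<in> borel_measurable borel"
    using w by (simp add: sqi_def w'_def[abs_def] borel_measurable_restrict_space_iff)
  have "integrable lborel (\<lambda>y. indicator cell y *\<^sub>R (norm (w y))\<^sup>2)"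
    using w by (simp add: sqi_def integrable_restrict_space)
  moreover have "indicator cell y *\<^sub>R (norm (w y))\<^sup>2 = (norm (w' y))\<^sup>2" for y by (simp add: w'_def indicator_def)
  ultimately have w'2: "integrable lborel (\<lambda>y. (norm (w' y))\<^sup>2)" by simp
  have eq: "st_ext T (\<lambda>t. w) = (\<lambda>(t, y). indicat_real {0<..<T} t *\<^sub>R w' y)"
    by (auto simp: st_ext_def w'_def)
  have m: "st_ext T (\<lambda>t. w) \<in> borel_measurable (lborel \<Otimes>\<^sub>M lborel)"
    unfolding eq by measurable
  have "integrable (lborel \<Otimes>\<^sub>M lborel) (\<lambda>z. (norm (st_ext T (\<lambda>t. w) z))\<^sup>2)"
  proof (rule lborel_pair.Fubini_integrable)
    have "(\<integral>y. norm ((norm (st_ext T (\<lambda>t. w) (t, y)))\<^sup>2) \<partial>lborel) = indicat_real {0<..<T} t * (\<integral>y. (norm (w' y))\<^sup>2 \<partial>lborel)" for t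
      by (simp add: eq indicator_def)
    moreover have "integrable lborel (indicat_real {0<..<T})"
      by (cases "0 \<le> T") (simp_all add: integrable_indicator_iff)
    ultimately show "integrable lborel (\<lambda>t. \<integral>y. norm ((norm (st_ext T (\<lambda>t. w) (t, y)))\<^sup>2) \<partial>lborel)" by simp
    show "AE t in lborel. integrable lborel (\<lambda>y. (norm (st_ext T (\<lambda>t. w) (t, y)))\<^sup>2)"
      using w'2 by (auto simp: eq indicator_def)
  qed (use m in measurable)
  then show ?thesis using m by (simp add: st_L2_iff sqi_def lborel_prod)
qed

text \<open>Joint measurability comes from the representative fixed in \<open>C1_Linf\<close>;
  symmetry and the bounds on the quadratic form make the flux no larger than its argument.\<close>

lemma flux_st_L2:
  fixes a :: "real \<Rightarrow> real^'n \<Rightarrow> real^'n^'n"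
  assumes lam: "0 < lam" and a: "hyp_coeff T lam a" and u: "st_L2 T u"
  shows "st_L2 T (\<lambda>t. flux (a t) (u t))"
  unfolding st_L2_iff
proof (rule sqi_bound[where C=1])
  show su: "sqi lborel (st_ext T u)" using u by (simp add: st_L2_iff)
  define A where "A z = indicator ({0..T} \<times> UNIV) z *\<^sub>R (case z of (t, y) \<Rightarrow> a t y)" for z
  have Am: "A \<in> borel_measurable lborel"
    using a by (simp add: hyp_coeff_def C1_Linf_def set_borel_measurable_def A_def[abs_def])
  have eq: "st_ext T (\<lambda>t. flux (a t) (u t)) z = A z *v st_ext T u z" for z
  proof (cases z)
    case (Pair t y)
    then show ?thesis
      by (cases "t \<in> {0<..<T}"; cases "y \<in> cell") (auto simp: st_ext_def A_def flux_def)
  qed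
  show "st_ext T (\<lambda>t. flux (a t) (u t)) \<in> borel_measurable lborel"
    unfolding eq[abs_def] by (rule measurable_matrix_vector[OF Am sqi_measurable[OF su]])
  have "AE p in lborel. case p of (t, y) \<Rightarrow> t \<in> {0<..<T} \<longrightarrow> elliptic_matrix lam (a t y)"
    using a unfolding hyp_coeff_def by (auto elim!: eventually_mono simp: elliptic_matrix_def split: prod.splits)
  then show "AE z in lborel. norm (st_ext T (\<lambda>t. flux (a t) (u t)) z) \<le> 1 * norm (st_ext T u z)"
  proof eventually_elim
    case (elim z)
    then show ?case
      using elliptic_matrix_norm_le[OF lam]
      by (cases z, cases "fst z \<in> {0<..<T}"; cases "snd z \<in> cell") (auto simp: st_ext_def flux_def)
  qed
qed

section \<open>Linearity of the weak equation\<close>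

lemma st_ip_add:
  assumes p: "st_L2 T p" and p': "st_L2 T p'" and q: "st_L2 T q"
  shows "(LINT t:{0<..<T}|lborel. cell_ip (\<lambda>y. p t y + p' t y) (q t)) =
    (LINT t:{0<..<T}|lborel. cell_ip (p t) (q t)) + (LINT t:{0<..<T}|lborel. cell_ip (p' t) (q t))"
proof -
  have "st_ext T (\<lambda>t y. p t y + p' t y) z = st_ext T p z + st_ext T p' z" for z
    by (simp add: st_ext_def scaleR_add_right)
  then show ?thesis
    unfolding st_diagonal_integrable(2)[OF p q] st_diagonal_integrable(2)[OF p' q] st_diagonal_integrable(2)[OF st_L2_add[OF p p'] q]
    using p p' q by (simp add: inner_left_distrib sqi_inner_integrable st_L2_iff)
qed

lemma st_weighted_ip_add:
  assumes p: "st_L2 T p" and p': "st_L2 T p'" and w: "sqi cellM w"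
    and m: "m \<in> borel_measurable borel" "\<And>t. \<bar>m t\<bar> \<le> B"
  shows "(LINT t:{0<..<T}|lborel. m t * cell_ip (\<lambda>y. p t y + p' t y) w) =
    (LINT t:{0<..<T}|lborel. m t * cell_ip (p t) w) + (LINT t:{0<..<T}|lborel. m t * cell_ip (p' t) w)"
  using st_ip_add[OF st_L2_scale[OF p m] st_L2_scale[OF p' m] st_L2_time_const[OF w]]
  by (simp add: scaleR_add_right[symmetric] cell_ip_scale_left)

lemma test_fun_bounded:
  assumes T: "0 < T" and \<eta>: "test_fun {0<..<T} \<eta>"
  shows "\<exists>B. (\<forall>t. \<bar>\<eta> t\<bar> \<le> B) \<and> (\<forall>t. \<bar>deriv \<eta> t\<bar> \<le> B)"
proof -
  obtain a b where ab: "\<And>t. \<eta> t \<noteq> 0 \<Longrightarrow> a < t \<and> t < b" using test_fun_realE[OF \<eta> T] by metis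
  then have s: "\<eta> t \<noteq> 0 \<Longrightarrow> a \<le> t \<and> t \<le> b" for t by force
  obtain B1 where B1: "\<And>t. \<bar>\<eta> t\<bar> \<le> B1"
    using smooth_on_bounded[OF test_fun_smooth[OF \<eta>] s] by blast
  obtain B2 where B2: "\<And>t. \<bar>deriv \<eta> t\<bar> \<le> B2"
    using smooth_on_bounded[OF smooth_on_deriv[OF test_fun_smooth[OF \<eta>]], of a b] deriv_support[of \<eta> a b, OF s] by blast
  show ?thesis
    by (rule exI[of _ "max B1 B2"]) (use B1 B2 in \<open>auto simp: le_max_iff_disj\<close>)
qed

lemma weak_evolution_add:
  assumes T: "0 < T" and u: "st_L2 T u" "st_L2 T F" "weak_evolution Cs T u F"
    and v: "st_L2 T v" "st_L2 T K" "weak_evolution Cs T v K"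
  shows "weak_evolution Cs T (\<lambda>t y. u t y + v t y) (\<lambda>t y. F t y + K t y)"
  unfolding weak_evolution_def
proof (intro allI impI)
  fix w :: "real^'a \<Rightarrow> real" and H \<eta> assume A: "H1per0 w H \<and> test_fun {0<..<T} \<eta>"
  then have \<eta>: "test_fun {0<..<T} \<eta>" by blast
  obtain B where B: "\<And>t. \<bar>deriv \<eta> t\<bar> \<le> B" using test_fun_bounded[OF T \<eta>] by blast
  obtain B' where B': "\<And>t. \<bar>\<eta> t / t\<bar> \<le> B'" using test_fun_bounded[OF T test_fun_divide[OF \<eta> T]] by blast
  have m: "deriv \<eta> \<in> borel_measurable borel" "(\<lambda>t. \<eta> t / t) \<in> borel_measurable borel"
    using smooth_measurable[OF smooth_on_deriv[OF test_fun_smooth[OF \<eta>]]]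
      smooth_measurable[OF test_fun_smooth[OF test_fun_divide[OF \<eta> T]]] by auto
  have w: "sqi cellM w" "sqi cellM H" using A H1per0_sqi by auto
  show "Cs * (LINT t:{0<..<T}|lborel. deriv \<eta> t * cell_ip (\<lambda>y. u t y + v t y) w) =
     (LINT t:{0<..<T}|lborel. \<eta> t / t * cell_ip (\<lambda>y. F t y + K t y) H)"
    using u(3)[unfolded weak_evolution_def, rule_format, OF A] v(3)[unfolded weak_evolution_def, rule_format, OF A]
    unfolding st_weighted_ip_add[OF u(1) v(1) w(1) m(1) B] st_weighted_ip_add[OF u(2) v(2) w(2) m(2) B'] distrib_left
    by (simp only:)
qed

lemma weak_evolution_cmult:
  fixes u :: "real \<Rightarrow> real^'n \<Rightarrow> real"
  assumes "weak_evolution Cs T u F"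
  shows "weak_evolution Cs T (\<lambda>t y. c * u t y) (\<lambda>t y. c *\<^sub>R F t y)"
proof -
  have 1: "m t * cell_ip (\<lambda>y. c * u t y) w = c * (m t * cell_ip (u t) w)"
    and 2: "m t * cell_ip (\<lambda>y. c *\<^sub>R F t y) H = c * (m t * cell_ip (F t) H)" for m t w H
    using cell_ip_scale_left[of c "u t" w] cell_ip_scale_left[of c "F t" H] by (simp_all add: mult_ac)
  show ?thesis
    unfolding weak_evolution_def
  proof (intro allI impI)
    fix w :: "real^'n \<Rightarrow> real" and H \<eta> assume A: "H1per0 w H \<and> test_fun {0<..<T} \<eta>"
    have "c * (Cs * (LINT t:{0<..<T}|lborel. deriv \<eta> t * cell_ip (u t) w)) = c * (LINT t:{0<..<T}|lborel. \<eta> t / t * cell_ip (F t) H)"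
      using assms[unfolded weak_evolution_def, rule_format, OF A] by (simp only:)
    then show "Cs * (LINT t:{0<..<T}|lborel. deriv \<eta> t * cell_ip (\<lambda>y. c * u t y) w) =
        (LINT t:{0<..<T}|lborel. \<eta> t / t * cell_ip (\<lambda>y. c *\<^sub>R F t y) H)"
      unfolding 1 2 set_integral_mult_right by (simp only: mult.left_commute)
  qed
qed

lemma weak_evolution_sum:
  assumes T: "0 < T" and I: "finite I"
    and u: "\<And>i. i \<in> I \<Longrightarrow> st_L2 T (u i)" "\<And>i. i \<in> I \<Longrightarrow> st_L2 T (F i)" "\<And>i. i \<in> I \<Longrightarrow> weak_evolution Cs T (u i) (F i)"
  shows "weak_evolution Cs T (\<lambda>t y. \<Sum>i\<in>I. u i t y) (\<lambda>t y. \<Sum>i\<in>I. F i t y)"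
  using I u
proof (induction I rule: finite_induct)
  case empty
  then show ?case by (simp add: weak_evolution_def cell_ip_zero)
next
  case (insert i I)
  have "weak_evolution Cs T (\<lambda>t y. u i t y + (\<Sum>i\<in>I. u i t y)) (\<lambda>t y. F i t y + (\<Sum>i\<in>I. F i t y))"
    by (rule weak_evolution_add[OF T]) (use insert in \<open>auto intro: st_L2_sum\<close>)
  then show ?case using insert by simp
qed

lemma H1per0_zero: "H1per0 (\<lambda>y :: real^'n. 0) (\<lambda>y. 0)"
proof -
  have "grad (\<lambda>y :: real^'n. 0) y = 0" for y
    by (simp add: grad_def vec_eq_iff)
  then have "H1per (\<lambda>y :: real^'n. 0) (\<lambda>y. 0)"
    by (intro H1perI exI[of _ "\<lambda>y. 0"])
      (auto simp: H1_def L2_cell_iff sqi_zero weak_grad_def smooth_on_const cell_periodic_def)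
  then show ?thesis by (simp add: H1per0_iff)
qed

lemma H1per0_sum:
  fixes u :: "'i \<Rightarrow> real^'n \<Rightarrow> real"
  assumes "finite I" "\<And>i. i \<in> I \<Longrightarrow> H1per0 (u i) (G i)"
  shows "H1per0 (\<lambda>y. \<Sum>i\<in>I. u i y) (\<lambda>y. \<Sum>i\<in>I. G i y)"
  using assms by (induction I rule: finite_induct) (auto intro: H1per0_zero H1per0_add)

section \<open>The corrector equations as inner products on the cell\<close>

lemma cell_ip_flux_eq: "(LINT y:cell|lborel. (A y *v (G y + \<xi>)) \<bullet> H y) = cell_ip (flux A (\<lambda>y. G y + \<xi>)) H"
  by (simp add: cell_ip_def flux_def cell_integral)

lemma cell_ip_real_eq: "(LINT y:cell|lborel. u y * w y) = cell_ip u w"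
  by (simp add: cell_ip_def cell_integral)

lemma parabolic_correctorD:
  fixes \<Phi> :: "real \<Rightarrow> real^'n \<Rightarrow> real"
  assumes "parabolic_corrector Cs T a \<xi> \<Phi> G"
  shows "st_L2 T \<Phi>" "st_L2 T G" "AE t in lborel. t \<in> {0<..<T} \<longrightarrow> H1per0 (\<Phi> t) (G t)"
    "\<And>w H \<eta>. H1per0 w H \<Longrightarrow> test_fun {0<..<T} \<eta> \<Longrightarrow>
      Cs * (LINT t:{0<..<T}|lborel. deriv (\<lambda>s. s * \<eta> s) t * cell_ip (\<Phi> t) w) =
      (LINT t:{0<..<T}|lborel. \<eta> t * cell_ip (flux (a t) (\<lambda>y. G t y + \<xi>)) H)"
  using assms unfolding parabolic_corrector_def st_L2_def cell_ip_flux_eq cell_ip_real_eq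
  by (auto simp: mult.assoc)

lemma parabolic_corrector_weak_evolution:
  fixes \<Phi> :: "real \<Rightarrow> real^'n \<Rightarrow> real"
  assumes T: "0 < T" and c: "parabolic_corrector Cs T a \<xi> \<Phi> G"
  shows "weak_evolution Cs T \<Phi> (\<lambda>t. flux (a t) (\<lambda>y. G t y + \<xi>))"
  unfolding weak_evolution_def
proof (intro allI impI)
  fix w :: "real^'n \<Rightarrow> real" and H \<eta> assume A: "H1per0 w H \<and> test_fun {0<..<T} \<eta>"
  then have \<eta>: "test_fun {0<..<T} \<eta>" by blast
  \<comment> \<open>At s = 0 the quotient \<eta>(s)/s is 0 by convention, so its product with s
    agrees with \<eta> there as well.\<close>
  have "\<eta> 0 = 0" using test_fun_realE[OF \<eta> T] by (metis less_asym)
  then have "(\<lambda>s. s * (\<eta> s / s)) = \<eta>" by auto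
  then show "Cs * (LINT t:{0<..<T}|lborel. deriv \<eta> t * cell_ip (\<Phi> t) w) =
      (LINT t:{0<..<T}|lborel. \<eta> t / t * cell_ip (flux (a t) (\<lambda>y. G t y + \<xi>)) H)"
    using parabolic_correctorD(4)[OF c _ test_fun_divide[OF \<eta> T]] A by fastforce
qed

lemma elliptic_correctorD:
  fixes \<Phi> :: "real \<Rightarrow> real^'n \<Rightarrow> real"
  assumes "elliptic_corrector T a \<xi> \<Phi> G" "t \<in> {0<..<T}"
  shows "H1per0 (\<Phi> t) (G t)" "\<And>w H. H1per0 w H \<Longrightarrow> cell_ip (flux (a t) (\<lambda>y. G t y + \<xi>)) H = 0"
  using assms unfolding elliptic_corrector_def cell_ip_flux_eq by blast+

text \<open>The basis expansion of \<xi> cancels the \<xi> of the last term, so the defect satisfies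
  an equation without forcing.\<close>

lemma flux_combination:
  fixes G :: "real^'n \<Rightarrow> real^'n \<Rightarrow> real^'n"
  shows "flux A (\<lambda>y. (\<Sum>k\<in>UNIV. \<xi> $ k *\<^sub>R G (axis k 1) y) - G \<xi> y) =
    (\<lambda>y. (\<Sum>k\<in>UNIV. \<xi> $ k *\<^sub>R flux A (\<lambda>y. G (axis k 1) y + axis k 1) y) + (-1) *\<^sub>R flux A (\<lambda>y. G \<xi> y + \<xi>) y)"
proof -
  have "(\<lambda>y. (\<Sum>k\<in>UNIV. \<xi> $ k *\<^sub>R G (axis k 1) y) - G \<xi> y) =
      (\<lambda>y. (\<Sum>k\<in>UNIV. \<xi> $ k *\<^sub>R (G (axis k 1) y + axis k 1)) - (G \<xi> y + \<xi>))"
    using basis_expansion[of \<xi>] by (simp add: scaleR_add_right sum.distrib scalar_mult_eq_scaleR)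
  then show ?thesis by (simp add: flux_diff flux_sum flux_scale)
qed

text \<open>The defect between the combined basis correctors and the corrector for \<xi> solves the
  homogeneous equation, to which uniqueness applies.\<close>

lemma parabolic_correctors_linear:
  fixes a :: "real \<Rightarrow> real^'n \<Rightarrow> real^'n^'n" and G :: "real^'n \<Rightarrow> real \<Rightarrow> real^'n \<Rightarrow> real^'n"
  assumes T: "0 < T" and lam: "0 < lam" and a: "hyp_coeff T lam a"
    and Cs: "0 < Cs" "Cs \<le> 2 * lam / (real CARD('n) / pi\<^sup>2)"
    and c: "\<And>\<xi>. parabolic_corrector Cs T a \<xi> (\<Phi> \<xi>) (G \<xi>)"
  shows "AE t in lborel. t \<in> {0<..<T} \<longrightarrow>
    cell_ip (\<lambda>y. (\<Sum>k\<in>UNIV. \<xi> $ k *\<^sub>R G (axis k 1) t y) - G \<xi> t y) (\<lambda>y. (\<Sum>k\<in>UNIV. \<xi> $ k *\<^sub>R G (axis k 1) t y) - G \<xi> t y) = 0"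
proof -
  define F where "F \<zeta> t = flux (a t) (\<lambda>y. G \<zeta> t y + \<zeta>)" for \<zeta> t
  have F: "st_L2 T (F \<zeta>)" for \<zeta>
    unfolding F_def by (intro flux_st_L2[OF lam a] st_L2_add parabolic_correctorD(2)[OF c] st_L2_const)
  define u where "u t y = (\<Sum>k\<in>UNIV. \<xi> $ k * \<Phi> (axis k 1) t y) + (-1) * \<Phi> \<xi> t y" for t y
  define K where "K t y = (\<Sum>k\<in>UNIV. \<xi> $ k *\<^sub>R F (axis k 1) t y) + (-1) *\<^sub>R F \<xi> t y" for t y
  define V where "V t y = (\<Sum>k\<in>UNIV. \<xi> $ k *\<^sub>R G (axis k 1) t y) - G \<xi> t y" for t y
  have VK: "flux (a t) (V t) = K t" for t
    unfolding V_def K_def F_def using flux_combination[of "a t" \<xi> "\<lambda>\<zeta>. G \<zeta> t"] by simp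
  have V': "V = (\<lambda>t y. (\<Sum>k\<in>UNIV. \<xi> $ k *\<^sub>R G (axis k 1) t y) + (-1) *\<^sub>R G \<xi> t y)"
    by (simp add: V_def[abs_def])
  have \<Phi>c: "st_L2 T (\<lambda>t y. r * \<Phi> \<zeta> t y)" for r \<zeta>
    using st_L2_cmult[OF parabolic_correctorD(1)[OF c], of r \<zeta>] by simp
  have "AE t in lborel. t \<in> {0<..<T} \<longrightarrow> cell_ip (V t) (V t) = 0"
  proof (rule parabolic_uniqueness[OF T _ _ _ _ _ _ Cs lam])
    show "st_L2 T u" unfolding u_def by (intro st_L2_add st_L2_sum \<Phi>c) simp
    show "st_L2 T V" unfolding V' by (intro st_L2_add st_L2_sum st_L2_cmult parabolic_correctorD(2)[OF c]) simp
    show "st_L2 T K" unfolding K_def by (intro st_L2_add st_L2_sum st_L2_cmult F) simp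
    have "AE t in lborel. \<forall>k\<in>UNIV. t \<in> {0<..<T} \<longrightarrow> H1per0 (\<Phi> (axis k 1) t) (G (axis k 1) t)"
      by (subst AE_ball_countable) (use parabolic_correctorD(3)[OF c] in \<open>auto simp: countable_finite\<close>)
    then show "AE t in lborel. t \<in> {0<..<T} \<longrightarrow> H1per0 (u t) (V t)"
      using parabolic_correctorD(3)[OF c[of \<xi>]]
    proof eventually_elim
      case (elim t)
      show ?case
      proof
        assume t: "t \<in> {0<..<T}"
        show "H1per0 (u t) (V t)"
          unfolding u_def V' by (intro H1per0_add H1per0_sum H1per0_cmult) (use elim t in auto)
      qed
    qed
    show "weak_evolution Cs T u K"
      unfolding u_def[abs_def] K_def[abs_def]
      by (intro weak_evolution_add[OF T] weak_evolution_sum[OF T] weak_evolution_cmult st_L2_sum st_L2_cmult F \<Phi>c)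
        (auto simp: F_def[abs_def] intro: parabolic_corrector_weak_evolution[OF T c])
    show "AE t in lborel. t \<in> {0<..<T} \<longrightarrow> lam * cell_ip (V t) (V t) \<le> cell_ip (K t) (V t)"
      using st_L2_section(1)[OF \<open>st_L2 T V\<close>]
    proof eventually_elim
      case (elim t)
      then show ?case
        using flux_ip_bounds(1)[OF lam hyp_coeff_elliptic_field[OF T a], of t "V t"] by (auto simp: VK)
    qed
  qed
  then show ?thesis unfolding V_def[abs_def] .
qed

text \<open>The energy identity, divided by \<open>Cs\<close> and read as a weak derivative. Because
  of the factor 1/t, integrability is obtained on compact subsets of (0,T), which keep a distance
  from 0.\<close>

lemma parabolic_energy_weak_deriv:
  fixes u :: "real \<Rightarrow> real^'n \<Rightarrow> real"
  assumes T: "0 < T" and u: "st_L2 T u" and G: "st_L2 T G" and F: "st_L2 T F"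
    and H: "AE t in lborel. t \<in> {0<..<T} \<longrightarrow> H1per0 (u t) (G t)"
    and weak: "weak_evolution Cs T u F" and Cs: "0 < Cs"
  shows "weak_deriv T (\<lambda>t. cell_sqnorm (u t)) (\<lambda>t. - 2 / (Cs * t) * cell_ip (F t) (G t))"
  unfolding weak_deriv_def cell_sqnorm_ip
proof (intro conjI allI impI)
  fix K assume K: "compact K \<and> K \<subseteq> {0<..<T}"
  then have Km: "K \<in> sets borel" by (simp add: borel_compact)
  show "set_integrable lborel K (\<lambda>t. cell_ip (u t) (u t))"
    by (rule set_integrable_subset[OF st_diagonal_integrable(1)[OF u u]]) (use K Km in auto)
  have i: "set_integrable lborel K (\<lambda>t. cell_ip (F t) (G t))"
    by (rule set_integrable_subset[OF st_diagonal_integrable(1)[OF F G]]) (use K Km in auto)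
  show "set_integrable lborel K (\<lambda>t. - 2 / (Cs * t) * cell_ip (F t) (G t))"
  proof (cases "K = {}")
    case False
    then obtain m where m: "m \<in> K" "\<And>t. t \<in> K \<Longrightarrow> m \<le> t"
      using compact_attains_inf[of K] K by blast
    have m0: "0 < m" using m(1) K by auto
    show ?thesis
      unfolding set_integrable_def
    proof (rule Bochner_Integration.integrable_bound)
      show "integrable lborel (\<lambda>t. (2 / (Cs * m)) * (indicator K t *\<^sub>R cell_ip (F t) (G t)))"
        using i by (simp add: set_integrable_def)
      have "(\<lambda>t. - 2 / (Cs * t) * (indicator K t *\<^sub>R cell_ip (F t) (G t))) \<in> borel_measurable lborel"
        by (rule borel_measurable_times[OF _ borel_measurable_integrable[OF i[unfolded set_integrable_def]]]) measurable
      then show "(\<lambda>t. indicator K t *\<^sub>R (- 2 / (Cs * t) * cell_ip (F t) (G t))) \<in> borel_measurable lborel"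
        by (simp add: mult_ac)
      show "AE t in lborel. norm (indicator K t *\<^sub>R (- 2 / (Cs * t) * cell_ip (F t) (G t))) \<le> norm ((2 / (Cs * m)) * (indicator K t *\<^sub>R cell_ip (F t) (G t)))"
      proof (rule AE_I2)
        fix t
        show "norm (indicator K t *\<^sub>R (- 2 / (Cs * t) * cell_ip (F t) (G t))) \<le> norm ((2 / (Cs * m)) * (indicator K t *\<^sub>R cell_ip (F t) (G t)))"
        proof (cases "t \<in> K")
          case True
          then have mt: "m \<le> t" "0 < t" using m m0 by force+
          have "\<bar>- 2 / (Cs * t)\<bar> \<le> \<bar>2 / (Cs * m)\<bar>"
            using mt m0 Cs by (simp add: abs_mult frac_le)
          then show ?thesis using True by (simp only: indicator_simps scaleR_one real_norm_def abs_mult mult_right_mono abs_ge_zero)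
        qed simp
      qed
    qed
  qed (simp add: set_integrable_def)
next
  fix \<eta> assume \<eta>: "test_fun {0<..<T} \<eta>"
  have "Cs * (LINT t:{0<..<T}|lborel. cell_ip (u t) (u t) * deriv \<eta> t) = 2 * (LINT t:{0<..<T}|lborel. \<eta> t / t * cell_ip (F t) (G t))"
    using energy_identity[OF T u G F H weak \<eta>] by (simp add: mult.commute)
  then have "(LINT t:{0<..<T}|lborel. cell_ip (u t) (u t) * deriv \<eta> t) = (2 / Cs) * (LINT t:{0<..<T}|lborel. \<eta> t / t * cell_ip (F t) (G t))"
    using Cs by (simp add: field_simps)
  also have "\<dots> = (LINT t:{0<..<T}|lborel. (2 / Cs) * (\<eta> t / t * cell_ip (F t) (G t)))"
    by (simp only: set_integral_mult_right)
  also have "\<dots> = (LINT t:{0<..<T}|lborel. - (- 2 / (Cs * t) * cell_ip (F t) (G t) * \<eta> t))"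
    by (rule set_lebesgue_integral_cong) (auto simp: field_simps)
  also have "\<dots> = - (LINT t:{0<..<T}|lborel. - 2 / (Cs * t) * cell_ip (F t) (G t) * \<eta> t)"
    unfolding set_lebesgue_integral_def by simp
  finally show "(LINT t:{0<..<T}|lborel. cell_ip (u t) (u t) * deriv \<eta> t) = - (LINT t:{0<..<T}|lborel. - 2 / (Cs * t) * cell_ip (F t) (G t) * \<eta> t)" .
qed

lemma a_hom_bounds:
  fixes a :: "real \<Rightarrow> real^'n \<Rightarrow> real^'n^'n"
  assumes lam: "0 < lam" and A: "elliptic_field lam (a t)"
    and \<Phi>: "H1per0 (\<Phi> \<xi> t) (G \<xi> t)" "\<And>k. H1per0 (\<Phi> (axis k 1) t) (G (axis k 1) t)"
    and lin: "cell_ip (\<lambda>y. (\<Sum>k\<in>UNIV. \<xi> $ k *\<^sub>R G (axis k 1) t y) - G \<xi> t y) (\<lambda>y. (\<Sum>k\<in>UNIV. \<xi> $ k *\<^sub>R G (axis k 1) t y) - G \<xi> t y) = 0"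
    and X: "X = - cell_ip (flux (a t) (\<lambda>y. G \<xi> t y + \<xi>)) (G \<xi> t)"
  shows "lam * (norm \<xi>)\<^sup>2 + lam * cell_sqnorm (G \<xi> t) + X \<le> (a_hom a G t *v \<xi>) \<bullet> \<xi> \<and>
    (a_hom a G t *v \<xi>) \<bullet> \<xi> \<le> (norm \<xi>)\<^sup>2 + cell_sqnorm (G \<xi> t) + X"
  using corrector_flux_bounds[OF lam A \<Phi>(1), of \<xi>]
    a_hom_quadratic[where a=a and G=G and t=t, OF lam A H1per0_sqi(2)[OF \<Phi>(2)] H1per0_sqi(2)[OF \<Phi>(1)] lin]
  unfolding X by simp

lemma elliptic_energy_weak_deriv:
  fixes a :: "real \<Rightarrow> real^'n \<Rightarrow> real^'n^'n"
  assumes T: "0 < T" and lam: "0 < lam" and a: "hyp_coeff T lam a"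
    and c: "elliptic_corrector T a \<xi> u G"
  shows "\<exists>D. weak_deriv T (\<lambda>t. cell_sqnorm (u t)) D"
proof -
  note e = elliptic_correctorD[OF c]
  have C1: "C1_Linf T a" using a by (simp add: hyp_coeff_def)
  obtain L where L: "0 \<le> L" "\<And>s t. s \<in> {0..T} \<Longrightarrow> t \<in> {0..T} \<Longrightarrow> AE y in lborel. norm (a t y - a s y) \<le> L * \<bar>t - s\<bar>"
    using C1_Linf_Lipschitz[OF T C1] by blast
  define C where "C = 2 * (real CARD('n) / 16) * (norm \<xi> / lam + norm \<xi>) * (norm \<xi> / lam) / lam"
  have C: "0 \<le> C" using lam by (simp add: C_def)
  have lip: "\<bar>cell_ip (u t) (u t) - cell_ip (u s) (u s)\<bar> \<le> (C * L) * \<bar>t - s\<bar>" if st: "s \<in> {0<..<T}" "t \<in> {0<..<T}" for s t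
  proof -
    have "\<bar>cell_ip (u t) (u t) - cell_ip (u s) (u s)\<bar> \<le> C * (L * \<bar>t - s\<bar>)"
      unfolding C_def
    proof (rule corrector_energy_Lipschitz[where G="G t" and H="G s", OF lam hyp_coeff_elliptic_field[OF T a st(2)] hyp_coeff_elliptic_field[OF T a st(1)]])
      show "AE y in lborel. norm (a t y - a s y) \<le> L * \<bar>t - s\<bar>" by (rule L(2)) (use st in auto)
    qed (use L(1) in \<open>auto intro: e[OF st(1)] e[OF st(2)] e(2)[OF st(1) e(1)[OF st(1)]] e(2)[OF st(1) e(1)[OF st(2)]]
        e(2)[OF st(2) e(1)[OF st(1)]] e(2)[OF st(2) e(1)[OF st(2)]]\<close>)
    then show ?thesis by (simp add: mult.assoc)
  qed
  have "set_integrable lborel {0<..<T} (\<lambda>t. cell_ip (u t) (u t))"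
    by (rule Lipschitz_on_interval_integrable[OF T _ lip]) (use C L in auto)
  from corrector_energy_weak_deriv[OF T lam a this, of G \<xi>] show ?thesis
    using e(1) e(2)[OF _ e(1)] by (auto intro!: AE_I2)
qed

text \<open>The comparison estimate with \<delta> = 0 shows that the energy is constant. For
  \<open>r > 2\<close> and nonzero \<open>Cs\<close> this makes the term with the time derivative
  vanish.\<close>

lemma elliptic_energy_autonomous:
  fixes a :: "real \<Rightarrow> real^'n \<Rightarrow> real^'n^'n"
  assumes T: "0 < T" and lam: "0 < lam" and a: "hyp_coeff T lam a"
    and c: "elliptic_corrector T a \<xi> u G"
    and A: "\<And>t. t \<in> {0..T} \<Longrightarrow> AE y in lborel. a t y = A y"
  shows "weak_deriv T (\<lambda>t. cell_sqnorm (u t)) (\<lambda>t. 0)"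
proof -
  note e = elliptic_correctorD[OF c]
  define E0 where "E0 = cell_ip (u (T/2)) (u (T/2))"
  have const: "cell_ip (u t) (u t) = E0" if t: "t \<in> {0<..<T}" for t
  proof -
    have st: "T/2 \<in> {0<..<T}" "t \<in> {0<..<T}" using T t by auto
    have "\<bar>cell_ip (u t) (u t) - cell_ip (u (T/2)) (u (T/2))\<bar> \<le>
        (2 * (real CARD('n) / 16) * (norm \<xi> / lam + norm \<xi>) * (norm \<xi> / lam) / lam) * 0"
    proof (rule corrector_energy_Lipschitz[where G="G t" and H="G (T/2)", OF lam hyp_coeff_elliptic_field[OF T a st(2)] hyp_coeff_elliptic_field[OF T a st(1)]])
      have "AE y in lborel. a t y = A y" "AE y in lborel. a (T/2) y = A y" using st by (auto intro!: A)
      then show "AE y in lborel. norm (a t y - a (T/2) y) \<le> 0" by eventually_elim simp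
    qed (auto intro: e[OF st(1)] e[OF st(2)] e(2)[OF st(1) e(1)[OF st(1)]] e(2)[OF st(1) e(1)[OF st(2)]]
        e(2)[OF st(2) e(1)[OF st(1)]] e(2)[OF st(2) e(1)[OF st(2)]])
    then show ?thesis by (simp add: E0_def)
  qed
  show ?thesis
    unfolding cell_sqnorm_ip
  proof (rule weak_deriv_density[OF T, where F="\<lambda>_. E0"])
    show "set_integrable lborel {0<..<T} (\<lambda>t. cell_ip (u t) (u t))"
      by (rule Lipschitz_on_interval_integrable[OF T, where L=0]) (auto simp: const)
  qed (auto simp: const set_integrable_def set_lebesgue_integral_def)
qed

text \<open>Three regimes: for \<open>r\<close> other than 2 the orthogonality relations hold at
  every time, for \<open>r = 2\<close> and \<open>Cs = 0\<close> almost everywhere; for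
  \<open>r = 2\<close> and \<open>Cs > 0\<close> the derivative of the energy takes their
  place.\<close>

lemma homogenized_matrix_properties:
  fixes \<Omega> :: "(real^'n) set" and T r lam Cs :: real
    and v0\<epsilon> v1\<epsilon> :: "real \<Rightarrow> real^'n \<Rightarrow> real" and f\<epsilon> :: "real \<Rightarrow> (real^'n) \<times> real \<Rightarrow> real"
    and v0 v1 :: "real^'n \<Rightarrow> real" and f :: "(real^'n) \<times> real \<Rightarrow> real"
    and a :: "real \<Rightarrow> real^'n \<Rightarrow> real^'n^'n" and g gper :: "real \<Rightarrow> real"
  assumes hyps: "standing_hyps \<Omega> T r v0\<epsilon> v1\<epsilon> f\<epsilon> v0 v1 f lam a g gper Cs"
    and corr: "\<And>\<xi>. corrector r Cs T a \<xi> (\<Phi> \<xi>) (G \<xi>)"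
  shows "\<exists>D. weak_deriv T (\<lambda>t. cell_sqnorm (\<Phi> \<xi> t)) D \<and>
          (AE t in lborel. t \<in> {0<..<T} \<longrightarrow>
             lam * (norm \<xi>)\<^sup>2 + lam * cell_sqnorm (G \<xi> t) + dt_coeff r Cs * t / 2 * D t
               \<le> (a_hom a G t *v \<xi>) \<bullet> \<xi> \<and>
             (a_hom a G t *v \<xi>) \<bullet> \<xi>
               \<le> (norm \<xi>)\<^sup>2 + cell_sqnorm (G \<xi> t) + dt_coeff r Cs * t / 2 * D t)"
    and "r \<noteq> 2 \<Longrightarrow> t \<in> {0<..<T} \<Longrightarrow> transpose (a_hom a G t) = a_hom a G t"
    and "r = 2 \<Longrightarrow> Cs = 0 \<Longrightarrow> AE t in lborel. t \<in> {0<..<T} \<longrightarrow> transpose (a_hom a G t) = a_hom a G t"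
proof -
  have T: "0 < T" and a: "hyp_coeff T lam a" and lam: "0 < lam" and damp: "hyp_damping CARD('n) r lam g gper Cs"
    and smooth: "hyp_smooth \<Omega> T r v0\<epsilon> v1\<epsilon> f\<epsilon> a g Cs"
    using hyps by (auto simp: standing_hyps_def hyp_coeff_def)
  have Cs0: "0 \<le> Cs" and CsP: "r = 2 \<Longrightarrow> Cs \<le> 2 * lam / (real CARD('n) / pi\<^sup>2)"
    using damp by (auto simp: hyp_damping_def)
  note ell = hyp_coeff_elliptic_field[OF T a]
  { assume r: "r \<noteq> 2"
    then have c: "elliptic_corrector T a \<zeta> (\<Phi> \<zeta>) (G \<zeta>)" for \<zeta> using corr[of \<zeta>] by (simp add: corrector_def)
    note e = elliptic_correctorD[OF c]
    have orth: "cell_ip (flux (a t) (\<lambda>y. G \<zeta> t y + \<zeta>)) (G \<zeta>' t) = 0" if "t \<in> {0<..<T}" for t \<zeta> \<zeta>'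
      by (rule e(2)[OF that e(1)[OF that]])
    show "transpose (a_hom a G t) = a_hom a G t" if "t \<in> {0<..<T}"
      by (rule a_hom_symmetric[where a=a and G=G and t=t, OF lam ell[OF that] H1per0_sqi(2)[OF e(1)[OF that]] orth[OF that]])
    \<comment> \<open>Either the coefficient is zero and any weak derivative will do, or the field
      is autonomous and the weak derivative is zero.\<close>
    have "\<exists>D. weak_deriv T (\<lambda>t. cell_sqnorm (\<Phi> \<xi> t)) D \<and> (\<forall>t. dt_coeff r Cs * t / 2 * D t = 0)"
    proof (cases "dt_coeff r Cs = 0")
      case True
      then show ?thesis using elliptic_energy_weak_deriv[OF T lam a c] by auto
    next
      case False
      then have "Cs \<noteq> 0 \<and> 2 < r" using r by (auto simp: dt_coeff_def split: if_splits)
      then obtain A where "\<And>t. t \<in> {0..T} \<Longrightarrow> AE y in lborel. a t y = A y"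
        using smooth unfolding hyp_smooth_def by blast
      from elliptic_energy_autonomous[OF T lam a c this] show ?thesis by (intro exI[of _ "\<lambda>t. 0"]) auto
    qed
    then obtain D where D: "weak_deriv T (\<lambda>t. cell_sqnorm (\<Phi> \<xi> t)) D" "\<And>t. dt_coeff r Cs * t / 2 * D t = 0" by blast
    have "lam * (norm \<xi>)\<^sup>2 + lam * cell_sqnorm (G \<xi> t) + dt_coeff r Cs * t / 2 * D t \<le> (a_hom a G t *v \<xi>) \<bullet> \<xi> \<and>
        (a_hom a G t *v \<xi>) \<bullet> \<xi> \<le> (norm \<xi>)\<^sup>2 + cell_sqnorm (G \<xi> t) + dt_coeff r Cs * t / 2 * D t" if t: "t \<in> {0<..<T}" for t
      by (rule a_hom_bounds[where a=a and G=G and \<Phi>=\<Phi> and \<xi>=\<xi>, OF lam ell[OF t] e(1)[OF t] e(1)[OF t] orthogonal_correctors_linear[where a=a and G=G, OF lam ell[OF t] H1per0_sqi(2)[OF e(1)[OF t]] orth[OF t]]])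
        (use D(2)[of t] orth[OF t] in simp)
    with D(1) have "\<exists>D. weak_deriv T (\<lambda>t. cell_sqnorm (\<Phi> \<xi> t)) D \<and>
          (AE t in lborel. t \<in> {0<..<T} \<longrightarrow>
             lam * (norm \<xi>)\<^sup>2 + lam * cell_sqnorm (G \<xi> t) + dt_coeff r Cs * t / 2 * D t
               \<le> (a_hom a G t *v \<xi>) \<bullet> \<xi> \<and>
             (a_hom a G t *v \<xi>) \<bullet> \<xi>
               \<le> (norm \<xi>)\<^sup>2 + cell_sqnorm (G \<xi> t) + dt_coeff r Cs * t / 2 * D t)"
      by blast
  } note elliptic = this
  have parabolic: "parabolic_corrector Cs T a \<zeta> (\<Phi> \<zeta>) (G \<zeta>)" if "r = 2" for \<zeta>
    using corr[of \<zeta>] that by (simp add: corrector_def)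
  \<comment> \<open>With finitely many directions the exceptional null sets unite to a null set;
    over all directions they need not.\<close>
  have finite_AE: "AE t in lborel. \<forall>\<zeta>\<in>insert \<xi> (range (\<lambda>k. axis k 1)). P \<zeta> t" if "\<And>\<zeta>. AE t in lborel. P \<zeta> t" for P \<xi>
    by (subst AE_ball_countable) (use that in \<open>auto simp: countable_finite\<close>)
  have AE_H: "AE t in lborel. \<forall>\<zeta>\<in>insert \<xi> (range (\<lambda>k. axis k 1)). t \<in> {0<..<T} \<longrightarrow> H1per0 (\<Phi> \<zeta> t) (G \<zeta> t)" if "r = 2" for \<xi>
    by (rule finite_AE, rule parabolic_correctorD(3)[OF parabolic[OF that]])
  have stF: "st_L2 T (\<lambda>t. flux (a t) (\<lambda>y. G \<zeta> t y + \<zeta>))" if "r = 2" for \<zeta>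
    by (intro flux_st_L2[OF lam a] st_L2_add parabolic_correctorD(2)[OF parabolic[OF that]] st_L2_const)
  { assume r: "r = 2" and z: "Cs = 0"
    note p = parabolic[OF r]
    have weak: "(LINT t:{0<..<T}|lborel. \<eta> t * cell_ip (flux (a t) (\<lambda>y. G \<zeta> t y + \<zeta>)) H) = 0"
      if "H1per0 w H" "test_fun {0<..<T} \<eta>" for w H \<eta> \<zeta>
      using parabolic_correctorD(4)[OF p that] z by simp
    note wo = weak_orthogonality[OF stF[OF r] parabolic_correctorD(2)[OF p] parabolic_correctorD(3)[OF p] weak]
    have orth: "AE t in lborel. \<forall>\<zeta>\<in>insert \<xi> (range (\<lambda>k. axis k 1)). \<forall>\<zeta>'\<in>insert \<xi> (range (\<lambda>k. axis k 1)).
        t \<in> {0<..<T} \<longrightarrow> cell_ip (flux (a t) (\<lambda>y. G \<zeta> t y + \<zeta>)) (G \<zeta>' t) = 0" for \<xi>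
      by (intro finite_AE wo(2))
    show "AE t in lborel. t \<in> {0<..<T} \<longrightarrow> transpose (a_hom a G t) = a_hom a G t"
      using orth[of 0] AE_H[OF r, of 0]
    proof eventually_elim
      case (elim t)
      show ?case
        using elim by (intro impI a_hom_symmetric[where a=a and G=G, OF lam ell]) (auto intro: H1per0_sqi(2))
    qed
    have E: "set_integrable lborel {0<..<T} (\<lambda>t. cell_ip (\<Phi> \<xi> t) (\<Phi> \<xi> t))"
      by (intro st_diagonal_integrable(1) parabolic_correctorD(1)[OF p])
    have K: "integrable (lborel \<Otimes>\<^sub>M lborel) (\<lambda>(s, t). st_kernel T (\<lambda>t. flux (a t) (\<lambda>y. G \<xi> t y + \<xi>)) (G \<xi>) s t)"
      by (intro st_kernel_integrable stF[OF r] parabolic_correctorD(2)[OF p])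
    have off1: "AE s in lborel. AE t in lborel. s \<in> {0<..<T} \<longrightarrow> t \<in> {0<..<T} \<longrightarrow> cell_ip (flux (a t) (\<lambda>y. G \<xi> t y + \<xi>)) (G \<xi> s) = 0"
      by (rule wo(1))
    \<comment> \<open>The two almost-everywhere quantifiers are exchanged, which uses the joint
      measurability of the kernel.\<close>
    have off2: "AE t in lborel. AE s in lborel. s \<in> {0<..<T} \<longrightarrow> t \<in> {0<..<T} \<longrightarrow> cell_ip (flux (a t) (\<lambda>y. G \<xi> t y + \<xi>)) (G \<xi> s) = 0"
    proof -
      define k where "k = st_kernel T (\<lambda>t. flux (a t) (\<lambda>y. G \<xi> t y + \<xi>)) (G \<xi>)"
      have km: "(\<lambda>(s, t). k s t) \<in> borel_measurable (lborel \<Otimes>\<^sub>M lborel)"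
        using borel_measurable_integrable[OF K] by (simp add: k_def)
      have m: "{x \<in> space (lborel \<Otimes>\<^sub>M lborel). k (fst x) (snd x) = 0} \<in> sets (lborel \<Otimes>\<^sub>M lborel)"
        using km unfolding case_prod_beta' by measurable
      have "AE s in lborel. AE t in lborel. k s t = 0"
        using off1
      proof eventually_elim
        case (elim s)
        then show ?case by eventually_elim (auto simp: k_def st_kernel_def indicator_def)
      qed
      then have "AE t in lborel. AE s in lborel. k s t = 0"
        using lborel_pair.AE_commute[OF m] by simp
      then show ?thesis
      proof eventually_elim
        case (elim t)
        then show ?case by eventually_elim (auto simp: k_def st_kernel_def)
      qed
    qed
    have "\<exists>D. weak_deriv T (\<lambda>t. cell_sqnorm (\<Phi> \<xi> t)) D"
    proof (rule corrector_energy_weak_deriv[OF T lam a E parabolic_correctorD(3)[OF p] wo(2)])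
      show "AE s in lborel. AE t in lborel. s \<in> {0<..<T} \<longrightarrow> t \<in> {0<..<T} \<longrightarrow>
        cell_ip (flux (a t) (\<lambda>y. G \<xi> t y + \<xi>)) (G \<xi> s) = 0 \<and> cell_ip (flux (a s) (\<lambda>y. G \<xi> s y + \<xi>)) (G \<xi> t) = 0"
        using off1 off2
      proof eventually_elim
        case (elim s)
        from elim show ?case by eventually_elim blast
      qed
    qed
    then obtain D where D: "weak_deriv T (\<lambda>t. cell_sqnorm (\<Phi> \<xi> t)) D" by blast
    have "AE t in lborel. t \<in> {0<..<T} \<longrightarrow>
             lam * (norm \<xi>)\<^sup>2 + lam * cell_sqnorm (G \<xi> t) + dt_coeff r Cs * t / 2 * D t \<le> (a_hom a G t *v \<xi>) \<bullet> \<xi> \<and>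
             (a_hom a G t *v \<xi>) \<bullet> \<xi> \<le> (norm \<xi>)\<^sup>2 + cell_sqnorm (G \<xi> t) + dt_coeff r Cs * t / 2 * D t"
      using orth[of \<xi>] AE_H[OF r, of \<xi>]
    proof eventually_elim
      case (elim t)
      show ?case
      proof
        assume t: "t \<in> {0<..<T}"
        have H: "H1per0 (\<Phi> \<zeta> t) (G \<zeta> t)" if "\<zeta> \<in> insert \<xi> (range (\<lambda>k. axis k 1))" for \<zeta> using elim t that by blast
        have o: "cell_ip (flux (a t) (\<lambda>y. G \<zeta> t y + \<zeta>)) (G \<zeta>' t) = 0"
          if "\<zeta> \<in> insert \<xi> (range (\<lambda>k. axis k 1))" "\<zeta>' \<in> insert \<xi> (range (\<lambda>k. axis k 1))" for \<zeta> \<zeta>'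
          using elim t that by blast
        show "lam * (norm \<xi>)\<^sup>2 + lam * cell_sqnorm (G \<xi> t) + dt_coeff r Cs * t / 2 * D t \<le> (a_hom a G t *v \<xi>) \<bullet> \<xi> \<and>
             (a_hom a G t *v \<xi>) \<bullet> \<xi> \<le> (norm \<xi>)\<^sup>2 + cell_sqnorm (G \<xi> t) + dt_coeff r Cs * t / 2 * D t"
        proof (rule a_hom_bounds[where a=a and G=G and \<Phi>=\<Phi> and \<xi>=\<xi>, OF lam ell[OF t]])
          show "cell_ip (\<lambda>y. (\<Sum>k\<in>UNIV. \<xi> $ k *\<^sub>R G (axis k 1) t y) - G \<xi> t y) (\<lambda>y. (\<Sum>k\<in>UNIV. \<xi> $ k *\<^sub>R G (axis k 1) t y) - G \<xi> t y) = 0"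
            by (rule orthogonal_correctors_linear[where a=a and G=G, OF lam ell[OF t] H1per0_sqi(2)[OF H] o])
          show "dt_coeff r Cs * t / 2 * D t = - cell_ip (flux (a t) (\<lambda>y. G \<xi> t y + \<xi>)) (G \<xi> t)"
            using o[of \<xi> \<xi>] z r by (simp add: dt_coeff_def)
        qed (auto intro: H)
      qed
    qed
    with D have "\<exists>D. weak_deriv T (\<lambda>t. cell_sqnorm (\<Phi> \<xi> t)) D \<and>
          (AE t in lborel. t \<in> {0<..<T} \<longrightarrow>
             lam * (norm \<xi>)\<^sup>2 + lam * cell_sqnorm (G \<xi> t) + dt_coeff r Cs * t / 2 * D t
               \<le> (a_hom a G t *v \<xi>) \<bullet> \<xi> \<and>
             (a_hom a G t *v \<xi>) \<bullet> \<xi>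
               \<le> (norm \<xi>)\<^sup>2 + cell_sqnorm (G \<xi> t) + dt_coeff r Cs * t / 2 * D t)"
      by blast
  } note undamped = this
  { assume r: "r = 2" and nz: "Cs \<noteq> 0"
    then have Cs: "0 < Cs" "Cs \<le> 2 * lam / (real CARD('n) / pi\<^sup>2)" using Cs0 CsP by auto
    note p = parabolic[OF r]
    \<comment> \<open>Chosen so that Cs t / 2 times \<open>D t\<close> is minus the pairing of flux
      and gradient.\<close>
    define D where "D t = - 2 / (Cs * t) * cell_ip (flux (a t) (\<lambda>y. G \<xi> t y + \<xi>)) (G \<xi> t)" for t
    have D: "weak_deriv T (\<lambda>t. cell_sqnorm (\<Phi> \<xi> t)) D"
      unfolding D_def[abs_def]
      by (rule parabolic_energy_weak_deriv[OF T parabolic_correctorD(1)[OF p] parabolic_correctorD(2)[OF p] stF[OF r]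
            parabolic_correctorD(3)[OF p] parabolic_corrector_weak_evolution[OF T p] Cs(1)])
    have "AE t in lborel. t \<in> {0<..<T} \<longrightarrow>
             lam * (norm \<xi>)\<^sup>2 + lam * cell_sqnorm (G \<xi> t) + dt_coeff r Cs * t / 2 * D t \<le> (a_hom a G t *v \<xi>) \<bullet> \<xi> \<and>
             (a_hom a G t *v \<xi>) \<bullet> \<xi> \<le> (norm \<xi>)\<^sup>2 + cell_sqnorm (G \<xi> t) + dt_coeff r Cs * t / 2 * D t"
      using parabolic_correctors_linear[OF T lam a Cs p, of \<xi>] AE_H[OF r, of \<xi>]
    proof eventually_elim
      case (elim t)
      show ?case
      proof
        assume t: "t \<in> {0<..<T}"
        have H: "H1per0 (\<Phi> \<zeta> t) (G \<zeta> t)" if "\<zeta> \<in> insert \<xi> (range (\<lambda>k. axis k 1))" for \<zeta> using elim t that by blast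
        show "lam * (norm \<xi>)\<^sup>2 + lam * cell_sqnorm (G \<xi> t) + dt_coeff r Cs * t / 2 * D t \<le> (a_hom a G t *v \<xi>) \<bullet> \<xi> \<and>
             (a_hom a G t *v \<xi>) \<bullet> \<xi> \<le> (norm \<xi>)\<^sup>2 + cell_sqnorm (G \<xi> t) + dt_coeff r Cs * t / 2 * D t"
        proof (rule a_hom_bounds[where a=a and G=G and \<Phi>=\<Phi> and \<xi>=\<xi>, OF lam ell[OF t]])
          show "dt_coeff r Cs * t / 2 * D t = - cell_ip (flux (a t) (\<lambda>y. G \<xi> t y + \<xi>)) (G \<xi> t)"
            using t r Cs(1) by (simp add: dt_coeff_def D_def)
        qed (use elim t in \<open>auto intro: H\<close>)
      qed
    qed
    with D have "\<exists>D. weak_deriv T (\<lambda>t. cell_sqnorm (\<Phi> \<xi> t)) D \<and>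
          (AE t in lborel. t \<in> {0<..<T} \<longrightarrow>
             lam * (norm \<xi>)\<^sup>2 + lam * cell_sqnorm (G \<xi> t) + dt_coeff r Cs * t / 2 * D t
               \<le> (a_hom a G t *v \<xi>) \<bullet> \<xi> \<and>
             (a_hom a G t *v \<xi>) \<bullet> \<xi>
               \<le> (norm \<xi>)\<^sup>2 + cell_sqnorm (G \<xi> t) + dt_coeff r Cs * t / 2 * D t)"
      by blast
  } note damped = this
  show "\<exists>D. weak_deriv T (\<lambda>t. cell_sqnorm (\<Phi> \<xi> t)) D \<and>
          (AE t in lborel. t \<in> {0<..<T} \<longrightarrow>
             lam * (norm \<xi>)\<^sup>2 + lam * cell_sqnorm (G \<xi> t) + dt_coeff r Cs * t / 2 * D t
               \<le> (a_hom a G t *v \<xi>) \<bullet> \<xi> \<and>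
             (a_hom a G t *v \<xi>) \<bullet> \<xi>
               \<le> (norm \<xi>)\<^sup>2 + cell_sqnorm (G \<xi> t) + dt_coeff r Cs * t / 2 * D t)"
    using elliptic undamped damped by blast
qed

section \<open>A homogenized matrix that is not symmetric\<close>

text \<open>The phase \<open>b\<close> closes the family under differentiation: a derivative is a
  multiple of the sine shifted by pi/2.\<close>

lemma smooth_on_sinusoid: "smooth_on UNIV (\<lambda>y::real^'n. k * sin (2 * pi * y $ i + b))"
proof -
  have "Ck_on m UNIV (\<lambda>y::real^'n. k * sin (2 * pi * y $ i + b))" for m
  proof (induction m arbitrary: k b)
    case 0
    show ?case by (auto intro!: continuous_intros)
  next
    case (Suc m)
    show ?case
    proof (rule Ck_on_SucI[where f'="\<lambda>y v. k * (2 * pi * v $ i) * sin (2 * pi * y $ i + (b + pi/2))"])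
      fix y :: "real^'n"
      have s: "sin (2 * pi * y $ i + (b + pi/2)) = cos (2 * pi * y $ i + b)"
        by (simp add: sin_add add.assoc[symmetric])
      show "((\<lambda>y. k * sin (2 * pi * y $ i + b)) has_derivative
          (\<lambda>v. k * (2 * pi * v $ i) * sin (2 * pi * y $ i + (b + pi/2)))) (at y)"
        unfolding s
        by (auto intro!: derivative_eq_intros bounded_linear.has_derivative[OF bounded_linear_vec_nth] simp: mult_ac)
    qed (rule Suc.IH)
  qed
  then show ?thesis by (simp add: smooth_on_def)
qed

lemma smooth_on_sin_coord: "smooth_on UNIV (\<lambda>y::real^'n. k * sin (2 * pi * y $ i))"
  using smooth_on_sinusoid[of k i 0] by simp

lemma sin_coord_directional:
  fixes y :: "real^'n"
  shows "((\<lambda>s. k * sin (2 * pi * (y + s *\<^sub>R axis m 1) $ i)) has_real_derivative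
    (if m = i then 2 * pi * k * cos (2 * pi * y $ i) else 0)) (at 0)"
  by (auto intro!: derivative_eq_intros simp: axis_def)

lemma grad_sin_coord:
  fixes y :: "real^'n"
  shows "grad (\<lambda>y. k * sin (2 * pi * y $ i)) y = (2 * pi * k * cos (2 * pi * y $ i)) *\<^sub>R axis i 1"
proof -
  have "frechet_derivative (\<lambda>y::real^'n. k * sin (2 * pi * y $ i)) (at y) (axis m 1) =
      (if m = i then 2 * pi * k * cos (2 * pi * y $ i) else 0)" for m
    using DERIV_unique[OF smooth_directional[OF smooth_on_sin_coord[of k i], of y "axis m 1" 0] sin_coord_directional[of k y m i]]
    by simp
  then show ?thesis by (auto simp: grad_def vec_eq_iff axis_def)
qed

lemma grad_zero_off_support:
  fixes \<phi> :: "real^'n \<Rightarrow> real"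
  assumes "y \<notin> closure {x. \<phi> x \<noteq> 0}"
  shows "grad \<phi> y = 0"
proof -
  have "(\<phi> has_derivative (\<lambda>v. 0)) (at y)"
    by (rule has_derivative_transform_within_open[where f="\<lambda>_. 0" and s="- closure {x. \<phi> x \<noteq> 0}"])
      (use assms closure_subset[of "{x. \<phi> x \<noteq> 0}"] in auto)
  from frechet_derivative_at[OF this, symmetric] show ?thesis
    by (simp add: grad_def vec_eq_iff)
qed

text \<open>The product with a test function vanishes outside the cell together with its
  derivatives, so the integral of a derivative over the cell is one over the whole space, which is
  zero.\<close>

lemma smooth_weak_grad_cell:
  fixes u :: "real^'n \<Rightarrow> real"
  assumes u: "smooth_on UNIV u"
  shows "weak_grad cell u (grad u)"
  unfolding weak_grad_def cell_integral
proof (intro allI impI)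
  fix \<phi> :: "real^'n \<Rightarrow> real" and i
  assume \<phi>: "test_fun cell \<phi>"
  note s\<phi> = test_fun_smooth[OF \<phi>]
  define d where "d y = u y * grad \<phi> y $ i + grad u y $ i * \<phi> y" for y
  have zero: "\<phi> y = 0 \<and> grad \<phi> y = 0" if "y \<notin> cell" for y
    using \<phi> that closure_subset[of "{x. \<phi> x \<noteq> 0}"] grad_zero_off_support[of y \<phi>] unfolding test_fun_def by blast
  have "continuous_on UNIV d"
    unfolding d_def
    by (intro continuous_intros smooth_on_continuous u s\<phi> smooth_on_grad_continuous)
  then have "compact (d ` cbox 0 1)"
    using continuous_on_subset by (intro compact_continuous_image compact_cbox) blast
  then obtain B where B0: "\<And>y. y \<in> cbox 0 1 \<Longrightarrow> \<bar>d y\<bar> \<le> B"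
    using compact_imp_bounded bounded_iff by (metis image_eqI real_norm_def)
  have B: "\<bar>d y\<bar> \<le> \<bar>B\<bar>" for y
  proof (cases "y \<in> cell")
    case True
    then have "y \<in> cbox 0 1" using box_subset_cbox by blast
    from B0[OF this] show ?thesis by linarith
  next
    case False
    from zero[OF this] show ?thesis by (simp add: d_def)
  qed
  have "bounded (cell :: (real^'n) set)" by (rule bounded_box)
  then obtain R where R: "\<And>y. y \<in> (cell :: (real^'n) set) \<Longrightarrow> norm y < R"
    unfolding bounded_iff by (meson gt_ex le_less_trans)
  have "(\<integral>y. d y \<partial>lborel) = 0"
  proof (rule integral_derivative_compact_support[where h="\<lambda>y. u y * \<phi> y" and v="axis i 1" and R=R, OF _ _ _ B])
    show "continuous_on UNIV (\<lambda>y. u y * \<phi> y)"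
      by (intro continuous_intros smooth_on_continuous u s\<phi>)
    show "u y * \<phi> y = 0" if "R \<le> norm y" for y
      using R[of y] zero[of y] that by auto
    show "((\<lambda>s. u (y + s *\<^sub>R axis i 1) * \<phi> (y + s *\<^sub>R axis i 1)) has_real_derivative d y) (at 0)" for y
      using DERIV_mult[OF smooth_directional[OF u, of y "axis i 1" 0] smooth_directional[OF s\<phi>, of y "axis i 1" 0]]
      by (simp add: d_def grad_def algebra_simps)
  qed
  moreover have "(\<integral>y. d y \<partial>cellM) = (\<integral>y. d y \<partial>lborel)"
  proof -
    have "indicator cell y *\<^sub>R d y = d y" for y
      using zero[of y] by (cases "y \<in> cell") (auto simp: d_def)
    then have "(\<integral>y. indicator cell y *\<^sub>R d y \<partial>lborel) = (\<integral>y. d y \<partial>lborel)" by presburger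
    then show ?thesis by (simp add: integral_restrict_space)
  qed
  moreover have "(\<integral>y. d y \<partial>cellM) = (\<integral>y. u y * grad \<phi> y $ i \<partial>cellM) + (\<integral>y. grad u y $ i * \<phi> y \<partial>cellM)"
    unfolding d_def
    by (intro Bochner_Integration.integral_add sqi_mult_integrable sqi_nth test_fun_sqi[OF \<phi>] cell_continuous_sqi
        smooth_on_continuous[OF u] smooth_on_grad_continuous[OF u])
  ultimately show "(\<integral>y. u y * grad \<phi> y $ i \<partial>cellM) = - (\<integral>y. grad u y $ i * \<phi> y \<partial>cellM)"
    by simp
qed

lemma smooth_H1per:
  fixes u :: "real^'n \<Rightarrow> real"
  assumes "smooth_on UNIV u" "cell_periodic u"
  shows "H1per u (grad u)"
proof (rule H1perI)
  show "H1 cell u (grad u)"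
    unfolding H1_def L2_cell_iff
    by (intro conjI smooth_weak_grad_cell cell_continuous_sqi smooth_on_continuous smooth_on_grad_continuous assms)
qed (use assms in \<open>auto intro!: exI[of _ u]\<close>)

lemma cell_integral_sin: "(\<integral>y. sin (2 * pi * y $ i) \<partial>cellM) = 0"
proof -
  have "(\<integral>y. - (2 * pi * sin (2 * pi * y $ i)) \<partial>cellM) = 0"
  proof (rule cell_integral_derivative[OF _ _ cell_periodic_cos_coord, where B=1 and B'="2*pi" and i=i])
    show "\<bar>- (2 * pi * sin (2 * pi * y $ i))\<bar> \<le> 2 * pi" for y
      using abs_sin_le_one[of "2 * pi * y $ i"] by (simp add: abs_mult)
    show "((\<lambda>s. cos (2 * pi * (y + s *\<^sub>R axis i 1) $ i)) has_real_derivative - (2 * pi * sin (2 * pi * y $ i))) (at 0)" for y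
      by (auto intro!: derivative_eq_intros simp: axis_def)
  qed (auto intro!: borel_measurable_continuous_onI continuous_intros)
  then show ?thesis by simp
qed

text \<open>The derivative of the periodic product of sine and cosine is 4 pi cos^2 - 2 pi, which
  has mean zero.\<close>

lemma cell_integral_cos_square:
  fixes i :: "'n::finite"
  shows "(\<integral>y. (cos (2 * pi * y $ i))\<^sup>2 \<partial>cellM) = 1/2"
proof -
  define d :: "real^'n \<Rightarrow> real" where "d y = 4 * pi * (cos (2 * pi * y $ i))\<^sup>2 - 2 * pi" for y
  have c: "(cos (2 * pi * y $ i))\<^sup>2 \<le> 1" for y :: "real^'n"
    using abs_cos_le_one[of "2 * pi * y $ i"] by (simp add: abs_square_le_1)
  have per: "cell_periodic (\<lambda>y. sin (2 * pi * y $ i) * cos (2 * pi * y $ i))"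
    using cell_periodic_cos_coord[of i] cell_periodic_sin_coord[of i] by (simp add: cell_periodic_def)
  have "(\<integral>y. d y \<partial>cellM) = 0"
  proof (rule cell_integral_derivative[OF _ _ per, where B=1 and B'="2*pi" and i=i])
    show "\<bar>sin (2 * pi * y $ i) * cos (2 * pi * y $ i)\<bar> \<le> 1" for y
      using abs_sin_le_one[of "2 * pi * y $ i"] abs_cos_le_one[of "2 * pi * y $ i"]
      by (simp add: abs_mult mult_le_one)
    show "\<bar>d y\<bar> \<le> 2 * pi" for y
      using c[of y] mult_left_mono[OF c[of y], of "4 * pi"] zero_le_power2[of "cos (2 * pi * y $ i)"]
      by (simp add: d_def abs_le_iff)
    show "((\<lambda>s. sin (2 * pi * (y + s *\<^sub>R axis i 1) $ i) * cos (2 * pi * (y + s *\<^sub>R axis i 1) $ i)) has_real_derivative d y) (at 0)" for y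
      by (rule derivative_eq_intros refl | simp)+
         (simp add: axis_def d_def sin_squared_eq power2_eq_square[symmetric] algebra_simps)
  qed (auto intro!: borel_measurable_continuous_onI continuous_intros)
  moreover have "(\<integral>y. d y \<partial>cellM) = 4 * pi * (\<integral>y. (cos (2 * pi * y $ i))\<^sup>2 \<partial>cellM) - 2 * pi"
  proof -
    have "integrable cellM (\<lambda>y::real^'n. (cos (2 * pi * y $ i))\<^sup>2)"
      by (intro sqi_power2_integrable cell_continuous_sqi continuous_intros)
    then show ?thesis using cellM.prob_space by (simp add: d_def)
  qed
  ultimately show ?thesis by simp
qed

text \<open>Smooth approximations of \<open>w\<close> reduce it to the vanishing mean of the
  derivative of a periodic product. Differentiability of \<open>u\<close> is asked in direction
  \<open>k\<close> alone, which suits a flux component differentiated in its own direction.\<close>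

lemma H1per_integral_by_parts:
  fixes u d :: "real^'n \<Rightarrow> real"
  assumes w: "H1per w H" and u: "continuous_on UNIV u" "cell_periodic u" and d: "continuous_on UNIV d" "cell_periodic d"
    and der: "\<And>y. ((\<lambda>s. u (y + s *\<^sub>R axis k 1)) has_real_derivative d y) (at 0)"
  shows "(\<integral>y. H y $ k * u y \<partial>cellM) = - (\<integral>y. w y * d y \<partial>cellM)"
proof -
  obtain \<phi> where \<phi>: "\<And>n::nat. smooth_on UNIV (\<phi> n)" "\<And>n. cell_periodic (\<phi> n)"
    and lim: "(\<lambda>n. \<integral>y. (norm (w y - \<phi> n y))\<^sup>2 \<partial>cellM) \<longlonglongrightarrow> 0" "(\<lambda>n. \<integral>y. (norm (H y - grad (\<phi> n) y))\<^sup>2 \<partial>cellM) \<longlonglongrightarrow> 0"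
    using H1per_approx_seq[OF w] by blast
  have s: "sqi cellM u" "sqi cellM d" "sqi cellM (\<phi> n)" "sqi cellM (grad (\<phi> n))" for n
    by (intro cell_continuous_sqi u d smooth_on_continuous smooth_on_grad_continuous \<phi>)+
  have eq: "(\<integral>y. grad (\<phi> n) y \<bullet> (u y *\<^sub>R axis k 1) \<partial>cellM) = - (\<integral>y. \<phi> n y \<bullet> d y \<partial>cellM)" for n
  proof -
    define h where "h y = \<phi> n y * u y" for y
    define e where "e y = grad (\<phi> n) y $ k * u y + \<phi> n y * d y" for y
    have hc: "continuous_on UNIV h" and ec: "continuous_on UNIV e"
      unfolding h_def e_def by (intro continuous_intros u d smooth_on_continuous smooth_on_grad_continuous \<phi>)+
    have hp: "cell_periodic h" and ep: "cell_periodic e"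
      using u(2) d(2) \<phi>(2)[of n] cell_periodic_grad[OF \<phi>(2,1), of n] by (auto simp: h_def e_def cell_periodic_def)
    obtain B where B: "\<And>y. norm (h y) \<le> B" using cell_periodic_bounded[OF hp hc] by blast
    obtain B' where B': "\<And>y. norm (e y) \<le> B'" using cell_periodic_bounded[OF ep ec] by blast
    have "(\<integral>y. e y \<partial>cellM) = 0"
    proof (rule cell_integral_derivative[where h=h and B=B and B'=B' and i=k])
      show "((\<lambda>s. h (y + s *\<^sub>R axis k 1)) has_real_derivative e y) (at 0)" for y
        using DERIV_mult[OF smooth_directional[OF \<phi>(1), of n y "axis k 1" 0] der[of y]]
        by (simp add: h_def e_def grad_def algebra_simps)
    qed (use B B' hp borel_measurable_continuous_onI[OF hc] in auto)
    moreover have "(\<integral>y. e y \<partial>cellM) = (\<integral>y. grad (\<phi> n) y $ k * u y \<partial>cellM) + (\<integral>y. \<phi> n y * d y \<partial>cellM)"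
      unfolding e_def by (intro Bochner_Integration.integral_add sqi_mult_integrable sqi_nth s)
    ultimately show ?thesis by (simp add: inner_axis mult.commute)
  qed
  have "(\<lambda>n. \<integral>y. grad (\<phi> n) y \<bullet> (u y *\<^sub>R axis k 1) \<partial>cellM) \<longlonglongrightarrow> (\<integral>y. H y \<bullet> (u y *\<^sub>R axis k 1) \<partial>cellM)"
    by (intro tendsto_integral_inner lim s H1per_sqi[OF w] cell_continuous_sqi continuous_intros u)
  moreover have "(\<lambda>n. - (\<integral>y. \<phi> n y \<bullet> d y \<partial>cellM)) \<longlonglongrightarrow> - (\<integral>y. w y \<bullet> d y \<partial>cellM)"
    by (intro tendsto_minus tendsto_integral_inner lim s H1per_sqi[OF w])
  ultimately have "(\<integral>y. H y \<bullet> (u y *\<^sub>R axis k 1) \<partial>cellM) = - (\<integral>y. w y \<bullet> d y \<partial>cellM)"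
    unfolding eq using LIMSEQ_unique by blast
  then show ?thesis by (simp add: inner_axis mult.commute)
qed

text \<open>The matrix c I + d E_ii + q (E_ij + E_ji), given by its action on vectors.\<close>

definition pert :: "'n::finite \<Rightarrow> 'n \<Rightarrow> real \<Rightarrow> real \<Rightarrow> real \<Rightarrow> real^'n \<Rightarrow> real^'n" where
  "pert i j c d q v = c *\<^sub>R v + (d * v $ i + q * v $ j) *\<^sub>R axis i 1 + (q * v $ i) *\<^sub>R axis j 1"

definition pert_matrix :: "'n::finite \<Rightarrow> 'n \<Rightarrow> real \<Rightarrow> real \<Rightarrow> real \<Rightarrow> real^'n^'n" where
  "pert_matrix i j c d q = matrix (pert i j c d q)"

lemma pert_matrix_mult: "pert_matrix i j c d q *v v = pert i j c d q v"
proof -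
  have "linear (pert i j c d q)"
    by (rule linearI) (simp_all add: pert_def algebra_simps)
  from matrix_works[OF this[unfolded linear_matrix_vector_mul_eq[symmetric]]] show ?thesis
    by (simp add: pert_matrix_def)
qed

lemma pert_matrix_entry: "pert_matrix i j c d q $ k $ l = pert i j c d q (axis l 1) $ k"
  by (simp add: pert_matrix_def matrix_def)

lemma transpose_pert_matrix: "transpose (pert_matrix i j c d q) = pert_matrix i j c d q"
  by (simp add: vec_eq_iff transpose_def pert_matrix_entry pert_def axis_def)

lemma pert_matrix_diff:
  "pert_matrix i j c d q - pert_matrix i j c' d' q' = pert_matrix i j (c - c') (d - d') (q - q')"
  by (simp add: vec_eq_iff pert_matrix_entry pert_def algebra_simps)

lemma pert_matrix_scaleR: "r *\<^sub>R pert_matrix i j c d q = pert_matrix i j (r * c) (r * d) (r * q)"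
  by (simp add: vec_eq_iff pert_matrix_entry pert_def algebra_simps)

lemma continuous_on_pert_matrix:
  assumes "continuous_on S d" "continuous_on S q"
  shows "continuous_on S (\<lambda>z. pert_matrix i j c (d z) (q z))"
proof -
  have "pert_matrix i j c d q = (\<chi> k l. pert i j c d q (axis l 1) $ k)" for d q
    by (simp add: vec_eq_iff pert_matrix_entry)
  then show ?thesis
    by (auto simp: pert_def intro!: continuous_on_vec_lambda continuous_intros assms)
qed

text \<open>For distinct \<open>i\<close> and \<open>j\<close> both v_i^2 and 2 |v_i v_j| are at
  most |v|^2, so the perturbation changes the form by at most (|d| + |q|) |v|^2.\<close>

lemma pert_quadratic_bounds:
  assumes "i \<noteq> j" "\<bar>d\<bar> + \<bar>q\<bar> \<le> \<delta>"
  shows "(c - \<delta>) * (norm v)\<^sup>2 \<le> pert i j c d q v \<bullet> v" "pert i j c d q v \<bullet> v \<le> (c + \<delta>) * (norm v)\<^sup>2"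
proof -
  have eq: "pert i j c d q v \<bullet> v = c * (norm v)\<^sup>2 + (d * (v $ i)\<^sup>2 + 2 * q * (v $ i * v $ j))"
    by (simp add: pert_def inner_add_left inner_axis' power2_norm_eq_inner power2_eq_square[of "v $ _"] algebra_simps)
  have "(v $ i)\<^sup>2 + (v $ j)\<^sup>2 = (\<Sum>k\<in>{i, j}. (v $ k)\<^sup>2)" using assms(1) by simp
  also have "\<dots> \<le> (\<Sum>k\<in>UNIV. (v $ k)\<^sup>2)" by (rule sum_mono2) auto
  also have "\<dots> = (norm v)\<^sup>2" by (simp add: power2_norm_eq_inner inner_vec_def power2_eq_square[of "v $ _"])
  finally have le: "(v $ i)\<^sup>2 + (v $ j)\<^sup>2 \<le> (norm v)\<^sup>2" .
  have "2 * \<bar>v $ i * v $ j\<bar> \<le> (v $ i)\<^sup>2 + (v $ j)\<^sup>2"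
    using sum_squares_bound[of "\<bar>v $ i\<bar>" "\<bar>v $ j\<bar>"] by (simp add: abs_mult)
  with le have q: "\<bar>2 * q * (v $ i * v $ j)\<bar> \<le> \<bar>q\<bar> * (norm v)\<^sup>2"
    using mult_left_mono[of "2 * \<bar>v $ i * v $ j\<bar>" "(norm v)\<^sup>2" "\<bar>q\<bar>"] by (simp add: abs_mult mult_ac)
  have d: "\<bar>d * (v $ i)\<^sup>2\<bar> \<le> \<bar>d\<bar> * (norm v)\<^sup>2"
    using mult_left_mono[of "(v $ i)\<^sup>2" "(norm v)\<^sup>2" "\<bar>d\<bar>"] le zero_le_power2[of "v $ j"] by (simp add: abs_mult)
  have "(\<bar>d\<bar> + \<bar>q\<bar>) * (norm v)\<^sup>2 \<le> \<delta> * (norm v)\<^sup>2"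
    by (rule mult_right_mono[OF assms(2)]) simp
  with q d have "\<bar>d * (v $ i)\<^sup>2 + 2 * q * (v $ i * v $ j)\<bar> \<le> \<delta> * (norm v)\<^sup>2"
    by (simp add: distrib_right)
  then show "(c - \<delta>) * (norm v)\<^sup>2 \<le> pert i j c d q v \<bullet> v" "pert i j c d q v \<bullet> v \<le> (c + \<delta>) * (norm v)\<^sup>2"
    unfolding eq left_diff_distrib distrib_right by linarith+
qed

section \<open>Integrals of test functions in time\<close>

lemma LINT_deriv_test_fun:
  fixes \<psi> :: "real \<Rightarrow> real"
  assumes "0 < T" "test_fun {0<..<T} \<psi>"
  shows "(LINT t:{0<..<T}|lborel. deriv \<psi> t) = 0"
proof -
  have "set_integrable lborel {0<..<T} (\<lambda>t. 1 :: real)"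
    using emeasure_bounded_finite[of "{0<..<T}"] by (simp add: set_integrable_def integrable_indicator_iff)
  then have "weak_deriv T (\<lambda>t. 1) (\<lambda>t. 0)"
    by (rule weak_deriv_density[OF assms(1), where F="\<lambda>_. 1"]) (auto simp: set_integrable_def set_lebesgue_integral_def)
  with assms(2) show ?thesis
    by (auto simp: weak_deriv_def set_lebesgue_integral_def)
qed

text \<open>The derivative of (p + q t) t \<eta>(t) integrates to zero. This evaluates the
  distributional time derivative of a corrector affine in \<open>t\<close>.\<close>

lemma LINT_moment_test_fun:
  fixes \<eta> :: "real \<Rightarrow> real"
  assumes T: "0 < T" and \<eta>: "test_fun {0<..<T} \<eta>"
  shows "(LINT t:{0<..<T}|lborel. deriv (\<lambda>s. s * \<eta> s) t * (p + q * t)) = - (LINT t:{0<..<T}|lborel. \<eta> t * (q * t))"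
proof -
  have int: "set_integrable lborel {0<..<T} f" if "continuous_on UNIV f" for f :: "real \<Rightarrow> real"
    by (rule set_integrable_subset[OF borel_integrable_atLeastAtMost'[OF continuous_on_subset[OF that subset_UNIV], of 0 T]]) auto
  have s\<eta>: "smooth_on UNIV (\<lambda>s. s * \<eta> s)"
    by (intro smooth_on_mult smooth_on_ident test_fun_smooth[OF \<eta>])
  have sl: "smooth_on UNIV (\<lambda>t. p + q * t)"
    by (intro smooth_on_add smooth_on_mult smooth_on_const smooth_on_ident)
  have \<psi>: "test_fun {0<..<T} (\<lambda>t. (p + q * t) * (t * \<eta> t))"
    by (intro test_fun_mult_left \<eta> sl smooth_on_ident)
  have "deriv (\<lambda>t. (p + q * t) * (t * \<eta> t)) t = deriv (\<lambda>s. s * \<eta> s) t * (p + q * t) + \<eta> t * (q * t)" for t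
  proof (rule DERIV_imp_deriv)
    have "((\<lambda>t. p + q * t) has_real_derivative q) (at t)" by (auto intro!: derivative_eq_intros)
    from DERIV_mult[OF this smooth_on_has_real_derivative[OF s\<eta>]]
    show "((\<lambda>t. (p + q * t) * (t * \<eta> t)) has_real_derivative deriv (\<lambda>s. s * \<eta> s) t * (p + q * t) + \<eta> t * (q * t)) (at t)"
      by (simp add: algebra_simps)
  qed
  with LINT_deriv_test_fun[OF T \<psi>]
  have "(LINT t:{0<..<T}|lborel. deriv (\<lambda>s. s * \<eta> s) t * (p + q * t) + \<eta> t * (q * t)) = 0" by simp
  also have "(LINT t:{0<..<T}|lborel. deriv (\<lambda>s. s * \<eta> s) t * (p + q * t) + \<eta> t * (q * t)) =
      (LINT t:{0<..<T}|lborel. deriv (\<lambda>s. s * \<eta> s) t * (p + q * t)) + (LINT t:{0<..<T}|lborel. \<eta> t * (q * t))"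
    by (intro set_integral_add int continuous_intros smooth_on_continuous[OF smooth_on_deriv[OF s\<eta>]]
        smooth_on_continuous[OF test_fun_smooth[OF \<eta>]])
  finally show ?thesis by simp
qed

lemma Linf_continuous_periodic:
  fixes u :: "real^'n \<Rightarrow> 'b::euclidean_space"
  assumes "continuous_on UNIV u" "cell_periodic u"
  shows "Linf u"
proof -
  obtain B where B: "\<And>y. norm (u y) \<le> B" using cell_periodic_bounded[OF assms(2,1)] by blast
  have "Linf_norm u \<le> ereal B"
    unfolding Linf_norm_def by (rule esssup_I) (use B borel_measurable_continuous_onI[OF assms(1)] in auto)
  also have "\<dots> < \<infinity>" by simp
  finally show ?thesis
    using borel_measurable_continuous_onI[OF assms(1)] by (simp add: Linf_def)
qed

lemma Linf_norm_zero: "Linf_norm (\<lambda>y::real^'n. 0 :: 'b::euclidean_space) = 0"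
  unfolding Linf_norm_def by (subst esssup_const) (simp_all add: zero_ereal_def)

text \<open>Only the entries \<open>ii\<close>, \<open>ij\<close>, \<open>ji\<close> depend on \<open>y\<close>, and only through \<open>y $ i\<close>. They are chosen so
  that the \<open>i\<close>-th component of the flux \<open>a (\<nabla>\<Phi> + \<xi>)\<close> is \<open>c \<xi>\<^sub>i - Cs e t \<xi>\<^sub>j cos (2 \<pi> y\<^sub>i) / (4 \<pi>\<^sup>2)\<close>
  when \<open>\<Phi> = (\<xi>\<^sub>i + \<xi>\<^sub>j t) e sin (2 \<pi> y\<^sub>i) / (2 \<pi>)\<close>; then \<open>div (a (\<nabla>\<Phi> + \<xi>)) = Cs t \<partial>\<^sub>t \<Phi>\<close>.\<close>
locale asymmetric_example =
  fixes i j :: "'n::finite" and lam Cs T e :: real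
  assumes ij: "i \<noteq> j" and lam: "0 < lam" "lam < 1" and Cs: "0 < Cs" and T: "0 < T"
    and e: "0 < e" "e \<le> 1/2" "e * (2 + T * (Cs + 2)) \<le> (1 - lam) / 2"
begin

text \<open>The midpoint of the ellipticity interval [lam, 1], with room (1 - lam)/2 on either side
  for the perturbation.\<close>

definition c :: real where "c = (1 + lam) / 2"

definition cs :: "real^'n \<Rightarrow> real" where "cs y = cos (2 * pi * y $ i)"

text \<open>Makes the ii entry equal to c / (1 + e cs). Multiplied by 1 + e cs, the i-th component
  of the field for \<xi> = \<open>axis i 1\<close>, it gives the constant c, as the flux across a
  layered medium must be.\<close>

definition dd :: "real^'n \<Rightarrow> real" where "dd y = - (c * e * cs y / (1 + e * cs y))"

text \<open>The summand with c cancels what the part of the gradient linear in \<open>t\<close> adds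
  to the i-th flux component; the summand with Cs / (4 pi^2) remains and has the divergence demanded
  by the time derivative.\<close>

definition qq :: "real^'n \<Rightarrow> real" where "qq y = - (e * cs y * (Cs / (4 * pi\<^sup>2) + c / (1 + e * cs y)))"

definition coef :: "real \<Rightarrow> real^'n \<Rightarrow> real^'n^'n" where
  "coef t y = pert_matrix i j c (dd y) (t * qq y)"

definition Cor :: "real^'n \<Rightarrow> real \<Rightarrow> real^'n \<Rightarrow> real" where
  "Cor \<xi> t y = (\<xi> $ i + \<xi> $ j * t) * e / (2 * pi) * sin (2 * pi * y $ i)"

definition Gr :: "real^'n \<Rightarrow> real \<Rightarrow> real^'n \<Rightarrow> real^'n" where
  "Gr \<xi> t y = ((\<xi> $ i + \<xi> $ j * t) * e * cs y) *\<^sub>R axis i 1"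

section \<open>Regularity and ellipticity of the coefficient field\<close>

lemma cs_le: "\<bar>cs y\<bar> \<le> 1" by (simp add: cs_def)

lemma den_ge: "1/2 \<le> 1 + e * cs y"
proof -
  have "\<bar>e * cs y\<bar> \<le> 1/2 * 1" unfolding abs_mult using e cs_le[of y] by (intro mult_mono) auto
  then show ?thesis by linarith
qed

lemma den_nz: "1 + e * cs y \<noteq> 0" using den_ge[of y] by linarith

lemma cs_axis: "cs (y + s *\<^sub>R axis k 1) = cs y" if "k \<noteq> i"
  using that by (simp add: cs_def axis_def)

lemma cs_per: "cs (y + axis k 1) = cs y"
  using cell_periodic_cos_coord[of i] by (simp add: cell_periodic_def cs_def)

lemma cs_continuous: "continuous_on S cs"
  unfolding cs_def by (intro continuous_intros)

lemma dd_continuous: "continuous_on S dd" and qq_continuous: "continuous_on S qq"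
  unfolding dd_def qq_def by (intro continuous_intros cs_continuous ballI den_nz; simp)+

lemma c_bounds: "0 < c" "c < 1" using lam by (auto simp: c_def)

lemma quot_le: "\<bar>c / (1 + e * cs y)\<bar> \<le> 2"
proof -
  have "c / (1 + e * cs y) \<le> 1 / (1/2)"
    using den_ge[of y] c_bounds by (intro frac_le) auto
  moreover have "0 \<le> c / (1 + e * cs y)" using den_ge[of y] c_bounds by (intro divide_nonneg_nonneg) auto
  ultimately show ?thesis by (simp only: abs_of_nonneg) simp
qed

text \<open>The bounds 2 e for \<open>dd\<close> and e (Cs + 2) for \<open>qq\<close> are the origin
  of the smallness condition on \<open>e\<close>. Both use 1 + e cs \<ge> 1/2, which is what e \<le>
  1/2 provides.\<close>

lemma perturbation_small:
  assumes t: "t \<in> {0..T}"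
  shows "\<bar>dd y\<bar> + \<bar>t * qq y\<bar> \<le> (1 - lam) / 2"
proof -
  have ec: "\<bar>e * cs y\<bar> \<le> e" using mult_left_mono[OF cs_le[of y], of e] e by (simp add: abs_mult)
  have "dd y = - (e * cs y * (c / (1 + e * cs y)))" by (simp add: dd_def)
  then have "\<bar>dd y\<bar> = \<bar>e * cs y\<bar> * \<bar>c / (1 + e * cs y)\<bar>" by (simp only: abs_minus abs_mult)
  also have "\<dots> \<le> e * 2" using ec quot_le[of y] e by (intro mult_mono) auto
  finally have d: "\<bar>dd y\<bar> \<le> e * 2" .
  have "1 * 1 \<le> pi * pi" using pi_gt3 by (intro mult_mono) auto
  then have "1 \<le> 4 * pi\<^sup>2" by (simp add: power2_eq_square)
  then have "Cs / (4 * pi\<^sup>2) \<le> Cs / 1" using Cs by (intro divide_left_mono) auto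
  moreover have "0 \<le> Cs / (4 * pi\<^sup>2)" using Cs by simp
  ultimately have s: "\<bar>Cs / (4 * pi\<^sup>2) + c / (1 + e * cs y)\<bar> \<le> Cs + 2" using quot_le[of y] by linarith
  have "\<bar>qq y\<bar> = \<bar>e * cs y\<bar> * \<bar>Cs / (4 * pi\<^sup>2) + c / (1 + e * cs y)\<bar>"
    unfolding qq_def by (simp only: abs_minus abs_mult)
  also have "\<dots> \<le> e * (Cs + 2)" using ec s e by (intro mult_mono) auto
  finally have "\<bar>qq y\<bar> \<le> e * (Cs + 2)" .
  then have "\<bar>t * qq y\<bar> \<le> T * (e * (Cs + 2))"
    unfolding abs_mult using t by (intro mult_mono) auto
  with d have "\<bar>dd y\<bar> + \<bar>t * qq y\<bar> \<le> e * (2 + T * (Cs + 2))" by (simp add: algebra_simps)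
  with e(3) show ?thesis by linarith
qed

lemma coef_continuous: "continuous_on UNIV (\<lambda>z. coef (fst z) (snd z))"
  unfolding coef_def
  by (intro continuous_on_pert_matrix continuous_intros continuous_on_compose2[OF dd_continuous[of UNIV]]
      continuous_on_compose2[OF qq_continuous[of UNIV]]) auto

lemma coef_continuous_space: "continuous_on UNIV (coef t)"
  unfolding coef_def by (intro continuous_on_pert_matrix continuous_intros dd_continuous qq_continuous)

lemma coef_per: "coef t (y + axis k 1) = coef t y"
  by (simp add: coef_def dd_def qq_def cs_per)

text \<open>The field is affine in \<open>t\<close>, so its difference quotients equal the
  derivative and both limits are limits of zero.\<close>

lemma coef_C1_Linf: "C1_Linf T coef"
  unfolding C1_Linf_def
proof (intro conjI exI[of _ "\<lambda>t y. pert_matrix i j 0 0 (qq y)"] ballI)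
  have "(\<lambda>z. coef (fst z) (snd z)) \<in> borel_measurable borel"
    by (rule borel_measurable_continuous_onI[OF coef_continuous])
  moreover have "{0..T} \<times> (UNIV :: (real^'n) set) \<in> sets borel"
    by (intro borel_closed closed_Times) auto
  ultimately show "set_borel_measurable lborel ({0..T} \<times> UNIV) (\<lambda>(t, y). coef t y)"
    unfolding set_borel_measurable_def case_prod_beta' by (simp add: borel_measurable_indicator_iff)
  fix t assume "t \<in> {0..T}"
  show "Linf (coef t)"
    by (rule Linf_continuous_periodic[OF coef_continuous_space]) (simp add: cell_periodic_def coef_per)
  show "Linf (\<lambda>y. pert_matrix i j 0 0 (qq y))"
    by (rule Linf_continuous_periodic)
      (auto intro!: continuous_on_pert_matrix continuous_on_const qq_continuous simp: cell_periodic_def qq_def[of "_ + _"] qq_def[of "_ :: real^'n", symmetric] cs_per)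
  have "(coef s y - coef t y) /\<^sub>R (s - t) - pert_matrix i j 0 0 (qq y) = 0" if "s \<noteq> t" for s y
  proof -
    have "coef s y - coef t y = (s - t) *\<^sub>R pert_matrix i j 0 0 (qq y)"
      by (simp add: coef_def pert_matrix_diff pert_matrix_scaleR left_diff_distrib)
    with that show ?thesis by simp
  qed
  then have "Linf_norm (\<lambda>y. (coef s y - coef t y) /\<^sub>R (s - t) - pert_matrix i j 0 0 (qq y)) = 0" if "s \<noteq> t" for s
    using that by (simp add: Linf_norm_zero)
  then show "((\<lambda>s. Linf_norm (\<lambda>y. (coef s y - coef t y) /\<^sub>R (s - t) - pert_matrix i j 0 0 (qq y))) \<longlongrightarrow> 0) (at t within {0..T})"
    by (intro tendsto_eventually) (auto simp: eventually_at_filter)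
qed (simp_all add: Linf_norm_zero)

lemma coef_hyp: "hyp_coeff T lam coef"
  unfolding hyp_coeff_def
proof (intro conjI coef_C1_Linf lam AE_I2, clarify)
  fix t :: real and y :: "real^'n"
  assume "t \<in> {0<..<T}"
  then have "\<bar>dd y\<bar> + \<bar>t * qq y\<bar> \<le> (1 - lam) / 2" by (intro perturbation_small) auto
  note b = pert_quadratic_bounds[OF ij this, of c]
  have c: "c - (1 - lam) / 2 = lam" "c + (1 - lam) / 2 = 1" by (simp_all add: c_def field_simps)
  show "transpose (coef t y) = coef t y \<and> (\<forall>\<xi>. lam * (norm \<xi>)\<^sup>2 \<le> (coef t y *v \<xi>) \<bullet> \<xi> \<and> (coef t y *v \<xi>) \<bullet> \<xi> \<le> (norm \<xi>)\<^sup>2) \<and>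
      (\<forall>j. coef t (y + axis j 1) = coef t y)"
    using b unfolding c by (simp add: coef_per) (simp add: coef_def transpose_pert_matrix pert_matrix_mult)
qed

section \<open>The flux and the corrector equation of the example\<close>

lemma flux_component_i:
  "(coef t y *v (Gr \<xi> t y + \<xi>)) $ i = c * \<xi> $ i - Cs * e * t * \<xi> $ j * cs y / (4 * pi\<^sup>2)"
proof -
  have w: "(Gr \<xi> t y + \<xi>) $ i = \<xi> $ i * (1 + e * cs y) + \<xi> $ j * t * e * cs y" "(Gr \<xi> t y + \<xi>) $ j = \<xi> $ j"
    using ij by (simp_all add: Gr_def axis_def algebra_simps)
  have "c + dd y = c / (1 + e * cs y)" using den_nz[of y] by (simp add: dd_def field_simps)
  then have "(coef t y *v (Gr \<xi> t y + \<xi>)) $ i =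
      c / (1 + e * cs y) * (\<xi> $ i * (1 + e * cs y) + \<xi> $ j * t * e * cs y) + t * qq y * \<xi> $ j"
    using ij w by (simp add: coef_def pert_matrix_mult pert_def axis_def distrib_right[symmetric])
  also have "\<dots> = c * \<xi> $ i - Cs * e * t * \<xi> $ j * cs y / (4 * pi\<^sup>2)"
  proof -
    define m where "m = c / (1 + e * cs y)"
    have m: "m * (1 + e * cs y) = c" using den_nz[of y] by (simp add: m_def)
    have "m * (\<xi> $ i * (1 + e * cs y) + \<xi> $ j * t * e * cs y) + t * qq y * \<xi> $ j =
        m * (1 + e * cs y) * \<xi> $ i - Cs / (4 * pi\<^sup>2) * (e * t * \<xi> $ j * cs y)"
      by (simp add: qq_def m_def[symmetric] algebra_simps)
    then show ?thesis unfolding m by (simp add: m_def mult_ac)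
  qed
  finally show ?thesis .
qed

text \<open>The factor 1 + e cs of the field, multiplied by the cosine in \<open>qq\<close>, creates
  a cos^2 term; it is the one with nonzero mean.\<close>

lemma flux_component_j:
  "(coef t y *v (Gr (axis i 1) t y + axis i 1)) $ j =
    - (e * t * (c + Cs / (4 * pi\<^sup>2))) * cs y - e\<^sup>2 * t * Cs / (4 * pi\<^sup>2) * (cs y)\<^sup>2"
proof -
  have "(coef t y *v (Gr (axis i 1) t y + axis i 1)) $ j = t * qq y * (1 + e * cs y)"
    using ij by (simp add: coef_def pert_matrix_mult pert_def axis_def Gr_def algebra_simps)
  also have "\<dots> = - (e * t * (c + Cs / (4 * pi\<^sup>2))) * cs y - e\<^sup>2 * t * Cs / (4 * pi\<^sup>2) * (cs y)\<^sup>2"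
  proof -
    define m where "m = c / (1 + e * cs y)"
    have m: "m * (1 + e * cs y) = c" using den_nz[of y] by (simp add: m_def)
    have "qq y * (1 + e * cs y) = - (e * cs y * (Cs / (4 * pi\<^sup>2) * (1 + e * cs y) + m * (1 + e * cs y)))"
      unfolding qq_def m_def[symmetric] by algebra
    then have "qq y * (1 + e * cs y) = - (e * cs y * (Cs / (4 * pi\<^sup>2) * (1 + e * cs y) + c))"
      unfolding m .
    then have "t * qq y * (1 + e * cs y) = t * - (e * cs y * (Cs / (4 * pi\<^sup>2) * (1 + e * cs y) + c))"
      by (simp only: mult.assoc)
    moreover have "t * - (e * cs y * (X * (1 + e * cs y) + c)) = - (e * t * (c + X)) * cs y - e\<^sup>2 * t * X * (cs y)\<^sup>2" for X
      by algebra
    ultimately show ?thesis by (simp only: times_divide_eq_right)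
  qed
  finally show ?thesis .
qed

lemma flux_continuous: "continuous_on UNIV (\<lambda>y. (coef t y *v (Gr \<xi> t y + \<xi>)) $ k)"
  unfolding coef_def pert_matrix_mult pert_def Gr_def
  by (intro continuous_intros dd_continuous qq_continuous cs_continuous)

lemma Cor_H1per0: "H1per0 (Cor \<xi> t) (Gr \<xi> t)"
proof -
  let ?k = "(\<xi> $ i + \<xi> $ j * t) * e / (2 * pi)"
  have u: "Cor \<xi> t = (\<lambda>y. ?k * sin (2 * pi * y $ i))" by (simp add: Cor_def fun_eq_iff)
  have g: "grad (Cor \<xi> t) = Gr \<xi> t"
    unfolding u fun_eq_iff grad_sin_coord by (simp add: fun_eq_iff Gr_def cs_def)
  have "cell_periodic (Cor \<xi> t)"
    using cell_periodic_sin_coord[of i] by (simp add: cell_periodic_def Cor_def)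
  from smooth_H1per[OF _ this] have "H1per (Cor \<xi> t) (Gr \<xi> t)"
    unfolding g unfolding u using smooth_on_sin_coord by blast
  then show ?thesis
    unfolding H1per0_iff by (simp add: u cell_integral_sin)
qed

text \<open>Coefficients and gradient depend on \<open>y\<close> through y_i alone, so the k-th flux
  component is constant in direction k unless k = i. Integration by parts leaves the derivative of
  the i-th component.\<close>

lemma flux_weak:
  assumes w: "H1per0 w H"
  shows "cell_ip (flux (coef t) (\<lambda>y. Gr \<xi> t y + \<xi>)) H = - (Cs * e * t * \<xi> $ j / (2 * pi) * (\<integral>y. sin (2 * pi * y $ i) * w y \<partial>cellM))"
proof -
  have wH: "H1per w H" using w by (simp add: H1per0_def)
  define F where "F k y = (coef t y *v (Gr \<xi> t y + \<xi>)) $ k" for k y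
  have Fc: "continuous_on UNIV (F k)" for k unfolding F_def by (rule flux_continuous)
  have Fp: "cell_periodic (F k)" for k by (simp add: F_def cell_periodic_def coef_per Gr_def cs_per)
  define s where "s k y = (if k = i then Cs * e * t * \<xi> $ j / (2 * pi) * sin (2 * pi * y $ i) else 0)" for k and y :: "real^'n"
  have parts: "(\<integral>y. H y $ k * F k y \<partial>cellM) = - (\<integral>y. w y * s k y \<partial>cellM)" for k
  proof (rule H1per_integral_by_parts[OF wH Fc Fp])
    show "continuous_on UNIV (s k)"
      by (cases "k = i") (auto simp: s_def intro!: continuous_intros)
    show "cell_periodic (s k)"
      using cell_periodic_sin_coord[of i] by (simp add: cell_periodic_def s_def)
    show "((\<lambda>r. F k (y + r *\<^sub>R axis k 1)) has_real_derivative s k y) (at 0)" for y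
    proof (cases "k = i")
      case True
      define m where "m = Cs * e * t * \<xi> $ j / (4 * pi\<^sup>2)"
      have "F i z = c * \<xi> $ i - m * cos (2 * pi * z $ i)" for z
        unfolding F_def by (simp add: flux_component_i cs_def m_def)
      moreover have "((\<lambda>r. c * \<xi> $ i - m * cos (2 * pi * (y + r *\<^sub>R axis i 1) $ i)) has_real_derivative
          m * (2 * pi * sin (2 * pi * y $ i))) (at 0)"
        by (auto intro!: derivative_eq_intros simp: axis_def)
      moreover have "m * (2 * pi * sin (2 * pi * y $ i)) = s k y"
        using True by (simp add: s_def m_def power2_eq_square)
      ultimately show ?thesis using True by simp
    next
      case False
      then have "F k (y + r *\<^sub>R axis k 1) = F k y" for r
        by (simp add: F_def coef_def dd_def qq_def Gr_def cs_axis)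
      then show ?thesis using False by (simp add: s_def)
    qed
  qed
  have "cell_ip (flux (coef t) (\<lambda>y. Gr \<xi> t y + \<xi>)) H = (\<integral>y. (\<Sum>k\<in>UNIV. H y $ k * F k y) \<partial>cellM)"
    by (simp add: cell_ip_def flux_def inner_vec_def F_def mult.commute)
  also have "\<dots> = (\<Sum>k\<in>UNIV. \<integral>y. H y $ k * F k y \<partial>cellM)"
    by (intro Bochner_Integration.integral_sum sqi_mult_integrable sqi_nth H1per0_sqi(2)[OF w] cell_continuous_sqi Fc)
  also have "\<dots> = (\<Sum>k\<in>UNIV. if k = i then - (Cs * e * t * \<xi> $ j / (2 * pi) * (\<integral>y. sin (2 * pi * y $ i) * w y \<partial>cellM)) else 0)"
  proof (rule sum.cong[OF refl])
    fix k
    show "(\<integral>y. H y $ k * F k y \<partial>cellM) =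
        (if k = i then - (Cs * e * t * \<xi> $ j / (2 * pi) * (\<integral>y. sin (2 * pi * y $ i) * w y \<partial>cellM)) else 0)"
    proof (cases "k = i")
      case True
      have "(\<integral>y. w y * s k y \<partial>cellM) = (\<integral>y. Cs * e * t * \<xi> $ j / (2 * pi) * (sin (2 * pi * y $ i) * w y) \<partial>cellM)"
        using True by (simp add: s_def mult_ac)
      also have "\<dots> = Cs * e * t * \<xi> $ j / (2 * pi) * (\<integral>y. sin (2 * pi * y $ i) * w y \<partial>cellM)"
        by (rule integral_mult_right_zero)
      finally show ?thesis using True by (simp only: parts) simp
    qed (simp add: parts s_def)
  qed
  finally show ?thesis by simp
qed

text \<open>Time and space separate: with K the scaled pairing of the sine profile with
  \<open>w\<close>, the corrector pairs to (\<xi>_i + \<xi>_j t) K and the flux to -Cs \<xi>_j t K.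
  The moment identity in \<open>t\<close> matches the two.\<close>

lemma Cor_corrector: "parabolic_corrector Cs T coef \<xi> (Cor \<xi>) (Gr \<xi>)"
  unfolding parabolic_corrector_def cell_ip_flux_eq cell_ip_real_eq st_L2_def[symmetric]
proof (intro conjI allI impI)
  have bd: "\<bar>\<xi> $ i + \<xi> $ j * t\<bar> \<le> \<bar>\<xi> $ i\<bar> + \<bar>\<xi> $ j\<bar> * T" if "t \<in> {0<..<T}" for t
    using that mult_left_mono[of t T "\<bar>\<xi> $ j\<bar>"] abs_triangle_ineq[of "\<xi> $ i" "\<xi> $ j * t"] by (simp add: abs_mult)
  show "st_L2 T (Cor \<xi>)"
  proof (rule st_L2_bounded)
    show "(\<lambda>z. Cor \<xi> (fst z) (snd z)) \<in> borel_measurable borel"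
      unfolding Cor_def by (intro borel_measurable_continuous_onI continuous_intros) simp
    show "norm (Cor \<xi> t y) \<le> (\<bar>\<xi> $ i\<bar> + \<bar>\<xi> $ j\<bar> * T) * (e / (2 * pi)) * 1" if "t \<in> {0<..<T}" for t y
    proof -
      have "Cor \<xi> t y = (\<xi> $ i + \<xi> $ j * t) * (e / (2 * pi)) * sin (2 * pi * y $ i)" by (simp add: Cor_def)
      then have "norm (Cor \<xi> t y) = \<bar>\<xi> $ i + \<xi> $ j * t\<bar> * (e / (2 * pi)) * \<bar>sin (2 * pi * y $ i)\<bar>"
        using e by (simp only: real_norm_def abs_mult) simp
      also have "\<dots> \<le> (\<bar>\<xi> $ i\<bar> + \<bar>\<xi> $ j\<bar> * T) * (e / (2 * pi)) * 1"
        using bd[OF that] e T by (intro mult_mono) auto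
      finally show ?thesis .
    qed
  qed
  show "st_L2 T (Gr \<xi>)"
  proof (rule st_L2_bounded)
    show "(\<lambda>z. Gr \<xi> (fst z) (snd z)) \<in> borel_measurable borel"
      unfolding Gr_def cs_def by (intro borel_measurable_continuous_onI continuous_intros)
    show "norm (Gr \<xi> t y) \<le> (\<bar>\<xi> $ i\<bar> + \<bar>\<xi> $ j\<bar> * T) * e * 1" if "t \<in> {0<..<T}" for t y
    proof -
      have "norm (Gr \<xi> t y) = \<bar>\<xi> $ i + \<xi> $ j * t\<bar> * e * \<bar>cs y\<bar>"
        using e by (simp add: Gr_def abs_mult)
      also have "\<dots> \<le> (\<bar>\<xi> $ i\<bar> + \<bar>\<xi> $ j\<bar> * T) * e * 1"
        using bd[OF that] e T cs_le[of y] by (intro mult_mono) auto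
      finally show ?thesis .
    qed
  qed
  show "AE t in lborel. t \<in> {0<..<T} \<longrightarrow> H1per0 (Cor \<xi> t) (Gr \<xi> t)"
    by (intro AE_I2 impI Cor_H1per0)
  fix w :: "real^'n \<Rightarrow> real" and H and \<eta> :: "real \<Rightarrow> real"
  assume "H1per0 w H \<and> test_fun {0<..<T} \<eta>"
  then have w: "H1per0 w H" and \<eta>: "test_fun {0<..<T} \<eta>" by auto
  define K where "K = e / (2 * pi) * (\<integral>y. sin (2 * pi * y $ i) * w y \<partial>cellM)"
  have 1: "cell_ip (Cor \<xi> t) w = (\<xi> $ i + \<xi> $ j * t) * K" for t
  proof -
    have "cell_ip (Cor \<xi> t) w = (\<integral>y. ((\<xi> $ i + \<xi> $ j * t) * e / (2 * pi)) * (sin (2 * pi * y $ i) * w y) \<partial>cellM)"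
      by (simp add: cell_ip_def Cor_def mult.assoc)
    also have "\<dots> = ((\<xi> $ i + \<xi> $ j * t) * e / (2 * pi)) * (\<integral>y. sin (2 * pi * y $ i) * w y \<partial>cellM)"
      by (rule integral_mult_right_zero)
    finally show ?thesis by (simp add: K_def)
  qed
  have 2: "cell_ip (flux (coef t) (\<lambda>y. Gr \<xi> t y + \<xi>)) H = (\<xi> $ j * t) * (- Cs * K)" for t
    by (simp add: flux_weak[OF w] K_def)
  have "(LINT t:{0<..<T}|lborel. Cs * deriv (\<lambda>s. s * \<eta> s) t * cell_ip (Cor \<xi> t) w) =
      (LINT t:{0<..<T}|lborel. (Cs * K) * (deriv (\<lambda>s. s * \<eta> s) t * (\<xi> $ i + \<xi> $ j * t)))"
    unfolding 1 by (simp add: mult_ac)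
  also have "\<dots> = (Cs * K) * - (LINT t:{0<..<T}|lborel. \<eta> t * (\<xi> $ j * t))"
    by (simp only: set_integral_mult_right LINT_moment_test_fun[OF T \<eta>])
  finally have l: "(LINT t:{0<..<T}|lborel. Cs * deriv (\<lambda>s. s * \<eta> s) t * cell_ip (Cor \<xi> t) w) =
      (Cs * K) * - (LINT t:{0<..<T}|lborel. \<eta> t * (\<xi> $ j * t))" .
  have "(LINT t:{0<..<T}|lborel. \<eta> t * cell_ip (flux (coef t) (\<lambda>y. Gr \<xi> t y + \<xi>)) H) =
      (LINT t:{0<..<T}|lborel. (- Cs * K) * (\<eta> t * (\<xi> $ j * t)))"
    unfolding 2 by (simp add: mult_ac)
  also have "\<dots> = (- Cs * K) * (LINT t:{0<..<T}|lborel. \<eta> t * (\<xi> $ j * t))"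
    by (simp only: set_integral_mult_right)
  finally show "- (LINT t:{0<..<T}|lborel. Cs * deriv (\<lambda>s. s * \<eta> s) t * cell_ip (Cor \<xi> t) w)
      + (LINT t:{0<..<T}|lborel. \<eta> t * cell_ip (flux (coef t) (\<lambda>y. Gr \<xi> t y + \<xi>)) H) = 0"
    using l by simp
qed

text \<open>The ij entry averages a multiple of the cosine and is 0; the ji entry retains the mean
  1/2 of the squared cosine and equals -e^2 t Cs / (8 pi^2), which is nonzero at every t >
  0.\<close>

lemma a_hom_not_symmetric:
  assumes t: "t \<in> {0<..<T}"
  shows "transpose (a_hom coef Gr t) \<noteq> a_hom coef Gr t"
proof -
  have entry: "a_hom coef Gr t $ k $ l = (\<integral>y. (coef t y *v (Gr (axis l 1) t y + axis l 1)) $ k \<partial>cellM)" for k l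
    using a_hom_entry[where a=coef and G=Gr and t=t, OF lam(1) hyp_coeff_elliptic_field[OF T coef_hyp t] H1per0_sqi(2)[OF Cor_H1per0]]
    by (simp add: cell_ip_def flux_def inner_axis)
  have int: "integrable cellM cs" "integrable cellM (\<lambda>y. (cs y)\<^sup>2)"
    by (intro cellM.sqi_integrable sqi_power2_integrable cell_continuous_sqi cs_continuous)+
  have mean: "(\<integral>y. cs y \<partial>cellM) = 0" "(\<integral>y. (cs y)\<^sup>2 \<partial>cellM) = 1/2"
    unfolding cs_def by (simp_all add: cell_integral_cos cell_integral_cos_square)
  have "a_hom coef Gr t $ i $ j = 0"
    unfolding entry flux_component_i using ij mean(1) by (simp add: axis_def)
  moreover have "a_hom coef Gr t $ j $ i = - (e\<^sup>2 * t * Cs / (4 * pi\<^sup>2)) / 2"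
  proof -
    have "(\<integral>y. - (e * t * (c + Cs / (4 * pi\<^sup>2))) * cs y - e\<^sup>2 * t * Cs / (4 * pi\<^sup>2) * (cs y)\<^sup>2 \<partial>cellM) =
        - (e * t * (c + Cs / (4 * pi\<^sup>2))) * (\<integral>y. cs y \<partial>cellM) - e\<^sup>2 * t * Cs / (4 * pi\<^sup>2) * (\<integral>y. (cs y)\<^sup>2 \<partial>cellM)"
      using int by (subst Bochner_Integration.integral_diff) auto
    then show ?thesis unfolding entry flux_component_j mean by simp
  qed
  moreover have "0 < e\<^sup>2 * t * Cs / (4 * pi\<^sup>2)" using e t Cs by simp
  ultimately have "a_hom coef Gr t $ i $ j \<noteq> a_hom coef Gr t $ j $ i" using e t Cs by simp
  then show ?thesis by (auto simp: transpose_def vec_eq_iff)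
qed

end

lemma ex_asymmetric_homogenized_matrix:
  assumes "2 \<le> CARD('n::finite)" "0 < lam" "lam < 1" "0 < Cs" "0 < T"
  shows "\<exists>(a :: real \<Rightarrow> real^'n \<Rightarrow> real^'n^'n) \<Phi> G. hyp_coeff T lam a \<and> (\<forall>\<xi>. parabolic_corrector Cs T a \<xi> (\<Phi> \<xi>) (G \<xi>)) \<and>
    (\<forall>t\<in>{0<..<T}. transpose (a_hom a G t) \<noteq> a_hom a G t)"
proof -
  have "\<exists>i j :: 'n. i \<noteq> j"
  proof (rule ccontr)
    assume "\<not> ?thesis"
    then have "(UNIV :: 'n set) \<subseteq> {undefined}" by auto
    then have "CARD('n) \<le> 1" using card_mono[of "{undefined :: 'n}" UNIV] by simp
    with assms(1) show False by simp
  qed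
  then obtain i j :: 'n where ij: "i \<noteq> j" by blast
  define m where "m = 2 + T * (Cs + 2)"
  \<comment> \<open>The largest value allowed by the two smallness conditions.\<close>
  define e where "e = min (1/2) ((1 - lam) / 2 / m)"
  have m: "0 < m" unfolding m_def using assms by (intro add_pos_nonneg) auto
  have "e * m \<le> (1 - lam) / 2 / m * m" unfolding e_def using m by (intro mult_right_mono) auto
  then have "e * m \<le> (1 - lam) / 2" using m by simp
  moreover have "0 < e" "e \<le> 1/2" using m assms by (auto simp: e_def)
  ultimately interpret asymmetric_example i j lam Cs T e
    using ij assms by unfold_locales (auto simp: m_def)
  show ?thesis
    using coef_hyp Cor_corrector a_hom_not_symmetric by blast
qed

text \<open>Asymmetry is stated as the existence of a coefficient field compatible with the given
  data: a field independent of \<open>y\<close>, for instance, has zero correctors and a symmetric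
  homogenized matrix. For N = 1 every matrix is symmetric, and lam = 1 forces the field to be the
  identity, whence the two side conditions.\<close>

theorem proposition1p7:
  fixes \<Omega> :: "(real^'n) set" and T r lam Cs :: real
    and v0\<epsilon> v1\<epsilon> :: "real \<Rightarrow> real^'n \<Rightarrow> real" and f\<epsilon> :: "real \<Rightarrow> (real^'n) \<times> real \<Rightarrow> real"
    and v0 v1 :: "real^'n \<Rightarrow> real" and f :: "(real^'n) \<times> real \<Rightarrow> real"
    and a :: "real \<Rightarrow> real^'n \<Rightarrow> real^'n^'n" and g gper :: "real \<Rightarrow> real"
  assumes A: "standing_hyps \<Omega> T r v0\<epsilon> v1\<epsilon> f\<epsilon> v0 v1 f lam a g gper Cs"
  shows
    "(\<forall>\<Phi> G. (\<forall>\<xi>. corrector r Cs T a \<xi> (\<Phi> \<xi>) (G \<xi>)) \<longrightarrow>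
        (\<forall>\<xi>. \<exists>D. weak_deriv T (\<lambda>t. cell_sqnorm (\<Phi> \<xi> t)) D \<and>
          (AE t in lborel. t \<in> {0<..<T} \<longrightarrow>
             lam * (norm \<xi>)\<^sup>2 + lam * cell_sqnorm (G \<xi> t) + dt_coeff r Cs * t / 2 * D t
               \<le> (a_hom a G t *v \<xi>) \<bullet> \<xi> \<and>
             (a_hom a G t *v \<xi>) \<bullet> \<xi>
               \<le> (norm \<xi>)\<^sup>2 + cell_sqnorm (G \<xi> t) + dt_coeff r Cs * t / 2 * D t)) \<and>
        (r \<noteq> 2 \<longrightarrow> (\<forall>t\<in>{0<..<T}. transpose (a_hom a G t) = a_hom a G t)) \<and>
        (r = 2 \<and> Cs = 0 \<longrightarrow>
          (AE t in lborel. t \<in> {0<..<T} \<longrightarrow> transpose (a_hom a G t) = a_hom a G t))) \<and>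
     (r = 2 \<and> Cs \<noteq> 0 \<and> 2 \<le> CARD('n) \<and> lam < 1 \<longrightarrow>
        (\<exists>a' \<Phi> G.
           standing_hyps \<Omega> T r v0\<epsilon> v1\<epsilon> f\<epsilon> v0 v1 f lam a' g gper Cs \<and>
           (\<forall>\<xi>. corrector r Cs T a' \<xi> (\<Phi> \<xi>) (G \<xi>)) \<and>
           (AE t in lborel. t \<in> {0<..<T} \<longrightarrow> transpose (a_hom a' G t) \<noteq> a_hom a' G t)))"
proof (intro conjI allI impI)
  assume h: "r = 2 \<and> Cs \<noteq> 0 \<and> 2 \<le> CARD('n) \<and> lam < 1"
  then have r: "r = 2" by blast
  have "0 < lam" "0 < T" "0 < Cs"
    using A h by (auto simp: standing_hyps_def hyp_coeff_def hyp_damping_def)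
  with h ex_asymmetric_homogenized_matrix[where 'n='n, of lam Cs T]
  obtain a' :: "real \<Rightarrow> real^'n \<Rightarrow> real^'n^'n" and \<Phi> G
    where a': "hyp_coeff T lam a'" and c: "\<And>\<xi>. parabolic_corrector Cs T a' \<xi> (\<Phi> \<xi>) (G \<xi>)"
      and ns: "\<And>t. t \<in> {0<..<T} \<Longrightarrow> transpose (a_hom a' G t) \<noteq> a_hom a' G t"
    by blast
  \<comment> \<open>Of the hypotheses, \<open>hyp_coeff\<close> and \<open>hyp_smooth\<close> speak
    of the field, and the demands of the latter are conditional on \<open>2 < r\<close>.\<close>
  have "standing_hyps \<Omega> T r v0\<epsilon> v1\<epsilon> f\<epsilon> v0 v1 f lam a' g gper Cs"
    using A a' r by (simp add: standing_hyps_def hyp_smooth_def)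
  moreover have "corrector r Cs T a' \<xi> (\<Phi> \<xi>) (G \<xi>)" for \<xi>
    using c r by (simp add: corrector_def)
  ultimately show "\<exists>a' \<Phi> G. standing_hyps \<Omega> T r v0\<epsilon> v1\<epsilon> f\<epsilon> v0 v1 f lam a' g gper Cs \<and>
      (\<forall>\<xi>. corrector r Cs T a' \<xi> (\<Phi> \<xi>) (G \<xi>)) \<and>
      (AE t in lborel. t \<in> {0<..<T} \<longrightarrow> transpose (a_hom a' G t) \<noteq> a_hom a' G t)"
    using ns by (intro exI[of _ a'] exI[of _ \<Phi>] exI[of _ G] conjI allI AE_I2 impI) auto
qed (use homogenized_matrix_properties[OF A] in blast)+

end
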